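(* Let $1<p<\infty$, let $(a,b)\in L^\infty(\mathbb T)\times L^\infty(\mathbb T)$ be an $\alpha$-matching pair with subordinated pair $(c,d)$, and let $T(c)$ be a Fredholm operator on $H^p$. Consider $T(a)\pm H_\alpha(b)$ on $H^p$. Then: (i) If $\operatorname{ind}T(c)=1$ and $\boldsymbol\sigma_\alpha(c)=1$, then $\ker(T(a)+H_\alpha(b))=\{0\}$ or $\operatorname{coker}(T(a)+H_\alpha(b))=\{0\}$. (ii) If $\operatorname{ind}T(c)=-1$ and $\boldsymbol\sigma_\alpha(c)=1$, then $\ker(T(a)-H_\alpha(b))=\{0\}$ or $\operatorname{coker}(T(a)-H_\alpha(b))=\{0\}$. (iii) If $\operatorname{ind}T(c)=0$, then, for each choice of the sign, $\ker(T(a)\pm H_\alpha(b))=\{0\}$ or $\operatorname{coker}(T(a)\pm H_\alpha(b))=\{0\}$.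
   Context: $\mathbb T$ is the unit circle, $L^p=L^p(\mathbb T)$, $1/p+1/q=1$. $H^p=\{f\in L^p:\widehat f_n=0,\ n<0\}$, $\overline{H^p}=\{f\in L^p:\widehat f_n=0,\ n>0\}$; elements of $H^p$ are identified with their analytic extensions to the open unit disc, and for $f\in\overline{H^p}$, $f(\infty):=\widehat f_0$. $P:\sum_{n\in\mathbb Z}\widehat f_nt^n\mapsto\sum_{n\ge0}\widehat f_nt^n$ on $L^p$, $Q=I-P$. Fix $\beta\in\mathbb C$, $|\beta|>1$, $\lambda:=i\sqrt{|\beta|^2-1}$, $\alpha(t)=\dfrac{t-\beta}{\overline\beta t-1}$ (a map of $\mathbb T$ onto itself, $\alpha\circ\alpha=\mathrm{id}$), $a_\alpha:=a\circ\alpha$, and $J_\alpha\varphi(t):=\dfrac{\lambda}{\overline\beta t-1}\varphi(\alpha(t))$. For $a\in L^\infty$, on $H^p$: $T(a)\varphi=P(a\varphi)$, $H_\alpha(a)\varphi=P(aQJ_\alpha\varphi)$. $\operatorname{coker}A:=\ker A^*$. A Fredholm operator has closed range and finite-dimensional kernel and cokernel; $\operatorname{ind}A=\dim\ker A-\dim\operatorname{coker}A$. (Only $T(c)$ is assumed Fredholm.) $(a,b)$ is an $\alpha$-matching pair if $a$ is invertible in $L^\infty$ and $aa_\alpha=bb_\alpha$ (so $b$ is invertible too). Its subordinated pair is $(c,d)$, $c=ab^{-1}$, $d=ba_\alpha^{-1}$; then $cc_\alpha=dd_\alpha=1$. If $g\in L^\infty$, $gg_\alpha=1$ and $T(g)$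 is Fredholm on $H^p$ with index $n$, then $g$ has a unique Wiener–Hopf factorization in $H^p$: $g=g_-t^{-n}g_+$, $g_-(\infty)=1$, $g_+\in H^q$, $g_+^{-1}\in H^p$, $g_-\in\overline{H^p}$, $g_-^{-1}\in\overline{H^q}$, with $g_+^{-1}Pg_-^{-1}I$ (defined on $\operatorname{span}\{t^k:k\ge0\}$) extending to a bounded operator on $H^p$. The $\alpha$-signature of $g$ is $\boldsymbol\sigma_\alpha(g):=(\lambda/\overline\beta)^n\,g_+^{-1}(1/\overline\beta)\in\{-1,1\}$. *)

theory Defs
  imports "HOL-Analysis.Analysis" "HOL-Library.Function_Algebras"
begin

section \<open>Functions on the unit circle modulo null sets\<close>

text \<open>Normalized arc length, as a measure on the whole complex plane that is carried by the unit
  circle; values of functions off the circle are irrelevant.\<close>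

definition circle :: "complex measure" where
  "circle = distr (restrict_space lborel {0..1::real}) borel (\<lambda>s. cis (2 * pi * s))"

lemma circle_map_measurable [measurable]:
  "(\<lambda>s::real. cis (2 * pi * s)) \<in> borel_measurable borel"
  by (intro borel_measurable_continuous_onI continuous_intros)

lemma sets_circle [simp, measurable_cong]: "sets circle = sets borel"
  by (simp add: circle_def)

lemma space_circle [simp]: "space circle = UNIV"
  by (simp add: circle_def)

lemma AE_circle_iff:
  assumes [measurable]: "Measurable.pred borel P"
  shows "(AE t in circle. P t) \<longleftrightarrow> (AE s in lborel. s \<in> {0..1} \<longrightarrow> P (cis (2 * pi * s)))"
proof -
  have m: "(\<lambda>s. cis (2 * pi * s)) \<in> measurable (restrict_space lborel {0..1::real}) borel"
    by (rule measurable_restrict_space1) simp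
  have "(AE t in circle. P t) \<longleftrightarrow> (AE s in restrict_space lborel {0..1}. P (cis (2 * pi * s)))"
    unfolding circle_def by (rule AE_distr_iff[OF m]) measurable
  also have "\<dots> \<longleftrightarrow> (AE s in lborel. s \<in> {0..1} \<longrightarrow> P (cis (2 * pi * s)))"
    by (rule AE_restrict_space_iff) simp
  finally show ?thesis .
qed

lemma circle_not_AE_False: "\<not> (AE t in circle. False)"
proof
  assume "AE t in circle. False"
  then have "AE s in lborel. s \<notin> {0..1::real}"
    by (subst (asm) AE_circle_iff) auto
  then have "{0..1::real} \<in> null_sets lborel"
    by (subst AE_iff_null_sets) auto
  then show False
    by (auto simp: null_sets_def)
qed

text \<open>The algebra of (classes of) measurable functions. Measurability is part of the relation, so
  that only measurable functions have a class.\<close>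

definition circle_eq :: "(complex \<Rightarrow> complex) \<Rightarrow> (complex \<Rightarrow> complex) \<Rightarrow> bool" where
  "circle_eq f g \<longleftrightarrow> f \<in> borel_measurable borel \<and> g \<in> borel_measurable borel
     \<and> (AE t in circle. f t = g t)"

lemma part_equivp_circle_eq: "part_equivp circle_eq"
proof (rule part_equivpI)
  show "\<exists>f. circle_eq f f"
    by (rule exI[of _ "\<lambda>_. 0"]) (simp add: circle_eq_def)
  show "symp circle_eq"
    by (auto simp: symp_def circle_eq_def elim: eventually_mono)
  show "transp circle_eq"
    unfolding transp_def circle_eq_def by (auto elim: eventually_elim2)
qed

quotient_type circle_fun = "complex \<Rightarrow> complex" / partial: circle_eq
  by (rule part_equivp_circle_eq)

instantiation circle_fun :: comm_ring_1
begin

lift_definition zero_circle_fun :: circle_fun is "\<lambda>_. 0"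
  by (simp add: circle_eq_def)

lift_definition one_circle_fun :: circle_fun is "\<lambda>_. 1"
  by (simp add: circle_eq_def)

lift_definition plus_circle_fun :: "circle_fun \<Rightarrow> circle_fun \<Rightarrow> circle_fun" is "\<lambda>f g t. f t + g t"
  by (auto simp: circle_eq_def)

lift_definition minus_circle_fun :: "circle_fun \<Rightarrow> circle_fun \<Rightarrow> circle_fun" is "\<lambda>f g t. f t - g t"
  by (auto simp: circle_eq_def)

lift_definition uminus_circle_fun :: "circle_fun \<Rightarrow> circle_fun" is "\<lambda>f t. - f t"
  by (auto simp: circle_eq_def)

lift_definition times_circle_fun :: "circle_fun \<Rightarrow> circle_fun \<Rightarrow> circle_fun" is "\<lambda>f g t. f t * g t"
  by (auto simp: circle_eq_def)

instance
proof
  fix a b c :: circle_fun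
  show "a + b + c = a + (b + c)" by transfer (simp add: circle_eq_def add.assoc)
  show "a + b = b + a" by transfer (simp add: circle_eq_def add.commute)
  show "0 + a = a" by transfer (simp add: circle_eq_def)
  show "- a + a = 0" by transfer (simp add: circle_eq_def)
  show "a - b = a + - b" by transfer (simp add: circle_eq_def)
  show "a * b * c = a * (b * c)" by transfer (simp add: circle_eq_def mult.assoc)
  show "a * b = b * a" by transfer (simp add: circle_eq_def mult.commute)
  show "1 * a = a" by transfer (simp add: circle_eq_def)
  show "(a + b) * c = a * c + b * c" by transfer (simp add: circle_eq_def distrib_right)
  show "(0::circle_fun) \<noteq> 1"
    by transfer (use circle_not_AE_False in \<open>simp add: circle_eq_def\<close>)
qed

end

text \<open>Pointwise inverse (with \<open>1 / 0 = 0\<close>); it is a multiplicative inverse exactly for the functions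
  that are nonzero almost everywhere.\<close>

instantiation circle_fun :: inverse
begin

lift_definition inverse_circle_fun :: "circle_fun \<Rightarrow> circle_fun" is "\<lambda>f t. inverse (f t)"
  by (auto simp: circle_eq_def)

definition divide_circle_fun :: "circle_fun \<Rightarrow> circle_fun \<Rightarrow> circle_fun" where
  "divide_circle_fun f g = f * inverse g"

instance ..

end

lift_definition scale :: "complex \<Rightarrow> circle_fun \<Rightarrow> circle_fun" is "\<lambda>c f t. c * f t"
  by (auto simp: circle_eq_def)

global_interpretation circle_fun: vector_space scale
proof
  fix a b :: complex and x y :: circle_fun
  show "scale a (x + y) = scale a x + scale a y"
    by transfer (simp add: circle_eq_def distrib_left)
  show "scale (a + b) x = scale a x + scale b x"
    by transfer (simp add: circle_eq_def distrib_right)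
  show "scale a (scale b x) = scale (a * b) x"
    by transfer (simp add: circle_eq_def mult.assoc)
  show "scale 1 x = x"
    by transfer (simp add: circle_eq_def)
qed

text \<open>The class of the function \<open>t \<mapsto> t\<close>.\<close>

lift_definition tvar :: circle_fun is "\<lambda>t. t"
  by (simp add: circle_eq_def)


section \<open>Lebesgue and Hardy spaces\<close>

lift_definition in_Lp :: "real \<Rightarrow> circle_fun \<Rightarrow> bool" is
  "\<lambda>p f. integrable circle (\<lambda>t. cmod (f t) powr p)"
proof -
  fix p :: real and f g :: "complex \<Rightarrow> complex"
  assume "circle_eq f g"
  then have [measurable]: "f \<in> borel_measurable borel" "g \<in> borel_measurable borel"
    and ae: "AE t in circle. f t = g t"
    by (auto simp: circle_eq_def)
  from ae have "AE t in circle. cmod (f t) powr p = cmod (g t) powr p"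
    by eventually_elim simp
  then show "integrable circle (\<lambda>t. cmod (f t) powr p) = integrable circle (\<lambda>t. cmod (g t) powr p)"
    by (intro integrable_cong_AE) measurable
qed

lift_definition Lp_norm :: "real \<Rightarrow> circle_fun \<Rightarrow> real" is
  "\<lambda>p f. (LINT t|circle. cmod (f t) powr p) powr (1 / p)"
proof -
  fix p :: real and f g :: "complex \<Rightarrow> complex"
  assume "circle_eq f g"
  then have [measurable]: "f \<in> borel_measurable borel" "g \<in> borel_measurable borel"
    and ae: "AE t in circle. f t = g t"
    by (auto simp: circle_eq_def)
  from ae have "AE t in circle. cmod (f t) powr p = cmod (g t) powr p"
    by eventually_elim simp
  then have "(LINT t|circle. cmod (f t) powr p) = (LINT t|circle. cmod (g t) powr p)"
    by (intro integral_cong_AE) measurable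
  then show "(LINT t|circle. cmod (f t) powr p) powr (1 / p)
    = (LINT t|circle. cmod (g t) powr p) powr (1 / p)"
    by simp
qed

lift_definition ess_bounded :: "circle_fun \<Rightarrow> bool" is
  "\<lambda>f. \<exists>C. AE t in circle. cmod (f t) \<le> C"
proof -
  fix f g :: "complex \<Rightarrow> complex"
  assume "circle_eq f g"
  then have ae: "AE t in circle. f t = g t"
    by (auto simp: circle_eq_def)
  have "(AE t in circle. cmod (f t) \<le> C) \<longleftrightarrow> (AE t in circle. cmod (g t) \<le> C)" for C
    by (rule eventually_subst) (use ae in eventually_elim, simp)
  then show "(\<exists>C. AE t in circle. cmod (f t) \<le> C) = (\<exists>C. AE t in circle. cmod (g t) \<le> C)"
    by simp
qed

definition Lp :: "real \<Rightarrow> circle_fun set" where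
  "Lp p = {f. in_Lp p f}"

definition Linf :: "circle_fun set" where
  "Linf = {f. ess_bounded f}"

definition conj_exp :: "real \<Rightarrow> real" where
  "conj_exp p = p / (p - 1)"

lift_definition fourier :: "circle_fun \<Rightarrow> int \<Rightarrow> complex" is
  "\<lambda>f n. LINT t|circle. f t * t powi (- n)"
proof -
  fix f g :: "complex \<Rightarrow> complex"
  assume "circle_eq f g"
  then have [measurable]: "f \<in> borel_measurable borel" "g \<in> borel_measurable borel"
    and ae: "AE t in circle. f t = g t"
    by (auto simp: circle_eq_def)
  show "(\<lambda>n. LINT t|circle. f t * t powi (- n)) = (\<lambda>n. LINT t|circle. g t * t powi (- n))"
  proof
    fix n :: int
    have [measurable]: "(\<lambda>t::complex. t powi (- n)) \<in> borel_measurable borel"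
      unfolding power_int_def by simp
    from ae have "AE t in circle. f t * t powi (- n) = g t * t powi (- n)"
      by eventually_elim simp
    then show "(LINT t|circle. f t * t powi (- n)) = (LINT t|circle. g t * t powi (- n))"
      by (intro integral_cong_AE) measurable
  qed
qed

definition Hp :: "real \<Rightarrow> circle_fun set" where
  "Hp p = {f \<in> Lp p. \<forall>n<0. fourier f n = 0}"

definition Hp_bar :: "real \<Rightarrow> circle_fun set" where
  "Hp_bar p = {f \<in> Lp p. \<forall>n>0. fourier f n = 0}"

text \<open>Analytic extension of an element of a Hardy space to the open unit disc.\<close>

definition disc_ext :: "circle_fun \<Rightarrow> complex \<Rightarrow> complex" where
  "disc_ext f z = (\<Sum>k. fourier f (int k) * z ^ k)"

text \<open>For \<open>1 < p\<close> and \<open>f\<close> in \<open>Lp p\<close> the description is proper: existence is M. Riesz's theorem,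
  uniqueness is the uniqueness theorem for Fourier coefficients.\<close>

definition riesz_P :: "real \<Rightarrow> circle_fun \<Rightarrow> circle_fun" where
  "riesz_P p f = (THE g. g \<in> Lp p \<and> (\<forall>n. fourier g n = (if n \<ge> 0 then fourier f n else 0)))"

definition riesz_Q :: "real \<Rightarrow> circle_fun \<Rightarrow> circle_fun" where
  "riesz_Q p f = f - riesz_P p f"


section \<open>The Carleman shift\<close>

definition alpha :: "complex \<Rightarrow> complex \<Rightarrow> complex" where
  "alpha \<beta> t = (t - \<beta>) / (cnj \<beta> * t - 1)"

definition lam :: "complex \<Rightarrow> complex" where
  "lam \<beta> = \<i> * complex_of_real (sqrt ((cmod \<beta>)\<^sup>2 - 1))"

text \<open>Composition with \<open>alpha \<beta>\<close>. For \<open>1 < cmod \<beta>\<close> the map preserves null sets of the circle, so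
  the result does not depend on the representative; see \<open>shift_abs\<close> below.\<close>

definition shift :: "complex \<Rightarrow> circle_fun \<Rightarrow> circle_fun" where
  "shift \<beta> f = abs_circle_fun (\<lambda>t. rep_circle_fun f (alpha \<beta> t))"

lemma alpha_measurable [measurable]: "alpha \<beta> \<in> borel_measurable borel"
  unfolding alpha_def by measurable

lemma shift_denom_nonzero:
  assumes "1 < cmod \<beta>" "cmod t = 1"
  shows "cnj \<beta> * t - 1 \<noteq> 0"
proof
  assume "cnj \<beta> * t - 1 = 0"
  then have "cnj \<beta> * t = 1" by simp
  then have "cmod (cnj \<beta> * t) = 1" by simp
  with assms show False by (simp add: norm_mult)
qed

lemma norm_alpha:
  assumes "1 < cmod \<beta>" "cmod t = 1"
  shows "cmod (alpha \<beta> t) = 1"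
proof -
  have "t * cnj t = 1"
    using assms(2) by (simp add: complex_norm_square[symmetric])
  then have "cnj \<beta> * t - 1 = - t * cnj (t - \<beta>)"
    by (simp add: algebra_simps)
  then have "cmod (cnj \<beta> * t - 1) = cmod t * cmod (cnj (t - \<beta>))"
    by (metis norm_minus_cancel norm_mult)
  then have "cmod (cnj \<beta> * t - 1) = cmod (t - \<beta>)"
    by (simp only: assms(2) complex_mod_cnj mult_1)
  moreover have "cmod (cnj \<beta> * t - 1) \<noteq> 0"
    using shift_denom_nonzero[OF assms] by simp
  ultimately show ?thesis
    unfolding alpha_def norm_divide by (metis divide_self)
qed

lemma alpha_alpha:
  assumes "1 < cmod \<beta>" "cmod t = 1"
  shows "alpha \<beta> (alpha \<beta> t) = t"
proof -
  let ?d = "cnj \<beta> * t - 1"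
  have d: "?d \<noteq> 0" by (rule shift_denom_nonzero[OF assms])
  have "alpha \<beta> t * ?d = t - \<beta>"
    using d by (simp add: alpha_def)
  then have m: "(alpha \<beta> t - \<beta>) * ?d = (t - \<beta>) - \<beta> * ?d"
    "(cnj \<beta> * alpha \<beta> t - 1) * ?d = cnj \<beta> * (t - \<beta>) - ?d"
    by (metis left_diff_distrib, metis left_diff_distrib mult.assoc mult_1)
  have n: "(alpha \<beta> t - \<beta>) * ?d = t * (1 - \<beta> * cnj \<beta>)"
    and e: "(cnj \<beta> * alpha \<beta> t - 1) * ?d = 1 - \<beta> * cnj \<beta>"
    unfolding m by (simp_all add: algebra_simps)
  have "(cnj \<beta> * alpha \<beta> t - 1) \<noteq> 0"
    by (rule shift_denom_nonzero[OF assms(1) norm_alpha[OF assms]])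
  then have k: "1 - \<beta> * cnj \<beta> \<noteq> 0"
    using d e by (metis no_zero_divisors)
  have "alpha \<beta> (alpha \<beta> t) = ((alpha \<beta> t - \<beta>) * ?d) / ((cnj \<beta> * alpha \<beta> t - 1) * ?d)"
    unfolding alpha_def[of \<beta> "alpha \<beta> t"] using d by simp
  also have "\<dots> = t"
    unfolding n e using k by simp
  finally show ?thesis .
qed

lemma alpha_null_sets:
  assumes b: "1 < cmod \<beta>" and [measurable]: "N \<in> sets borel"
    and N: "AE t in circle. t \<notin> N"
  shows "AE t in circle. alpha \<beta> t \<notin> N"
proof -
  define z where "z s = alpha \<beta> (cis (2 * pi * s))" for s :: real
  define h where "h s = (Im (Ln (- z s)) + pi) / (2 * pi)" for s :: real
  define E where "E = {s \<in> {0..1}. cis (2 * pi * s) \<in> N}"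
  define E' where "E' = {s \<in> E. z s \<noteq> 1}"
  define F where "F = {s \<in> {0..1}. z s \<in> N}"
  have [measurable]: "E \<in> sets borel"
    unfolding E_def by measurable
  have [measurable]: "z \<in> borel_measurable borel"
    unfolding z_def by measurable
  have [measurable]: "F \<in> sets borel"
    unfolding F_def by measurable
  have "AE s in lborel. s \<in> {0..1} \<longrightarrow> cis (2 * pi * s) \<notin> N"
    using N by (subst (asm) AE_circle_iff) auto
  then have "AE s in lborel. s \<notin> E"
    by (auto simp: E_def)
  then have "E \<in> null_sets lborel"
    by (subst AE_iff_null_sets) auto
  then have "negligible E"
    by (simp add: negligible_iff_null_sets null_sets_completionI)
  then have "negligible E'"
    by (rule negligible_subset) (auto simp: E'_def)
  moreover have "h differentiable_on E'"
    unfolding differentiable_on_def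
  proof
    fix s assume s: "s \<in> E'"
    have zn: "cmod (z s) = 1"
      unfolding z_def by (rule norm_alpha[OF b]) simp
    have "- z s \<notin> \<real>\<^sub>\<le>\<^sub>0"
    proof
      assume "- z s \<in> \<real>\<^sub>\<le>\<^sub>0"
      then obtain x where x: "z s = of_real x" "x \<ge> 0"
        by (metis add.inverse_inverse neg_0_le_iff_le nonpos_Reals_cases of_real_minus)
      with zn have "x = 1" by simp
      with x s show False by (simp add: E'_def)
    qed
    then have L: "(Ln has_field_derivative inverse (- z s)) (at (- z s))"
      by (rule has_field_derivative_Ln)
    have "((\<lambda>s. \<i> * of_real (2 * pi * s)) has_vector_derivative \<i> * of_real (2 * pi)) (at s)"
      by (auto intro!: derivative_eq_intros simp: has_vector_derivative_def scaleR_conv_of_real)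
    then have c: "((\<lambda>s. cis (2 * pi * s)) has_vector_derivative
        \<i> * of_real (2 * pi) * exp (\<i> * of_real (2 * pi * s))) (at s)"
      using field_vector_diff_chain_at[OF _ DERIV_exp]
      by (fastforce simp: o_def cis_conv_exp)
    have "alpha \<beta> field_differentiable (at (cis (2 * pi * s)))"
      unfolding alpha_def
      by (intro derivative_intros shift_denom_nonzero[OF b]) simp
    then obtain D where D: "(alpha \<beta> has_field_derivative D) (at (cis (2 * pi * s)))"
      by (auto simp: field_differentiable_def)
    obtain z' where "(z has_vector_derivative z') (at s)"
      using field_vector_diff_chain_at[OF c D] by (auto simp: o_def z_def[abs_def])
    then have "((\<lambda>s. - z s) has_vector_derivative - z') (at s)"
      by (rule has_vector_derivative_minus)
    from field_vector_diff_chain_at[OF this L]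
    obtain l where "((\<lambda>s. Ln (- z s)) has_vector_derivative l) (at s)"
      by (auto simp: o_def)
    then have "((\<lambda>s. Im (Ln (- z s))) has_vector_derivative Im l) (at s)"
      by (rule bounded_linear.has_vector_derivative[OF bounded_linear_Im])
    then have "(\<lambda>s. Im (Ln (- z s))) differentiable (at s)"
      by (rule differentiableI_vector)
    then have "h differentiable (at s)"
      unfolding h_def[abs_def] by (auto intro!: derivative_intros)
    then show "h differentiable at s within E'"
      by (rule differentiable_at_withinI)
  qed
  ultimately have "negligible (h ` E')"
    by (intro negligible_differentiable_image_negligible) auto
  then have "negligible (h ` E' \<union> {0, 1})"
    by (rule negligible_Un) (simp add: negligible_finite)
  moreover have "F \<subseteq> h ` E' \<union> {0, 1}"
  proof
    fix s assume s: "s \<in> F"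
    show "s \<in> h ` E' \<union> {0, 1}"
    proof (cases "s = 0 \<or> s = 1")
      case False
      with s have s01: "0 < s" "s < 1" by (auto simp: F_def)
      have zn: "cmod (z s) = 1"
        unfolding z_def by (rule norm_alpha[OF b]) simp
      define u where "u = Arg2pi (z s) / (2 * pi)"
      have "z s = cis (2 * pi * u)"
        using Arg2pi_eq[of "z s"] zn by (simp add: u_def cis_conv_exp)
      moreover have u: "u \<in> {0..1}"
        using Arg2pi[of "z s"] by (auto simp: u_def field_simps)
      ultimately have "u \<in> E"
        using s by (simp add: E_def F_def)
      have zu: "z u = cis (2 * pi * s)"
        unfolding z_def[of u] \<open>z s = cis (2 * pi * u)\<close>[symmetric]
        unfolding z_def by (rule alpha_alpha[OF b]) simp
      have "- z u = exp (\<i> * of_real (2 * pi * s - pi))"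
        unfolding zu cis_conv_exp[symmetric] by (simp add: complex_eq_iff cos_diff sin_diff)
      then have "Ln (- z u) = \<i> * of_real (2 * pi * s - pi)"
        using s01 by (simp only:) (rule Ln_exp, auto)
      then have "h u = s"
        by (simp add: h_def)
      moreover have "z u \<noteq> 1"
      proof
        assume "z u = 1"
        with \<open>Ln (- z u) = _\<close> have "Im (Ln (-1)) = 2 * pi * s - pi"
          by simp
        with s01 show False by simp
      qed
      ultimately show ?thesis
        using \<open>u \<in> E\<close> by (auto simp: E'_def)
    qed auto
  qed
  ultimately have "negligible F"
    by (rule negligible_subset)
  then have "F \<in> null_sets lborel"
    by (simp add: negligible_iff_null_sets null_sets_completion_iff)
  then have "AE s in lborel. s \<notin> F"
    by (rule AE_not_in)
  then show ?thesis
    by (subst AE_circle_iff) (auto simp: F_def z_def)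
qed

lemma shift_abs:
  assumes b: "1 < cmod \<beta>" and f [measurable]: "f \<in> borel_measurable borel"
  shows "shift \<beta> (abs_circle_fun f) = abs_circle_fun (\<lambda>t. f (alpha \<beta> t))"
proof -
  define r where "r = rep_circle_fun (abs_circle_fun f)"
  have "circle_eq f f" by (simp add: circle_eq_def)
  then have "circle_eq r f"
    unfolding r_def
    by (rule rep_abs_rsp_left[OF Quotient3_circle_fun])
  then have [measurable]: "r \<in> borel_measurable borel" and ae: "AE t in circle. r t = f t"
    by (auto simp: circle_eq_def)
  have "AE t in circle. t \<notin> {t. r t \<noteq> f t}"
    using ae by simp
  then have "AE t in circle. alpha \<beta> t \<notin> {t. r t \<noteq> f t}"
    by (intro alpha_null_sets[OF b]) measurable
  then have "circle_eq (\<lambda>t. r (alpha \<beta> t)) (\<lambda>t. f (alpha \<beta> t))"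
    by (simp add: circle_eq_def)
  then show ?thesis
    unfolding shift_def r_def[symmetric]
    by (rule Quotient3_rel_abs[OF Quotient3_circle_fun])
qed

definition J :: "complex \<Rightarrow> circle_fun \<Rightarrow> circle_fun" where
  "J \<beta> \<phi> = abs_circle_fun (\<lambda>t. lam \<beta> / (cnj \<beta> * t - 1)) * shift \<beta> \<phi>"


section \<open>Toeplitz and Hankel operators\<close>

text \<open>Operators on \<open>Hp p\<close> are functions on \<open>circle_fun\<close> of which only the restriction to \<open>Hp p\<close>
  matters; their sums and differences are pointwise.\<close>

definition toeplitz :: "real \<Rightarrow> circle_fun \<Rightarrow> circle_fun \<Rightarrow> circle_fun" where
  "toeplitz p a \<phi> = riesz_P p (a * \<phi>)"

definition hankel :: "real \<Rightarrow> complex \<Rightarrow> circle_fun \<Rightarrow> circle_fun \<Rightarrow> circle_fun" where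
  "hankel p \<beta> a \<phi> = riesz_P p (a * riesz_Q p (J \<beta> \<phi>))"

definition bounded_operator :: "real \<Rightarrow> (circle_fun \<Rightarrow> circle_fun) \<Rightarrow> bool" where
  "bounded_operator p A \<longleftrightarrow>
     (\<forall>f\<in>Hp p. A f \<in> Hp p)
   \<and> (\<forall>f\<in>Hp p. \<forall>g\<in>Hp p. A (f + g) = A f + A g)
   \<and> (\<forall>c. \<forall>f\<in>Hp p. A (scale c f) = scale c (A f))
   \<and> (\<exists>C. \<forall>f\<in>Hp p. Lp_norm p (A f) \<le> C * Lp_norm p f)"

text \<open>The Banach space dual of \<open>Hp p\<close>; functionals are extended by \<open>0\<close> outside \<open>Hp p\<close> so that
  equal functionals are equal functions.\<close>

definition dual :: "real \<Rightarrow> (circle_fun \<Rightarrow> complex) set" where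
  "dual p = {l. (\<forall>f\<in>Hp p. \<forall>g\<in>Hp p. l (f + g) = l f + l g)
     \<and> (\<forall>c. \<forall>f\<in>Hp p. l (scale c f) = c * l f)
     \<and> (\<exists>C. \<forall>f\<in>Hp p. cmod (l f) \<le> C * Lp_norm p f)
     \<and> (\<forall>f. f \<notin> Hp p \<longrightarrow> l f = 0)}"

definition adjoint_op ::
    "real \<Rightarrow> (circle_fun \<Rightarrow> circle_fun) \<Rightarrow> (circle_fun \<Rightarrow> complex) \<Rightarrow> circle_fun \<Rightarrow> complex" where
  "adjoint_op p A l = (\<lambda>f. if f \<in> Hp p then l (A f) else 0)"

definition fun_scale :: "complex \<Rightarrow> (circle_fun \<Rightarrow> complex) \<Rightarrow> circle_fun \<Rightarrow> complex" where
  "fun_scale c l = (\<lambda>f. c * l f)"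

global_interpretation functional: vector_space fun_scale
  by unfold_locales (auto simp: fun_scale_def fun_eq_iff algebra_simps)

definition ker :: "real \<Rightarrow> (circle_fun \<Rightarrow> circle_fun) \<Rightarrow> circle_fun set" where
  "ker p A = {f \<in> Hp p. A f = 0}"

definition coker :: "real \<Rightarrow> (circle_fun \<Rightarrow> circle_fun) \<Rightarrow> (circle_fun \<Rightarrow> complex) set" where
  "coker p A = {l \<in> dual p. adjoint_op p A l = 0}"

definition closed_range :: "real \<Rightarrow> (circle_fun \<Rightarrow> circle_fun) \<Rightarrow> bool" where
  "closed_range p A \<longleftrightarrow>
     (\<forall>F g. (\<forall>n::nat. F n \<in> A ` Hp p) \<longrightarrow> g \<in> Hp p
        \<longrightarrow> (\<lambda>n. Lp_norm p (F n - g)) \<longlonglongrightarrow> 0 \<longrightarrow> g \<in> A ` Hp p)"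

text \<open>To be used for bounded operators \<open>A\<close> on \<open>Hp p\<close>. Note that \<open>dim\<close> is \<open>0\<close> for
  infinite-dimensional spaces, so finite dimension is expressed by finite spanning sets.\<close>

definition fredholm :: "real \<Rightarrow> (circle_fun \<Rightarrow> circle_fun) \<Rightarrow> bool" where
  "fredholm p A \<longleftrightarrow> closed_range p A
     \<and> (\<exists>B. finite B \<and> ker p A \<subseteq> circle_fun.span B)
     \<and> (\<exists>B. finite B \<and> coker p A \<subseteq> functional.span B)"

definition ind :: "real \<Rightarrow> (circle_fun \<Rightarrow> circle_fun) \<Rightarrow> int" where
  "ind p A = int (circle_fun.dim (ker p A)) - int (functional.dim (coker p A))"


section \<open>Matching pairs, Wiener--Hopf factorization and signature\<close>

definition invertible_Linf :: "circle_fun \<Rightarrow> bool" where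
  "invertible_Linf a \<longleftrightarrow> a \<in> Linf \<and> (\<exists>a'\<in>Linf. a * a' = 1)"

definition matching_pair :: "complex \<Rightarrow> circle_fun \<Rightarrow> circle_fun \<Rightarrow> bool" where
  "matching_pair \<beta> a b \<longleftrightarrow>
     a \<in> Linf \<and> b \<in> Linf \<and> invertible_Linf a \<and> a * shift \<beta> a = b * shift \<beta> b"

definition subordinated_pair :: "complex \<Rightarrow> circle_fun \<Rightarrow> circle_fun \<Rightarrow> circle_fun \<times> circle_fun" where
  "subordinated_pair \<beta> a b = (a * inverse b, b * inverse (shift \<beta> a))"

text \<open>\<open>g = gm t\<^sup>-\<^sup>n gp\<close>. The operator \<open>gp\<^sup>-\<^sup>1 P gm\<^sup>-\<^sup>1\<close> is only defined on polynomials at first: for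
  a polynomial \<open>f\<close> the product \<open>gm\<^sup>-\<^sup>1 f\<close> is in \<open>L\<^sup>q\<close>, whence the projection on \<open>L\<^sup>q\<close> there.\<close>

definition wiener_hopf ::
    "real \<Rightarrow> circle_fun \<Rightarrow> int \<Rightarrow> circle_fun \<Rightarrow> circle_fun \<Rightarrow> bool" where
  "wiener_hopf p g n gm gp \<longleftrightarrow>
     (let q = conj_exp p in
      g = gm * tvar powi (- n) * gp
    \<and> gm * inverse gm = 1 \<and> gp * inverse gp = 1
    \<and> fourier gm 0 = 1
    \<and> gp \<in> Hp q \<and> inverse gp \<in> Hp p
    \<and> gm \<in> Hp_bar p \<and> inverse gm \<in> Hp_bar q
    \<and> (\<exists>B. bounded_operator p B \<and>
         (\<forall>f \<in> circle_fun.span (range (\<lambda>k::nat. tvar ^ k)).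
            B f = inverse gp * riesz_P q (inverse gm * f))))"

definition signature :: "real \<Rightarrow> complex \<Rightarrow> circle_fun \<Rightarrow> complex" where
  "signature p \<beta> g =
     (let n = ind p (toeplitz p g);
          gp = (THE gp. \<exists>gm. wiener_hopf p g n gm gp)
      in (lam \<beta> / cnj \<beta>) powi n * disc_ext (inverse gp) (1 / cnj \<beta>))"

end

theory Submission
  imports Defs "HOL-Complex_Analysis.Complex_Analysis"
begin

text \<open>Let \<open>N\<close> be \<open>J\<^sub>\<alpha>\<close> or \<open>- J\<^sub>\<alpha>\<close>, so that the operator \<open>A\<close> under consideration is
  \<open>\<phi> \<mapsto> P (a \<phi> + b N \<phi>)\<close>. The involution \<open>N\<close> interchanges the ranges of \<open>P\<close> and \<open>Q\<close>, and
  \<open>N (h f) = h\<^sub>\<alpha> N f\<close>. If \<open>l \<noteq> 0\<close> annihilates the range of \<open>A\<close>, then \<open>l' f = l (P (a N f + b f))\<close>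
  annihilates the range of \<open>T(c)\<close> and satisfies \<open>l' (P f) = l' (P (c N f))\<close>. Suppose that this forces
  \<open>l' = 0\<close>. Then for \<open>\<phi> \<in> ker A\<close> the function \<open>r = a \<phi> + b N \<phi>\<close> satisfies \<open>l (P (t\<^sup>n r)) = 0\<close> for
  all \<open>n \<ge> 0\<close>, which implies \<open>r = 0\<close>; thus \<open>c \<phi> = - N \<phi>\<close>, and in particular \<open>\<phi> \<in> ker T(c)\<close>.
  By Coburn's theorem it remains to exclude such \<open>l'\<close> and \<open>\<phi>\<close> when the kernel or the cokernel of
  \<open>T(c)\<close> is one-dimensional. Then this space is spanned by an explicit element obtained from the
  Wiener--Hopf factorization of \<open>c\<close>, on which the symmetry acts by the signature.\<close>

subsection \<open>Inequalities for integrals of powers\<close>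

text \<open>Behind \<open>l'\<close> stands the composition of \<open>l\<close> with
  \<open>f \<mapsto> P (a f + b N f)\<close>. It makes sense on all of \<open>L^p\<close> and
  vanishes on the range of \<open>P\<close>; \<open>l'\<close> is its transport under
  \<open>N\<close>, so \<open>l' = 0\<close> says that it vanishes on the range of \<open>Q\<close>
  too, hence everywhere. The resulting antisymmetry \<open>l (P (a f)) = - l (P (b N f))\<close> is
  what kills \<open>l (P (t^n r))\<close>: the matching condition writes \<open>t^n r\<close> as
  \<open>a f\<close> with \<open>b N f = N (t^n N r)\<close>, which lies in the range of
  \<open>Q\<close>.

  The sign is decided by one number. For \<open>\<phi> = g_+^-1\<close> the coefficients at -1 of
  \<open>c \<phi>\<close> and \<open>J \<phi>\<close> are 1 and the signature; the functional
  \<open>f \<mapsto>\<close> mean of \<open>g_-^-1 f\<close> takes at \<open>1\<close> and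
  \<open>P (c J 1)\<close> the value 1 and the reciprocal of the signature. Signature 1 therefore
  contradicts the minus sign in the symmetry to be excluded.

  The signature is given by a definite description, so it says nothing before the factorization of
  \<open>c\<close> is known to exist and to be unique. For index \<open>n\<close> in
  \<open>{1, -1}\<close> existence is reduced to the invertible operator
  \<open>T(t^n c)\<close>.\<close>

lemma powr_add_le:
  fixes x y p :: real
  assumes "0 \<le> x" "0 \<le> y" "0 \<le> p"
  shows "(x + y) powr p \<le> 2 powr p * (x powr p + y powr p)"
proof -
  have "(x + y) powr p \<le> (2 * max x y) powr p"
    using assms by (intro powr_mono2) auto
  also have "\<dots> = 2 powr p * max x y powr p"
    using assms by (simp add: powr_mult)
  also have "max x y powr p \<le> x powr p + y powr p"
    by (auto simp: max_def)
  finally show ?thesis by simp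
qed

text \<open>Young's inequality with the second factor \<open>z powr (p - 1)\<close>, where
  \<open>z = s * x + t * y\<close>, bounds \<open>z * z powr (p - 1)\<close> by
  \<open>(s * x powr p + t * y powr p) / p + z powr p / q\<close>. The last term is absorbed on the
  left, because \<open>1 - 1 / q = 1 / p\<close>.\<close>

lemma powr_convex:
  fixes x y s t p :: real
  assumes "0 \<le> x" "0 \<le> y" "0 \<le> s" "0 \<le> t" "s + t = 1" "1 \<le> p"
  shows "(s * x + t * y) powr p \<le> s * x powr p + t * y powr p"
proof (cases "p = 1")
  case False
  define z where "z = s * x + t * y"
  define q where "q = p / (p - 1)"
  have p: "1 < p" and q: "1 < q" and pq: "1 / p + 1 / q = 1"
    using assms False by (auto simp: q_def field_simps)
  have z: "0 \<le> z" using assms by (simp add: z_def)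
  have *: "w * z powr (p - 1) \<le> w powr p / p + z powr p / q" if "0 \<le> w" for w
    using Youngs_inequality[OF p q pq that, of "z powr (p - 1)"] p
    by (simp add: powr_powr q_def)
  have "z powr p = z * z powr (p - 1)"
    using z p by (cases "z = 0") (simp_all add: powr_mult_base)
  also have "\<dots> = s * (x * z powr (p - 1)) + t * (y * z powr (p - 1))"
    by (simp add: z_def algebra_simps)
  also have "\<dots> \<le> s * (x powr p / p + z powr p / q) + t * (y powr p / p + z powr p / q)"
    using assms * by (intro add_mono mult_left_mono) auto
  also have "\<dots> = (s * x powr p + t * y powr p) / p + (s + t) * (z powr p / q)"
    by (simp add: algebra_simps add_divide_distrib)
  finally have "z powr p \<le> (s * x powr p + t * y powr p) / p + z powr p * (1 / q)"
    using assms by simp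
  also have "1 / q = 1 - 1 / p" using pq by simp
  finally have "z powr p / p \<le> (s * x powr p + t * y powr p) / p"
    by (simp add: algebra_simps)
  then show ?thesis
    using p by (simp add: z_def divide_le_cancel)
qed (use assms in auto)

lemma integrable_powr_add:
  fixes f g :: "'a \<Rightarrow> 'b::{banach,second_countable_topology}"
  assumes [measurable]: "f \<in> borel_measurable M" "g \<in> borel_measurable M"
    and p: "0 \<le> p"
    and int: "integrable M (\<lambda>x. norm (f x) powr p)" "integrable M (\<lambda>x. norm (g x) powr p)"
  shows "integrable M (\<lambda>x. norm (f x + g x) powr p)"
proof (rule Bochner_Integration.integrable_bound)
  show "integrable M (\<lambda>x. 2 powr p * (norm (f x) powr p + norm (g x) powr p))"
    using int by simp
  have "norm (f x + g x) powr p \<le> 2 powr p * (norm (f x) powr p + norm (g x) powr p)" for x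
    using p by (intro order_trans[OF powr_mono2 powr_add_le] norm_triangle_ineq) auto
  then show "AE x in M. norm (norm (f x + g x) powr p)
      \<le> norm (2 powr p * (norm (f x) powr p + norm (g x) powr p))"
    by (auto intro!: AE_I2)
qed measurable

text \<open>After division by \<open>A\<close> and \<open>B\<close> both functions have norm at most
  1, and their sum divided by \<open>A + B\<close> is a convex combination of the two, so convexity
  of the power suffices. The margin \<open>e / 2\<close> keeps the divisors positive even when a
  norm vanishes.\<close>

lemma Minkowski:
  fixes f g :: "'a \<Rightarrow> 'b::{banach,second_countable_topology}"
  assumes [measurable]: "f \<in> borel_measurable M" "g \<in> borel_measurable M"
    and p: "1 \<le> p"
    and int: "integrable M (\<lambda>x. norm (f x) powr p)" "integrable M (\<lambda>x. norm (g x) powr p)"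
  shows "(LINT x|M. norm (f x + g x) powr p) powr (1 / p)
    \<le> (LINT x|M. norm (f x) powr p) powr (1 / p) + (LINT x|M. norm (g x) powr p) powr (1 / p)"
    (is "?l \<le> ?f + ?g")
proof (rule field_le_epsilon)
  fix e :: real assume e: "0 < e"
  define A where "A = ?f + e / 2"
  define B where "B = ?g + e / 2"
  have A: "0 < A" and B: "0 < B"
    using e by (auto simp: A_def B_def add_nonneg_pos)
  have "LINT x|M. norm (f x) powr p = ?f powr p"
    using p by (simp add: powr_powr integral_nonneg_AE)
  also have "\<dots> \<le> A powr p"
    using p e by (intro powr_mono2) (auto simp: A_def)
  finally have fA: "LINT x|M. norm (f x) powr p \<le> A powr p" .
  have "LINT x|M. norm (g x) powr p = ?g powr p"
    using p by (simp add: powr_powr integral_nonneg_AE)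
  also have "\<dots> \<le> B powr p"
    using p e by (intro powr_mono2) (auto simp: B_def)
  finally have gB: "LINT x|M. norm (g x) powr p \<le> B powr p" .
  define s where "s = A / (A + B)"
  define t where "t = B / (A + B)"
  have st: "0 \<le> s" "0 \<le> t" "s + t = 1"
    using A B by (auto simp: s_def t_def add_divide_distrib[symmetric])
  have pt: "norm (f x + g x) powr p
      \<le> (A + B) powr p * (s * (norm (f x) powr p / A powr p) + t * (norm (g x) powr p / B powr p))" for x
  proof -
    have "norm (f x + g x) powr p \<le> (norm (f x) + norm (g x)) powr p"
      using p by (intro powr_mono2 norm_triangle_ineq) auto
    also have "norm (f x) + norm (g x) = (A + B) * (s * (norm (f x) / A) + t * (norm (g x) / B))"
      using A B by (simp add: s_def t_def distrib_left)
    also have "\<dots> powr p = (A + B) powr p * (s * (norm (f x) / A) + t * (norm (g x) / B)) powr p"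
      using A B st by (intro powr_mult)
    also have "\<dots> \<le> (A + B) powr p * (s * (norm (f x) / A) powr p + t * (norm (g x) / B) powr p)"
      using A B st p by (intro mult_left_mono powr_convex) auto
    finally show ?thesis
      using A B by (simp add: powr_divide)
  qed
  have "(LINT x|M. norm (f x + g x) powr p)
      \<le> (LINT x|M. (A + B) powr p * (s * (norm (f x) powr p / A powr p) + t * (norm (g x) powr p / B powr p)))"
    using int pt by (intro integral_mono integrable_powr_add) (use p in auto)
  also have "\<dots> = (A + B) powr p * (s * ((LINT x|M. norm (f x) powr p) / A powr p) + t * ((LINT x|M. norm (g x) powr p) / B powr p))"
    using int by simp
  also have "\<dots> \<le> (A + B) powr p * (s * 1 + t * 1)"
    using fA gB A B st by (intro mult_left_mono add_mono) (auto simp: divide_le_eq)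
  finally have "(LINT x|M. norm (f x + g x) powr p) \<le> (A + B) powr p"
    using st by simp
  then have "?l \<le> ((A + B) powr p) powr (1 / p)"
    using p by (intro powr_mono2) (auto intro: integral_nonneg_AE)
  also have "\<dots> = A + B"
    using A B p by (simp add: powr_powr)
  finally show "?l \<le> ?f + ?g + e"
    by (simp add: A_def B_def)
qed

text \<open>Young's inequality is applied to the functions divided by numbers slightly larger than
  their norms, so that norm 0 is no special case. The margin \<open>d\<close> is chosen such that
  the product of the enlarged norms exceeds the product of the norms by less than
  \<open>e\<close>.\<close>

lemma Hoelder:
  fixes f g :: "'a \<Rightarrow> 'b::{banach,second_countable_topology,real_normed_algebra}"
  assumes [measurable]: "f \<in> borel_measurable M" "g \<in> borel_measurable M"
    and p: "1 < p" and q: "1 < q" and pq: "1 / p + 1 / q = 1"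
    and int: "integrable M (\<lambda>x. norm (f x) powr p)" "integrable M (\<lambda>x. norm (g x) powr q)"
  shows "integrable M (\<lambda>x. f x * g x)" (is ?int)
    and "(LINT x|M. norm (f x * g x))
      \<le> (LINT x|M. norm (f x) powr p) powr (1 / p) * (LINT x|M. norm (g x) powr q) powr (1 / q)"
      (is "?l \<le> ?f * ?g")
proof -
  have bound: "norm (f x * g x) \<le> A * B * ((norm (f x) / A) powr p / p + (norm (g x) / B) powr q / q)"
    if A: "0 < A" and B: "0 < B" for A B x
  proof -
    have "norm (f x * g x) \<le> norm (f x) * norm (g x)"
      by (rule norm_mult_ineq)
    also have "\<dots> = A * B * (norm (f x) / A * (norm (g x) / B))"
      using A B by simp
    also have "\<dots> \<le> A * B * ((norm (f x) / A) powr p / p + (norm (g x) / B) powr q / q)"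
      using A B by (intro mult_left_mono Youngs_inequality p q pq) auto
    finally show ?thesis .
  qed
  show i: ?int
  proof (rule Bochner_Integration.integrable_bound)
    show "integrable M (\<lambda>x. norm (f x) powr p / p + norm (g x) powr q / q)"
      using int by simp
    show "AE x in M. norm (f x * g x) \<le> norm (norm (f x) powr p / p + norm (g x) powr q / q)"
      using bound[of 1 1] by (auto intro!: AE_I2 order_trans[OF _ abs_ge_self])
  qed measurable
  show "?l \<le> ?f * ?g"
  proof (rule field_le_epsilon)
    fix e :: real assume e: "0 < e"
    have "((\<lambda>d. (?f + d) * (?g + d)) \<longlongrightarrow> (?f + 0) * (?g + 0)) (at_right 0)"
      by (intro tendsto_intros)
    then have "\<forall>\<^sub>F d in at_right 0. (?f + d) * (?g + d) < ?f * ?g + e"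
      using e by (intro order_tendstoD(2)) auto
    then have "\<forall>\<^sub>F d in at_right 0. (?f + d) * (?g + d) < ?f * ?g + e \<and> 0 < d"
      using eventually_at_right_less[of 0] by eventually_elim auto
    then obtain d where d: "(?f + d) * (?g + d) < ?f * ?g + e" "0 < d"
      using eventually_happens'[OF trivial_limit_at_right_real] by blast
    define A where "A = ?f + d"
    define B where "B = ?g + d"
    have A: "0 < A" and B: "0 < B"
      using d by (auto simp: A_def B_def add_nonneg_pos)
    have "LINT x|M. norm (f x) powr p = ?f powr p"
      using p by (simp add: powr_powr integral_nonneg_AE)
    also have "\<dots> \<le> A powr p"
      using p d by (intro powr_mono2) (auto simp: A_def)
    finally have fA: "LINT x|M. norm (f x) powr p \<le> A powr p" .
    have "LINT x|M. norm (g x) powr q = ?g powr q"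
      using q by (simp add: powr_powr integral_nonneg_AE)
    also have "\<dots> \<le> B powr q"
      using q d by (intro powr_mono2) (auto simp: B_def)
    finally have gB: "LINT x|M. norm (g x) powr q \<le> B powr q" .
    have "?l \<le> (LINT x|M. A * B * ((norm (f x) / A) powr p / p + (norm (g x) / B) powr q / q))"
      using int A B i by (intro integral_mono bound) (auto simp: powr_divide)
    also have "\<dots> = A * B * ((LINT x|M. norm (f x) powr p) / A powr p / p + (LINT x|M. norm (g x) powr q) / B powr q / q)"
      using int A B by (simp add: powr_divide)
    also have "\<dots> \<le> A * B * (1 / p + 1 / q)"
      using fA gB A B p q by (intro mult_left_mono add_mono divide_right_mono) (auto simp: divide_le_eq)
    also have "\<dots> < ?f * ?g + e"
      using d pq by (simp add: A_def B_def)
    finally show "?l \<le> ?f * ?g + e" by simp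
  qed
qed

lemma AE_zero_of_integral_powr:
  fixes f :: "'a \<Rightarrow> 'b::{banach,second_countable_topology}"
  assumes int: "integrable M (\<lambda>x. norm (f x) powr p)"
    and "(LINT x|M. norm (f x) powr p) = 0"
  shows "AE x in M. f x = 0"
proof -
  have "AE x in M. norm (f x) powr p = 0"
    using assms by (subst (asm) integral_nonneg_eq_0_iff_AE) auto
  then show ?thesis
    by eventually_elim auto
qed

subsection \<open>Polynomials are dense in \<open>L\<^sup>1\<close> of a finite measure on a compact set\<close>

lemma continuous_approx_integrable:
  fixes M :: "'a::euclidean_space measure" and f :: "'a \<Rightarrow> real"
  assumes sb: "sets M = sets borel" and fin: "finite_measure M"
    and f: "integrable M f" and e: "0 < e"
  shows "\<exists>h. continuous_on UNIV h \<and> bounded (range h) \<and> (LINT x|M. \<bar>f x - h x\<bar>) < e"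
proof -
  interpret finite_measure M by fact
  have [measurable_cong]: "sets M = sets borel" by (rule sb)
  have ci: "integrable M h" if hc: "continuous_on UNIV h" "bounded (range h)" for h :: "'a \<Rightarrow> real"
  proof -
    obtain C where "\<bar>h x\<bar> \<le> C" for x
      using hc(2) unfolding bounded_iff by auto
    moreover have [measurable]: "h \<in> borel_measurable borel"
      using hc by (simp add: borel_measurable_continuous_onI)
    ultimately show ?thesis
      by (intro integrable_const_bound[of _ C]) auto
  qed
  show ?thesis
    using f e
  proof (induction arbitrary: e rule: integrable_induct)
    case (base A c)
    have A: "A \<in> sets borel" using base sb by simp
    \<comment> \<open>The continuous function will differ from the indicator only outside two
      compact sets, and the rest has measure below \<open>2 * d\<close>. Multiplied by
      \<open>|c|\<close> this stays below \<open>e\<close>; the \<open>+ 1\<close> covers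
      \<open>c = 0\<close>.\<close>
    define d where "d = e / (2 * (\<bar>c\<bar> + 1))"
    have d: "0 < d" using base by (simp add: d_def)
    have inner: "\<exists>K\<subseteq>B. compact K \<and> measure M B - d < measure M K" if B: "B \<in> sets borel" for B
    proof (cases "measure M B < d")
      case False
      have "ennreal (measure M B - d) < emeasure M B"
        using False d by (simp add: emeasure_eq_measure ennreal_less_iff)
      then have "ennreal (measure M B - d) < (SUP K \<in> {K. K \<subseteq> B \<and> compact K}. emeasure M K)"
        using inner_regular[OF sb _ B] by simp
      then show ?thesis
        using False by (auto simp: less_SUP_iff emeasure_eq_measure ennreal_less_iff)
    qed (use d in \<open>auto intro!: exI[of _ "{}"]\<close>)
    obtain K where K: "K \<subseteq> A" "compact K" "measure M A - d < measure M K"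
      using inner[OF A] by blast
    obtain L where L: "L \<subseteq> - A" "compact L" "measure M (- A) - d < measure M L"
      using inner[of "- A"] A by auto
    have [measurable]: "A \<in> sets borel" "K \<in> sets borel" "L \<in> sets borel"
      using A K L by (auto intro: borel_compact)
    have "L \<inter> K = {}" using K L by auto
    then obtain h where h: "continuous_on UNIV h" "\<And>x. h x \<in> closed_segment 0 (1::real)"
        "\<And>x. x \<in> L \<Longrightarrow> h x = 0" "\<And>x. x \<in> K \<Longrightarrow> h x = 1"
      using Urysohn[of L K "0::real" 1] K L compact_imp_closed by metis
    have h01: "0 \<le> h x" "h x \<le> 1" for x
      using h(2)[of x] by (auto simp: closed_segment_eq_real_ivl)
    have [measurable]: "h \<in> borel_measurable borel"
      using h(1) by (simp add: borel_measurable_continuous_onI)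
    have hb: "bounded (range h)"
      using h01 by (auto simp: bounded_iff intro!: exI[of _ 1])
    have sp: "space M = UNIV" using sets_eq_imp_space_eq[OF sb] by simp
    have K2: "L \<in> sets M" "K \<in> sets M" "- L - K \<in> sets M"
      unfolding sb using borel_compact[OF K(2)] borel_compact[OF L(2)]
      by (auto intro: sets.Diff borel_comp)
    have "measure M (- L - K) = measure M UNIV - measure M L - measure M K"
    proof -
      have "measure M UNIV = measure M (L \<union> K \<union> (- L - K))"
        by (rule arg_cong[of _ _ "measure M"]) auto
      also have "\<dots> = measure M L + measure M K + measure M (- L - K)"
        using \<open>L \<inter> K = {}\<close> K2 finite_measure_Union[of L K] finite_measure_Union[of "L \<union> K" "- L - K"]
        by auto
      finally show ?thesis by simp
    qed
    also have "measure M UNIV = measure M A + measure M (- A)"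
      using finite_measure_compl[of A] A sb sp by (simp add: Compl_eq_Diff_UNIV)
    finally have mLK: "measure M (- L - K) < 2 * d"
      using K L by simp
    have "(LINT x|M. \<bar>indicator A x *\<^sub>R c - c * h x\<bar>) \<le> (LINT x|M. \<bar>c\<bar> * indicator (- L - K) x)"
    proof (rule integral_mono)
      show "integrable M (\<lambda>x. \<bar>indicator A x *\<^sub>R c - c * h x\<bar>)"
      proof -
        have "integrable M (indicat_real A)"
          by (rule integrable_const_bound[of _ 1]) (auto simp: A sb)
        then show ?thesis
          using ci[OF h(1) hb] by (intro integrable_abs Bochner_Integration.integrable_diff) auto
      qed
      show "integrable M (\<lambda>x. \<bar>c\<bar> * indicator (- L - K) x)"
        using K2(3) by (intro integrable_mult_right integrable_const_bound[of _ 1]) auto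
      fix x
      have "\<bar>indicator A x - h x\<bar> \<le> indicator (- L - K) x"
        using h01[of x] h(3,4)[of x] K L by (auto simp: indicator_def)
      then have "\<bar>c\<bar> * \<bar>indicator A x - h x\<bar> \<le> \<bar>c\<bar> * indicator (- L - K) x"
        by (intro mult_left_mono) auto
      then show "\<bar>indicator A x *\<^sub>R c - c * h x\<bar> \<le> \<bar>c\<bar> * indicator (- L - K) x"
        by (simp add: abs_mult[symmetric] right_diff_distrib mult.commute)
    qed
    also have "\<dots> = \<bar>c\<bar> * measure M (- L - K)"
      using sp by simp
    also have "\<dots> \<le> \<bar>c\<bar> * (2 * d)"
      using mLK by (intro mult_left_mono) auto
    also have "\<dots> < e"
      using base.prems by (simp add: d_def field_simps)
    finally show ?case
      using h(1) bounded_scaling[OF hb, of c]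
      by (intro exI[of _ "\<lambda>x. c * h x"]) (auto intro!: continuous_intros simp: image_image)
  next
    case (add f g)
    obtain h1 where h1: "continuous_on UNIV h1" "bounded (range h1)" "(LINT x|M. \<bar>f x - h1 x\<bar>) < e/2"
      using add(3)[of "e/2"] add.prems by auto
    obtain h2 where h2: "continuous_on UNIV h2" "bounded (range h2)" "(LINT x|M. \<bar>g x - h2 x\<bar>) < e/2"
      using add(4)[of "e/2"] add.prems by auto
    have "(LINT x|M. \<bar>(f x + g x) - (h1 x + h2 x)\<bar>) \<le> (LINT x|M. \<bar>f x - h1 x\<bar> + \<bar>g x - h2 x\<bar>)"
      using add(1,2) ci h1 h2 by (intro integral_mono) auto
    also have "\<dots> < e"
      using add(1,2) ci h1 h2 by simp
    finally show ?case
      using h1 h2 by (intro exI[of _ "\<lambda>x. h1 x + h2 x"]) (auto intro!: continuous_intros bounded_plus_comp)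
  next
    case (lim f s)
    \<comment> \<open>The approximating functions satisfy \<open>|s i x| <= 2 * |f x|\<close>,
      whence the factor 3 in the dominating function.\<close>
    have "(\<lambda>i. LINT x|M. \<bar>f x - s i x\<bar>) \<longlonglongrightarrow> (LINT x|M. 0)"
    proof (rule integral_dominated_convergence[where w="\<lambda>x. 3 * \<bar>f x\<bar>"])
      show "AE x in M. (\<lambda>i. \<bar>f x - s i x\<bar>) \<longlonglongrightarrow> 0"
        using lim(2) by (auto intro!: AE_I2 tendsto_eq_intros)
      show "AE x in M. norm \<bar>f x - s i x\<bar> \<le> 3 * \<bar>f x\<bar>" for i
        using lim(3)[of _ i] by (intro AE_I2) (auto, smt (verit))
    qed (use lim in auto)
    then have "\<forall>\<^sub>F i in sequentially. (LINT x|M. \<bar>f x - s i x\<bar>) < e/2"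
      using lim.prems by (intro order_tendstoD(2)) auto
    then obtain i where i: "(LINT x|M. \<bar>f x - s i x\<bar>) < e/2"
      using eventually_happens'[OF sequentially_bot] by blast
    obtain h where h: "continuous_on UNIV h" "bounded (range h)" "(LINT x|M. \<bar>s i x - h x\<bar>) < e/2"
      using lim(5)[of "e/2" i] lim.prems by auto
    have "(LINT x|M. \<bar>f x - h x\<bar>) \<le> (LINT x|M. \<bar>f x - s i x\<bar> + \<bar>s i x - h x\<bar>)"
      using lim(1,4) ci h by (intro integral_mono) auto
    also have "\<dots> < e"
      using lim(1,4) ci h i by simp
    finally show ?case
      using h by blast
  qed
qed


text \<open>The bound \<open>B + 1\<close> independent of \<open>e\<close> is the point: it makes
  dominated convergence available for the approximating sequences built from this lemma.\<close>

lemma polynomial_approx_integrable: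
  fixes M :: "'a::euclidean_space measure" and f :: "'a \<Rightarrow> real"
  assumes sb: "sets M = sets borel" and fin: "finite_measure M"
    and K: "compact K" "AE x in M. x \<in> K"
    and f: "integrable M f" and fB: "AE x in M. \<bar>f x\<bar> \<le> B" and B: "0 \<le> B" and e: "0 < e"
  shows "\<exists>g. real_polynomial_function g \<and> (\<forall>x\<in>K. \<bar>g x\<bar> \<le> B + 1) \<and> (LINT x|M. \<bar>f x - g x\<bar>) < e"
proof -
  interpret finite_measure M by fact
  have [measurable_cong]: "sets M = sets borel" by (rule sb)
  obtain h where h: "continuous_on UNIV h" "bounded (range h)" "(LINT x|M. \<bar>f x - h x\<bar>) < e / 2"
    using continuous_approx_integrable[OF sb fin f, of "e / 2"] e by auto
  \<comment> \<open>Clipping to \<open>[-B, B]\<close> does not increase the distance to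
    \<open>f\<close>, whose values lie there almost everywhere.\<close>
  define k where "k x = max (- B) (min B (h x))" for x
  have k: "continuous_on UNIV k"
    unfolding k_def by (intro continuous_intros h)
  define d where "d = min 1 (e / (2 * (measure M (space M) + 1)))"
  have d: "0 < d" "d \<le> 1"
    using e by (auto simp: d_def add_nonneg_pos)
  obtain g where g: "real_polynomial_function g" "\<And>x. x \<in> K \<Longrightarrow> \<bar>k x - g x\<bar> < d"
    using Stone_Weierstrass_real_polynomial_function[OF K(1) continuous_on_subset[OF k] d(1)] by auto
  have [measurable]: "h \<in> borel_measurable borel" "k \<in> borel_measurable borel" "g \<in> borel_measurable borel"
    using h k continuous_on_polymonial_function[of g UNIV] g(1)
    by (simp_all add: borel_measurable_continuous_onI real_polynomial_function_eq)
  obtain C where C: "\<bar>h x\<bar> \<le> C" for x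
    using h(2) unfolding bounded_iff by auto
  have hi: "integrable M h"
    using C by (intro integrable_const_bound[of _ C]) auto
  have ki: "integrable M k"
    using B by (intro integrable_const_bound[of _ B]) (auto simp: k_def)
  have gB: "\<bar>g x\<bar> \<le> B + 1" if "x \<in> K" for x
  proof -
    have "\<bar>k x\<bar> \<le> B" using B by (auto simp: k_def)
    with g(2)[OF that] d show ?thesis by linarith
  qed
  have gi: "integrable M g"
    using K(2) gB by (intro integrable_const_bound[of _ "B + 1"]) (auto elim: eventually_mono)
  have "(LINT x|M. \<bar>f x - g x\<bar>) \<le> (LINT x|M. \<bar>f x - h x\<bar> + d)"
  proof (rule integral_mono_AE)
    show "AE x in M. \<bar>f x - g x\<bar> \<le> \<bar>f x - h x\<bar> + d"
      using fB K(2)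
    proof eventually_elim
      case (elim x)
      have "\<bar>f x - k x\<bar> \<le> \<bar>f x - h x\<bar>"
        using elim(1) by (auto simp: k_def)
      with g(2)[OF elim(2)] show ?case by linarith
    qed
  qed (use f hi gi in auto)
  also have "\<dots> = (LINT x|M. \<bar>f x - h x\<bar>) + d * measure M (space M)"
    using f hi by simp
  also have "d * measure M (space M) \<le> e / (2 * (measure M (space M) + 1)) * measure M (space M)"
    by (intro mult_right_mono) (auto simp: d_def)
  also have "\<dots> \<le> e / 2"
  proof -
    define m where "m = measure M (space M)"
    have "0 \<le> m" by (simp add: m_def)
    with e show ?thesis
      unfolding m_def[symmetric] by (simp add: field_simps)
  qed
  finally have "(LINT x|M. \<bar>f x - g x\<bar>) < e"
    using h(3) by simp
  with g(1) gB show ?thesis by blast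
qed

subsection \<open>The circle measure\<close>

lemma emeasure_circle_UNIV: "emeasure circle UNIV = 1"
proof -
  have "(\<lambda>s. cis (2 * pi * s)) \<in> measurable (restrict_space lborel {0..1::real}) borel"
    by (rule measurable_restrict_space1) simp
  then show ?thesis
    unfolding circle_def
    by (subst emeasure_distr) (auto simp: emeasure_restrict_space space_restrict_space)
qed

interpretation circle: finite_measure circle
  by (rule finite_measureI) (simp add: emeasure_circle_UNIV)

lemma measure_circle_UNIV [simp]: "measure circle UNIV = 1"
  by (simp add: measure_def emeasure_circle_UNIV)

lemma AE_circle_norm: "AE t in circle. cmod t = 1"
  by (subst AE_circle_iff) auto

lemma AE_circleI:
  assumes "\<And>t. cmod t = 1 \<Longrightarrow> P t"
  shows "AE t in circle. P t"
  using AE_circle_norm by eventually_elim (use assms in auto)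

text \<open>Two functions occur because the measure lives on the whole plane: \<open>f\<close> has
  to be Borel there, whereas the formula \<open>F\<close> only has to be continuous on the
  circle.\<close>

lemma circle_integral_eq:
  assumes [measurable]: "f \<in> borel_measurable borel"
    and F: "\<And>t. cmod t = 1 \<Longrightarrow> f t = F t" "continuous_on (sphere 0 1) F"
  shows "(LINT t|circle. f t) = integral {0..1} (\<lambda>s. F (cis (2 * pi * s)) :: complex)"
proof -
  have m: "(\<lambda>s. cis (2 * pi * s)) \<in> measurable (restrict_space lborel {0..1::real}) borel"
    by (rule measurable_restrict_space1) simp
  have "(LINT t|circle. f t) = (LINT s|restrict_space lborel {0..1}. f (cis (2 * pi * s)))"
    unfolding circle_def by (rule integral_distr[OF m]) measurable
  also have "\<dots> = (LINT s|restrict_space lborel {0..1}. F (cis (2 * pi * s)))"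
    by (intro Bochner_Integration.integral_cong) (auto simp: F)
  also have "\<dots> = (LINT s:{0..1}|lborel. F (cis (2 * pi * s)))"
    by (subst integral_restrict_space) (auto simp: set_lebesgue_integral_def)
  also have "\<dots> = integral {0..1} (\<lambda>s. F (cis (2 * pi * s)))"
    by (intro set_borel_integral_eq_integral borel_integrable_atLeastAtMost')
      (auto intro!: continuous_on_compose2[OF F(2)] continuous_intros)
  finally show ?thesis .
qed

text \<open>Normalized arc length is \<open>dt / (2 pi i t)\<close> along the circle, which accounts
  for the factor \<open>t\<close> in the integrand.\<close>

lemma circle_Cauchy:
  assumes f: "f \<in> borel_measurable borel" and w: "cmod w < 1"
    and F: "\<And>t. cmod t = 1 \<Longrightarrow> f t = F t * t / (t - w)"
    and cF: "continuous_on (cball 0 1) F" and hF: "F holomorphic_on ball 0 1"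
  shows "(LINT t|circle. f t) = F w"
proof -
  have nz: "t - w \<noteq> 0" if "cmod t = 1" for t using that w by auto
  have "((\<lambda>u. F u / (u - w)) has_contour_integral (2 * of_real pi * \<i> * F w)) (circlepath 0 1)"
    by (rule Cauchy_integral_circlepath[OF cF hF]) (use w in simp)
  then have "((\<lambda>x. F (circlepath 0 1 x) / (circlepath 0 1 x - w) * vector_derivative (circlepath 0 1) (at x within {0..1}))
      has_integral 2 * of_real pi * \<i> * F w) {0..1}"
    by (simp add: has_contour_integral_def)
  then have "((\<lambda>x. (2 * of_real pi * \<i>) * (F (cis (2 * pi * x)) * cis (2 * pi * x) / (cis (2 * pi * x) - w)))
      has_integral (2 * of_real pi * \<i>) * F w) {0..1}"
  proof (rule has_integral_eq[rotated])
    fix x :: real assume "x \<in> {0..1}"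
    then show "F (circlepath 0 1 x) / (circlepath 0 1 x - w) * vector_derivative (circlepath 0 1) (at x within {0..1})
        = (2 * of_real pi * \<i>) * (F (cis (2 * pi * x)) * cis (2 * pi * x) / (cis (2 * pi * x) - w))"
      using vector_derivative_circlepath01[of x 0 1] by (simp add: circlepath cis_conv_exp mult_ac)
  qed
  note * = has_integral_mult_right[OF this, of "inverse (2 * of_real pi * \<i>)"]
  have "((\<lambda>x. F (cis (2 * pi * x)) * cis (2 * pi * x) / (cis (2 * pi * x) - w)) has_integral F w) {0..1}"
  proof -
    have gen: "inverse c * (c * z) = z" if "c \<noteq> 0" for c z :: complex
      using that by simp
    have k: "inverse (2 * of_real pi * \<i>) * (2 * of_real pi * \<i> * z) = z" for z
      by (rule gen) simp
    show ?thesis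
      using * unfolding k .
  qed
  moreover have "(LINT t|circle. f t) = integral {0..1} (\<lambda>x. F (cis (2 * pi * x)) * cis (2 * pi * x) / (cis (2 * pi * x) - w))"
    using nz by (intro circle_integral_eq[OF f F] continuous_intros continuous_on_subset[OF cF sphere_cball]) auto
  ultimately show ?thesis
    by (simp add: integral_unique)
qed

lemma circle_mean_value:
  assumes f: "f \<in> borel_measurable borel"
    and F: "\<And>t. cmod t = 1 \<Longrightarrow> f t = F t"
    and cF: "continuous_on (cball 0 1) F" and hF: "F holomorphic_on ball 0 1"
  shows "(LINT t|circle. f t) = F 0"
proof (rule circle_Cauchy[OF f _ _ cF hF])
  show "f t = F t * t / (t - 0)" if "cmod t = 1" for t using that F by auto
qed simp

lemma cnj_measurable [measurable (raw)]:
  assumes "f \<in> borel_measurable M"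
  shows "(\<lambda>x. cnj (f x)) \<in> borel_measurable M"
  by (rule measurable_compose[OF assms borel_measurable_continuous_onI]) (intro continuous_intros)

lemma powi_measurable [measurable]: "(\<lambda>t::complex. t powi n) \<in> borel_measurable borel"
  unfolding power_int_def by simp

lemma circle_integral_powi: "(LINT t|circle. t powi n) = (if n = 0 then 1 else 0)"
proof (cases "n \<ge> 0")
  case True
  have "(LINT t|circle. t powi n) = 0 ^ nat n"
    using True by (intro circle_mean_value) (auto simp: power_int_def intro!: continuous_intros holomorphic_intros)
  with True show ?thesis by (auto simp: power_0_left)
next
  case False
  have "(LINT t|circle. t powi n) = (LINT t|circle. cnj (t powi (- n)))"
  proof (intro integral_cong_AE AE_circleI)
    fix t :: complex assume "cmod t = 1"
    then have "inverse t = cnj t"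
      by (simp add: inverse_eq_divide divide_conv_cnj)
    then show "t powi n = cnj (t powi (- n))"
      using False by (simp add: power_int_def)
  qed measurable
  also have "\<dots> = cnj (LINT t|circle. t powi (- n))"
    by (rule Bochner_Integration.integral_cnj)
  also have "(LINT t|circle. t powi (- n)) = 0 ^ nat (- n)"
    using False by (intro circle_mean_value) (auto simp: power_int_def intro!: continuous_intros holomorphic_intros)
  finally show ?thesis using False by (simp add: power_0_left)
qed

subsection \<open>Representatives\<close>

text \<open>A chosen representative. It respects the algebraic operations only almost everywhere, so
  identities between classes are proved by combining finitely or countably many such
  statements.\<close>

abbreviation val :: "circle_fun \<Rightarrow> complex \<Rightarrow> complex" where
  "val \<equiv> rep_circle_fun"

lemma val_measurable [measurable]: "val f \<in> borel_measurable borel"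
  using Quotient3_rep_reflp[OF Quotient3_circle_fun, of f] by (simp add: circle_eq_def)

lemma circle_eq_val: "circle_eq (val f) (val f)"
  by (simp add: circle_eq_def)

lemma abs_val [simp]: "abs_circle_fun (val f) = f"
  by (rule Quotient3_abs_rep[OF Quotient3_circle_fun])

lemma val_abs:
  assumes "f \<in> borel_measurable borel"
  shows "AE t in circle. val (abs_circle_fun f) t = f t"
  using rep_abs_rsp_left[OF Quotient3_circle_fun, of f f] assms
  by (simp add: circle_eq_def)

lemma circle_fun_eq_iff: "f = g \<longleftrightarrow> (AE t in circle. val f t = val g t)"
proof
  assume "AE t in circle. val f t = val g t"
  then have "circle_eq (val f) (val g)" by (simp add: circle_eq_def)
  then show "f = g" using Quotient3_rel_abs[OF Quotient3_circle_fun] by fastforce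
qed simp

lemma val_plus: "AE t in circle. val (f + g) t = val f t + val g t"
  using plus_circle_fun.abs_eq[OF circle_eq_val circle_eq_val, of f g] val_abs[of "\<lambda>t. val f t + val g t"]
  by simp

lemma val_minus: "AE t in circle. val (f - g) t = val f t - val g t"
  using minus_circle_fun.abs_eq[OF circle_eq_val circle_eq_val, of f g] val_abs[of "\<lambda>t. val f t - val g t"]
  by simp

lemma val_times: "AE t in circle. val (f * g) t = val f t * val g t"
  using times_circle_fun.abs_eq[OF circle_eq_val circle_eq_val, of f g] val_abs[of "\<lambda>t. val f t * val g t"]
  by simp

lemma val_inverse: "AE t in circle. val (inverse f) t = inverse (val f t)"
  using inverse_circle_fun.abs_eq[OF circle_eq_val, of f] val_abs[of "\<lambda>t. inverse (val f t)"]
  by simp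

lemma val_scale: "AE t in circle. val (scale c f) t = c * val f t"
  using scale.abs_eq[OF circle_eq_val, of c f] val_abs[of "\<lambda>t. c * val f t"]
  by simp

lemma val_0: "AE t in circle. val 0 t = 0"
  using zero_circle_fun_def val_abs[of "\<lambda>t. 0"] by simp

lemma val_1: "AE t in circle. val 1 t = 1"
  using one_circle_fun_def val_abs[of "\<lambda>t. 1"] by simp

lemma val_tvar: "AE t in circle. val tvar t = t"
  using tvar_def val_abs[of "\<lambda>t. t"] by simp

lemma val_power: "AE t in circle. val (f ^ n) t = val f t ^ n"
proof (induction n)
  case (Suc n)
  then show ?case
    using val_times[of f "f ^ n"] unfolding power_Suc by eventually_elim simp
qed (use val_1 in simp)

lemma val_powi: "AE t in circle. val (tvar powi k) t = t powi k"
proof (cases "k \<ge> 0")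
  case True
  then show ?thesis
    using val_power[of tvar "nat k"] val_tvar
    by (auto simp: power_int_def elim: eventually_elim2)
next
  case False
  have "AE t in circle. val (inverse tvar ^ nat (- k)) t = inverse t ^ nat (- k)"
    using val_power[of "inverse tvar" "nat (- k)"] val_inverse[of tvar] val_tvar
    by eventually_elim simp
  with False show ?thesis
    by (simp add: power_int_def)
qed

lemma scale_eq_times: "scale c f * g = scale c (f * g)" "f * scale c g = scale c (f * g)"
proof -
  show "scale c f * g = scale c (f * g)"
    unfolding circle_fun_eq_iff
    using val_times[of f g] val_times[of "scale c f" g] val_scale[of c f] val_scale[of c "f * g"]
    by eventually_elim simp
  show "f * scale c g = scale c (f * g)"
    unfolding circle_fun_eq_iff
    using val_times[of f g] val_times[of f "scale c g"] val_scale[of c g] val_scale[of c "f * g"]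
    by eventually_elim simp
qed

lemma tvar_powi_add: "tvar powi (j + k) = tvar powi j * tvar powi k"
  unfolding circle_fun_eq_iff
  using val_times[of "tvar powi j" "tvar powi k"] val_powi[of "j + k"] val_powi[of j] val_powi[of k] AE_circle_norm
  by eventually_elim (auto intro!: power_int_add)

lemma inverse_unique_circle_fun:
  fixes f g :: circle_fun
  assumes "f * g = 1"
  shows "inverse f = g" "f * inverse f = 1"
proof -
  have "AE t in circle. val f t * val g t = 1"
    using val_times[of f g] val_1 unfolding assms by eventually_elim simp
  then show "inverse f = g"
    unfolding circle_fun_eq_iff using val_inverse[of f]
    by eventually_elim (metis inverse_unique)
  then show "f * inverse f = 1" using assms by simp
qed

lemma mem_Lp_iff: "f \<in> Lp p \<longleftrightarrow> integrable circle (\<lambda>t. cmod (val f t) powr p)"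
  using in_Lp.abs_eq[OF circle_eq_val, of p f] by (simp add: Lp_def)

lemma Lp_norm_val: "Lp_norm p f = (LINT t|circle. cmod (val f t) powr p) powr (1 / p)"
  using Lp_norm.abs_eq[OF circle_eq_val, of p f] by simp

lemma fourier_val: "fourier f n = (LINT t|circle. val f t * t powi (- n))"
  using fourier.abs_eq[OF circle_eq_val, of f] by simp

lemma mem_Linf_iff: "f \<in> Linf \<longleftrightarrow> (\<exists>C. AE t in circle. cmod (val f t) \<le> C)"
  using ess_bounded.abs_eq[OF circle_eq_val, of f] by (simp add: Linf_def)

lemma mem_Lp_1_iff: "f \<in> Lp 1 \<longleftrightarrow> integrable circle (val f)"
  by (simp add: mem_Lp_iff integrable_norm_iff)

lemma Lp_norm_1: "Lp_norm 1 f = (LINT t|circle. cmod (val f t))"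
  by (simp add: Lp_norm_val integral_nonneg_AE)

lemma Lp_cong:
  assumes "AE t in circle. cmod (val f t) = cmod (g t)" and [measurable]: "g \<in> borel_measurable borel"
  shows "f \<in> Lp p \<longleftrightarrow> integrable circle (\<lambda>t. cmod (g t) powr p)"
    "Lp_norm p f = (LINT t|circle. cmod (g t) powr p) powr (1 / p)"
proof -
  have ae: "AE t in circle. cmod (val f t) powr p = cmod (g t) powr p"
    using assms(1) by eventually_elim simp
  show "f \<in> Lp p \<longleftrightarrow> integrable circle (\<lambda>t. cmod (g t) powr p)"
    unfolding mem_Lp_iff using ae by (intro integrable_cong_AE) measurable
  have "(LINT t|circle. cmod (val f t) powr p) = (LINT t|circle. cmod (g t) powr p)"
    using ae by (intro integral_cong_AE) measurable
  then show "Lp_norm p f = (LINT t|circle. cmod (g t) powr p) powr (1 / p)"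
    by (simp add: Lp_norm_val)
qed

subsection \<open>Lebesgue spaces\<close>

lemma Lp_norm_nonneg [simp]: "0 \<le> Lp_norm p f"
  by (simp add: Lp_norm_val)

lemma Lp_zero [simp]: "0 \<in> Lp p" "Lp_norm p 0 = 0"
proof -
  have ae: "AE t in circle. cmod (val 0 t) = cmod 0"
    using val_0 by eventually_elim simp
  show "0 \<in> Lp p" "Lp_norm p 0 = 0"
    using Lp_cong[OF ae, of p] by simp_all
qed

lemma Lp_add:
  assumes "f \<in> Lp p" "g \<in> Lp p" "0 \<le> p"
  shows "f + g \<in> Lp p"
proof -
  have ae: "AE t in circle. cmod (val (f + g) t) = cmod (val f t + val g t)"
    using val_plus[of f g] by eventually_elim simp
  show ?thesis
    using assms unfolding Lp_cong(1)[OF ae, of p, simplified] by (intro integrable_powr_add) (auto simp: mem_Lp_iff)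
qed

lemma Lp_norm_triangle:
  assumes "f \<in> Lp p" "g \<in> Lp p" "1 \<le> p"
  shows "Lp_norm p (f + g) \<le> Lp_norm p f + Lp_norm p g"
proof -
  have ae: "AE t in circle. cmod (val (f + g) t) = cmod (val f t + val g t)"
    using val_plus[of f g] by eventually_elim simp
  show ?thesis
    using assms unfolding Lp_cong(2)[OF ae, of p, simplified] Lp_norm_val[of p f] Lp_norm_val[of p g]
    by (intro Minkowski) (auto simp: mem_Lp_iff)
qed

lemma Lp_scale:
  assumes "f \<in> Lp p"
  shows "scale c f \<in> Lp p"
proof -
  have ae: "AE t in circle. cmod (val (scale c f) t) = cmod (c * val f t)"
    using val_scale[of c f] by eventually_elim simp
  show ?thesis
    using assms unfolding Lp_cong(1)[OF ae, of p, simplified] by (simp add: mem_Lp_iff norm_mult powr_mult)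
qed

lemma Lp_norm_scale:
  assumes "1 \<le> p"
  shows "Lp_norm p (scale c f) = cmod c * Lp_norm p f"
proof -
  have ae: "AE t in circle. cmod (val (scale c f) t) = cmod (c * val f t)"
    using val_scale[of c f] by eventually_elim simp
  show ?thesis
    unfolding Lp_cong(2)[OF ae, of p, simplified] Lp_norm_val[of p f] norm_mult
    using assms by (simp add: powr_mult integral_nonneg_AE powr_powr)
qed

lemma uminus_eq_scale: "- f = scale (- 1) f"
  by (metis circle_fun.scale_minus_left circle_fun.scale_one)

lemma Lp_uminus [simp]: "- f \<in> Lp p \<longleftrightarrow> f \<in> Lp p"
  using Lp_scale[of f p "-1"] Lp_scale[of "- f" p "-1"] by (metis uminus_eq_scale add.inverse_inverse)

lemma Lp_norm_uminus: "1 \<le> p \<Longrightarrow> Lp_norm p (- f) = Lp_norm p f"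
  using Lp_norm_scale[of p "- 1" f] by simp

lemma Lp_diff: "f \<in> Lp p \<Longrightarrow> g \<in> Lp p \<Longrightarrow> 0 \<le> p \<Longrightarrow> f - g \<in> Lp p"
  using Lp_add[of f p "- g"] by simp

lemma Lp_norm_minus_commute: "1 \<le> p \<Longrightarrow> Lp_norm p (f - g) = Lp_norm p (g - f)"
  using Lp_norm_uminus[of p "f - g"] by simp

lemma Lp_norm_triangle_diff:
  assumes "f \<in> Lp p" "g \<in> Lp p" "1 \<le> p"
  shows "Lp_norm p (f - g) \<le> Lp_norm p f + Lp_norm p g"
  using Lp_norm_triangle[of f p "- g"] assms by (simp add: Lp_norm_uminus)

lemma Lp_norm_triangle_mid:
  assumes "f \<in> Lp p" "g \<in> Lp p" "h \<in> Lp p" "1 \<le> p"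
  shows "Lp_norm p (f - h) \<le> Lp_norm p (f - g) + Lp_norm p (g - h)"
  using Lp_norm_triangle[of "f - g" p "g - h"] assms Lp_diff by simp

lemma Lp_sum: "0 \<le> p \<Longrightarrow> (\<And>i. i \<in> I \<Longrightarrow> f i \<in> Lp p) \<Longrightarrow> sum f I \<in> Lp p"
  by (induction I rule: infinite_finite_induct) (auto intro: Lp_add)

lemma Lp_norm_sum:
  assumes "1 \<le> p" "\<And>i. i \<in> I \<Longrightarrow> f i \<in> Lp p"
  shows "Lp_norm p (sum f I) \<le> (\<Sum>i\<in>I. Lp_norm p (f i))"
  using assms
proof (induction I rule: infinite_finite_induct)
  case (insert i I)
  have "Lp_norm p (sum f (insert i I)) \<le> Lp_norm p (f i) + Lp_norm p (sum f I)"
    using insert by (auto intro!: Lp_norm_triangle Lp_sum)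
  with insert show ?case by auto
qed auto

lemma Lp_norm_eq_0:
  assumes "f \<in> Lp p" "Lp_norm p f = 0"
  shows "f = 0"
proof -
  have "AE t in circle. val f t = 0"
    using assms by (intro AE_zero_of_integral_powr[of _ _ p]) (auto simp: mem_Lp_iff Lp_norm_val)
  then show ?thesis
    unfolding circle_fun_eq_iff using val_0 by eventually_elim simp
qed

lemma Lp_norm_powr: "1 \<le> p \<Longrightarrow> Lp_norm p f powr p = (LINT t|circle. cmod (val f t) powr p)"
  by (simp add: Lp_norm_val powr_powr integral_nonneg_AE)

lemma conj_exp:
  assumes "1 < p"
  shows "1 < conj_exp p" "1 / p + 1 / conj_exp p = 1" "conj_exp (conj_exp p) = p"
  using assms by (simp_all add: conj_exp_def field_simps)

lemma Lp_mult:
  assumes p: "1 < p" and f: "f \<in> Lp p" and g: "g \<in> Lp (conj_exp p)"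
  shows "f * g \<in> Lp 1" "Lp_norm 1 (f * g) \<le> Lp_norm p f * Lp_norm (conj_exp p) g"
proof -
  have ae: "AE t in circle. cmod (val (f * g) t) = cmod (val f t * val g t)"
    using val_times[of f g] by eventually_elim simp
  note H = Hoelder[OF val_measurable[of f, folded measurable_cong_sets[OF sets_circle refl]]
      val_measurable[of g, folded measurable_cong_sets[OF sets_circle refl]] p conj_exp(1,2)[OF p]
      f[unfolded mem_Lp_iff] g[unfolded mem_Lp_iff]]
  show "f * g \<in> Lp 1"
    unfolding Lp_cong(1)[OF ae, of 1, simplified] using H(1) by (simp add: integrable_norm_iff)
  show "Lp_norm 1 (f * g) \<le> Lp_norm p f * Lp_norm (conj_exp p) g"
    unfolding Lp_cong(2)[OF ae, of 1, simplified] using H(2)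
    by (simp add: Lp_norm_val integral_nonneg_AE)
qed

lemma Linf_Lp:
  assumes "f \<in> Linf" "0 \<le> p"
  shows "f \<in> Lp p"
proof -
  obtain C where C: "AE t in circle. cmod (val f t) \<le> C"
    using assms by (auto simp: mem_Linf_iff)
  show ?thesis
    unfolding mem_Lp_iff
    by (rule circle.integrable_const_bound[of _ "C powr p"])
      (use C assms in \<open>auto elim!: eventually_mono intro!: powr_mono2\<close>)
qed

lemma Lp_norm_bound:
  assumes "AE t in circle. cmod (val f t) \<le> C" "0 \<le> C" "1 \<le> p"
  shows "Lp_norm p f \<le> C"
proof -
  have "f \<in> Lp p" using assms by (intro Linf_Lp) (auto simp: mem_Linf_iff)
  have "(LINT t|circle. cmod (val f t) powr p) \<le> (LINT t|circle. C powr p)"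
    using \<open>f \<in> Lp p\<close> assms
    by (intro integral_mono_AE) (auto simp: mem_Lp_iff elim!: eventually_mono intro!: powr_mono2)
  then have "Lp_norm p f powr p \<le> C powr p"
    using assms by (simp add: Lp_norm_powr)
  then show ?thesis
    using assms powr_mono2[of "1 / p" "Lp_norm p f powr p" "C powr p"]
    by (simp add: powr_powr)
qed

lemma one_Linf: "1 \<in> Linf"
  unfolding mem_Linf_iff by (rule exI[of _ 1]) (use val_1 in \<open>auto elim: eventually_mono\<close>)

lemma Lp_one_norm: "1 \<le> p \<Longrightarrow> Lp_norm p 1 \<le> 1"
  by (rule Lp_norm_bound) (use val_1 in \<open>auto elim: eventually_mono\<close>)

lemma Lp_subset_L1:
  assumes "1 < p" "f \<in> Lp p"
  shows "f \<in> Lp 1" "Lp_norm 1 f \<le> Lp_norm p f"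
proof -
  have 1: "1 \<in> Lp (conj_exp p)" "Lp_norm (conj_exp p) 1 \<le> 1"
    using conj_exp[OF assms(1)] by (auto intro: Linf_Lp one_Linf Lp_one_norm)
  show "f \<in> Lp 1"
    using Lp_mult(1)[OF assms 1(1)] by simp
  show "Lp_norm 1 f \<le> Lp_norm p f"
    using Lp_mult(2)[OF assms 1(1)] mult_left_le[OF 1(2), of "Lp_norm p f"] by simp
qed

lemma Linf_mult_Lp:
  assumes "a \<in> Linf"
  obtains C where "0 \<le> C" "\<And>f p. f \<in> Lp p \<Longrightarrow> 1 \<le> p \<Longrightarrow> a * f \<in> Lp p"
    "\<And>f p. f \<in> Lp p \<Longrightarrow> 1 \<le> p \<Longrightarrow> Lp_norm p (a * f) \<le> C * Lp_norm p f"
proof -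
  obtain C' where C': "AE t in circle. cmod (val a t) \<le> C'"
    using assms by (auto simp: mem_Linf_iff)
  define C where "C = max 0 C'"
  have C: "AE t in circle. cmod (val a t) \<le> C" "0 \<le> C"
    using C' by (auto simp: C_def elim: eventually_mono)
  have main: "a * f \<in> Lp p \<and> Lp_norm p (a * f) \<le> C * Lp_norm p f" if f: "f \<in> Lp p" and p: "1 \<le> p" for f p
  proof -
    have ae: "AE t in circle. cmod (val (a * f) t) = cmod (val a t * val f t)"
      using val_times[of a f] by eventually_elim simp
    have bd: "AE t in circle. cmod (val a t * val f t) powr p \<le> C powr p * cmod (val f t) powr p"
      using C(1) by eventually_elim (use C(2) p in \<open>auto simp: norm_mult powr_mult intro!: mult_right_mono powr_mono2\<close>)
    have fi: "integrable circle (\<lambda>t. C powr p * cmod (val f t) powr p)"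
      using f by (simp add: mem_Lp_iff)
    have i: "integrable circle (\<lambda>t. cmod (val a t * val f t) powr p)"
      by (rule Bochner_Integration.integrable_bound[OF fi]) (use bd in \<open>auto elim: eventually_mono\<close>)
    then have af: "a * f \<in> Lp p"
      using Lp_cong(1)[OF ae, of p] by simp
    have "Lp_norm p (a * f) powr p \<le> (C * Lp_norm p f) powr p"
    proof -
      have "Lp_norm p (a * f) powr p = (LINT t|circle. cmod (val a t * val f t) powr p)"
        using p by (simp add: Lp_cong(2)[OF ae] powr_powr integral_nonneg_AE)
      also have "\<dots> \<le> (LINT t|circle. C powr p * cmod (val f t) powr p)"
        by (rule integral_mono_AE[OF i fi bd])
      also have "\<dots> = (C * Lp_norm p f) powr p"
        using p C(2) by (simp add: Lp_norm_powr powr_mult)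
      finally show ?thesis .
    qed
    then have "Lp_norm p (a * f) \<le> C * Lp_norm p f"
      using p C(2) powr_mono2[of "1 / p" "Lp_norm p (a * f) powr p" "(C * Lp_norm p f) powr p"]
      by (simp add: powr_powr)
    with af show ?thesis by simp
  qed
  with C(2) that show thesis by blast
qed

lemma Linf_Lp_mult: "a \<in> Linf \<Longrightarrow> f \<in> Lp p \<Longrightarrow> 1 \<le> p \<Longrightarrow> a * f \<in> Lp p"
  by (rule Linf_mult_Lp) auto

lemma Linf_mult: 
  assumes "a \<in> Linf" "b \<in> Linf"
  shows "a * b \<in> Linf"
proof -
  obtain C D where "AE t in circle. cmod (val a t) \<le> C" "AE t in circle. cmod (val b t) \<le> D"
    using assms by (auto simp: mem_Linf_iff)
  then have "AE t in circle. cmod (val (a * b) t) \<le> \<bar>C\<bar> * \<bar>D\<bar>"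
    using val_times[of a b] by eventually_elim (auto simp: norm_mult intro!: mult_mono)
  then show ?thesis by (auto simp: mem_Linf_iff)
qed

lemma Linf_tvar_powi: "tvar powi k \<in> Linf"
  unfolding mem_Linf_iff
  by (rule exI[of _ 1]) (use val_powi[of k] AE_circle_norm in \<open>eventually_elim, auto simp: norm_power_int\<close>)

lemma Lp_tvar_powi_mult:
  shows "tvar powi k * f \<in> Lp p \<longleftrightarrow> f \<in> Lp p" "Lp_norm p (tvar powi k * f) = Lp_norm p f"
proof -
  have ae: "AE t in circle. cmod (val (tvar powi k * f) t) = cmod (val f t)"
    using val_times[of "tvar powi k" f] val_powi[of k] AE_circle_norm
    by eventually_elim (auto simp: norm_mult norm_power_int)
  show "tvar powi k * f \<in> Lp p \<longleftrightarrow> f \<in> Lp p" "Lp_norm p (tvar powi k * f) = Lp_norm p f"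
    using Lp_cong[OF ae, of p] by (simp_all add: mem_Lp_iff Lp_norm_val)
qed

lemma Lp_tvar_powi: "0 \<le> p \<Longrightarrow> tvar powi k \<in> Lp p"
  by (intro Linf_Lp Linf_tvar_powi)

subsection \<open>Fourier coefficients\<close>

lemma fourier_integrable:
  assumes "f \<in> Lp 1"
  shows "integrable circle (\<lambda>t. val f t * t powi n)"
proof (rule Bochner_Integration.integrable_bound)
  show "integrable circle (val f)" using assms by (simp add: mem_Lp_1_iff)
  show "AE t in circle. cmod (val f t * t powi n) \<le> cmod (val f t)"
    by (rule AE_circleI) (simp add: norm_mult norm_power_int)
qed measurable

lemma fourier_bound:
  assumes "f \<in> Lp 1"
  shows "cmod (fourier f n) \<le> Lp_norm 1 f"
proof -
  have "cmod (fourier f n) \<le> (LINT t|circle. cmod (val f t * t powi (- n)))"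
    unfolding fourier_val by (rule integral_norm_bound)
  also have "\<dots> = (LINT t|circle. cmod (val f t))"
  proof (intro integral_cong_AE AE_circleI)
    show "cmod (val f t * t powi - n) = cmod (val f t)" if "cmod t = 1" for t
      using that by (simp add: norm_mult norm_power_int)
  qed measurable
  finally show ?thesis by (simp add: Lp_norm_1)
qed

lemma fourier_add:
  assumes "f \<in> Lp 1" "g \<in> Lp 1"
  shows "fourier (f + g) n = fourier f n + fourier g n"
proof -
  have "fourier (f + g) n = (LINT t|circle. val f t * t powi (- n) + val g t * t powi (- n))"
    unfolding fourier_val
    by (intro integral_cong_AE) (use val_plus[of f g] in \<open>auto simp: distrib_right elim: eventually_mono\<close>)
  also have "\<dots> = fourier f n + fourier g n"
    unfolding fourier_val using assms by (intro Bochner_Integration.integral_add fourier_integrable)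
  finally show ?thesis .
qed

lemma fourier_scale: "fourier (scale c f) n = c * fourier f n"
proof -
  have "fourier (scale c f) n = (LINT t|circle. c * (val f t * t powi (- n)))"
    unfolding fourier_val
    by (intro integral_cong_AE) (use val_scale[of c f] in \<open>auto elim: eventually_mono\<close>)
  then show ?thesis by (simp add: fourier_val)
qed

lemma fourier_uminus: "fourier (- f) n = - fourier f n"
  unfolding uminus_eq_scale fourier_scale by simp

lemma fourier_diff: "f \<in> Lp 1 \<Longrightarrow> g \<in> Lp 1 \<Longrightarrow> fourier (f - g) n = fourier f n - fourier g n"
  using fourier_add[of f "- g" n] by (simp add: fourier_uminus)

lemma fourier_0 [simp]: "fourier 0 n = 0"
  using fourier_scale[of 0 0 n] by simp

lemma fourier_sum: "(\<And>i. i \<in> I \<Longrightarrow> f i \<in> Lp 1) \<Longrightarrow> fourier (sum f I) n = (\<Sum>i\<in>I. fourier (f i) n)"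
  by (induction I rule: infinite_finite_induct) (auto simp: fourier_add Lp_sum)

lemma fourier_shift: "fourier (tvar powi k * f) n = fourier f (n - k)"
  unfolding fourier_val
proof (intro integral_cong_AE)
  show "AE t in circle. val (tvar powi k * f) t * t powi - n = val f t * t powi - (n - k)"
    using val_times[of "tvar powi k" f] val_powi[of k] AE_circle_norm
  proof eventually_elim
    case (elim t)
    have "t powi k * t powi (- n) = t powi (k + - n)"
      using elim by (intro power_int_add[symmetric]) auto
    with elim show ?case by (simp add: mult_ac)
  qed
qed measurable

lemma fourier_tvar_powi: "fourier (tvar powi k) n = (if n = k then 1 else 0)"
proof -
  have "fourier (tvar powi k) n = (LINT t|circle. t powi (k - n))"
    unfolding fourier_val
  proof (intro integral_cong_AE)
    show "AE t in circle. val (tvar powi k) t * t powi - n = t powi (k - n)"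
      using val_powi[of k] AE_circle_norm
    proof eventually_elim
      case (elim t)
      have "t powi (k + - n) = t powi k * t powi (- n)"
        using elim by (intro power_int_add) auto
      with elim show ?case by simp
    qed
  qed measurable
  then show ?thesis by (auto simp: circle_integral_powi)
qed

subsection \<open>Convergence in Lebesgue spaces\<close>

lemma Lp_subset_L1': "1 \<le> p \<Longrightarrow> f \<in> Lp p \<Longrightarrow> f \<in> Lp 1"
  using Lp_subset_L1(1)[of p f] by (cases "p = 1") auto

lemma fourier_bound_Lp: "1 < p \<Longrightarrow> f \<in> Lp p \<Longrightarrow> cmod (fourier f n) \<le> Lp_norm p f"
  using Lp_subset_L1[of p f] fourier_bound[of f n] by linarith

lemma fourier_tendsto:
  assumes "1 < p" "\<And>k. F k \<in> Lp p" "f \<in> Lp p" "(\<lambda>k. Lp_norm p (F k - f)) \<longlonglongrightarrow> 0"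
  shows "(\<lambda>k. fourier (F k) n) \<longlonglongrightarrow> fourier f n"
proof (rule LIM_zero_cancel, rule Lim_null_comparison[OF always_eventually assms(4)], rule allI)
  fix k
  have "fourier (F k) n - fourier f n = fourier (F k - f) n"
    using assms by (intro fourier_diff[symmetric] Lp_subset_L1) auto
  then show "norm (fourier (F k) n - fourier f n) \<le> Lp_norm p (F k - f)"
    using assms by (auto intro!: fourier_bound_Lp Lp_diff)
qed

lemma Lp_dominated_convergence:
  assumes p: "1 \<le> p" and lim: "AE t in circle. (\<lambda>k. val (F k) t) \<longlonglongrightarrow> val f t"
    and bound: "\<And>k. AE t in circle. cmod (val (F k) t) \<le> w t"
    and w: "integrable circle (\<lambda>t. w t powr p)"
  shows "f \<in> Lp p" "\<And>k. F k \<in> Lp p" "(\<lambda>k. Lp_norm p (F k - f)) \<longlonglongrightarrow> 0"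
proof -
  have w0: "AE t in circle. 0 \<le> w t"
    using bound[of 0] by eventually_elim (meson norm_ge_zero order_trans)
  have b: "AE t in circle. \<forall>k. cmod (val (F k) t) \<le> w t"
    using bound by (simp add: AE_all_countable)
  have fb: "AE t in circle. cmod (val f t) \<le> w t"
    using lim b by eventually_elim (auto intro: LIMSEQ_le_const2[OF tendsto_norm])
  show f: "f \<in> Lp p"
    unfolding mem_Lp_iff using fb p w0
    by (intro Bochner_Integration.integrable_bound[OF w]) (auto elim!: eventually_elim2 intro!: powr_mono2)
  show F: "F k \<in> Lp p" for k
    unfolding mem_Lp_iff using bound[of k] p w0
    by (intro Bochner_Integration.integrable_bound[OF w]) (auto elim!: eventually_elim2 intro!: powr_mono2)
  have "(\<lambda>k. LINT t|circle. cmod (val (F k) t - val f t) powr p) \<longlonglongrightarrow> (LINT t|circle. 0)"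
  proof (rule integral_dominated_convergence[where w="\<lambda>t. 2 powr p * w t powr p"])
    show "AE t in circle. (\<lambda>k. cmod (val (F k) t - val f t) powr p) \<longlonglongrightarrow> 0"
      using lim
    proof eventually_elim
      case (elim t)
      then have "(\<lambda>k. cmod (val (F k) t - val f t)) \<longlonglongrightarrow> 0"
        by (intro tendsto_norm_zero LIM_zero)
      then show ?case
        using p by (intro tendsto_zero_powrI[where b=p] tendsto_const) auto
    qed
    show "AE t in circle. norm (cmod (val (F k) t - val f t) powr p) \<le> 2 powr p * w t powr p" for k
      using fb bound[of k] w0
    proof eventually_elim
      case (elim t)
      have "cmod (val (F k) t - val f t) \<le> 2 * w t"
        using norm_triangle_ineq4[of "val (F k) t" "val f t"] elim by linarith
      then have "cmod (val (F k) t - val f t) powr p \<le> (2 * w t) powr p"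
        using p by (intro powr_mono2) auto
      then show ?case using elim by (simp add: powr_mult)
    qed
  qed (use w in auto)
  then have *: "(\<lambda>k. LINT t|circle. cmod (val (F k) t - val f t) powr p) \<longlonglongrightarrow> 0"
    by simp
  have eq: "Lp_norm p (F k - f) = (LINT t|circle. cmod (val (F k) t - val f t) powr p) powr (1 / p)" for k
    by (rule Lp_cong(2)) (use val_minus[of "F k" f] in \<open>auto elim: eventually_mono\<close>)
  show "(\<lambda>k. Lp_norm p (F k - f)) \<longlonglongrightarrow> 0"
    unfolding eq using p * by (intro tendsto_zero_powrI[where b="1/p"] tendsto_const) (auto intro!: always_eventually integral_nonneg_AE)
qed

text \<open>Riesz-Fischer. A subsequence with summable increments converges almost everywhere, and
  Fatou's lemma turns the Cauchy condition into norm convergence of the whole sequence to the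
  pointwise limit.\<close>

theorem Lp_complete:
  assumes p: "1 < p" and F: "\<And>n::nat. F n \<in> Lp p"
    and cauchy: "\<And>e. 0 < e \<Longrightarrow> \<exists>N. \<forall>m\<ge>N. \<forall>n\<ge>N. Lp_norm p (F m - F n) < e"
  shows "\<exists>f\<in>Lp p. (\<lambda>n. Lp_norm p (F n - f)) \<longlonglongrightarrow> 0"
proof -
  have "\<exists>N. \<forall>m\<ge>N. \<forall>n\<ge>N. Lp_norm p (F m - F n) < (1/2) ^ k" for k :: nat
    by (rule cauchy) simp
  then obtain N where N: "\<And>k m n. N k \<le> m \<Longrightarrow> N k \<le> n \<Longrightarrow> Lp_norm p (F m - F n) < (1/2) ^ k"
    by metis
  \<comment> \<open>Summing the \<open>N i\<close> makes \<open>r\<close> increasing with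
    \<open>N k \<le> r k\<close>; hence the increment from \<open>r k\<close> to
    \<open>r (Suc k)\<close> has norm at most \<open>(1/2) ^ k\<close>.\<close>
  define r where "r k = (\<Sum>i\<le>k. N i) + k" for k
  have rN: "N k \<le> r k" for k
    using member_le_sum[of k "{..k}" N] by (simp add: r_def)
  have rmono: "r k \<le> r (Suc k)" for k by (simp add: r_def)
  have rk: "k \<le> r k" for k by (simp add: r_def)
  define g where "g k = F (r (Suc k)) - F (r k)" for k
  have g: "g k \<in> Lp p" for k
    using F p by (auto simp: g_def intro!: Lp_diff)
  have gn: "Lp_norm p (g k) \<le> (1/2) ^ k" for k
    unfolding g_def using N[of k "r (Suc k)" "r k"] rN[of k] rmono[of k] by simp
  \<comment> \<open>Pointwise summability is obtained from the \<open>L^1\<close> norms, which are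
    below the \<open>L^p\<close> norms because the total mass is 1.\<close>
  have "(\<integral>\<^sup>+t. (\<Sum>k. ennreal (cmod (val (g k) t))) \<partial>circle) = (\<Sum>k. \<integral>\<^sup>+t. ennreal (cmod (val (g k) t)) \<partial>circle)"
    by (rule nn_integral_suminf) measurable
  also have "\<dots> \<le> (\<Sum>k. ennreal ((1/2) ^ k))"
  proof (intro suminf_le allI summableI)
    fix k
    have "(\<integral>\<^sup>+t. ennreal (cmod (val (g k) t)) \<partial>circle) = ennreal (LINT t|circle. cmod (val (g k) t))"
      using Lp_subset_L1(1)[OF p g[of k]] by (intro nn_integral_eq_integral) (auto simp: mem_Lp_1_iff)
    also have "\<dots> \<le> ennreal ((1/2) ^ k)"
      using Lp_subset_L1(2)[OF p g[of k]] gn[of k] by (intro ennreal_leI) (simp add: Lp_norm_1)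
    finally show "(\<integral>\<^sup>+t. ennreal (cmod (val (g k) t)) \<partial>circle) \<le> ennreal ((1/2) ^ k)" .
  qed
  also have "\<dots> < top"
    by (subst suminf_ennreal2) (auto intro!: summable_geometric)
  finally have "AE t in circle. (\<Sum>k. ennreal (cmod (val (g k) t))) \<noteq> \<infinity>"
    by (intro nn_integral_PInf_AE) auto
  moreover have "AE t in circle. \<forall>k. val (g k) t = val (F (r (Suc k))) t - val (F (r k)) t"
    unfolding AE_all_countable g_def by (simp add: val_minus)
  ultimately have conv: "AE t in circle. convergent (\<lambda>k. val (F (r k)) t)"
  proof eventually_elim
    case (elim t)
    have "summable (\<lambda>k. cmod (val (g k) t))"
      using elim(1) by (intro summable_suminf_not_top) auto
    then have "summable (\<lambda>k. val (F (r (Suc k))) t - val (F (r k)) t)"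
      unfolding elim(2)[rule_format, symmetric] by (rule summable_norm_cancel)
    then have "convergent (\<lambda>n. \<Sum>k<n. val (F (r (Suc k))) t - val (F (r k)) t)"
      by (simp add: summable_iff_convergent)
    then have "convergent (\<lambda>n. val (F (r n)) t - val (F (r 0)) t)"
      by (simp add: sum_lessThan_telescope[of "\<lambda>k. val (F (r k)) t"])
    from convergent_add[OF this convergent_const[of "val (F (r 0)) t"]] show ?case by simp
  qed
  define \<phi> where "\<phi> t = lim (\<lambda>k. val (F (r k)) t)" for t
  have [measurable]: "\<phi> \<in> borel_measurable borel"
    unfolding \<phi>_def by measurable
  have lim: "AE t in circle. (\<lambda>k. val (F (r k)) t) \<longlonglongrightarrow> \<phi> t"
    using conv unfolding \<phi>_def by eventually_elim (simp add: convergent_LIMSEQ_iff)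
  define f where "f = abs_circle_fun \<phi>"
  have f\<phi>: "AE t in circle. val f t = \<phi> t"
    unfolding f_def by (rule val_abs) measurable
  \<comment> \<open>Fatou's lemma along the subsequence. That \<open>F n - f\<close> is in
    \<open>Lp p\<close> comes out together with the estimate, and this is how the limit is seen to
    belong to \<open>Lp p\<close>.\<close>
  have key: "F n - f \<in> Lp p \<and> Lp_norm p (F n - f) \<le> e"
    if n: "\<And>m. M \<le> m \<Longrightarrow> Lp_norm p (F n - F m) \<le> e" for n M e
  proof -
    have e0: "0 \<le> e" using order_trans[OF Lp_norm_nonneg n[of M]] by simp
    have ae: "AE t in circle. cmod (val (F n - f) t) = cmod (val (F n) t - \<phi> t)"
      using val_minus[of "F n" f] f\<phi> by eventually_elim simp
    have "(\<integral>\<^sup>+t. ennreal (cmod (val (F n) t - \<phi> t) powr p) \<partial>circle)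
        = (\<integral>\<^sup>+t. liminf (\<lambda>m. ennreal (cmod (val (F n) t - val (F (r m)) t) powr p)) \<partial>circle)"
    proof (intro nn_integral_cong_AE)
      show "AE t in circle. ennreal (cmod (val (F n) t - \<phi> t) powr p)
          = liminf (\<lambda>m. ennreal (cmod (val (F n) t - val (F (r m)) t) powr p))"
        using lim
      proof eventually_elim
        case (elim t)
        have "(\<lambda>m. ennreal (cmod (val (F n) t - val (F (r m)) t) powr p)) \<longlonglongrightarrow> ennreal (cmod (val (F n) t - \<phi> t) powr p)"
          using p elim by (intro tendsto_ennrealI tendsto_powr' tendsto_intros) auto
        then show ?case by (intro lim_imp_Liminf[symmetric]) auto
      qed
    qed
    also have "\<dots> \<le> liminf (\<lambda>m. \<integral>\<^sup>+t. ennreal (cmod (val (F n) t - val (F (r m)) t) powr p) \<partial>circle)"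
      by (rule nn_integral_liminf) measurable
    also have "\<dots> \<le> ennreal (e powr p)"
    proof (rule Liminf_le)
      have "(\<integral>\<^sup>+t. ennreal (cmod (val (F n) t - val (F (r m)) t) powr p) \<partial>circle) \<le> ennreal (e powr p)" if "M \<le> m" for m
      proof -
        have ae2: "AE t in circle. cmod (val (F n - F (r m)) t) = cmod (val (F n) t - val (F (r m)) t)"
          using val_minus[of "F n" "F (r m)"] by eventually_elim simp
        have L: "F n - F (r m) \<in> Lp p" using F p by (auto intro!: Lp_diff)
        have "(\<integral>\<^sup>+t. ennreal (cmod (val (F n) t - val (F (r m)) t) powr p) \<partial>circle)
            = ennreal (LINT t|circle. cmod (val (F n) t - val (F (r m)) t) powr p)"
          using L Lp_cong(1)[OF ae2, of p] by (intro nn_integral_eq_integral) auto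
        also have "(LINT t|circle. cmod (val (F n) t - val (F (r m)) t) powr p) = Lp_norm p (F n - F (r m)) powr p"
          using Lp_cong(2)[OF ae2, of p] p by (simp add: powr_powr integral_nonneg_AE)
        also have "\<dots> \<le> e powr p"
          using n[of "r m"] that rk[of m] p by (intro powr_mono2) auto
        finally show ?thesis by (simp add: ennreal_leI)
      qed
      then show "\<forall>\<^sub>F m in sequentially. (\<integral>\<^sup>+t. ennreal (cmod (val (F n) t - val (F (r m)) t) powr p) \<partial>circle) \<le> ennreal (e powr p)"
        by (auto simp: eventually_sequentially)
    qed simp
    finally have nn: "(\<integral>\<^sup>+t. ennreal (cmod (val (F n) t - \<phi> t) powr p) \<partial>circle) \<le> ennreal (e powr p)" .
    then have i: "integrable circle (\<lambda>t. cmod (val (F n) t - \<phi> t) powr p)"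
      by (intro integrableI_bounded) (auto simp: order_le_less_trans)
    then have L: "F n - f \<in> Lp p"
      using Lp_cong(1)[OF ae, of p] by simp
    have "ennreal (LINT t|circle. cmod (val (F n) t - \<phi> t) powr p) \<le> ennreal (e powr p)"
      using nn nn_integral_eq_integral[OF i] by simp
    then have "(LINT t|circle. cmod (val (F n) t - \<phi> t) powr p) \<le> e powr p"
      by (simp add: ennreal_le_iff)
    then have "Lp_norm p (F n - f) \<le> (e powr p) powr (1 / p)"
      using p by (subst Lp_cong(2)[OF ae]) (auto intro!: powr_mono2 integral_nonneg_AE)
    with L e0 p show ?thesis by (simp add: powr_powr)
  qed
  have "\<exists>M. \<forall>n\<ge>M. F n - f \<in> Lp p \<and> Lp_norm p (F n - f) \<le> e" if e: "0 < e" for e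
  proof -
    obtain M where "\<forall>m\<ge>M. \<forall>n\<ge>M. Lp_norm p (F m - F n) < e"
      using cauchy[OF e] by blast
    then show ?thesis by (intro exI[of _ M] allI impI key[of M]) (auto intro: less_imp_le)
  qed
  note K = this
  obtain M where "F M - f \<in> Lp p" using K[of 1] by auto
  then have fL: "f \<in> Lp p"
    using Lp_diff[of "F M" p "F M - f"] F p by simp
  have "(\<lambda>n. Lp_norm p (F n - f)) \<longlonglongrightarrow> 0"
  proof (rule LIMSEQ_I)
    fix e :: real assume e: "0 < e"
    obtain M where "\<forall>n\<ge>M. F n - f \<in> Lp p \<and> Lp_norm p (F n - f) \<le> e / 2"
      using K[of "e/2"] e by auto
    then show "\<exists>no. \<forall>n\<ge>no. norm (Lp_norm p (F n - f) - 0) < e"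
      using e by (intro exI[of _ M]) (auto intro: le_less_trans)
  qed
  with fL show ?thesis by blast
qed

subsection \<open>Trigonometric polynomials\<close>

definition trig :: "circle_fun set" where
  "trig = circle_fun.span (range (\<lambda>k::int. tvar powi k))"

lemma trig_tvar_powi [simp]: "tvar powi k \<in> trig"
  unfolding trig_def by (intro circle_fun.span_base) auto

lemma trig_add: "f \<in> trig \<Longrightarrow> g \<in> trig \<Longrightarrow> f + g \<in> trig"
  unfolding trig_def by (rule circle_fun.span_add)

lemma trig_diff: "f \<in> trig \<Longrightarrow> g \<in> trig \<Longrightarrow> f - g \<in> trig"
  unfolding trig_def by (rule circle_fun.span_diff)

lemma trig_scale: "f \<in> trig \<Longrightarrow> scale c f \<in> trig"
  unfolding trig_def by (rule circle_fun.span_scale)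

lemma trig_0 [simp]: "0 \<in> trig"
  unfolding trig_def by (rule circle_fun.span_zero)

lemma trig_1 [simp]: "1 \<in> trig"
  using trig_tvar_powi[of 0] by simp

lemma trig_induct [consumes 1, case_names zero add]:
  assumes "f \<in> trig" "P 0" "\<And>c k f. f \<in> trig \<Longrightarrow> P f \<Longrightarrow> P (scale c (tvar powi k) + f)"
  shows "P f"
proof -
  have "f \<in> trig \<and> P f"
    using assms(1) unfolding trig_def
  proof (induction rule: circle_fun.span_induct_alt)
    case (step c x y)
    then obtain k where "x = tvar powi k" by auto
    with step assms(3)[of y c k] show ?case
      by (auto simp: trig_def intro!: circle_fun.span_add circle_fun.span_scale intro: circle_fun.span_base rangeI)
  qed (use assms(2) in \<open>simp add: circle_fun.span_zero\<close>)
  then show ?thesis by simp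
qed

lemma trig_mult:
  assumes "f \<in> trig" "g \<in> trig"
  shows "f * g \<in> trig"
proof -
  have *: "tvar powi k * g \<in> trig" if "g \<in> trig" for k g
    using that
    by (induction rule: trig_induct) (auto simp: distrib_left scale_eq_times tvar_powi_add[symmetric] intro: trig_add trig_scale trig_tvar_powi)
  show ?thesis
    using assms(1)
    by (induction rule: trig_induct) (auto simp: distrib_right scale_eq_times intro: trig_add trig_scale * assms(2))
qed

lemma Linf_add: 
  assumes "a \<in> Linf" "b \<in> Linf"
  shows "a + b \<in> Linf"
proof -
  obtain C D where "AE t in circle. cmod (val a t) \<le> C" "AE t in circle. cmod (val b t) \<le> D"
    using assms by (auto simp: mem_Linf_iff)
  then have "AE t in circle. cmod (val (a + b) t) \<le> C + D"
    using val_plus[of a b] by eventually_elim (auto intro: norm_triangle_mono)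
  then show ?thesis by (auto simp: mem_Linf_iff)
qed

lemma Linf_scale: 
  assumes "a \<in> Linf"
  shows "scale c a \<in> Linf"
proof -
  obtain C where "AE t in circle. cmod (val a t) \<le> C"
    using assms by (auto simp: mem_Linf_iff)
  then have "AE t in circle. cmod (val (scale c a) t) \<le> cmod c * C"
    using val_scale[of c a] by eventually_elim (auto simp: norm_mult intro!: mult_left_mono)
  then show ?thesis by (auto simp: mem_Linf_iff)
qed

lemma Linf_0: "0 \<in> Linf"
  using Linf_scale[OF one_Linf, of 0] by simp

lemma trig_Linf: "f \<in> trig \<Longrightarrow> f \<in> Linf"
  by (induction rule: trig_induct) (auto intro: Linf_0 Linf_add Linf_scale Linf_tvar_powi)

lemma trig_Lp: "f \<in> trig \<Longrightarrow> 0 \<le> p \<Longrightarrow> f \<in> Lp p"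
  by (intro Linf_Lp trig_Linf)

text \<open>Links polynomials on the plane, as supplied by Stone-Weierstrass, with trigonometric
  polynomials: on the circle \<open>cnj t\<close> is the inverse of \<open>t\<close>, so real and
  imaginary part are combinations of \<open>t\<close> and its inverse.\<close>

lemma trig_of_real_polynomial:
  assumes "real_polynomial_function g"
  shows "\<exists>h\<in>trig. AE t in circle. val h t = of_real (g t)"
  using assms
proof (induction rule: real_polynomial_function.induct)
  case (linear f)
  \<comment> \<open>The coefficients come from \<open>f t = Re t * f 1 + Im t * f \<i>\<close> with
    \<open>Re t = (t + 1/t) / 2\<close> and \<open>Im t = (t - 1/t) / (2 * \<i>)\<close>.\<close>
  define h where "h = scale ((f 1 - \<i> * f \<i>) / 2) (tvar powi 1) + scale ((f 1 + \<i> * f \<i>) / 2) (tvar powi (-1))"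
  have "AE t in circle. val h t = of_real (f t)"
    unfolding h_def
    using val_plus[of "scale ((f 1 - \<i> * f \<i>) / 2) (tvar powi 1)" "scale ((f 1 + \<i> * f \<i>) / 2) (tvar powi (-1))"]
      val_scale[of "(f 1 - \<i> * f \<i>) / 2" "tvar powi 1"] val_scale[of "(f 1 + \<i> * f \<i>) / 2" "tvar powi (-1)"]
      val_powi[of 1] val_powi[of "-1"] AE_circle_norm
  proof eventually_elim
    case (elim t)
    have "inverse t = cnj t"
      using elim by (simp add: inverse_eq_divide divide_conv_cnj)
    moreover have "f t = f (Re t *\<^sub>R 1 + Im t *\<^sub>R \<i>)"
      by (rule arg_cong[of _ _ f]) (simp add: complex_eq_iff)
    then have "f t = Re t * f 1 + Im t * f \<i>"
      using linear by (simp add: linear_add linear_scale bounded_linear.linear)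
    ultimately show ?case
      using elim by (simp add: complex_eq_iff power_int_minus field_simps)
  qed
  moreover have "h \<in> trig"
    unfolding h_def by (intro trig_add trig_scale trig_tvar_powi)
  ultimately show ?case by blast
next
  case (const c)
  show ?case
    by (rule bexI[of _ "scale c 1"]) (use val_scale[of c 1] val_1 in \<open>auto elim: eventually_elim2 intro: trig_scale\<close>)
next
  case (add f g)
  then obtain h1 h2 where h: "h1 \<in> trig" "AE t in circle. val h1 t = of_real (f t)"
      "h2 \<in> trig" "AE t in circle. val h2 t = of_real (g t)" by auto
  have "AE t in circle. val (h1 + h2) t = of_real (f t + g t)"
    using h(2,4) val_plus[of h1 h2] by eventually_elim simp
  with h show ?case by (intro bexI[of _ "h1 + h2"] trig_add)
next
  case (mult f g)
  then obtain h1 h2 where h: "h1 \<in> trig" "AE t in circle. val h1 t = of_real (f t)"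
      "h2 \<in> trig" "AE t in circle. val h2 t = of_real (g t)" by auto
  have "AE t in circle. val (h1 * h2) t = of_real (f t * g t)"
    using h(2,4) val_times[of h1 h2] by eventually_elim simp
  with h show ?case by (intro bexI[of _ "h1 * h2"] trig_mult)
qed

text \<open>Uniform boundedness together with convergence almost everywhere permits dominated
  convergence against every function in \<open>L^1\<close> or \<open>L^p\<close>; norm convergence
  alone would not suffice for products with merely integrable functions.\<close>

lemma trig_bounded_approx:
  assumes "f \<in> Linf"
  obtains h C where "\<And>n::nat. h n \<in> trig" "\<And>n. AE t in circle. cmod (val (h n) t) \<le> C" "0 \<le> C"
    "AE t in circle. (\<lambda>n. val (h n) t) \<longlonglongrightarrow> val f t"
proof -
  obtain B' where B': "AE t in circle. cmod (val f t) \<le> B'"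
    using assms by (auto simp: mem_Linf_iff)
  define B where "B = max 0 B'"
  have B: "AE t in circle. cmod (val f t) \<le> B" "0 \<le> B"
    using B' by (auto simp: B_def elim: eventually_mono)
  have fi: "integrable circle (val f)"
    using Linf_Lp[OF assms, of 1] by (simp add: mem_Lp_1_iff)
  have K: "AE t in circle. t \<in> sphere 0 1"
    using AE_circle_norm by eventually_elim simp
  have "\<exists>h\<in>trig. (AE t in circle. cmod (val h t) \<le> 2 * B + 2) \<and> (LINT t|circle. cmod (val f t - val h t)) < e" if e: "0 < e" for e
  proof -
    have re: "AE t in circle. \<bar>Re (val f t)\<bar> \<le> B" "AE t in circle. \<bar>Im (val f t)\<bar> \<le> B"
      using B(1) by (auto elim!: eventually_mono intro: order_trans[OF abs_Re_le_cmod] order_trans[OF abs_Im_le_cmod])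
    obtain g1 where g1: "real_polynomial_function g1" "\<forall>x\<in>sphere 0 1. \<bar>g1 x\<bar> \<le> B + 1" "(LINT t|circle. \<bar>Re (val f t) - g1 t\<bar>) < e / 2"
      using polynomial_approx_integrable[OF sets_circle circle.finite_measure_axioms compact_sphere K integrable_Re[OF fi] re(1) B(2), of "e/2"] e by auto
    obtain g2 where g2: "real_polynomial_function g2" "\<forall>x\<in>sphere 0 1. \<bar>g2 x\<bar> \<le> B + 1" "(LINT t|circle. \<bar>Im (val f t) - g2 t\<bar>) < e / 2"
      using polynomial_approx_integrable[OF sets_circle circle.finite_measure_axioms compact_sphere K integrable_Im[OF fi] re(2) B(2), of "e/2"] e by auto
    obtain h1 where h1: "h1 \<in> trig" "AE t in circle. val h1 t = of_real (g1 t)"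
      using trig_of_real_polynomial[OF g1(1)] by auto
    obtain h2 where h2: "h2 \<in> trig" "AE t in circle. val h2 t = of_real (g2 t)"
      using trig_of_real_polynomial[OF g2(1)] by auto
    define h where "h = h1 + scale \<i> h2"
    have hv: "AE t in circle. val h t = of_real (g1 t) + \<i> * of_real (g2 t)"
      unfolding h_def using h1(2) h2(2) val_plus[of h1 "scale \<i> h2"] val_scale[of \<i> h2]
      by eventually_elim simp
    have hb: "AE t in circle. cmod (val h t) \<le> 2 * B + 2"
      using hv K
    proof eventually_elim
      case (elim t)
      have "cmod (val h t) \<le> \<bar>g1 t\<bar> + \<bar>g2 t\<bar>"
        unfolding elim(1) by (rule order_trans[OF norm_triangle_ineq]) (simp add: norm_mult)
      with g1(2) g2(2) elim(2) show ?case by fastforce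
    qed
    have [measurable]: "g1 \<in> borel_measurable borel" "g2 \<in> borel_measurable borel"
      using g1(1) g2(1) continuous_on_polymonial_function[of g1 UNIV] continuous_on_polymonial_function[of g2 UNIV]
      by (simp_all add: borel_measurable_continuous_onI real_polynomial_function_eq)
    have hi: "integrable circle (val h)"
      using hb by (intro circle.integrable_const_bound) auto
    have gi: "integrable circle g1" "integrable circle g2"
      using g1(2) g2(2) K by (auto intro!: circle.integrable_const_bound[of _ "B + 1"] elim!: eventually_mono)
    have "(LINT t|circle. cmod (val f t - val h t)) \<le> (LINT t|circle. \<bar>Re (val f t) - g1 t\<bar> + \<bar>Im (val f t) - g2 t\<bar>)"
    proof (rule integral_mono_AE)
      show "AE t in circle. cmod (val f t - val h t) \<le> \<bar>Re (val f t) - g1 t\<bar> + \<bar>Im (val f t) - g2 t\<bar>"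
        using hv
      proof eventually_elim
        case (elim t)
        show ?case using cmod_le[of "val f t - val h t"] elim by simp
      qed
    qed (use fi hi gi in auto)
    also have "\<dots> < e"
      using fi gi g1(3) g2(3) by simp
    finally show ?thesis
      using hb h1(1) h2(1) unfolding h_def by (intro bexI[of _ "h1 + scale \<i> h2"]) (auto intro: trig_add trig_scale)
  qed
  note approx = this
  have "\<exists>h\<in>trig. (AE t in circle. cmod (val h t) \<le> 2 * B + 2) \<and> (LINT t|circle. cmod (val f t - val h t)) < 1 / Suc n" for n :: nat
    by (rule approx) simp
  then obtain h where h: "\<And>n. h n \<in> trig" "\<And>n. AE t in circle. cmod (val (h n) t) \<le> 2 * B + 2"
      "\<And>n. (LINT t|circle. cmod (val f t - val (h n) t)) < 1 / Suc n"
    by metis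
  have lim: "(\<lambda>n. LINT t|circle. cmod (val f t - val (h n) t)) \<longlonglongrightarrow> 0"
    by (rule tendsto_sandwich[OF _ _ tendsto_const LIMSEQ_inverse_real_of_nat])
      (use h(3) in \<open>auto intro!: always_eventually less_imp_le simp: inverse_eq_divide\<close>)
  have hi: "integrable circle (val (h n))" for n
    using h(2)[of n] by (intro circle.integrable_const_bound) auto
  \<comment> \<open>Convergence in \<open>L^1\<close> yields convergence almost everywhere along a
    subsequence.\<close>
  obtain r where r: "strict_mono r" "AE t in circle. (\<lambda>n. val f t - val (h (r n)) t) \<longlonglongrightarrow> 0"
    using tendsto_L1_AE_subseq[OF _ lim] fi hi by auto
  have "AE t in circle. (\<lambda>n. val (h (r n)) t) \<longlonglongrightarrow> val f t"
    using r(2)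
  proof eventually_elim
    case (elim t)
    from tendsto_diff[OF tendsto_const[of "val f t"] this] show ?case by simp
  qed
  with h(1,2) B(2) show thesis
    by (intro that[of "\<lambda>n. h (r n)" "2 * B + 2"]) auto
qed

lemma trig_dense_Linf:
  assumes "f \<in> Linf" "1 \<le> p"
  obtains h where "\<And>n::nat. h n \<in> trig" "(\<lambda>n. Lp_norm p (h n - f)) \<longlonglongrightarrow> 0"
proof -
  obtain h C where h: "\<And>n::nat. h n \<in> trig" "\<And>n. AE t in circle. cmod (val (h n) t) \<le> C" "0 \<le> C"
    "AE t in circle. (\<lambda>n. val (h n) t) \<longlonglongrightarrow> val f t"
    using trig_bounded_approx[OF assms(1)] by blast
  have "(\<lambda>n. Lp_norm p (h n - f)) \<longlonglongrightarrow> 0"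
    by (rule Lp_dominated_convergence(3)[OF assms(2) h(4,2)]) simp
  with h(1) show thesis by (rule that)
qed

lemma Linf_dense:
  assumes f: "f \<in> Lp p" and p: "1 \<le> p"
  obtains h where "\<And>n::nat. h n \<in> Linf" "(\<lambda>n. Lp_norm p (h n - f)) \<longlonglongrightarrow> 0"
proof -
  define h where "h n = abs_circle_fun (\<lambda>t. if cmod (val f t) \<le> real n then val f t else 0)" for n :: nat
  have hv: "AE t in circle. val (h n) t = (if cmod (val f t) \<le> real n then val f t else 0)" for n
    unfolding h_def by (rule val_abs) measurable
  show thesis
  proof (rule that)
    show "h n \<in> Linf" for n
      unfolding mem_Linf_iff by (rule exI[of _ "real n"]) (use hv[of n] in \<open>auto elim!: eventually_mono\<close>)
    show "(\<lambda>n. Lp_norm p (h n - f)) \<longlonglongrightarrow> 0"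
    proof (rule Lp_dominated_convergence(3)[OF p, where w="\<lambda>t. cmod (val f t)"])
      have "AE t in circle. \<forall>n. val (h n) t = (if cmod (val f t) \<le> real n then val f t else 0)"
        using hv by (simp add: AE_all_countable)
      then show "AE t in circle. (\<lambda>n. val (h n) t) \<longlonglongrightarrow> val f t"
      proof eventually_elim
        case (elim t)
        obtain N :: nat where "cmod (val f t) \<le> real N"
          using real_arch_simple by blast
        then have "\<forall>n\<ge>N. val (h n) t = val f t"
          using elim by (auto intro: order_trans)
        then have "\<forall>\<^sub>F n in sequentially. val (h n) t = val f t"
          unfolding eventually_sequentially by blast
        then show ?case by (rule tendsto_eventually)
      qed
      show "AE t in circle. cmod (val (h n) t) \<le> cmod (val f t)" for n
        using hv[of n] by eventually_elim simp
    qed (use f in \<open>simp add: mem_Lp_iff\<close>)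
  qed
qed

lemma trig_dense:
  assumes f: "f \<in> Lp p" and p: "1 \<le> p" and e: "0 < e"
  obtains h where "h \<in> trig" "Lp_norm p (h - f) < e"
proof -
  obtain g where g: "\<And>n::nat. g n \<in> Linf" "(\<lambda>n. Lp_norm p (g n - f)) \<longlonglongrightarrow> 0"
    using Linf_dense[OF f p] by blast
  have "\<forall>\<^sub>F n in sequentially. Lp_norm p (g n - f) < e / 2"
    using g(2) e by (intro order_tendstoD(2)) auto
  then obtain n where n: "Lp_norm p (g n - f) < e / 2"
    using eventually_happens'[OF sequentially_bot] by blast
  obtain h where h: "\<And>n::nat. h n \<in> trig" "(\<lambda>k. Lp_norm p (h k - g n)) \<longlonglongrightarrow> 0"
    using trig_dense_Linf[OF g(1) p] by blast
  have "\<forall>\<^sub>F k in sequentially. Lp_norm p (h k - g n) < e / 2"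
    using h(2) e by (intro order_tendstoD(2)) auto
  then obtain k where k: "Lp_norm p (h k - g n) < e / 2"
    using eventually_happens'[OF sequentially_bot] by blast
  have "Lp_norm p (h k - f) \<le> Lp_norm p (h k - g n) + Lp_norm p (g n - f)"
    using p f g(1)[of n] h(1)[of k] by (intro Lp_norm_triangle_mid) (auto intro: Linf_Lp trig_Lp)
  with n k have "Lp_norm p (h k - f) < e" by simp
  with h(1) show thesis by (rule that)
qed

lemma trig_dense_seq:
  assumes f: "f \<in> Lp p" and p: "1 \<le> p"
  obtains h where "\<And>n::nat. h n \<in> trig" "(\<lambda>n. Lp_norm p (h n - f)) \<longlonglongrightarrow> 0"
proof -
  have "\<exists>h\<in>trig. Lp_norm p (h - f) < 1 / Suc n" for n :: nat
    by (rule trig_dense[OF f p, of "1 / Suc n"]) auto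
  then obtain h where h: "\<And>n. h n \<in> trig" "\<And>n. Lp_norm p (h n - f) < 1 / Suc n"
    by metis
  have "(\<lambda>n. Lp_norm p (h n - f)) \<longlonglongrightarrow> 0"
    by (rule tendsto_sandwich[OF _ _ tendsto_const LIMSEQ_inverse_real_of_nat])
      (use h(2) in \<open>auto intro!: always_eventually less_imp_le simp: inverse_eq_divide\<close>)
  with h(1) show thesis by (rule that)
qed

lemma fourier_mult_Linf_limit:
  assumes f: "f \<in> Lp 1" and h: "AE t in circle. (\<lambda>n. val (h n) t) \<longlonglongrightarrow> val g t"
    and C: "\<And>n. AE t in circle. cmod (val (h n) t) \<le> C"
  shows "(\<lambda>n. fourier (f * h n) k) \<longlonglongrightarrow> fourier (f * g) k"
proof -
  have C0: "0 \<le> C"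
  proof (rule ccontr)
    assume "\<not> 0 \<le> C"
    have "AE t in circle. False"
    proof (rule AE_mp[OF C[of 0]], rule AE_I2, rule impI)
      fix t assume "cmod (val (h 0) t) \<le> C"
      with \<open>\<not> 0 \<le> C\<close> norm_ge_zero[of "val (h 0) t"] show False by linarith
    qed
    then show False using circle_not_AE_False by simp
  qed
  have "AE t in circle. \<forall>n. val (f * h n) t = val f t * val (h n) t"
    unfolding AE_all_countable using val_times by blast
  then have A: "AE t in circle. (\<lambda>n. val (f * h n) t) \<longlonglongrightarrow> val (f * g) t"
    using h val_times[of f g]
  proof eventually_elim
    case (elim t)
    then show ?case by (simp add: tendsto_mult_left)
  qed
  have B: "AE t in circle. cmod (val (f * h n) t) \<le> C * cmod (val f t)" for n
    using C[of n] val_times[of f "h n"]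
  proof eventually_elim
    case (elim t)
    show ?case
      unfolding elim(2) norm_mult by (subst mult.commute) (rule mult_right_mono[OF elim(1) norm_ge_zero])
  qed
  have I: "integrable circle (\<lambda>t. (C * cmod (val f t)) powr 1)"
    using f C0 by (simp add: mem_Lp_1_iff)
  note L = Lp_dominated_convergence(1,2)[OF order_refl A B I]
    and lim = Lp_dominated_convergence(3)[OF order_refl A B I]
  show ?thesis
  proof (rule LIM_zero_cancel, rule Lim_null_comparison[OF always_eventually lim], rule allI)
    fix n
    have "fourier (f * h n) k - fourier (f * g) k = fourier (f * h n - f * g) k"
      using L by (intro fourier_diff[symmetric])
    then show "norm (fourier (f * h n) k - fourier (f * g) k) \<le> Lp_norm 1 (f * h n - f * g)"
      using L by (auto intro!: fourier_bound Lp_diff)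
  qed
qed

lemma fourier_mult_trig_zero:
  assumes "\<And>n. fourier f n = 0" "f \<in> Lp 1" "h \<in> trig"
  shows "fourier (f * h) n = 0"
  using assms(3)
proof (induction rule: trig_induct)
  case (add c k h)
  have "f * h \<in> Lp 1" "f * tvar powi k \<in> Lp 1"
    using Linf_Lp_mult[OF trig_Linf[OF add(1)] assms(2)] Linf_Lp_mult[OF Linf_tvar_powi assms(2)]
    by (simp_all add: mult.commute)
  then show ?case
    using add fourier_shift[of k f n] assms(1)
    by (simp add: distrib_left scale_eq_times fourier_add Lp_scale fourier_scale mult.commute)
qed simp

text \<open>The product of \<open>f\<close> with the bounded function \<open>cnj (sgn f)\<close> has
  the \<open>L^1\<close> norm of \<open>f\<close> as its mean. Boundedly convergent trigonometric
  polynomials replace this multiplier, and against them the mean is 0.\<close>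

theorem fourier_unique:
  assumes f: "f \<in> Lp 1" and zero: "\<And>n. fourier f n = 0"
  shows "f = 0"
proof -
  define g where "g = abs_circle_fun (\<lambda>t. cnj (sgn (val f t)))"
  have gv: "AE t in circle. val g t = cnj (sgn (val f t))"
    unfolding g_def by (rule val_abs) measurable
  have "g \<in> Linf"
    unfolding mem_Linf_iff by (rule exI[of _ 1]) (use gv in eventually_elim, auto simp: norm_sgn)
  then obtain h C where h: "\<And>n::nat. h n \<in> trig" "\<And>n. AE t in circle. cmod (val (h n) t) \<le> C" "0 \<le> C"
    "AE t in circle. (\<lambda>n. val (h n) t) \<longlonglongrightarrow> val g t"
    using trig_bounded_approx by blast
  have "(\<lambda>n. fourier (f * h n) 0) \<longlonglongrightarrow> fourier (f * g) 0"
    by (rule fourier_mult_Linf_limit[OF f h(4,2)])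
  then have "fourier (f * g) 0 = 0"
    using fourier_mult_trig_zero[OF zero f h(1)] by (simp add: LIMSEQ_const_iff)
  moreover have "fourier (f * g) 0 = (LINT t|circle. of_real (cmod (val f t)))"
    unfolding fourier_val
  proof (intro integral_cong_AE)
    show "AE t in circle. val (f * g) t * t powi - 0 = of_real (cmod (val f t))"
      using gv val_times[of f g]
    proof eventually_elim
      case (elim t)
      have "val f t * cnj (sgn (val f t)) = of_real (cmod (val f t))"
        by (cases "val f t = 0") (auto simp: sgn_eq complex_norm_square[symmetric] power2_eq_square)
      with elim show ?case by simp
    qed
  qed measurable
  ultimately have "Lp_norm 1 f = 0"
    by (simp add: Lp_norm_1)
  with f show ?thesis by (rule Lp_norm_eq_0)
qed

lemma fourier_eqI:
  assumes "f \<in> Lp 1" "g \<in> Lp 1" "\<And>n. fourier f n = fourier g n"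
  shows "f = g"
  using fourier_unique[of "f - g"] assms by (simp add: Lp_diff fourier_diff)

subsection \<open>The theorem of M. Riesz\<close>

lemma AE_circle_continuous_zero:
  fixes u :: "complex \<Rightarrow> complex"
  assumes [measurable]: "u \<in> borel_measurable borel" and u: "continuous_on (sphere 0 1) u"
    and ae: "AE t in circle. u t = 0" and t: "cmod t = 1"
  shows "u t = 0"
proof -
  have "0 = (LINT t|circle. of_real (cmod (u t)) :: complex)"
    by (rule integral_eq_zero_AE[symmetric]) (use ae in eventually_elim, simp)
  also have "\<dots> = integral {0..1} (\<lambda>s. of_real (cmod (u (cis (2 * pi * s)))))"
    using circle_integral_eq[of "\<lambda>t. of_real (cmod (u t))" "\<lambda>t. of_real (cmod (u t))"] u
    by (auto intro!: continuous_intros)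
  also have "\<dots> = of_real (integral {0..1} (\<lambda>s. cmod (u (cis (2 * pi * s)))))"
  proof -
    have "(\<lambda>s. cmod (u (cis (2 * pi * s)))) integrable_on {0..1}"
      by (intro integrable_continuous_interval continuous_intros continuous_on_compose2[OF u]) auto
    from has_integral_of_real[OF integrable_integral[OF this]] show ?thesis
      by (rule integral_unique)
  qed
  finally have "integral {0..1} (\<lambda>s. cmod (u (cis (2 * pi * s)))) = 0"
    by simp
  then have z: "\<forall>s\<in>{0..1}. cmod (u (cis (2 * pi * s))) = 0"
    by (subst (asm) integral_eq_0_iff)
      (auto intro!: continuous_intros continuous_on_compose2[OF u])
  have "t = cis (2 * pi * (Arg2pi t / (2 * pi)))"
    using Arg2pi_eq[of t] t by (simp add: cis_conv_exp)
  moreover have "Arg2pi t / (2 * pi) \<in> {0..1}"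
    using Arg2pi[of t] by (auto simp: field_simps)
  ultimately show ?thesis using z by force
qed

text \<open>A polynomial plus a conjugated polynomial, recorded as entire functions so that the mean
  value property and the maximum principle apply. The condition \<open>G 0 = 0\<close> puts the
  constant term into \<open>F\<close>, which is then the analytic part.\<close>

lemma trig_split:
  assumes "h \<in> trig"
  shows "\<exists>F G. F holomorphic_on UNIV \<and> G holomorphic_on UNIV \<and> G 0 = 0 \<and> (AE t in circle. val h t = F t + cnj (G t))"
  using assms
proof (induction rule: trig_induct)
  case zero
  show ?case
    by (rule exI[of _ "\<lambda>_. 0"], rule exI[of _ "\<lambda>_. 0"]) (use val_0 in auto)
next
  case (add c k h)
  then obtain F G where FG: "F holomorphic_on UNIV" "G holomorphic_on UNIV" "G 0 = 0" "AE t in circle. val h t = F t + cnj (G t)"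
    by auto
  have ae: "AE t in circle. val (scale c (tvar powi k) + h) t = c * t powi k + F t + cnj (G t)"
    using FG(4) val_plus[of "scale c (tvar powi k)" h] val_scale[of c "tvar powi k"] val_powi[of k]
    by eventually_elim simp
  show ?case
  proof (cases "0 \<le> k")
    case True
    show ?thesis
      using FG ae True
      by (intro exI[of _ "\<lambda>t. c * t ^ nat k + F t"] exI[of _ G]) (auto simp: power_int_def intro!: holomorphic_intros)
  next
    case False
    have "AE t in circle. val (scale c (tvar powi k) + h) t = F t + cnj (cnj c * t ^ nat (- k) + G t)"
      using ae AE_circle_norm
    proof eventually_elim
      case (elim t)
      then have "inverse t = cnj t"
        by (simp add: inverse_eq_divide divide_conv_cnj)
      with elim False show ?case
        by (simp add: power_int_def)
    qed
    with FG False show ?thesis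
      by (intro exI[of _ F] exI[of _ "\<lambda>t. cnj c * t ^ nat (- k) + G t"]) (auto simp: power_0_left intro!: holomorphic_intros)
  qed
qed

text \<open>The relation between \<open>f\<close> and its Riesz projection in terms of coefficients.
  Being a relation, it can be used before existence in \<open>Lp p\<close> is established.\<close>

definition analytic_part :: "circle_fun \<Rightarrow> circle_fun \<Rightarrow> bool" where
  "analytic_part f g \<longleftrightarrow> (\<forall>n. fourier g n = (if n \<ge> 0 then fourier f n else 0))"

lemma holomorphic_measurable:
  "F holomorphic_on UNIV \<Longrightarrow> (F :: complex \<Rightarrow> complex) \<in> borel_measurable borel"
  by (intro borel_measurable_continuous_onI holomorphic_on_imp_continuous_on)

lemma entire_Lp:
  assumes F: "F holomorphic_on UNIV"
  shows "abs_circle_fun F \<in> Linf"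
proof -
  have "compact (F ` sphere 0 1)"
    by (intro compact_continuous_image holomorphic_on_imp_continuous_on holomorphic_on_subset[OF F]) auto
  then obtain C where "\<forall>t\<in>sphere 0 1. cmod (F t) \<le> C"
    using compact_imp_bounded[of "F ` sphere 0 1"] unfolding bounded_iff by auto
  then have C: "cmod (F t) \<le> C" if "cmod t = 1" for t
    using that by auto
  show ?thesis
    unfolding mem_Linf_iff
    by (rule exI[of _ C]) (use val_abs[OF holomorphic_measurable[OF F]] AE_circle_norm in \<open>eventually_elim, auto simp: C\<close>)
qed

lemma entire_fourier:
  assumes F: "F holomorphic_on UNIV" and n: "0 \<le> n"
  shows "(LINT t|circle. F t * t powi n) = (if n = 0 then F 0 else 0)"
proof -
  have [measurable]: "F \<in> borel_measurable borel" by (rule holomorphic_measurable[OF F])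
  have "(LINT t|circle. F t * t powi n) = F 0 * 0 ^ nat n"
  proof (rule circle_mean_value)
    show "(\<lambda>t. F t * t powi n) \<in> borel_measurable borel" by measurable
    show "F t * t powi n = F t * t ^ nat n" for t
      using n by (simp add: power_int_def)
    show "continuous_on (cball 0 1) (\<lambda>t. F t * t ^ nat n)"
      by (intro continuous_intros holomorphic_on_imp_continuous_on holomorphic_on_subset[OF F]) auto
    show "(\<lambda>t. F t * t ^ nat n) holomorphic_on ball 0 1"
      by (intro holomorphic_intros holomorphic_on_subset[OF F]) auto
  qed
  with n show ?thesis by (auto simp: power_0_left)
qed

lemma analytic_part_split:
  assumes h: "AE t in circle. val h t = F t + cnj (G t)"
    and F: "F holomorphic_on UNIV" and G: "G holomorphic_on UNIV" "G 0 = 0"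
    and g: "g \<in> Lp 1" "analytic_part h g"
  shows "AE t in circle. val g t = F t"
proof -
  have [measurable]: "F \<in> borel_measurable borel" "G \<in> borel_measurable borel"
    using F G by (auto intro: holomorphic_measurable)
  define f where "f = abs_circle_fun F"
  have fv: "AE t in circle. val f t = F t"
    unfolding f_def by (rule val_abs) measurable
  have f1: "f \<in> Lp 1" unfolding f_def by (intro Linf_Lp entire_Lp F) auto
  have Gi: "integrable circle (\<lambda>t. G t * t powi n)" and Fi: "integrable circle (\<lambda>t. F t * t powi n)" for n
  proof -
    have *: "integrable circle (\<lambda>t. H t * t powi n)" if H: "H holomorphic_on UNIV" for H :: "complex \<Rightarrow> complex"
    proof -
      have [measurable]: "H \<in> borel_measurable borel" by (rule holomorphic_measurable[OF H])
      have "integrable circle (\<lambda>t. val (abs_circle_fun H) t * t powi n)"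
        by (intro fourier_integrable Linf_Lp entire_Lp H) auto
      then show ?thesis
        by (rule integrable_cong_AE_imp) (use val_abs[of H] in \<open>auto elim: eventually_mono\<close>)
    qed
    show "integrable circle (\<lambda>t. G t * t powi n)" "integrable circle (\<lambda>t. F t * t powi n)"
      using F G by (auto intro: *)
  qed
  have ff: "fourier f n = (LINT t|circle. F t * t powi (- n))" for n
    unfolding fourier_val by (intro integral_cong_AE) (use fv in \<open>auto elim: eventually_mono\<close>)
  have "fourier g n = fourier f n" for n
  proof (cases "0 \<le> n")
    case True
    have "fourier h n = (LINT t|circle. F t * t powi (- n) + cnj (G t * t powi n))"
      unfolding fourier_val
    proof (intro integral_cong_AE)
      show "AE t in circle. val h t * t powi - n = F t * t powi - n + cnj (G t * t powi n)"
        using h AE_circle_norm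
      proof eventually_elim
        case (elim t)
        then have "inverse t = cnj t"
          by (simp add: inverse_eq_divide divide_conv_cnj)
        moreover have "t powi (- n) = inverse t ^ nat n"
          using True by (cases "n = 0") (auto simp: power_int_def)
        ultimately have "t powi (- n) = cnj (t powi n)"
          using True by (simp add: power_int_def)
        with elim show ?case by (simp add: distrib_right)
      qed
    qed measurable
    also have "\<dots> = (LINT t|circle. F t * t powi (- n)) + (LINT t|circle. cnj (G t * t powi n))"
      by (intro Bochner_Integration.integral_add Fi Bochner_Integration.integrable_cnj Gi)
    also have "(LINT t|circle. cnj (G t * t powi n)) = cnj (LINT t|circle. G t * t powi n)"
      by (rule Bochner_Integration.integral_cnj)
    also have "\<dots> = 0"
      using entire_fourier[OF G(1) True] G(2) by simp
    finally show ?thesis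
      using g(2) True by (simp add: analytic_part_def ff)
  next
    case False
    then show ?thesis
      using g(2) entire_fourier[OF F, of "- n"] by (simp add: analytic_part_def ff)
  qed
  then have "g = f" by (intro fourier_eqI g f1)
  with fv show ?thesis by simp
qed

lemma trig_analytic_part:
  assumes "f \<in> trig"
  shows "\<exists>g\<in>trig. analytic_part f g"
  using assms
proof (induction rule: trig_induct)
  case zero
  then show ?case by (intro bexI[of _ 0]) (auto simp: analytic_part_def)
next
  case (add c k f)
  then obtain g where g: "g \<in> trig" "analytic_part f g" by auto
  have fc: "fourier (scale c (tvar powi k) + h) n = (if n = k then c else 0) + fourier h n" if "h \<in> trig" for h n
    using that by (simp add: fourier_add Lp_scale Lp_tvar_powi trig_Lp fourier_scale fourier_tvar_powi)
  show ?case
  proof (cases "0 \<le> k")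
    case True
    then show ?thesis
      using g fc add by (intro bexI[of _ "scale c (tvar powi k) + g"])
        (auto simp: analytic_part_def intro: trig_add trig_scale trig_tvar_powi)
  next
    case False
    then show ?thesis
      using g fc add by (intro bexI[of _ g]) (auto simp: analytic_part_def)
  qed
qed

lemma trig_expand:
  assumes "f \<in> trig"
  shows "\<exists>S. finite S \<and> f = (\<Sum>k\<in>S. scale (fourier f k) (tvar powi k))"
proof -
  \<comment> \<open>Quantification over all larger finite sets makes the induction work: adding a
    term at a frequency already in \<open>S\<close> needs no case distinction.\<close>
  have "\<exists>S. finite S \<and> (\<forall>T. finite T \<and> S \<subseteq> T \<longrightarrow> f = (\<Sum>k\<in>T. scale (fourier f k) (tvar powi k)))"
    using assms
  proof (induction rule: trig_induct)
    case zero
    show ?case by (rule exI[of _ "{}"]) auto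
  next
    case (add c k f)
    then obtain S where S: "finite S" "\<And>T. finite T \<Longrightarrow> S \<subseteq> T \<Longrightarrow> f = (\<Sum>k\<in>T. scale (fourier f k) (tvar powi k))"
      by auto
    show ?case
    proof (intro exI[of _ "insert k S"] conjI allI impI)
      fix T assume T: "finite T \<and> insert k S \<subseteq> T"
      have fT: "(\<Sum>j\<in>T. scale (fourier f j) (tvar powi j)) = f"
        using S(2)[of T, symmetric] T by auto
      have "(\<Sum>j\<in>T. scale (fourier (scale c (tvar powi k) + f) j) (tvar powi j))
          = (\<Sum>j\<in>T. scale (if j = k then c else 0) (tvar powi j) + scale (fourier f j) (tvar powi j))"
        using add(1)
        by (intro sum.cong refl)
          (simp add: fourier_add Lp_scale Lp_tvar_powi trig_Lp fourier_scale fourier_tvar_powi circle_fun.scale_left_distrib)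
      also have "\<dots> = (\<Sum>j\<in>T. scale (if j = k then c else 0) (tvar powi j)) + f"
        unfolding sum.distrib fT ..
      also have "(\<Sum>j\<in>T. scale (if j = k then c else 0) (tvar powi j)) = (\<Sum>j\<in>T. if j = k then scale c (tvar powi j) else 0)"
        by (intro sum.cong) auto
      also have "\<dots> = scale c (tvar powi k)"
        using T by (simp add: sum.delta)
      finally show "scale c (tvar powi k) + f = (\<Sum>j\<in>T. scale (fourier (scale c (tvar powi k) + f) j) (tvar powi j))" ..
    qed (use S in auto)
  qed
  then show ?thesis by blast
qed

lemma fourier_mult_zero_trig:
  assumes a: "a \<in> Lp 1" and b: "b \<in> trig" and z: "\<And>k. fourier b k = 0 \<or> fourier a (n - k) = 0"
  shows "fourier (a * b) n = 0"
proof -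
  obtain S where S: "finite S" "b = (\<Sum>k\<in>S. scale (fourier b k) (tvar powi k))"
    using trig_expand[OF b] by blast
  have "a * b = (\<Sum>k\<in>S. scale (fourier b k) (tvar powi k * a))"
    by (subst S(2)) (simp add: sum_distrib_left scale_eq_times mult.commute)
  then have "fourier (a * b) n = (\<Sum>k\<in>S. fourier b k * fourier a (n - k))"
    using a by (simp add: fourier_sum Lp_scale Lp_tvar_powi_mult fourier_scale fourier_shift)
  also have "\<dots> = 0"
    using z by (intro sum.neutral) auto
  finally show ?thesis .
qed

text \<open>For \<open>1 < p \<le> 2\<close> the angle \<open>p * pi / 2\<close> lies beyond
  \<open>pi / 2\<close> and not beyond \<open>pi\<close>, so its cosine is negative. Near the end
  points the term \<open>- B * cos (p * \<theta>)\<close> exceeds 1 by itself; elsewhere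
  \<open>cos \<theta>\<close> is bounded below and a large \<open>A\<close> does the work.\<close>

lemma riesz_trig_inequality:
  fixes p :: real
  assumes p: "1 < p" "p \<le> 2"
  obtains A B where "0 \<le> A" "0 \<le> B"
    "\<And>\<theta>. \<bar>\<theta>\<bar> < pi / 2 \<Longrightarrow> 1 \<le> A * cos \<theta> powr p - B * cos (p * \<theta>)"
proof -
  have "pi / 2 < p * (pi / 2)" "p * (pi / 2) \<le> pi"
    using p by (auto simp: field_simps)
  then have "cos (p * (pi / 2)) < cos (pi / 2)"
    by (intro cos_monotone_0_pi) auto
  then have neg: "cos (p * (pi / 2)) < 0" by simp
  \<comment> \<open>With this value \<open>- B * cos (p * \<theta>)\<close> equals 2 at
    \<open>\<theta> = pi / 2\<close>, hence is still above 1 nearby.\<close>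
  define B where "B = - 2 / cos (p * (pi / 2))"
  have B: "0 < B" using neg by (simp add: B_def divide_neg_neg)
  have "((\<lambda>\<theta>. - B * cos (p * \<theta>)) \<longlongrightarrow> - B * cos (p * (pi / 2))) (at (pi / 2))"
    by (intro tendsto_intros)
  then have "\<forall>\<^sub>F \<theta> in at (pi / 2). 1 < - B * cos (p * \<theta>)"
    using neg by (intro order_tendstoD(1)) (auto simp: B_def)
  then have "\<exists>d>0. \<forall>\<theta>. \<theta> \<noteq> pi / 2 \<and> dist \<theta> (pi / 2) < d \<longrightarrow> 1 < - B * cos (p * \<theta>)"
    by (simp add: eventually_at)
  then obtain d where d: "0 < d" "\<And>\<theta>. \<theta> \<noteq> pi / 2 \<Longrightarrow> dist \<theta> (pi / 2) < d \<Longrightarrow> 1 < - B * cos (p * \<theta>)"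
    by blast
  define e where "e = min d (pi / 2)"
  have e: "0 < e" "e \<le> pi / 2" "e \<le> d" using d by (auto simp: e_def)
  define m where "m = cos (pi / 2 - e)"
  have m: "0 < m" unfolding m_def using e by (intro cos_gt_zero_pi) auto
  \<comment> \<open>Where \<open>cos \<theta> \<ge> m\<close>, the first term is at least
    \<open>1 + B\<close>, which outweighs the worst value \<open>- B\<close> of the second.\<close>
  define A where "A = (1 + B) / m powr p"
  have A: "0 < A" using m B by (simp add: A_def)
  have main: "1 \<le> A * cos \<theta> powr p - B * cos (p * \<theta>)" if \<theta>: "0 \<le> \<theta>" "\<theta> < pi / 2" for \<theta>
  proof (cases "pi / 2 - e < \<theta>")
    case True
    then have "1 < - B * cos (p * \<theta>)"
      using \<theta> e by (intro d(2)) (auto simp: dist_real_def)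
    moreover have "0 \<le> A * cos \<theta> powr p" using A by simp
    ultimately show ?thesis by linarith
  next
    case False
    then have "m \<le> cos \<theta>"
      unfolding m_def using \<theta> e by (intro cos_monotone_0_pi_le) auto
    then have "m powr p \<le> cos \<theta> powr p"
      using m p by (intro powr_mono2) auto
    then have "A * m powr p \<le> A * cos \<theta> powr p"
      using A by (intro mult_left_mono) auto
    then have "1 + B \<le> A * cos \<theta> powr p"
      using m by (simp add: A_def)
    moreover have "B * cos (p * \<theta>) \<le> B" using B by (simp add: mult_left_le)
    ultimately show ?thesis by linarith
  qed
  show thesis
  proof (rule that[of A B])
    fix \<theta> :: real assume "\<bar>\<theta>\<bar> < pi / 2"
    then have "1 \<le> A * cos \<bar>\<theta>\<bar> powr p - B * cos (p * \<bar>\<theta>\<bar>)"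
      by (intro main) auto
    then show "1 \<le> A * cos \<theta> powr p - B * cos (p * \<theta>)"
      by (auto simp: abs_if split: if_splits)
  qed (use A B in auto)
qed

text \<open>The minimum principle for the harmonic function \<open>Re E\<close>, read off from the
  maximum modulus principle for \<open>exp (- E)\<close>, whose modulus is
  \<open>exp (- Re E)\<close>.\<close>

lemma Re_pos_on_disc:
  assumes E: "E holomorphic_on UNIV" and pos: "\<And>t. cmod t = 1 \<Longrightarrow> 0 < Re (E t)" and z: "cmod z \<le> 1"
  shows "0 < Re (E z)"
proof -
  have cont: "continuous_on S E" for S
    by (intro holomorphic_on_imp_continuous_on holomorphic_on_subset[OF E]) auto
  have "compact ((\<lambda>t. Re (E t)) ` sphere 0 1)"
    by (intro compact_continuous_image continuous_intros cont) auto
  moreover have "(\<lambda>t. Re (E t)) ` sphere 0 1 \<noteq> {}" by auto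
  ultimately obtain m where m: "m \<in> (\<lambda>t. Re (E t)) ` sphere 0 1" "\<And>x. x \<in> (\<lambda>t. Re (E t)) ` sphere 0 1 \<Longrightarrow> m \<le> x"
    using compact_attains_inf by metis
  have "cmod (exp (- E z)) \<le> exp (- m)"
  proof (rule maximum_modulus_frontier[where S="cball 0 1" and f="\<lambda>z. exp (- E z)"])
    show "(\<lambda>z. exp (- E z)) holomorphic_on interior (cball 0 1)"
      by (intro holomorphic_intros holomorphic_on_subset[OF E]) auto
    show "continuous_on (closure (cball 0 1)) (\<lambda>z. exp (- E z))"
      by (intro continuous_intros cont)
    show "cmod (exp (- E z)) \<le> exp (- m)" if "z \<in> frontier (cball 0 1)" for z
      using that m(2)[of "Re (E z)"] by auto
  qed (use z in auto)
  then have "m \<le> Re (E z)" by simp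
  moreover have "0 < m" using m(1) pos by auto
  ultimately show ?thesis by simp
qed

text \<open>Compare \<open>(Re E)\<^sup>p\<close> with \<open>Re (E\<^sup>p)\<close> pointwise on the circle by the previous inequality; the mean
  of the latter is \<open>E(0)\<^sup>p \<ge> 0\<close>.\<close>

lemma riesz_entire_bound:
  fixes p :: real
  assumes p: "1 < p" "p \<le> 2"
  obtains A where "0 \<le> A" "\<And>E. E holomorphic_on UNIV \<Longrightarrow> Im (E 0) = 0 \<Longrightarrow> (\<And>t. cmod t = 1 \<Longrightarrow> 0 < Re (E t)) \<Longrightarrow>
    (LINT t|circle. cmod (E t) powr p) \<le> A * (LINT t|circle. Re (E t) powr p)"
proof -
  obtain A B where AB: "0 \<le> A" "0 \<le> B"
    "\<And>\<theta>. \<bar>\<theta>\<bar> < pi / 2 \<Longrightarrow> 1 \<le> A * cos \<theta> powr p - B * cos (p * \<theta>)"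
    using riesz_trig_inequality[OF p] by blast
  have "(LINT t|circle. cmod (E t) powr p) \<le> A * (LINT t|circle. Re (E t) powr p)"
    if E: "E holomorphic_on UNIV" and E0: "Im (E 0) = 0" and pos: "\<And>t. cmod t = 1 \<Longrightarrow> 0 < Re (E t)" for E
  proof -
    have [measurable]: "E \<in> borel_measurable borel" by (rule holomorphic_measurable[OF E])
    have pos': "0 < Re (E z)" if "cmod z \<le> 1" for z
      by (rule Re_pos_on_disc[OF E pos that])
    then have nn: "E z \<notin> \<real>\<^sub>\<le>\<^sub>0" if "z \<in> cball 0 1" for z
      using that by (force simp: complex_nonpos_Reals_iff)
    \<comment> \<open>The principal branch of \<open>E\<close> to the power \<open>p\<close>; it is
      analytic on the disc and continuous on its closure because \<open>Re E\<close> is positive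
      there.\<close>
    define L where "L z = exp (of_real p * Ln (E z))" for z
    have Lc: "continuous_on (cball 0 1) L"
      unfolding L_def by (intro continuous_intros nn holomorphic_on_imp_continuous_on holomorphic_on_subset[OF E]) auto
    have Lh: "L holomorphic_on ball 0 1"
      unfolding L_def by (intro holomorphic_intros nn holomorphic_on_subset[OF E]) auto
    \<comment> \<open>Off the closed disc \<open>L\<close> need not be measurable, so it is cut off
      there.\<close>
    define M where "M z = indicator (cball 0 1) z *\<^sub>R L z" for z
    have [measurable]: "M \<in> borel_measurable borel"
      unfolding M_def by (intro borel_measurable_continuous_on_indicator Lc) auto
    have MeqL: "M t = L t" if "cmod t = 1" for t
      using that by (simp add: M_def)
    have mv: "(LINT t|circle. M t) = L 0"
      by (rule circle_mean_value[OF _ MeqL Lc Lh]) auto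
    have "0 \<le> Re (L 0)"
    proof -
      have "E 0 = of_real (Re (E 0))" using E0 by (simp add: complex_eq_iff)
      moreover have "0 < Re (E 0)" by (rule pos') simp
      ultimately have "L 0 = of_real (exp (p * ln (Re (E 0))))"
        unfolding L_def by (metis Ln_of_real exp_of_real of_real_mult)
      then show ?thesis by simp
    qed
    have pt: "cmod (E t) powr p \<le> A * Re (E t) powr p - B * Re (M t)" if t: "cmod t = 1" for t
    proof -
      define w where "w = Ln (E t)"
      have "E t \<noteq> 0" using pos[OF t] by auto
      then have w: "E t = exp w" by (simp add: w_def)
      have "\<bar>Im w\<bar> < pi / 2"
        using pos[OF t] Re_Ln_pos_lt[OF \<open>E t \<noteq> 0\<close>] unfolding w_def by blast
      then have "1 \<le> A * cos (Im w) powr p - B * cos (p * Im w)" "0 \<le> cos (Im w)"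
        by (auto intro!: AB(3) cos_ge_zero)
      then have "exp (p * Re w) * 1 \<le> exp (p * Re w) * (A * cos (Im w) powr p - B * cos (p * Im w))"
        by (intro mult_left_mono) auto
      moreover have "cmod (E t) powr p = exp (p * Re w)"
        by (simp add: w powr_def)
      moreover have "Re (E t) powr p = exp (p * Re w) * cos (Im w) powr p"
        using \<open>0 \<le> cos (Im w)\<close> by (simp add: w Re_exp powr_mult) (simp add: powr_def)
      moreover have "Re (M t) = exp (p * Re w) * cos (p * Im w)"
        by (simp add: MeqL[OF t] L_def w_def[symmetric] Re_exp)
      ultimately show ?thesis by (simp add: algebra_simps)
    qed
    have bdd: "integrable circle f" if fm [measurable]: "f \<in> borel_measurable borel"
      and fg: "\<And>t. cmod t = 1 \<Longrightarrow> f t = g t" and g: "continuous_on (sphere 0 1) g" for f g :: "complex \<Rightarrow> real"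
    proof -
      have "compact (g ` sphere 0 1)" by (intro compact_continuous_image g) auto
      then obtain C where "\<forall>t\<in>sphere 0 1. \<bar>g t\<bar> \<le> C"
        using compact_imp_bounded[of "g ` sphere 0 1"] unfolding bounded_iff by auto
      then show ?thesis
        using fg by (intro circle.integrable_const_bound[of _ C] AE_circleI) auto
    qed
    have Ec: "continuous_on (sphere 0 1) E"
      by (intro holomorphic_on_imp_continuous_on holomorphic_on_subset[OF E]) auto
    have i1: "integrable circle (\<lambda>t. cmod (E t) powr p)"
      by (rule bdd[of _ "\<lambda>t. cmod (E t) powr p"]) (use p pos in \<open>force intro!: continuous_intros Ec\<close>)+
    have i2: "integrable circle (\<lambda>t. Re (E t) powr p)"
      by (rule bdd[of _ "\<lambda>t. Re (E t) powr p"]) (use p pos in \<open>force intro!: continuous_intros Ec\<close>)+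
    have i3: "integrable circle (\<lambda>t. Re (M t))"
      by (rule bdd[of _ "\<lambda>t. Re (L t)"]) (auto simp: MeqL intro!: continuous_intros continuous_on_subset[OF Lc])
    have i4: "integrable circle (\<lambda>t. cmod (M t))"
      by (rule bdd[of _ "\<lambda>t. cmod (L t)"]) (auto simp: MeqL intro!: continuous_intros continuous_on_subset[OF Lc])
    have i5: "integrable circle M"
      using i4 by (subst (asm) integrable_norm_iff) auto
    have "(LINT t|circle. cmod (E t) powr p) \<le> (LINT t|circle. A * Re (E t) powr p - B * Re (M t))"
      using i1 i2 i3 by (intro integral_mono_AE AE_circleI pt) auto
    also have "\<dots> = A * (LINT t|circle. Re (E t) powr p) - B * Re (LINT t|circle. M t)"
      using i2 i3 i5 by simp
    also have "\<dots> \<le> A * (LINT t|circle. Re (E t) powr p)"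
      using mv \<open>0 \<le> Re (L 0)\<close> AB(2) by simp
    finally show ?thesis .
  qed
  with AB(1) that show thesis by blast
qed

lemma Lp_norm_mono_add:
  assumes g: "g \<in> Lp p" and p: "1 \<le> p" and c: "0 \<le> c"
    and le: "AE t in circle. cmod (val f t) \<le> cmod (val g t) + c"
  shows "Lp_norm p f \<le> Lp_norm p g + c"
proof -
  define h where "h = abs_circle_fun (\<lambda>t. of_real (cmod (val g t)))"
  have hv: "AE t in circle. val h t = of_real (cmod (val g t))"
    unfolding h_def by (rule val_abs) measurable
  then have hv': "AE t in circle. cmod (val h t) = cmod (val g t)"
    by eventually_elim simp
  have h: "h \<in> Lp p" "Lp_norm p h = Lp_norm p g"
    using Lp_cong[OF hv', of p] g by (auto simp: mem_Lp_iff Lp_norm_val)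
  have c1: "scale (of_real c) 1 \<in> Lp p" "Lp_norm p (scale (of_real c) 1) \<le> c"
    using p c Lp_one_norm[OF p] one_Linf by (auto simp: Lp_norm_scale mult_left_le intro!: Lp_scale Linf_Lp)
  have k: "h + scale (of_real c) 1 \<in> Lp p"
    using h c1 p by (intro Lp_add) auto
  have le2: "AE t in circle. cmod (val f t) powr p \<le> cmod (val (h + scale (of_real c) 1) t) powr p"
    using le hv val_plus[of h "scale (of_real c) 1"] val_scale[of "of_real c" 1] val_1
  proof eventually_elim
    case (elim t)
    have "cmod (val (h + scale (of_real c) 1) t) = cmod (val g t) + c"
      using elim c by (simp flip: of_real_add)
    then show ?case using elim(1) p by (intro powr_mono2) auto
  qed
  have fi: "integrable circle (\<lambda>t. cmod (val f t) powr p)"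
    by (rule Bochner_Integration.integrable_bound[OF k[unfolded mem_Lp_iff]])
      (use le2 in \<open>auto elim: eventually_mono\<close>)
  have "(LINT t|circle. cmod (val f t) powr p) \<le> (LINT t|circle. cmod (val (h + scale (of_real c) 1) t) powr p)"
    using fi k le2 by (intro integral_mono_AE) (auto simp: mem_Lp_iff)
  then have "Lp_norm p f \<le> Lp_norm p (h + scale (of_real c) 1)"
    unfolding Lp_norm_val using p by (intro powr_mono2) (auto intro: integral_nonneg_AE)
  also have "\<dots> \<le> Lp_norm p h + Lp_norm p (scale (of_real c) 1)"
    using p by (intro Lp_norm_triangle h c1)
  also have "\<dots> \<le> Lp_norm p g + c" using h c1 by simp
  finally show ?thesis .
qed

lemma analytic_part_diff:
  "f \<in> Lp 1 \<Longrightarrow> g \<in> Lp 1 \<Longrightarrow> f' \<in> Lp 1 \<Longrightarrow> g' \<in> Lp 1 \<Longrightarrow> analytic_part f f' \<Longrightarrow> analytic_part g g' \<Longrightarrow>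
    analytic_part (f - g) (f' - g')"
  by (auto simp: analytic_part_def fourier_diff)

lemma analytic_part_unique: "analytic_part f g \<Longrightarrow> analytic_part f h \<Longrightarrow> g \<in> Lp 1 \<Longrightarrow> h \<in> Lp 1 \<Longrightarrow> g = h"
  by (rule fourier_eqI) (auto simp: analytic_part_def)

definition riesz_bound :: "real \<Rightarrow> real \<Rightarrow> bool" where
  "riesz_bound p C \<longleftrightarrow> 0 \<le> C \<and> (\<forall>f\<in>trig. \<forall>g\<in>trig. analytic_part f g \<longrightarrow> Lp_norm p g \<le> C * Lp_norm p f)"

text \<open>If \<open>f = F + cnj G\<close> is real on the circle, then \<open>E = F + G\<close>, up
  to an imaginary constant, has real part \<open>f\<close> there, and the analytic part of
  \<open>f\<close> is \<open>(E + E 0) / 2\<close>. The estimate for entire functions with positive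
  real part then bounds it.\<close>

lemma riesz_bound_positive:
  assumes p: "1 < p" "p \<le> 2"
  obtains C where "0 \<le> C"
    "\<And>f g u. f \<in> trig \<Longrightarrow> g \<in> trig \<Longrightarrow> analytic_part f g \<Longrightarrow> continuous_on UNIV u \<Longrightarrow>
      AE t in circle. val f t = of_real (u t) \<Longrightarrow> (\<And>t. cmod t = 1 \<Longrightarrow> 0 < u t) \<Longrightarrow>
      Lp_norm p g \<le> C * Lp_norm p f"
proof -
  obtain A where A: "0 \<le> A" "\<And>E. E holomorphic_on UNIV \<Longrightarrow> Im (E 0) = 0 \<Longrightarrow> (\<And>t. cmod t = 1 \<Longrightarrow> 0 < Re (E t)) \<Longrightarrow>
    (LINT t|circle. cmod (E t) powr p) \<le> A * (LINT t|circle. Re (E t) powr p)"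
    using riesz_entire_bound[OF p] by metis
  have "Lp_norm p g \<le> A powr (1 / p) * Lp_norm p f"
    if f: "f \<in> trig" and g: "g \<in> trig" and fg: "analytic_part f g" and u: "continuous_on UNIV u"
      and fu: "AE t in circle. val f t = of_real (u t)" and pos: "\<And>t. cmod t = 1 \<Longrightarrow> 0 < u t" for f g u
  proof -
    obtain F G where FG: "F holomorphic_on UNIV" "G holomorphic_on UNIV" "G 0 = 0" "AE t in circle. val f t = F t + cnj (G t)"
      using trig_split[OF f] by blast
    \<comment> \<open>The subtracted constant makes \<open>E 0\<close> real; this is needed for the
      mean of the power of \<open>E\<close> to be nonnegative.\<close>
    define E where "E z = F z + G z - \<i> * of_real (Im (F 0))" for z
    have E: "E holomorphic_on UNIV"
      unfolding E_def by (intro holomorphic_intros FG)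
    have E0: "Im (E 0) = 0" by (simp add: E_def FG)
    have [measurable]: "E \<in> borel_measurable borel" "u \<in> borel_measurable borel"
      using E u by (auto intro: holomorphic_measurable borel_measurable_continuous_onI)
    have "AE t in circle. of_real (Re (E t) - u t) = (0 :: complex)"
      using FG(4) fu
    proof eventually_elim
      case (elim t)
      have "u t = Re (F t + cnj (G t))" using elim by (metis Re_complex_of_real)
      then show ?case by (simp add: E_def)
    qed
    moreover have "continuous_on (sphere 0 1) (\<lambda>t. of_real (Re (E t) - u t) :: complex)"
    proof -
      have "continuous_on (sphere 0 1) E"
        by (intro holomorphic_on_imp_continuous_on holomorphic_on_subset[OF E]) auto
      then show ?thesis
        by (intro continuous_intros continuous_on_subset[OF u]) auto
    qed
    \<comment> \<open>By continuity the identity holds at every point of the circle, so that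
      positivity of \<open>u\<close> becomes positivity of \<open>Re E\<close> on the whole
      circle.\<close>
    ultimately have "of_real (Re (E t) - u t) = (0 :: complex)" if "cmod t = 1" for t
      using that by (intro AE_circle_continuous_zero[of "\<lambda>t. of_real (Re (E t) - u t)"]) measurable
    then have Eu: "Re (E t) = u t" if "cmod t = 1" for t
      using that by (metis eq_iff_diff_eq_0 of_real_eq_0_iff)
    have gv: "AE t in circle. val g t = (E t + E 0) / 2"
    proof (rule analytic_part_split[OF _ _ _ _ _ fg])
      show "AE t in circle. val f t = (E t + E 0) / 2 + cnj ((E t - E 0) / 2)"
        using fu AE_circle_norm
        by eventually_elim (use Eu E0 in \<open>auto simp: complex_eq_iff field_simps\<close>)
    qed (use E g in \<open>auto intro!: holomorphic_intros trig_Lp\<close>)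
    define e where "e = abs_circle_fun E"
    have ev: "AE t in circle. val e t = E t"
      unfolding e_def by (rule val_abs) measurable
    have e: "e \<in> Lp p" unfolding e_def using p by (intro Linf_Lp entire_Lp E) auto
    have "fourier e 0 = E 0"
    proof -
      have "fourier e 0 = (LINT t|circle. E t * t powi 0)"
        unfolding fourier_val by (intro integral_cong_AE) (use ev in \<open>auto elim: eventually_mono\<close>)
      then show ?thesis using entire_fourier[OF E, of 0] by simp
    qed
    then have E0n: "cmod (E 0) \<le> Lp_norm p e"
      using fourier_bound_Lp[OF p(1) e, of 0] by simp
    have "g = scale (1/2) e + scale (E 0 / 2) 1"
      unfolding circle_fun_eq_iff
      using gv ev val_plus[of "scale (1/2) e" "scale (E 0 / 2) 1"] val_scale[of "1/2" e] val_scale[of "E 0 / 2" 1] val_1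
      by eventually_elim (simp add: add_divide_distrib)
    then have "Lp_norm p g \<le> Lp_norm p (scale (1/2) e) + Lp_norm p (scale (E 0 / 2) 1)"
      using p e by (auto intro!: Lp_norm_triangle Lp_scale Linf_Lp one_Linf)
    also have "\<dots> \<le> 1/2 * Lp_norm p e + cmod (E 0) / 2 * 1"
      using p Lp_one_norm[of p] by (simp add: Lp_norm_scale) (simp add: mult_left_le norm_divide)
    also have "\<dots> \<le> Lp_norm p e" using E0n by simp
    also have "\<dots> \<le> A powr (1 / p) * Lp_norm p f"
    proof -
      have "(LINT t|circle. cmod (val e t) powr p) = (LINT t|circle. cmod (E t) powr p)"
        by (intro integral_cong_AE) (use ev in \<open>auto elim: eventually_mono\<close>)
      also have "\<dots> \<le> A * (LINT t|circle. Re (E t) powr p)"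
        by (rule A(2)[OF E E0]) (simp add: Eu pos)
      also have "(LINT t|circle. Re (E t) powr p) = (LINT t|circle. cmod (val f t) powr p)"
      proof (intro integral_cong_AE)
        show "AE t in circle. Re (E t) powr p = cmod (val f t) powr p"
          using fu AE_circle_norm by eventually_elim (use Eu pos in \<open>force simp: less_imp_le\<close>)
      qed measurable
      finally have "Lp_norm p e powr p \<le> A * Lp_norm p f powr p"
        using p by (simp add: Lp_norm_powr)
      then have "(Lp_norm p e powr p) powr (1 / p) \<le> (A * Lp_norm p f powr p) powr (1 / p)"
        using p by (intro powr_mono2) auto
      then show ?thesis
        using p A(1) by (simp add: powr_mult powr_powr)
    qed
    finally show ?thesis .
  qed
  then show thesis by (intro that[of "A powr (1 / p)"]) auto
qed

lemma Lp_norm_le_Lp_norm: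
  assumes "1 \<le> p" "p \<le> r" "f \<in> Lp r"
  shows "Lp_norm p f \<le> Lp_norm r f"
proof (cases "p = r")
  case False
  define s where "s = r / p"
  have s: "1 < s" using assms False by (simp add: s_def)
  have c1: "1 < conj_exp s" "1 / s + 1 / conj_exp s = 1" using conj_exp[OF s] by auto
  have eq: "norm (cmod (val f t) powr p) powr s = cmod (val f t) powr r" for t
    using assms by (simp add: powr_powr s_def)
  have "(LINT t|circle. norm (cmod (val f t) powr p * 1))
    \<le> (LINT t|circle. norm (cmod (val f t) powr p) powr s) powr (1 / s) * (LINT t|circle. norm (1::real) powr conj_exp s) powr (1 / conj_exp s)"
    by (rule Hoelder(2)) (use s c1 assms(3) in \<open>auto simp: eq[simplified] mem_Lp_iff\<close>)
  then have "(LINT t|circle. cmod (val f t) powr p) \<le> (LINT t|circle. cmod (val f t) powr r) powr (1 / s)"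
    unfolding eq by simp
  then have "Lp_norm p f \<le> ((LINT t|circle. cmod (val f t) powr r) powr (1 / s)) powr (1 / p)"
    unfolding Lp_norm_val using assms by (intro powr_mono2) (auto intro: integral_nonneg_AE)
  then show ?thesis
    using assms by (simp add: powr_powr Lp_norm_val s_def)
qed simp

text \<open>Since \<open>|F + cnj G|^2 = |F|^2 + 2 * Re (F * G) + |G|^2\<close> and the mean of
  \<open>F * G\<close> is \<open>F 0 * G 0 = 0\<close>, dropping \<open>cnj G\<close> does not
  increase the norm.\<close>

lemma analytic_part_L2:
  assumes "f \<in> trig" "g \<in> trig" "analytic_part f g"
  shows "Lp_norm 2 g \<le> Lp_norm 2 f"
proof -
  obtain F G where FG: "F holomorphic_on UNIV" "G holomorphic_on UNIV" "G 0 = 0" "AE t in circle. val f t = F t + cnj (G t)"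
    using trig_split[OF assms(1)] by blast
  have [measurable]: "F \<in> borel_measurable borel" "G \<in> borel_measurable borel"
    using FG by (auto intro: holomorphic_measurable)
  have gF: "AE t in circle. val g t = F t"
    by (rule analytic_part_split[OF FG(4,1,2,3) _ assms(3)]) (use assms(2) in \<open>auto intro: trig_Lp\<close>)
  have FGh: "(\<lambda>t. F t * G t) holomorphic_on UNIV"
    by (intro holomorphic_intros FG)
  have i: "integrable circle (\<lambda>t. F t * G t)"
  proof -
    have "integrable circle (val (abs_circle_fun (\<lambda>t. F t * G t)))"
      using Linf_Lp[OF entire_Lp[OF FGh], of 1] by (simp add: mem_Lp_1_iff)
    then show ?thesis
      by (rule integrable_cong_AE_imp) (use val_abs[OF holomorphic_measurable[OF FGh]] in \<open>auto elim: eventually_mono\<close>)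
  qed
  have mean: "(LINT t|circle. F t * G t) = 0"
    using entire_fourier[OF FGh, of 0] FG(3) by simp
  have gi: "integrable circle (\<lambda>t. (cmod (F t))\<^sup>2)"
  proof -
    have "integrable circle (\<lambda>t. cmod (val g t) powr 2)"
      using trig_Lp[OF assms(2), of 2] by (simp add: mem_Lp_iff)
    then show ?thesis
      by (rule integrable_cong_AE_imp) (use gF in \<open>auto elim: eventually_mono\<close>)
  qed
  have fi: "integrable circle (\<lambda>t. cmod (val f t) powr 2)"
    using trig_Lp[OF assms(1), of 2] by (simp add: mem_Lp_iff)
  have "(LINT t|circle. cmod (val g t) powr 2) = (LINT t|circle. (cmod (F t))\<^sup>2)"
    by (intro integral_cong_AE) (use gF in \<open>auto elim: eventually_mono\<close>)
  also have "\<dots> = (LINT t|circle. (cmod (F t))\<^sup>2 + 2 * Re (F t * G t))"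
  proof -
    have "(LINT t|circle. (cmod (F t))\<^sup>2 + 2 * Re (F t * G t)) = (LINT t|circle. (cmod (F t))\<^sup>2) + 2 * (LINT t|circle. Re (F t * G t))"
      using gi integrable_Re[OF i] by (simp del: times_complex.sel)
    then show ?thesis unfolding integral_Re[OF i] mean by simp
  qed
  also have "\<dots> \<le> (LINT t|circle. cmod (val f t) powr 2)"
  proof (rule integral_mono_AE)
    show "AE t in circle. (cmod (F t))\<^sup>2 + 2 * Re (F t * G t) \<le> cmod (val f t) powr 2"
      using FG(4)
    proof eventually_elim
      case (elim t)
      have "(cmod (F t + cnj (G t)))\<^sup>2 = (cmod (F t))\<^sup>2 + 2 * Re (F t * G t) + (cmod (G t))\<^sup>2"
        unfolding cmod_power2 by (simp add: power2_eq_square algebra_simps)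
      then show ?case using elim by simp
    qed
  qed (use gi integrable_Re[OF i] fi in \<open>auto simp del: times_complex.sel\<close>)
  finally show ?thesis
    unfolding Lp_norm_val by (intro powr_mono2) (auto intro: integral_nonneg_AE)
qed

lemma complex_four_parts:
  "z = (\<Sum>k<4. \<i> ^ k * of_real (max 0 (Re ((- \<i>) ^ k * z))))"
  by (simp add: eval_nat_numeral lessThan_Suc complex_eq_iff max_def)

text \<open>The function is split into four nonnegative parts with coefficients
  \<open>\<i> ^ k\<close>, to each of which the estimate for positive functions should apply. The
  parts are no longer trigonometric polynomials; they are replaced by positive ones, and the
  uniformly small remainder is controlled by contractivity in \<open>L^2\<close>, which dominates
  \<open>L^p\<close> because \<open>p \<le> 2\<close>.\<close>

lemma riesz_bound_le_2:
  assumes p: "1 < p" "p \<le> 2"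
  shows "\<exists>C. riesz_bound p C"
proof -
  obtain C where C: "0 \<le> C"
    "\<And>f g u. f \<in> trig \<Longrightarrow> g \<in> trig \<Longrightarrow> analytic_part f g \<Longrightarrow> continuous_on UNIV u \<Longrightarrow>
      AE t in circle. val f t = of_real (u t) \<Longrightarrow> (\<And>t. cmod t = 1 \<Longrightarrow> 0 < u t) \<Longrightarrow>
      Lp_norm p g \<le> C * Lp_norm p f"
  proof (rule riesz_bound_positive[OF p], goal_cases)
    case (1 C)
    show ?case by (rule 1(1)[OF 1(2,3)])
  qed
  have "Lp_norm p g \<le> 4 * C * Lp_norm p f" if f: "f \<in> trig" and g: "g \<in> trig" and fg: "analytic_part f g" for f g
  proof (rule field_le_epsilon)
    fix e :: real assume e: "0 < e"
    \<comment> \<open>The remainder costs \<open>12 * d\<close>, namely \<open>3 * d\<close> for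
      each of four parts; the norm of each approximant exceeds that of \<open>f\<close> by at most
      \<open>3 * d\<close>, which costs another \<open>12 * C * d\<close>. The total is
      \<open>e\<close>.\<close>
    define d where "d = e / (12 + 12 * C)"
    have d: "0 < d" using e C(1) by (simp add: d_def add_pos_nonneg)
    obtain F G where FG: "F holomorphic_on UNIV" "G holomorphic_on UNIV" "AE t in circle. val f t = F t + cnj (G t)"
      using trig_split[OF f] by blast
    define H where "H t = F t + cnj (G t)" for t
    have H: "continuous_on UNIV H"
      unfolding H_def by (intro continuous_intros holomorphic_on_imp_continuous_on FG)
    define u where "u k t = max 0 (Re ((- \<i>) ^ k * H t))" for k :: nat and t
    have u: "continuous_on UNIV (u k)" for k
      unfolding u_def by (intro continuous_intros H)
    have u0: "0 \<le> u k t" for k t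
      by (simp add: u_def)
    have uH: "u k t \<le> cmod (H t)" for k t
      using abs_Re_le_cmod[of "(- \<i>) ^ k * H t"] by (auto simp: u_def norm_mult norm_power)
    \<comment> \<open>The offset \<open>2 * d\<close> with error below \<open>d\<close> places
      \<open>q\<close> between \<open>u k + d\<close> and \<open>u k + 3 * d\<close>, so it is
      positive on the circle.\<close>
    have "\<exists>q. real_polynomial_function q \<and> (\<forall>t\<in>sphere 0 1. \<bar>(u k t + 2 * d) - q t\<bar> < d)" for k
    proof -
      have "continuous_on (sphere 0 1) (\<lambda>t. u k t + 2 * d)"
        by (intro continuous_intros continuous_on_subset[OF u]) auto
      then show ?thesis
      proof (rule Stone_Weierstrass_real_polynomial_function[OF compact_sphere _ d], goal_cases)
        case (1 q)
        then show ?case by (intro exI[of _ q]) auto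
      qed
    qed
    then obtain q where q0: "\<forall>k. real_polynomial_function (q k) \<and> (\<forall>t\<in>sphere 0 1. \<bar>(u k t + 2 * d) - q k t\<bar> < d)"
      using choice[of "\<lambda>k q. real_polynomial_function q \<and> (\<forall>t\<in>sphere 0 1. \<bar>(u k t + 2 * d) - q t\<bar> < d)"] by auto
    then have q: "real_polynomial_function (q k)" "cmod t = 1 \<Longrightarrow> \<bar>(u k t + 2 * d) - q k t\<bar> < d" for k t
      by auto
    have "\<exists>h\<in>trig. AE t in circle. val h t = of_real (q k t)" for k
      by (rule trig_of_real_polynomial[OF q(1)])
    then obtain h where h: "\<And>k. h k \<in> trig" "\<And>k. AE t in circle. val (h k) t = of_real (q k t)"
      by metis
    have "\<exists>r\<in>trig. analytic_part (h k) r" for k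
      by (rule trig_analytic_part[OF h(1)])
    then obtain r where r: "\<And>k. r k \<in> trig" "\<And>k. analytic_part (h k) (r k)"
      by metis
    have fv: "AE t in circle. val f t = H t" using FG(3) by (simp add: H_def)
    have hn: "Lp_norm p (h k) \<le> Lp_norm p f + 3 * d" for k
    proof (rule Lp_norm_mono_add)
      show "AE t in circle. cmod (val (h k) t) \<le> cmod (val f t) + 3 * d"
        using h(2)[of k] fv AE_circle_norm
      proof eventually_elim
        case (elim t)
        have "\<bar>q k t\<bar> \<le> cmod (H t) + 3 * d"
          using q(2)[OF elim(3), of k] uH[of k t] u0[of k t] by linarith
        with elim show ?case by simp
      qed
    qed (use p d f in \<open>auto intro: trig_Lp\<close>)
    have rn: "Lp_norm p (r k) \<le> C * (Lp_norm p f + 3 * d)" for k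
    proof -
      have "Lp_norm p (r k) \<le> C * Lp_norm p (h k)"
      proof (rule C(2)[OF h(1) r(1,2) _ h(2)])
        show "continuous_on UNIV (q k)"
          using q(1)[of k] continuous_on_polymonial_function[of "q k" UNIV] by (simp add: real_polynomial_function_eq)
        show "0 < q k t" if "cmod t = 1" for t
          using q(2)[OF that, of k] d u0[of k t] by linarith
      qed
      also have "\<dots> \<le> C * (Lp_norm p f + 3 * d)"
        using hn[of k] C(1) by (intro mult_left_mono)
      finally show ?thesis .
    qed
    define x where "x = (\<Sum>k<4. scale (\<i> ^ k) (h k))"
    define y where "y = (\<Sum>k<4. scale (\<i> ^ k) (r k))"
    have xy: "x \<in> trig" "y \<in> trig"
      unfolding x_def y_def trig_def
      by (intro circle_fun.span_sum circle_fun.span_scale h(1)[unfolded trig_def] r(1)[unfolded trig_def])+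
    have "analytic_part x y"
      unfolding analytic_part_def x_def y_def
      using r(2) h(1) r(1) by (auto simp: fourier_sum Lp_scale trig_Lp fourier_scale analytic_part_def)
    then have part: "analytic_part (f - x) (g - y)"
      using f g xy fg by (intro analytic_part_diff trig_Lp) auto
    have xv: "AE t in circle. val x t = (\<Sum>k<4. \<i> ^ k * of_real (q k t))"
    proof -
      have vs: "AE t in circle. val (\<Sum>k\<in>S. F k) t = (\<Sum>k\<in>S. val (F k) t)" if "finite S" for F and S :: "nat set"
        using that
      proof (induction S)
        case empty
        then show ?case using val_0 by simp
      next
        case (insert k S)
        show ?case
          using insert.IH val_plus[of "F k" "sum F S"]
          unfolding sum.insert[OF insert.hyps] by eventually_elim simp
      qed
      have "AE t in circle. \<forall>k. val (scale (\<i> ^ k) (h k)) t = \<i> ^ k * of_real (q k t)"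
        unfolding AE_all_countable
      proof
        fix k show "AE t in circle. val (scale (\<i> ^ k) (h k)) t = \<i> ^ k * of_real (q k t)"
          using h(2)[of k] val_scale[of "\<i> ^ k" "h k"] by eventually_elim simp
      qed
      with vs[of "{..<4}" "\<lambda>k. scale (\<i> ^ k) (h k)"] show ?thesis
        unfolding x_def by (auto elim: eventually_elim2)
    qed
    have "Lp_norm p (g - y) \<le> Lp_norm 2 (g - y)"
      using p g xy by (intro Lp_norm_le_Lp_norm trig_Lp trig_diff) auto
    also have "\<dots> \<le> Lp_norm 2 (f - x)"
      using f g xy part by (intro analytic_part_L2 trig_diff)
    also have "\<dots> \<le> 12 * d"
    proof (rule Lp_norm_bound)
      show "AE t in circle. cmod (val (f - x) t) \<le> 12 * d"
        using fv xv val_minus[of f x] AE_circle_norm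
      proof eventually_elim
        case (elim t)
        have "val (f - x) t = (\<Sum>k<4. \<i> ^ k * of_real (u k t)) - (\<Sum>k<4. \<i> ^ k * of_real (q k t))"
          unfolding u_def complex_four_parts[of "H t", symmetric] using elim by simp
        also have "\<dots> = (\<Sum>k<4. \<i> ^ k * of_real (u k t - q k t))"
          by (simp add: sum_subtractf right_diff_distrib)
        also have "cmod \<dots> \<le> (\<Sum>k<(4::nat). 3 * d)"
        proof (rule sum_norm_le)
          fix k
          have "\<bar>u k t - q k t\<bar> \<le> 3 * d"
            using q(2)[OF elim(4), of k] by linarith
          then show "cmod (\<i> ^ k * of_real (u k t - q k t)) \<le> 3 * d"
            by (simp add: norm_mult norm_power del: of_real_diff)
        qed
        finally show ?case by simp
      qed
    qed (use d in auto)
    finally have 1: "Lp_norm p (g - y) \<le> 12 * d" .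
    have "Lp_norm p y \<le> (\<Sum>k<4. Lp_norm p (scale (\<i> ^ k) (r k)))"
      unfolding y_def using p r(1) by (intro Lp_norm_sum) (auto intro!: Lp_scale trig_Lp)
    also have "\<dots> \<le> (\<Sum>k<(4::nat). C * (Lp_norm p f + 3 * d))"
      using p rn by (intro sum_mono) (simp add: Lp_norm_scale norm_power)
    finally have 2: "Lp_norm p y \<le> 4 * (C * (Lp_norm p f + 3 * d))" by simp
    have "Lp_norm p g \<le> Lp_norm p (g - y) + Lp_norm p y"
      using Lp_norm_triangle[of "g - y" p y] p g xy by (simp add: trig_Lp trig_diff)
    also have "\<dots> \<le> 12 * d + 4 * (C * (Lp_norm p f + 3 * d))" using 1 2 by simp
    also have "\<dots> = 4 * C * Lp_norm p f + (12 + 12 * C) * d" by (simp add: algebra_simps)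
    also have "(12 + 12 * C) * d = e"
      using C(1) by (simp add: d_def)
    finally show "Lp_norm p g \<le> 4 * C * Lp_norm p f + e" .
  qed
  with C(1) show ?thesis
    unfolding riesz_bound_def by (intro exI[of _ "4 * C"]) auto
qed

text \<open>Duality with respect to the mean of a product: pairing the analytic part
  \<open>g\<close> of \<open>f\<close> with \<open>h\<close> amounts to pairing \<open>f\<close>
  with the part \<open>z\<close> of \<open>h\<close> at frequencies at most 0, and
  \<open>z = h - t P (h / t)\<close> has norm at most \<open>1 + C\<close> times that of
  \<open>h\<close>. The norm of \<open>g\<close> is recovered by the extremal multiplier
  \<open>|g|^(p-1) cnj (sgn g)\<close>.\<close>

lemma riesz_bound_conj_exp:
  assumes p: "1 < p" and b: "riesz_bound (conj_exp p) C"
  shows "riesz_bound p (1 + C)"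
proof -
  define q where "q = conj_exp p"
  have q: "1 < q" using conj_exp[OF p] by (simp add: q_def)
  have C: "0 \<le> C" "\<And>f g. f \<in> trig \<Longrightarrow> g \<in> trig \<Longrightarrow> analytic_part f g \<Longrightarrow> Lp_norm q g \<le> C * Lp_norm q f"
    using b by (auto simp: riesz_bound_def q_def)
  have "Lp_norm p g \<le> (1 + C) * Lp_norm p f" if f: "f \<in> trig" and g: "g \<in> trig" and fg: "analytic_part f g" for f g
  proof (cases "Lp_norm p g = 0")
    case False
    define G where "G = Lp_norm p g"
    have G: "0 < G" using False by (simp add: G_def order_less_le)
    define y where "y = abs_circle_fun (\<lambda>t. of_real (cmod (val g t) powr (p - 1)) * cnj (sgn (val g t)))"
    have yv: "AE t in circle. val y t = of_real (cmod (val g t) powr (p - 1)) * cnj (sgn (val g t))"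
      unfolding y_def by (rule val_abs) measurable
    obtain B where B: "AE t in circle. cmod (val g t) \<le> B"
      using trig_Linf[OF g] by (auto simp: mem_Linf_iff)
    have yn: "AE t in circle. cmod (val y t) = cmod (val g t) powr (p - 1)"
      using yv by eventually_elim (auto simp: norm_mult norm_sgn)
    have "AE t in circle. cmod (val y t) \<le> B powr (p - 1)"
      using yn B by eventually_elim (use p in \<open>auto intro!: powr_mono2\<close>)
    then have y: "y \<in> Linf" by (auto simp: mem_Linf_iff)
    \<comment> \<open>The extremal multiplier is not a trigonometric polynomial, whereas the bound
      for the conjugate exponent is so far known only for these; hence the approximation.\<close>
    obtain h D where h: "\<And>n::nat. h n \<in> trig" "\<And>n. AE t in circle. cmod (val (h n) t) \<le> D" "0 \<le> D"
      "AE t in circle. (\<lambda>n. val (h n) t) \<longlonglongrightarrow> val y t"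
      using trig_bounded_approx[OF y] by blast
    have yq: "Lp_norm q y = G powr (p - 1)"
    proof -
      have "(LINT t|circle. cmod (val y t) powr q) = (LINT t|circle. cmod (val g t) powr p)"
      proof (intro integral_cong_AE)
        have pq: "(p - 1) * q = p" using p by (simp add: q_def conj_exp_def)
        show "AE t in circle. cmod (val y t) powr q = cmod (val g t) powr p"
          using yn by eventually_elim (simp add: powr_powr pq)
      qed measurable
      then have "Lp_norm q y = (G powr p) powr (1 / q)"
        using p by (simp add: Lp_norm_val[of q] Lp_norm_powr G_def)
      then show ?thesis
        using p by (simp add: powr_powr q_def conj_exp_def)
    qed
    have hy: "(\<lambda>n. Lp_norm q (h n - y)) \<longlonglongrightarrow> 0"
      by (rule Lp_dominated_convergence(3)[OF _ h(4,2)]) (use q in auto)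
    have lim: "(\<lambda>n. fourier (g * h n) 0) \<longlonglongrightarrow> fourier (g * y) 0"
      by (rule fourier_mult_Linf_limit[OF _ h(4,2)]) (use g in \<open>auto intro: trig_Lp\<close>)
    have gy: "fourier (g * y) 0 = of_real (G powr p)"
    proof -
      have "fourier (g * y) 0 = (LINT t|circle. of_real (cmod (val g t) powr p))"
        unfolding fourier_val
      proof (intro integral_cong_AE)
        show "AE t in circle. val (g * y) t * t powi - 0 = of_real (cmod (val g t) powr p)"
          using yv val_times[of g y]
        proof eventually_elim
          case (elim t)
          show ?case
          proof (cases "val g t = 0")
            case False
            have "val g t * cnj (sgn (val g t)) = of_real (cmod (val g t))"
              using False by (auto simp: sgn_eq complex_norm_square[symmetric] power2_eq_square)
            moreover have "cmod (val g t) powr p = cmod (val g t) * cmod (val g t) powr (p - 1)"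
              using False by (simp add: powr_mult_base)
            moreover have "val (g * y) t = val g t * cnj (sgn (val g t)) * of_real (cmod (val g t) powr (p - 1))"
              unfolding elim by simp
            ultimately show ?thesis by simp
          qed (use elim p in auto)
        qed
      qed measurable
      also have "\<dots> = of_real (LINT t|circle. cmod (val g t) powr p)" by simp
      finally show ?thesis using p by (simp add: Lp_norm_powr G_def)
    qed
    have bd: "cmod (fourier (g * h n) 0) \<le> Lp_norm p f * ((1 + C) * Lp_norm q (h n))" for n
    proof -
      obtain w where w: "w \<in> trig" "analytic_part (tvar powi (-1) * h n) w"
        using trig_analytic_part[OF trig_mult[OF trig_tvar_powi h(1)]] by blast
      define z where "z = h n - tvar powi 1 * w"
      have z: "z \<in> trig" unfolding z_def by (intro trig_diff trig_mult h w trig_tvar_powi)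
      have fz: "fourier z k = (if k \<le> 0 then fourier (h n) k else 0)" for k
        using w h(1)[of n] unfolding z_def
        by (subst fourier_diff)
          (auto simp: trig_Lp trig_mult fourier_shift analytic_part_def simp del: power_int_1_right power_int_minus1_right)
      have hz: "fourier (h n - z) k = (if k \<le> 0 then 0 else fourier (h n) k)" for k
        using z h(1)[of n] by (simp add: fourier_diff trig_Lp fz)
      have gz: "fourier (f - g) k = (if k \<ge> 0 then 0 else fourier f k)" for k
        using f g fg by (simp add: fourier_diff trig_Lp analytic_part_def)
      have "fourier (g * (h n - z)) 0 = 0"
        using g z h(1)[of n] fg by (intro fourier_mult_zero_trig trig_Lp trig_diff) (auto simp: hz analytic_part_def)
      moreover have "fourier ((f - g) * z) 0 = 0"
        using f g z by (intro fourier_mult_zero_trig trig_Lp trig_diff) (auto simp: gz fz)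
      \<comment> \<open>The first product has only positive and the second only negative
        frequencies, so the mean of \<open>g * h n\<close> is that of \<open>f * z\<close>.\<close>
      moreover have "g * h n = g * (h n - z) - (f - g) * z + f * z"
        by (simp add: algebra_simps)
      ultimately have "fourier (g * h n) 0 = fourier (f * z) 0"
        using f g z h(1)[of n] by (simp add: fourier_add fourier_diff trig_Lp trig_mult trig_diff)
      also have "cmod \<dots> \<le> Lp_norm 1 (f * z)"
        using f z by (intro fourier_bound trig_Lp trig_mult) auto
      also have "\<dots> \<le> Lp_norm p f * Lp_norm q z"
        unfolding q_def using p conj_exp[OF p] f z by (intro Lp_mult trig_Lp) auto
      also have "Lp_norm q z \<le> (1 + C) * Lp_norm q (h n)"
      proof -
        have "Lp_norm q z \<le> Lp_norm q (h n) + Lp_norm q (tvar powi 1 * w)"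
          unfolding z_def using q h(1)[of n] w by (intro Lp_norm_triangle_diff trig_Lp trig_mult trig_tvar_powi) auto
        also have "Lp_norm q (tvar powi 1 * w) = Lp_norm q w" by (rule Lp_tvar_powi_mult)
        also have "\<dots> \<le> C * Lp_norm q (tvar powi (-1) * h n)"
          by (intro C w trig_mult trig_tvar_powi h)
        also have "Lp_norm q (tvar powi (-1) * h n) = Lp_norm q (h n)" by (rule Lp_tvar_powi_mult)
        finally show ?thesis by (simp add: algebra_simps)
      qed
      finally show ?thesis by (simp add: mult_left_mono)
    qed
    have hq: "(\<lambda>n. Lp_norm q (h n)) \<longlonglongrightarrow> Lp_norm q y"
    proof (rule LIM_zero_cancel, rule Lim_null_comparison[OF always_eventually hy], rule allI)
      fix n
      have L: "h n \<in> Lp q" "y \<in> Lp q" using q h(1) y by (auto intro: trig_Lp Linf_Lp)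
      have "Lp_norm q (h n) \<le> Lp_norm q (h n - y) + Lp_norm q y"
        using Lp_norm_triangle[of "h n - y" q y] q L by (simp add: Lp_diff)
      moreover have "Lp_norm q y \<le> Lp_norm q (h n - y) + Lp_norm q (h n)"
        using Lp_norm_triangle[of "y - h n" q "h n"] q L by (simp add: Lp_diff Lp_norm_minus_commute[of q y])
      ultimately show "norm (Lp_norm q (h n) - Lp_norm q y) \<le> Lp_norm q (h n - y)" by auto
    qed
    have "cmod (fourier (g * y) 0) \<le> Lp_norm p f * ((1 + C) * Lp_norm q y)"
      by (rule LIMSEQ_le[OF tendsto_norm[OF lim] tendsto_mult_left[OF tendsto_mult_left[OF hq]]]) (use bd in auto)
    then have "G powr p \<le> Lp_norm p f * ((1 + C) * G powr (p - 1))"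
      by (simp add: gy yq)
    moreover have "G powr p = G * G powr (p - 1)"
      using G by (simp add: powr_mult_base)
    ultimately have "G * G powr (p - 1) \<le> ((1 + C) * Lp_norm p f) * G powr (p - 1)"
      by (simp add: mult_ac)
    then show ?thesis using G by (simp add: G_def[symmetric])
  qed (use C(1) in auto)
  with C(1) show ?thesis by (auto simp: riesz_bound_def)
qed

lemma riesz_bound_exists:
  assumes "1 < p"
  shows "\<exists>C. riesz_bound p C"
proof (cases "p \<le> 2")
  case False
  then have "conj_exp p \<le> 2" using assms by (simp add: conj_exp_def field_simps)
  then show ?thesis
    using riesz_bound_le_2[of "conj_exp p"] conj_exp[OF assms] riesz_bound_conj_exp[OF assms] by blast
qed (use assms riesz_bound_le_2 in blast)

theorem M_Riesz:
  assumes p: "1 < p"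
  obtains C where "0 \<le> C" "\<And>f. f \<in> Lp p \<Longrightarrow> \<exists>g\<in>Lp p. analytic_part f g \<and> Lp_norm p g \<le> C * Lp_norm p f"
proof -
  obtain C where C: "0 \<le> C" "\<And>f g. f \<in> trig \<Longrightarrow> g \<in> trig \<Longrightarrow> analytic_part f g \<Longrightarrow> Lp_norm p g \<le> C * Lp_norm p f"
    using riesz_bound_exists[OF p] unfolding riesz_bound_def by metis
  have "\<exists>g\<in>Lp p. analytic_part f g \<and> Lp_norm p g \<le> C * Lp_norm p f" if f: "f \<in> Lp p" for f
  proof -
    obtain h where h: "\<And>n::nat. h n \<in> trig" "(\<lambda>n. Lp_norm p (h n - f)) \<longlonglongrightarrow> 0"
      using trig_dense_seq[OF f] p by (metis less_imp_le)
    have hL: "h n \<in> Lp p" "h n \<in> Lp 1" for n using h(1) p by (auto intro: trig_Lp)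
    have "\<exists>g\<in>trig. analytic_part (h n) g" for n by (rule trig_analytic_part[OF h(1)])
    then obtain g where g: "\<And>n. g n \<in> trig" "\<And>n. analytic_part (h n) (g n)" by metis
    have gL: "g n \<in> Lp p" "g n \<in> Lp 1" for n using g(1) p by (auto intro: trig_Lp)
    have gmn: "Lp_norm p (g m - g n) \<le> C * (Lp_norm p (h m - f) + Lp_norm p (h n - f))" for m n
    proof -
      have "Lp_norm p (g m - g n) \<le> C * Lp_norm p (h m - h n)"
        using g h hL gL by (intro C(2) trig_diff analytic_part_diff)
      also have "Lp_norm p (h m - h n) \<le> Lp_norm p (h m - f) + Lp_norm p (f - h n)"
        using p f hL by (intro Lp_norm_triangle_mid) auto
      also have "Lp_norm p (f - h n) = Lp_norm p (h n - f)"
        using p by (intro Lp_norm_minus_commute) auto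
      finally show ?thesis using C(1) by (simp add: mult_left_mono)
    qed
    have "\<exists>N. \<forall>m\<ge>N. \<forall>n\<ge>N. Lp_norm p (g m - g n) < e" if e: "0 < e" for e
    proof -
      \<comment> \<open>Two terms of size \<open>d\<close> are multiplied by \<open>C\<close>; with
        \<open>C + 1\<close> in the denominator the outcome is strictly below \<open>e\<close>, also
        for \<open>C = 0\<close>.\<close>
      define d where "d = e / 2 / (C + 1)"
      have d: "0 < d" using e C(1) by (simp add: d_def)
      have "\<forall>\<^sub>F n in sequentially. Lp_norm p (h n - f) < d"
        using h(2) d by (intro order_tendstoD(2)) auto
      then obtain N where N: "\<And>n. N \<le> n \<Longrightarrow> Lp_norm p (h n - f) < d"
        by (auto simp: eventually_sequentially)
      have "Lp_norm p (g m - g n) < e" if "N \<le> m" "N \<le> n" for m n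
      proof -
        have "Lp_norm p (g m - g n) \<le> C * (d + d)"
          using gmn[of m n] N[OF that(1)] N[OF that(2)] C(1)
          by (intro order_trans[OF gmn] mult_left_mono add_mono) auto
        also have "\<dots> < (C + 1) * (d + d)" using d C(1) by (intro mult_strict_right_mono) auto
        also have "\<dots> = e"
        proof -
          have "(C + 1) * d = e / 2"
            using C(1) unfolding d_def by (subst times_divide_eq_right, subst nonzero_mult_div_cancel_left) auto
          then show ?thesis by (simp add: distrib_left)
        qed
        finally show ?thesis .
      qed
      then show ?thesis by blast
    qed
    from Lp_complete[OF p gL(1) this]
    obtain g' where g': "g' \<in> Lp p" "(\<lambda>n. Lp_norm p (g n - g')) \<longlonglongrightarrow> 0"
      by blast
    have ap: "analytic_part f g'"
      unfolding analytic_part_def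
    proof
      fix n
      have a: "(\<lambda>k. fourier (g k) n) \<longlonglongrightarrow> fourier g' n"
        by (rule fourier_tendsto[OF p gL(1) g'])
      have b: "(\<lambda>k. fourier (h k) n) \<longlonglongrightarrow> fourier f n"
        by (rule fourier_tendsto[OF p hL(1) f h(2)])
      show "fourier g' n = (if n \<ge> 0 then fourier f n else 0)"
      proof (cases "0 \<le> n")
        case True
        then have "(\<lambda>k. fourier (g k) n) = (\<lambda>k. fourier (h k) n)"
          using g(2) by (simp add: analytic_part_def)
        with a b True show ?thesis using LIMSEQ_unique by auto
      next
        case False
        then have "(\<lambda>k. fourier (g k) n) = (\<lambda>k. 0)"
          using g(2) by (simp add: analytic_part_def)
        with a False show ?thesis by (simp add: LIMSEQ_const_iff)
      qed
    qed
    have "Lp_norm p g' \<le> C * Lp_norm p f"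
    proof (rule LIMSEQ_le_const)
      show "(\<lambda>n. Lp_norm p (g n - g') + C * (Lp_norm p (h n - f) + Lp_norm p f)) \<longlonglongrightarrow> C * Lp_norm p f"
        using tendsto_add[OF g'(2) tendsto_mult_left[OF tendsto_add[OF h(2) tendsto_const[of "Lp_norm p f"]], of C]] by simp
      have "Lp_norm p g' \<le> Lp_norm p (g n - g') + C * (Lp_norm p (h n - f) + Lp_norm p f)" for n
      proof -
        have "Lp_norm p g' \<le> Lp_norm p (g' - g n) + Lp_norm p (g n)"
          using Lp_norm_triangle[of "g' - g n" p "g n"] p g' gL by (simp add: Lp_diff)
        moreover have "Lp_norm p (g n) \<le> C * Lp_norm p (h n)" by (intro C(2) g h)
        moreover have "Lp_norm p (h n) \<le> Lp_norm p (h n - f) + Lp_norm p f"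
          using Lp_norm_triangle[of "h n - f" p f] p f hL by (simp add: Lp_diff)
        moreover have "Lp_norm p (g' - g n) = Lp_norm p (g n - g')"
          using p by (intro Lp_norm_minus_commute) auto
        moreover have "C * Lp_norm p (h n) \<le> C * (Lp_norm p (h n - f) + Lp_norm p f)"
          using calculation(3) C(1) by (rule mult_left_mono)
        ultimately show ?thesis by linarith
      qed
      then show "\<exists>N. \<forall>n\<ge>N. Lp_norm p g' \<le> Lp_norm p (g n - g') + C * (Lp_norm p (h n - f) + Lp_norm p f)" by blast
    qed
    with g' ap show ?thesis by blast
  qed
  with C(1) show thesis by (rule that)
qed

section \<open>The Riesz projection on \<open>L^p\<close>\<close>

lemma riesz_P_eqI:
  assumes "1 < p" "g \<in> Lp p" "analytic_part f g"
  shows "riesz_P p f = g"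
  unfolding riesz_P_def
proof (rule the_equality)
  fix h assume "h \<in> Lp p \<and> (\<forall>n. fourier h n = (if n \<ge> 0 then fourier f n else 0))"
  then show "h = g"
    using assms analytic_part_unique[of f h g] Lp_subset_L1[OF assms(1)] by (auto simp: analytic_part_def)
qed (use assms in \<open>auto simp: analytic_part_def\<close>)

lemma riesz_P:
  assumes "1 < p" "f \<in> Lp p"
  shows riesz_P_Lp: "riesz_P p f \<in> Lp p"
    and fourier_riesz_P: "fourier (riesz_P p f) n = (if n \<ge> 0 then fourier f n else 0)"
proof -
  obtain g where "g \<in> Lp p" "analytic_part f g"
    by (rule M_Riesz[OF assms(1)]) (use assms(2) in blast)
  with riesz_P_eqI[OF assms(1) this]
  show "riesz_P p f \<in> Lp p" "fourier (riesz_P p f) n = (if n \<ge> 0 then fourier f n else 0)"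
    by (auto simp: analytic_part_def)
qed

lemma riesz_P_bounded:
  assumes "1 < p"
  obtains C where "0 \<le> C" "\<And>f. f \<in> Lp p \<Longrightarrow> Lp_norm p (riesz_P p f) \<le> C * Lp_norm p f"
proof (rule M_Riesz[OF assms], goal_cases)
  case (1 C)
  have "Lp_norm p (riesz_P p f) \<le> C * Lp_norm p f" if f: "f \<in> Lp p" for f
  proof -
    obtain g where "g \<in> Lp p" "analytic_part f g" "Lp_norm p g \<le> C * Lp_norm p f"
      using 1(3)[OF f] by blast
    then show ?thesis using riesz_P_eqI[OF assms] by simp
  qed
  with 1(2) show ?case by (rule 1(1))
qed

subsection \<open>The shift operator\<close>

context
  fixes \<beta> :: complex
  assumes \<beta>: "1 < cmod \<beta>"
begin

lemma beta_nonzero: "\<beta> \<noteq> 0"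
  using \<beta> by auto

lemma inverse_beta_less: "1 / cmod \<beta> < 1"
  using \<beta> by (subst divide_less_eq_1_pos) auto

lemma circle_inverse: "cmod t = 1 \<Longrightarrow> inverse t = cnj t"
  by (simp add: inverse_eq_divide divide_conv_cnj)

lemma beta_minus_nonzero: "cmod t \<le> 1 \<Longrightarrow> t - \<beta> \<noteq> 0"
  using \<beta> by auto

lemma cnj_alpha: "cmod t = 1 \<Longrightarrow> cnj (alpha \<beta> t) = (cnj \<beta> * t - 1) / (t - \<beta>)"
  using circle_inverse[OF norm_alpha[OF \<beta>], of t] by (simp add: alpha_def)

lemma powi_measurable': "f \<in> borel_measurable M \<Longrightarrow> (\<lambda>t. (f t :: complex) powi k) \<in> borel_measurable M"
  by (rule measurable_compose[OF _ powi_measurable])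

text \<open>The pole \<open>1 / cnj \<beta>\<close> of \<open>alpha\<close> lies inside the disc and
  its zero \<open>\<beta>\<close> outside. On the circle \<open>cnj alpha = 1 / alpha\<close>
  therefore extends analytically to the closed disc with value \<open>1 / \<beta>\<close> at 0;
  nonnegative powers of \<open>alpha\<close> are treated by conjugation.\<close>

lemma integral_alpha_powi:
  "(LINT t|circle. alpha \<beta> t powi k) = (if 0 \<le> k then (1 / cnj \<beta>) ^ nat k else (1 / \<beta>) ^ nat (- k))"
proof -
  have neg: "(LINT t|circle. cnj (alpha \<beta> t) ^ n) = (1 / \<beta>) ^ n" for n
  proof (rule circle_mean_value[where F="\<lambda>t. ((cnj \<beta> * t - 1) / (t - \<beta>)) ^ n", THEN trans])
    show "(\<lambda>t. cnj (alpha \<beta> t) ^ n) \<in> borel_measurable borel" by measurable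
    show "cnj (alpha \<beta> t) ^ n = ((cnj \<beta> * t - 1) / (t - \<beta>)) ^ n" if "cmod t = 1" for t
      using cnj_alpha[OF that] by simp
    show "continuous_on (cball 0 1) (\<lambda>t. ((cnj \<beta> * t - 1) / (t - \<beta>)) ^ n)"
      using beta_minus_nonzero by (intro continuous_intros) auto
    show "(\<lambda>t. ((cnj \<beta> * t - 1) / (t - \<beta>)) ^ n) holomorphic_on ball 0 1"
      using beta_minus_nonzero by (intro holomorphic_intros) auto
  qed simp
  show ?thesis
  proof (cases "0 \<le> k")
    case True
    have "(LINT t|circle. alpha \<beta> t powi k) = (LINT t|circle. cnj (cnj (alpha \<beta> t) ^ nat k))"
      using True by (simp add: power_int_def)
    also have "\<dots> = cnj (LINT t|circle. cnj (alpha \<beta> t) ^ nat k)"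
      by (rule Bochner_Integration.integral_cnj)
    finally show ?thesis using True by (simp add: neg)
  next
    case False
    have "(LINT t|circle. alpha \<beta> t powi k) = (LINT t|circle. cnj (alpha \<beta> t) ^ nat (- k))"
    proof (intro integral_cong_AE AE_circleI)
      show "alpha \<beta> t powi k = cnj (alpha \<beta> t) ^ nat (- k)" if "cmod t = 1" for t
        using False circle_inverse[OF norm_alpha[OF \<beta> that]] by (simp add: power_int_def)
    qed (auto intro!: powi_measurable')
    then show ?thesis using False by (simp add: neg)
  qed
qed

text \<open>The Poisson kernel of the point \<open>1 / cnj \<beta>\<close>; it is the density of the image of the circle
  measure under \<open>alpha \<beta>\<close>.\<close>

definition poisson :: "complex \<Rightarrow> real" where
  "poisson t = ((cmod \<beta>)\<^sup>2 - 1) / (cmod (cnj \<beta> * t - 1))\<^sup>2"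

lemma poisson_measurable [measurable]: "poisson \<in> borel_measurable borel"
  unfolding poisson_def by measurable

text \<open>Splits the kernel into a function analytic on the closed disc that vanishes at 0 and the
  Cauchy kernel of the point \<open>1 / cnj \<beta>\<close>. In this form its moments are computed
  by the mean value property and Cauchy's formula.\<close>

lemma poisson_eq:
  assumes t: "cmod t = 1"
  shows "of_real (poisson t) = (1 / (1 - t / \<beta>) - 1) + t / (t - 1 / cnj \<beta>)"
proof -
  have nz: "cnj \<beta> * t - 1 \<noteq> 0" "\<beta> - t \<noteq> 0" "\<beta> \<noteq> 0" "t \<noteq> 0"
    using shift_denom_nonzero[OF \<beta> t] beta_minus_nonzero[of t] beta_nonzero t by auto
  have "of_real ((cmod (cnj \<beta> * t - 1))\<^sup>2) = (cnj \<beta> * t - 1) * (\<beta> * cnj t - 1)"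
    by (simp only: complex_norm_square) simp
  also have "cnj t = 1 / t"
    using circle_inverse[OF t] by (simp add: inverse_eq_divide)
  finally have a: "of_real ((cmod (cnj \<beta> * t - 1))\<^sup>2) = (cnj \<beta> * t - 1) * (\<beta> - t) / t"
    using nz by (simp add: field_simps)
  have b: "of_real ((cmod \<beta>)\<^sup>2 - 1) = \<beta> * cnj \<beta> - 1"
    by (simp only: of_real_diff complex_norm_square) simp
  have "of_real (poisson t) = (\<beta> * cnj \<beta> - 1) * t / ((cnj \<beta> * t - 1) * (\<beta> - t))"
    unfolding poisson_def of_real_divide a b by simp
  moreover have "1 / (1 - t / \<beta>) = \<beta> / (\<beta> - t)" "t / (t - 1 / cnj \<beta>) = cnj \<beta> * t / (cnj \<beta> * t - 1)"
    using nz by (simp_all add: field_simps)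
  moreover have "\<beta> / (\<beta> - t) - 1 = t / (\<beta> - t)"
    using nz by (simp add: field_simps)
  moreover have "t / (\<beta> - t) + cnj \<beta> * t / (cnj \<beta> * t - 1) = (t * (cnj \<beta> * t - 1) + cnj \<beta> * t * (\<beta> - t)) / ((\<beta> - t) * (cnj \<beta> * t - 1))"
    using nz by (subst add_frac_eq) auto
  ultimately show ?thesis
    by (simp add: algebra_simps)
qed

lemma poisson_nonneg: "0 \<le> poisson t"
  using \<beta> by (simp add: poisson_def)

lemma poisson_le:
  assumes t: "cmod t = 1"
  shows "poisson t \<le> ((cmod \<beta>)\<^sup>2 - 1) / (cmod \<beta> - 1)\<^sup>2"
proof -
  have "cmod \<beta> - 1 \<le> cmod (cnj \<beta> * t - 1)"
    using norm_triangle_ineq2[of "cnj \<beta> * t" 1] t by (simp add: norm_mult)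
  moreover from this have "0 < cmod (cnj \<beta> * t - 1)" using \<beta> by linarith
  ultimately show ?thesis
    unfolding poisson_def using \<beta> by (intro divide_left_mono power_mono mult_pos_pos zero_less_power) auto
qed

lemma integral_powi_poisson:
  "(LINT t|circle. t powi k * of_real (poisson t)) = (if 0 \<le> k then (1 / cnj \<beta>) ^ nat k else (1 / \<beta>) ^ nat (- k))"
proof -
  have w: "cmod (1 / cnj \<beta>) < 1" using inverse_beta_less by (simp add: norm_divide)
  have bnd: "cmod (1 / (1 - t / \<beta>) - 1) \<le> D" if "cmod t = 1" "D = 1 / (1 - 1 / cmod \<beta>) + 1" for t D
  proof -
    have "1 - 1 / cmod \<beta> \<le> cmod (1 - t / \<beta>)"
      using norm_triangle_ineq2[of 1 "t / \<beta>"] that by (simp add: norm_divide)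
    moreover have "0 < 1 - 1 / cmod \<beta>" using inverse_beta_less by simp
    ultimately have "cmod (1 / (1 - t / \<beta>)) \<le> 1 / (1 - 1 / cmod \<beta>)"
      by (simp add: norm_divide frac_le)
    then show ?thesis using that norm_triangle_ineq4[of "1 / (1 - t / \<beta>)" 1] by simp
  qed
  have pos: "(LINT t|circle. t ^ n * of_real (poisson t)) = (1 / cnj \<beta>) ^ n" for n
  proof -
    have nz: "1 - t / \<beta> \<noteq> 0" if "cmod t \<le> 1" for t
      using that beta_nonzero beta_minus_nonzero[of t] by (auto simp: field_simps)
    have i1: "integrable circle (\<lambda>t. t ^ n * (1 / (1 - t / \<beta>) - 1))"
      by (rule circle.integrable_const_bound[of _ "1 / (1 - 1 / cmod \<beta>) + 1"])
        (auto intro!: AE_circleI bnd simp: norm_mult norm_power)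
    have i0: "integrable circle (\<lambda>t. t ^ n * of_real (poisson t))"
      by (rule circle.integrable_const_bound[of _ "((cmod \<beta>)\<^sup>2 - 1) / (cmod \<beta> - 1)\<^sup>2"])
        (auto intro!: AE_circleI poisson_le simp: norm_mult norm_power poisson_nonneg)
    have i2: "integrable circle (\<lambda>t. t ^ n * t / (t - 1 / cnj \<beta>))"
    proof (rule integrable_cong_AE_imp[OF Bochner_Integration.integrable_diff[OF i0 i1]])
      show "AE t in circle. t ^ n * complex_of_real (poisson t) - t ^ n * (1 / (1 - t / \<beta>) - 1) = t ^ n * t / (t - 1 / cnj \<beta>)"
        by (rule AE_circleI) (simp add: poisson_eq algebra_simps)
    qed measurable
    have "(LINT t|circle. t ^ n * of_real (poisson t)) = (LINT t|circle. t ^ n * (1 / (1 - t / \<beta>) - 1) + t ^ n * t / (t - 1 / cnj \<beta>))"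
      by (intro integral_cong_AE AE_circleI) (auto simp: poisson_eq algebra_simps)
    also have "\<dots> = (LINT t|circle. t ^ n * (1 / (1 - t / \<beta>) - 1)) + (LINT t|circle. t ^ n * t / (t - 1 / cnj \<beta>))"
      using i1 i2 by simp
    also have "(LINT t|circle. t ^ n * (1 / (1 - t / \<beta>) - 1)) = 0 ^ n * (1 / (1 - 0 / \<beta>) - 1)"
      using nz beta_nonzero by (intro circle_mean_value[where F="\<lambda>t. t ^ n * (1 / (1 - t / \<beta>) - 1)"] continuous_intros holomorphic_intros) auto
    also have "(LINT t|circle. t ^ n * t / (t - 1 / cnj \<beta>)) = (1 / cnj \<beta>) ^ n"
      by (rule circle_Cauchy[OF _ w, where F="\<lambda>t. t ^ n"]) (auto intro!: continuous_intros holomorphic_intros)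
    finally show ?thesis by simp
  qed
  show ?thesis
  proof (cases "0 \<le> k")
    case True
    then show ?thesis using pos[of "nat k"] by (simp add: power_int_def)
  next
    case False
    have "(LINT t|circle. t powi k * of_real (poisson t)) = (LINT t|circle. cnj (t ^ nat (- k) * of_real (poisson t)))"
    proof (intro integral_cong_AE AE_circleI)
      show "t powi k * of_real (poisson t) = cnj (t ^ nat (- k) * of_real (poisson t))" if "cmod t = 1" for t
        using False circle_inverse[OF that] by (simp add: power_int_def)
    qed measurable
    also have "\<dots> = cnj (LINT t|circle. t ^ nat (- k) * of_real (poisson t))"
      by (rule Bochner_Integration.integral_cnj)
    finally show ?thesis using False by (simp add: pos)
  qed
qed

lemma AE_alpha:
  assumes "AE t in circle. P t" and [measurable]: "Measurable.pred borel P"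
  shows "AE t in circle. P (alpha \<beta> t)"
  using alpha_null_sets[OF \<beta>, of "{t. \<not> P t}"] assms by simp

text \<open>The change of variables under \<open>alpha\<close>: the powers of \<open>alpha\<close>
  and the powers of \<open>t\<close> against the Poisson kernel have the same integrals.\<close>

lemma integral_trig_alpha:
  assumes "h \<in> trig"
  shows "integrable circle (\<lambda>t. val h (alpha \<beta> t)) \<and> integrable circle (\<lambda>t. val h t * of_real (poisson t))
    \<and> (LINT t|circle. val h (alpha \<beta> t)) = (LINT t|circle. val h t * of_real (poisson t))"
  using assms
proof (induction rule: trig_induct)
  case zero
  have a: "AE t in circle. val 0 (alpha \<beta> t) = 0"
    using AE_alpha[OF val_0] by simp
  have b: "AE t in circle. val 0 t * of_real (poisson t) = 0"
    using val_0 by eventually_elim simp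
  have "integrable circle (\<lambda>t. val 0 (alpha \<beta> t))" "integrable circle (\<lambda>t. val 0 t * of_real (poisson t))"
    by (rule integrable_cong_AE_imp[of _ "\<lambda>_. 0"]; use a b in \<open>auto elim: eventually_mono\<close>)+
  then show ?case
    unfolding integral_eq_zero_AE[OF a] integral_eq_zero_AE[OF b] by simp
next
  case (add c k h)
  have v: "AE t in circle. val (scale c (tvar powi k) + h) t = c * t powi k + val h t"
    using val_plus[of "scale c (tvar powi k)" h] val_scale[of c "tvar powi k"] val_powi[of k]
    by eventually_elim simp
  have va: "AE t in circle. val (scale c (tvar powi k) + h) (alpha \<beta> t) = c * alpha \<beta> t powi k + val h (alpha \<beta> t)"
    using AE_alpha[OF v] by simp
  note [measurable] = powi_measurable'
  have ik: "integrable circle (\<lambda>t. alpha \<beta> t powi k)"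
    by (rule circle.integrable_const_bound[of _ 1]) (auto intro!: AE_circleI simp: norm_power_int norm_alpha[OF \<beta>])
  have ip: "integrable circle (\<lambda>t. t powi k * of_real (poisson t))"
    by (rule circle.integrable_const_bound[of _ "((cmod \<beta>)\<^sup>2 - 1) / (cmod \<beta> - 1)\<^sup>2"])
      (auto intro!: AE_circleI poisson_le simp: norm_mult norm_power_int poisson_nonneg)
  have v': "AE t in circle. val (scale c (tvar powi k) + h) t * of_real (poisson t)
      = c * (t powi k * of_real (poisson t)) + val h t * of_real (poisson t)"
    using v by eventually_elim (simp add: algebra_simps)
  have 1: "integrable circle (\<lambda>t. val (scale c (tvar powi k) + h) (alpha \<beta> t)) = integrable circle (\<lambda>t. c * alpha \<beta> t powi k + val h (alpha \<beta> t))"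
    "(LINT t|circle. val (scale c (tvar powi k) + h) (alpha \<beta> t)) = (LINT t|circle. c * alpha \<beta> t powi k + val h (alpha \<beta> t))"
    by (rule integrable_cong_AE[OF _ _ va] integral_cong_AE[OF _ _ va]; measurable)+
  have 2: "integrable circle (\<lambda>t. val (scale c (tvar powi k) + h) t * of_real (poisson t)) =
      integrable circle (\<lambda>t. c * (t powi k * of_real (poisson t)) + val h t * of_real (poisson t))"
    "(LINT t|circle. val (scale c (tvar powi k) + h) t * of_real (poisson t)) =
      (LINT t|circle. c * (t powi k * of_real (poisson t)) + val h t * of_real (poisson t))"
    by (rule integrable_cong_AE[OF _ _ v'] integral_cong_AE[OF _ _ v']; measurable)+
  show ?case
    unfolding 1 2 using ik ip add.IH by (simp add: integral_alpha_powi integral_powi_poisson)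
qed

end

text \<open>Carries the change of variables from trigonometric polynomials to sets: a Urysohn
  function between \<open>K\<close> and \<open>U\<close> is approximated uniformly on the circle by
  a polynomial. The constant \<open>C\<close>, equal to
  \<open>(|\<beta>| + 1) / (|\<beta>| - 1)\<close>, bounds the Poisson kernel on the circle.\<close>

lemma measure_alpha_compact_open:
  assumes \<beta>: "1 < cmod \<beta>" and C: "C = ((cmod \<beta>)\<^sup>2 - 1) / (cmod \<beta> - 1)\<^sup>2"
    and K: "compact K" "K \<subseteq> U" "open U"
  shows "measure circle {t. alpha \<beta> t \<in> K} \<le> C * measure circle U"
proof (rule field_le_epsilon)
  fix e :: real assume e: "0 < e"
  have C0: "0 \<le> C" using \<beta> by (simp add: C)
  have [measurable]: "K \<in> sets borel" "U \<in> sets borel"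
    using K by (auto intro: borel_compact)
  have "- U \<inter> K = {}" "closed (- U)" using K by auto
  then obtain h where h: "continuous_on UNIV h" "\<And>x. h x \<in> closed_segment 0 (1::real)"
      "\<And>x. x \<in> - U \<Longrightarrow> h x = 0" "\<And>x. x \<in> K \<Longrightarrow> h x = 1"
    using Urysohn[of "- U" K "0::real" 1] compact_imp_closed[OF K(1)] by metis
  have h01: "0 \<le> h x" "h x \<le> 1" for x
    using h(2)[of x] by (auto simp: closed_segment_eq_real_ivl)
  define d where "d = e / (1 + C)"
  \<comment> \<open>The approximation is paid for twice, by \<open>d\<close> when the indicator is
    bounded from above and by \<open>C * d\<close> when it is integrated against the kernel.\<close>
  have d: "0 < d" using e C0 by (simp add: d_def)
  have "\<exists>g. real_polynomial_function g \<and> (\<forall>t\<in>sphere 0 1. \<bar>h t - g t\<bar> < d)"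
    by (rule Stone_Weierstrass_real_polynomial_function[OF compact_sphere continuous_on_subset[OF h(1) subset_UNIV] d]) blast
  then obtain g where g: "real_polynomial_function g" "\<forall>t\<in>sphere 0 1. \<bar>h t - g t\<bar> < d"
    by blast
  obtain v where v: "v \<in> trig" "AE t in circle. val v t = of_real (g t)"
    using trig_of_real_polynomial[OF g(1)] by blast
  have [measurable]: "g \<in> borel_measurable borel" "h \<in> borel_measurable borel"
    using g(1) h(1) continuous_on_polymonial_function[of g UNIV]
    by (simp_all add: borel_measurable_continuous_onI real_polynomial_function_eq)
  have va: "AE t in circle. val v (alpha \<beta> t) = of_real (g (alpha \<beta> t))"
    using AE_alpha[OF \<beta> v(2)] by simp
  note I = integral_trig_alpha[OF \<beta> v(1)]
  have gb: "\<bar>g t\<bar> \<le> 1 + d" if "cmod t = 1" for t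
  proof -
    have "\<bar>h t - g t\<bar> < d" using g(2) that by simp
    with h01[of t] show ?thesis by linarith
  qed
  have ga: "integrable circle (\<lambda>t. g (alpha \<beta> t))"
    by (rule circle.integrable_const_bound[of _ "1 + d"]) (auto intro!: AE_circleI gb norm_alpha[OF \<beta>])
  have pi': "integrable circle (poisson \<beta>)"
    by (rule circle.integrable_const_bound[of _ C])
      (use poisson_measurable[OF \<beta>] poisson_nonneg[OF \<beta>] poisson_le[OF \<beta>] in \<open>auto intro!: AE_circleI simp: C\<close>)
  have [measurable]: "poisson \<beta> \<in> borel_measurable borel" by (rule poisson_measurable[OF \<beta>])
  have gp: "integrable circle (\<lambda>t. g t * poisson \<beta> t)"
  proof (rule Bochner_Integration.integrable_bound[of _ "\<lambda>t. (1 + d) * poisson \<beta> t"])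
    show "AE t in circle. norm (g t * poisson \<beta> t) \<le> norm ((1 + d) * poisson \<beta> t)"
      using d by (auto intro!: AE_circleI mult_right_mono gb simp: abs_mult poisson_nonneg[OF \<beta>])
  qed (use pi' in auto)
  have "of_real (LINT t|circle. g (alpha \<beta> t)) = (LINT t|circle. val v (alpha \<beta> t))"
    unfolding integral_complex_of_real[symmetric]
    using va by (intro integral_cong_AE) (auto elim: eventually_mono)
  also have "\<dots> = (LINT t|circle. val v t * of_real (poisson \<beta> t))" using I by simp
  also have "\<dots> = (LINT t|circle. of_real (g t * poisson \<beta> t))"
    using v(2) by (intro integral_cong_AE) (auto elim: eventually_mono)
  also have "\<dots> = of_real (LINT t|circle. g t * poisson \<beta> t)"
    by (rule integral_complex_of_real)
  finally have eq: "(LINT t|circle. g (alpha \<beta> t)) = (LINT t|circle. g t * poisson \<beta> t)"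
    by (simp only: of_real_eq_iff)
  have "measure circle {t. alpha \<beta> t \<in> K} = (LINT t|circle. indicator {t. alpha \<beta> t \<in> K} t)"
    by simp
  also have "\<dots> \<le> (LINT t|circle. g (alpha \<beta> t) + d)"
  proof (rule integral_mono_AE)
    show "AE t in circle. indicator {t. alpha \<beta> t \<in> K} t \<le> g (alpha \<beta> t) + d"
    proof (rule AE_circleI)
      fix t :: complex assume "cmod t = 1"
      then have "alpha \<beta> t \<in> sphere 0 1" using norm_alpha[OF \<beta>, of t] by simp
      with g(2) have "\<bar>h (alpha \<beta> t) - g (alpha \<beta> t)\<bar> < d" by blast
      then show "indicator {t. alpha \<beta> t \<in> K} t \<le> g (alpha \<beta> t) + d"
        using h(4)[of "alpha \<beta> t"] h01[of "alpha \<beta> t"] by (auto simp: indicator_def)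
    qed
    have "{t. alpha \<beta> t \<in> K} \<in> sets circle" by simp
    then show "integrable circle (indicat_real {t. alpha \<beta> t \<in> K})"
      by (intro circle.integrable_const_bound[of _ 1]) auto
  qed (use ga in auto)
  also have "\<dots> = (LINT t|circle. g t * poisson \<beta> t) + d"
    using ga by (simp add: eq)
  also have "(LINT t|circle. g t * poisson \<beta> t) \<le> (LINT t|circle. C * indicator U t + C * d)"
  proof (rule integral_mono_AE[OF gp])
    have "U \<in> sets circle" by simp
    then have "integrable circle (indicat_real U)"
      by (intro circle.integrable_const_bound[of _ 1]) auto
    then show "integrable circle (\<lambda>t. C * indicator U t + C * d)" by simp
    show "AE t in circle. g t * poisson \<beta> t \<le> C * indicator U t + C * d"
    proof (rule AE_circleI)
      fix t :: complex assume t: "cmod t = 1"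
      then have "\<bar>h t - g t\<bar> < d" using g(2) by simp
      then have "g t \<le> h t + d" by linarith
      then have "g t * poisson \<beta> t \<le> (h t + d) * poisson \<beta> t"
        by (intro mult_right_mono poisson_nonneg[OF \<beta>])
      also have "\<dots> \<le> (h t + d) * C"
        using poisson_le[OF \<beta> t] h01[of t] d by (intro mult_left_mono) (auto simp: C)
      also have "(h t + d) * C \<le> (indicator U t + d) * C"
        using h(3)[of t] h01[of t] C0 by (intro mult_right_mono) (auto simp: indicator_def)
      finally show "g t * poisson \<beta> t \<le> C * indicator U t + C * d"
        by (simp add: algebra_simps)
    qed
  qed
  also have "(LINT t|circle. C * indicator U t + C * d) = C * measure circle U + C * d"
  proof -
    have "U \<in> sets circle" by simp
    then have "integrable circle (indicat_real U)"
      by (intro circle.integrable_const_bound[of _ 1]) auto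
    then show ?thesis by simp
  qed
  also have "C * measure circle U + C * d + d = C * measure circle U + e"
  proof -
    have "(1 + C) * d = e"
      using C0 unfolding d_def by (subst times_divide_eq_right, subst nonzero_mult_div_cancel_left) auto
    then show ?thesis by (simp add: algebra_simps)
  qed
  finally show "measure circle {t. alpha \<beta> t \<in> K} \<le> C * measure circle U + e" by simp
qed

text \<open>Inner regularity is used for the image of the circle measure under \<open>alpha\<close>,
  outer regularity for the circle measure itself; together they sandwich a Borel set between the
  \<open>K\<close> and \<open>U\<close> of the previous estimate.\<close>

lemma measure_alpha_le:
  assumes \<beta>: "1 < cmod \<beta>" and C: "C = ((cmod \<beta>)\<^sup>2 - 1) / (cmod \<beta> - 1)\<^sup>2"
    and A: "A \<in> sets borel"
  shows "measure circle {t. alpha \<beta> t \<in> A} \<le> C * measure circle A"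
proof (rule field_le_epsilon)
  fix e :: real assume e: "0 < e"
  have C0: "0 \<le> C" using \<beta> by (simp add: C)
  define d where "d = e / (1 + C)"
  have d: "0 < d" using e C0 by (simp add: d_def)
  have m: "alpha \<beta> \<in> measurable circle borel" by measurable
  define M where "M = distr circle borel (alpha \<beta>)"
  have sM: "sets M = sets borel" by (simp add: M_def)
  have fM: "finite_measure M" unfolding M_def by (rule circle.finite_measure_distr[OF m])
  interpret M: finite_measure M by (rule fM)
  have M: "measure M B = measure circle {t. alpha \<beta> t \<in> B}" if "B \<in> sets borel" for B
    unfolding M_def using that by (subst measure_distr[OF m]) (auto simp: vimage_def)
  obtain K where K: "K \<subseteq> A" "compact K" "measure M A \<le> measure M K + d"
  proof (cases "measure M A < d")
    case True
    then show ?thesis using that[of "{}"] by simp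
  next
    case False
    have "ennreal (measure M A - d) < emeasure M A"
      using False d by (simp add: M.emeasure_eq_measure ennreal_less_iff)
    then have "ennreal (measure M A - d) < (SUP K \<in> {K. K \<subseteq> A \<and> compact K}. emeasure M K)"
      using inner_regular[OF sM _ A] by simp
    then obtain K where "K \<subseteq> A" "compact K" "ennreal (measure M A - d) < emeasure M K"
      by (auto simp: less_SUP_iff)
    then show ?thesis
      using False that[of K] by (auto simp: M.emeasure_eq_measure ennreal_less_iff)
  qed
  obtain U where U: "A \<subseteq> U" "open U" "measure circle U \<le> measure circle A + d"
  proof -
    have "ennreal (measure circle A) < ennreal (measure circle A + d)"
      using d by (simp add: ennreal_less_iff)
    then have "(INF U \<in> {U. A \<subseteq> U \<and> open U}. emeasure circle U) < ennreal (measure circle A + d)"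
      using outer_regular[OF sets_circle _ A] by (simp add: circle.emeasure_eq_measure)
    then obtain U where "A \<subseteq> U" "open U" "emeasure circle U < ennreal (measure circle A + d)"
      by (auto simp: INF_less_iff)
    then show ?thesis
      using d that[of U] by (auto simp: circle.emeasure_eq_measure ennreal_less_iff simp del: ennreal_plus)
  qed
  have "measure circle {t. alpha \<beta> t \<in> A} = measure M A" using M[OF A] by simp
  also have "\<dots> \<le> measure M K + d" by (rule K)
  also have "measure M K = measure circle {t. alpha \<beta> t \<in> K}" using K by (intro M borel_compact)
  also have "\<dots> \<le> C * measure circle U"
    using K U by (intro measure_alpha_compact_open[OF \<beta> C]) auto
  also have "\<dots> \<le> C * (measure circle A + d)" using U C0 by (intro mult_left_mono)
  also have "C * (measure circle A + d) + d = C * measure circle A + e"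
  proof -
    have "(1 + C) * d = e"
      using C0 unfolding d_def by (subst times_divide_eq_right, subst nonzero_mult_div_cancel_left) auto
    then show ?thesis by (simp add: algebra_simps)
  qed
  finally show "measure circle {t. alpha \<beta> t \<in> A} \<le> C * measure circle A + e" by simp
qed

lemma nn_integral_alpha_le:
  assumes \<beta>: "1 < cmod \<beta>" and C: "C = ((cmod \<beta>)\<^sup>2 - 1) / (cmod \<beta> - 1)\<^sup>2"
    and [measurable]: "f \<in> borel_measurable borel"
  shows "(\<integral>\<^sup>+t. f (alpha \<beta> t) \<partial>circle) \<le> ennreal C * (\<integral>\<^sup>+t. f t \<partial>circle)"
proof -
  have C0: "0 \<le> C" using \<beta> by (simp add: C)
  have m: "alpha \<beta> \<in> measurable circle borel" by measurable
  have "(\<integral>\<^sup>+t. f (alpha \<beta> t) \<partial>circle) = (\<integral>\<^sup>+t. f t \<partial>distr circle borel (alpha \<beta>))"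
    by (rule nn_integral_distr[symmetric]) measurable
  also have "\<dots> \<le> (\<integral>\<^sup>+t. f t \<partial>scale_measure (ennreal C) circle)"
  proof (rule nn_integral_mono_measure)
    show "distr circle borel (alpha \<beta>) \<le> scale_measure (ennreal C) circle"
    proof (subst le_measure)
      show "\<forall>A\<in>sets (distr circle borel (alpha \<beta>)). emeasure (distr circle borel (alpha \<beta>)) A \<le> emeasure (scale_measure (ennreal C) circle) A"
      proof
        fix A assume "A \<in> sets (distr circle borel (alpha \<beta>))"
        then have A: "A \<in> sets borel" by simp
        have "emeasure (distr circle borel (alpha \<beta>)) A = emeasure circle {t. alpha \<beta> t \<in> A}"
          using A by (subst emeasure_distr[OF m]) (auto simp: vimage_def)
        also have "\<dots> \<le> ennreal (C * measure circle A)"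
          unfolding circle.emeasure_eq_measure by (intro ennreal_leI measure_alpha_le[OF \<beta> C A])
        also have "\<dots> = emeasure (scale_measure (ennreal C) circle) A"
          using C0 by (simp add: circle.emeasure_eq_measure ennreal_mult)
        finally show "emeasure (distr circle borel (alpha \<beta>)) A \<le> emeasure (scale_measure (ennreal C) circle) A" .
      qed
    qed simp
  qed simp
  also have "\<dots> = ennreal C * (\<integral>\<^sup>+t. f t \<partial>circle)"
    by (rule nn_integral_scale_measure) simp
  finally show ?thesis .
qed

section \<open>Algebra and boundedness of the operator \<open>J\<close>\<close>

lemma val_shift: "AE t in circle. val (shift \<beta> f) t = val f (alpha \<beta> t)"
  unfolding shift_def by (rule val_abs) measurable

lemma val_J: "AE t in circle. val (J \<beta> f) t = lam \<beta> / (cnj \<beta> * t - 1) * val f (alpha \<beta> t)"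
proof -
  have "AE t in circle. val (abs_circle_fun (\<lambda>t. lam \<beta> / (cnj \<beta> * t - 1))) t = lam \<beta> / (cnj \<beta> * t - 1)"
    by (rule val_abs) measurable
  then show ?thesis
    unfolding J_def
    using val_times[of "abs_circle_fun (\<lambda>t. lam \<beta> / (cnj \<beta> * t - 1))" "shift \<beta> f"] val_shift[of \<beta> f]
    by eventually_elim simp
qed

lemma J_add:
  assumes \<beta>: "1 < cmod \<beta>"
  shows "J \<beta> (f + g) = J \<beta> f + J \<beta> g"
proof -
  have "AE t in circle. val (f + g) (alpha \<beta> t) = val f (alpha \<beta> t) + val g (alpha \<beta> t)"
    by (rule AE_alpha[OF \<beta> val_plus[of f g]]) measurable
  then show ?thesis
    unfolding circle_fun_eq_iff
    using val_J[of \<beta> f] val_J[of \<beta> g] val_J[of \<beta> "f + g"] val_plus[of "J \<beta> f" "J \<beta> g"]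
    by eventually_elim (simp add: distrib_left)
qed

lemma J_scale:
  assumes \<beta>: "1 < cmod \<beta>"
  shows "J \<beta> (scale c f) = scale c (J \<beta> f)"
proof -
  have "AE t in circle. val (scale c f) (alpha \<beta> t) = c * val f (alpha \<beta> t)"
    by (rule AE_alpha[OF \<beta> val_scale[of c f]]) measurable
  then show ?thesis
    unfolding circle_fun_eq_iff
    using val_J[of \<beta> f] val_J[of \<beta> "scale c f"] val_scale[of c "J \<beta> f"]
    by eventually_elim simp
qed

lemma J_uminus: "1 < cmod \<beta> \<Longrightarrow> J \<beta> (- f) = - J \<beta> f"
  unfolding uminus_eq_scale by (rule J_scale)

lemma J_diff: "1 < cmod \<beta> \<Longrightarrow> J \<beta> (f - g) = J \<beta> f - J \<beta> g"
  using J_add[of \<beta> f "- g"] J_uminus[of \<beta> g] by simp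

lemma J_0 [simp]: "1 < cmod \<beta> \<Longrightarrow> J \<beta> 0 = 0"
  using J_scale[of \<beta> 0 0] by simp

lemma J_mult:
  assumes \<beta>: "1 < cmod \<beta>"
  shows "J \<beta> (a * f) = shift \<beta> a * J \<beta> f"
proof -
  have "AE t in circle. val (a * f) (alpha \<beta> t) = val a (alpha \<beta> t) * val f (alpha \<beta> t)"
    by (rule AE_alpha[OF \<beta> val_times[of a f]]) measurable
  then show ?thesis
    unfolding circle_fun_eq_iff
    using val_J[of \<beta> f] val_J[of \<beta> "a * f"] val_times[of "shift \<beta> a" "J \<beta> f"] val_shift[of \<beta> a]
    by eventually_elim simp
qed

lemma shift_mult:
  assumes \<beta>: "1 < cmod \<beta>"
  shows "shift \<beta> (a * b) = shift \<beta> a * shift \<beta> b"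
proof -
  have "AE t in circle. val (a * b) (alpha \<beta> t) = val a (alpha \<beta> t) * val b (alpha \<beta> t)"
    by (rule AE_alpha[OF \<beta> val_times[of a b]]) measurable
  then show ?thesis
    unfolding circle_fun_eq_iff
    using val_shift[of \<beta> "a * b"] val_times[of "shift \<beta> a" "shift \<beta> b"] val_shift[of \<beta> a] val_shift[of \<beta> b]
    by eventually_elim simp
qed

lemma shift_1:
  assumes \<beta>: "1 < cmod \<beta>"
  shows "shift \<beta> 1 = 1"
proof -
  have "AE t in circle. val 1 (alpha \<beta> t) = 1"
    by (rule AE_alpha[OF \<beta> val_1]) measurable
  then show ?thesis
    unfolding circle_fun_eq_iff using val_shift[of \<beta> 1] val_1 by eventually_elim simp
qed

lemma shift_shift:
  assumes \<beta>: "1 < cmod \<beta>"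
  shows "shift \<beta> (shift \<beta> a) = a"
proof -
  have "AE t in circle. val (shift \<beta> a) (alpha \<beta> t) = val a (alpha \<beta> (alpha \<beta> t))"
    by (rule AE_alpha[OF \<beta> val_shift[of \<beta> a]]) measurable
  then show ?thesis
    unfolding circle_fun_eq_iff using val_shift[of \<beta> "shift \<beta> a"] AE_circle_norm
    by eventually_elim (simp add: alpha_alpha[OF \<beta>])
qed

lemma shift_Linf:
  assumes \<beta>: "1 < cmod \<beta>" and a: "a \<in> Linf"
  shows "shift \<beta> a \<in> Linf"
proof -
  obtain C where "AE t in circle. cmod (val a t) \<le> C"
    using a by (auto simp: mem_Linf_iff)
  then have "AE t in circle. cmod (val a (alpha \<beta> t)) \<le> C"
    by (rule AE_alpha[OF \<beta>]) measurable
  then have "AE t in circle. cmod (val (shift \<beta> a) t) \<le> C"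
    using val_shift[of \<beta> a] by eventually_elim simp
  then show ?thesis by (auto simp: mem_Linf_iff)
qed

lemma lam_square:
  assumes \<beta>: "1 < cmod \<beta>"
  shows "lam \<beta> * lam \<beta> = 1 - \<beta> * cnj \<beta>"
proof -
  define s where "s = sqrt ((cmod \<beta>)\<^sup>2 - 1)"
  have "s * s = (cmod \<beta>)\<^sup>2 - 1" using \<beta> by (simp add: s_def)
  then have "of_real (s * s) = \<beta> * cnj \<beta> - (1 :: complex)"
    by (simp only: of_real_diff complex_norm_square of_real_1)
  moreover have "lam \<beta> * lam \<beta> = - of_real (s * s)"
    unfolding lam_def s_def[symmetric] by (simp add: algebra_simps)
  ultimately show ?thesis by simp
qed

lemma alpha_denom:
  assumes \<beta>: "1 < cmod \<beta>" and t: "cmod t = 1"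
  shows "(cnj \<beta> * alpha \<beta> t - 1) * (cnj \<beta> * t - 1) = 1 - \<beta> * cnj \<beta>"
proof -
  have "alpha \<beta> t * (cnj \<beta> * t - 1) = t - \<beta>"
    using shift_denom_nonzero[OF \<beta> t] by (simp add: alpha_def)
  then show ?thesis
    by (simp add: left_diff_distrib mult.assoc) (simp add: algebra_simps)
qed

text \<open>The weights at \<open>t\<close> and at \<open>alpha \<beta> t\<close> multiply to
  \<open>lam \<beta> ^ 2 / (1 - \<beta> * cnj \<beta>) = 1\<close>; the number
  \<open>lam \<beta>\<close> is normalized for exactly this.\<close>

lemma J_J:
  assumes \<beta>: "1 < cmod \<beta>"
  shows "J \<beta> (J \<beta> f) = f"
proof -
  have "AE t in circle. val (J \<beta> f) (alpha \<beta> t) = lam \<beta> / (cnj \<beta> * alpha \<beta> t - 1) * val f (alpha \<beta> (alpha \<beta> t))"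
    by (rule AE_alpha[OF \<beta> val_J[of \<beta> f]]) measurable
  then show ?thesis
    unfolding circle_fun_eq_iff using val_J[of \<beta> "J \<beta> f"] AE_circle_norm
  proof eventually_elim
    case (elim t)
    have nz: "cnj \<beta> * t - 1 \<noteq> 0" "cnj \<beta> * alpha \<beta> t - 1 \<noteq> 0"
      using elim(3) by (auto intro!: shift_denom_nonzero[OF \<beta>] norm_alpha[OF \<beta>] simp del: right_minus_eq)
    have "lam \<beta> / (cnj \<beta> * t - 1) * (lam \<beta> / (cnj \<beta> * alpha \<beta> t - 1))
        = (lam \<beta> * lam \<beta>) / ((cnj \<beta> * alpha \<beta> t - 1) * (cnj \<beta> * t - 1))"
      by (simp add: mult.commute)
    also have "\<dots> = 1"
      using nz lam_square[OF \<beta>] alpha_denom[OF \<beta> elim(3)] by (metis divide_self mult_eq_0_iff)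
    finally show ?case
      using elim by (simp only: alpha_alpha[OF \<beta> elim(3)] mult.assoc[symmetric] mult_1)
  qed
qed

lemma J_Lp_bounded:
  assumes \<beta>: "1 < cmod \<beta>" and p: "1 \<le> p"
  obtains D where "0 \<le> D" "\<And>f. f \<in> Lp p \<Longrightarrow> J \<beta> f \<in> Lp p" "\<And>f. f \<in> Lp p \<Longrightarrow> Lp_norm p (J \<beta> f) \<le> D * Lp_norm p f"
proof -
  define C where "C = ((cmod \<beta>)\<^sup>2 - 1) / (cmod \<beta> - 1)\<^sup>2"
  define K where "K = cmod (lam \<beta>) / (cmod \<beta> - 1)"
  have C0: "0 \<le> C" "0 \<le> K" using \<beta> by (simp_all add: C_def K_def)
  have main: "J \<beta> f \<in> Lp p \<and> Lp_norm p (J \<beta> f) \<le> (K * C powr (1 / p)) * Lp_norm p f" if f: "f \<in> Lp p" for f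
  proof -
    have le: "AE t in circle. cmod (val (J \<beta> f) t) powr p \<le> K powr p * cmod (val f (alpha \<beta> t)) powr p"
      using val_J[of \<beta> f] AE_circle_norm
    proof eventually_elim
      case (elim t)
      have "cmod \<beta> - 1 \<le> cmod (cnj \<beta> * t - 1)"
        using norm_triangle_ineq2[of "cnj \<beta> * t" 1] elim by (simp add: norm_mult)
      then have "cmod (lam \<beta>) / cmod (cnj \<beta> * t - 1) \<le> K"
        unfolding K_def using \<beta> by (intro frac_le) auto
      then have "cmod (val (J \<beta> f) t) \<le> K * cmod (val f (alpha \<beta> t))"
        unfolding elim(1) norm_mult norm_divide by (intro mult_right_mono) auto
      then have "cmod (val (J \<beta> f) t) powr p \<le> (K * cmod (val f (alpha \<beta> t))) powr p"
        using p by (intro powr_mono2) auto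
      then show ?case using C0 by (simp add: powr_mult)
    qed
    have "(\<integral>\<^sup>+t. ennreal (cmod (val (J \<beta> f) t) powr p) \<partial>circle)
        \<le> (\<integral>\<^sup>+t. ennreal (K powr p) * ennreal (cmod (val f (alpha \<beta> t)) powr p) \<partial>circle)"
      using le by (intro nn_integral_mono_AE) (auto elim!: eventually_mono intro!: ennreal_leI simp flip: ennreal_mult)
    also have "\<dots> = ennreal (K powr p) * (\<integral>\<^sup>+t. ennreal (cmod (val f (alpha \<beta> t)) powr p) \<partial>circle)"
      by (rule nn_integral_cmult) measurable
    also have "\<dots> \<le> ennreal (K powr p) * (ennreal C * (\<integral>\<^sup>+t. ennreal (cmod (val f t) powr p) \<partial>circle))"
      by (intro mult_left_mono nn_integral_alpha_le[OF \<beta> C_def]) auto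
    also have "(\<integral>\<^sup>+t. ennreal (cmod (val f t) powr p) \<partial>circle) = ennreal (Lp_norm p f powr p)"
      using f p by (subst nn_integral_eq_integral) (auto simp: mem_Lp_iff Lp_norm_powr)
    also have "ennreal (K powr p) * (ennreal C * ennreal (Lp_norm p f powr p)) = ennreal (K powr p * (C * Lp_norm p f powr p))"
      using C0 by (simp add: ennreal_mult)
    finally have nn: "(\<integral>\<^sup>+t. ennreal (cmod (val (J \<beta> f) t) powr p) \<partial>circle) \<le> ennreal (K powr p * (C * Lp_norm p f powr p))" .
    then have i: "integrable circle (\<lambda>t. cmod (val (J \<beta> f) t) powr p)"
      by (intro integrableI_bounded) (auto simp: order_le_less_trans)
    have "ennreal (Lp_norm p (J \<beta> f) powr p) \<le> ennreal (K powr p * (C * Lp_norm p f powr p))"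
      using nn nn_integral_eq_integral[OF i] p by (simp add: Lp_norm_powr)
    then have "Lp_norm p (J \<beta> f) powr p \<le> K powr p * (C * Lp_norm p f powr p)"
      using C0 by (simp add: ennreal_le_iff)
    then have "(Lp_norm p (J \<beta> f) powr p) powr (1 / p) \<le> (K powr p * (C * Lp_norm p f powr p)) powr (1 / p)"
      using p by (intro powr_mono2) auto
    then have "Lp_norm p (J \<beta> f) \<le> K * C powr (1 / p) * Lp_norm p f"
      using p C0 by (simp add: powr_powr powr_mult)
    with i show ?thesis by (simp add: mem_Lp_iff)
  qed
  show thesis
    by (rule that[of "K * C powr (1 / p)"]) (use main C0 in auto)
qed

lemma J_Lp: "1 < cmod \<beta> \<Longrightarrow> 1 \<le> p \<Longrightarrow> f \<in> Lp p \<Longrightarrow> J \<beta> f \<in> Lp p"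
  by (rule J_Lp_bounded) auto

section \<open>Fourier coefficients of the images of powers of \<open>t\<close> under
  \<open>J\<close>\<close>

lemma fourier_J_powi_integral:
  assumes \<beta>: "1 < cmod \<beta>"
  shows "fourier (J \<beta> (tvar powi k)) n = (LINT t|circle. lam \<beta> / (cnj \<beta> * t - 1) * alpha \<beta> t powi k * t powi (- n))"
  unfolding fourier_val
proof (intro integral_cong_AE)
  note [measurable] = powi_measurable'[OF \<beta>]
  show "(\<lambda>t. val (J \<beta> (tvar powi k)) t * t powi - n) \<in> borel_measurable circle"
    "(\<lambda>t. lam \<beta> / (cnj \<beta> * t - 1) * alpha \<beta> t powi k * t powi - n) \<in> borel_measurable circle"
    by measurable
  have "AE t in circle. val (tvar powi k) (alpha \<beta> t) = alpha \<beta> t powi k"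
    by (rule AE_alpha[OF \<beta> val_powi]) measurable
  then show "AE t in circle. val (J \<beta> (tvar powi k)) t * t powi - n = lam \<beta> / (cnj \<beta> * t - 1) * alpha \<beta> t powi k * t powi - n"
    using val_J[of \<beta> "tvar powi k"] by eventually_elim simp
qed

text \<open>For negative exponents the factor \<open>cnj \<beta> * t - 1\<close> in the numerator of
  \<open>1 / alpha\<close> cancels the pole of the weight, and what remains has poles only at
  \<open>\<beta>\<close>, outside the disc. The factor \<open>t ^ nat (- n)\<close> makes the mean
  vanish.\<close>

lemma fourier_J_neg:
  assumes \<beta>: "1 < cmod \<beta>" and k: "k < 0" and n: "n < 0"
  shows "fourier (J \<beta> (tvar powi k)) n = 0"
proof -
  define F where "F t = lam \<beta> * (cnj \<beta> * t - 1) ^ nat (- k - 1) / (t - \<beta>) ^ nat (- k) * t ^ nat (- n)" for t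
  have nb: "t \<noteq> \<beta>" if "cmod t \<le> 1" for t using that \<beta> by auto
  have "(LINT t|circle. lam \<beta> / (cnj \<beta> * t - 1) * alpha \<beta> t powi k * t powi (- n)) = F 0"
  proof (rule circle_mean_value)
    show "(\<lambda>t. lam \<beta> / (cnj \<beta> * t - 1) * alpha \<beta> t powi k * t powi - n) \<in> borel_measurable borel"
      using powi_measurable'[OF \<beta>, measurable] by measurable
    show "lam \<beta> / (cnj \<beta> * t - 1) * alpha \<beta> t powi k * t powi - n = F t" if t: "cmod t = 1" for t
    proof -
      have nz: "cnj \<beta> * t - 1 \<noteq> 0" using shift_denom_nonzero[OF \<beta> t] .
      have "alpha \<beta> t powi k = ((cnj \<beta> * t - 1) / (t - \<beta>)) ^ nat (- k)"
        using k by (simp add: power_int_def alpha_def)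
      moreover have "nat (- k) = Suc (nat (- k - 1))" using k by simp
      ultimately have "lam \<beta> / (cnj \<beta> * t - 1) * alpha \<beta> t powi k = lam \<beta> * (cnj \<beta> * t - 1) ^ nat (- k - 1) / (t - \<beta>) ^ nat (- k)"
        using nz by (simp add: power_divide)
      then show ?thesis using n by (simp add: F_def power_int_def)
    qed
    show "continuous_on (cball 0 1) F"
      unfolding F_def using nb nb[of \<beta>] by (intro continuous_intros) auto
    show "F holomorphic_on ball 0 1"
      unfolding F_def using nb nb[of \<beta>] by (intro holomorphic_intros) auto
  qed
  also have "F 0 = 0" using n by (simp add: F_def power_0_left)
  finally show ?thesis by (simp add: fourier_J_powi_integral[OF \<beta>])
qed

text \<open>Here the integrand has poles inside the disc, so its conjugate is integrated. The weight
  contributes an extra factor \<open>t\<close>, which is why vanishing starts at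
  \<open>n = 0\<close> while \<open>n = - 1\<close> gives a nonzero value; that value is the source
  of \<open>lam \<beta> / cnj \<beta>\<close> and of the point \<open>1 / cnj \<beta>\<close> in the
  signature.\<close>

lemma fourier_J_nonneg:
  assumes \<beta>: "1 < cmod \<beta>" and k: "0 \<le> k" and n: "- 1 \<le> n"
  shows "fourier (J \<beta> (tvar powi k)) n = (if n = - 1 then lam \<beta> / cnj \<beta> * (1 / cnj \<beta>) ^ nat k else 0)"
proof -
  define F where "F t = cnj (lam \<beta>) / (\<beta> - t) * ((cnj \<beta> * t - 1) / (t - \<beta>)) ^ nat k * t ^ nat (n + 1)" for t
  have nb: "t \<noteq> \<beta>" if "cmod t \<le> 1" for t using that \<beta> by auto
  have m: "(\<lambda>t. lam \<beta> / (cnj \<beta> * t - 1) * alpha \<beta> t powi k * t powi - n) \<in> borel_measurable borel"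
    using powi_measurable'[OF \<beta>, measurable] by measurable
  have "(LINT t|circle. lam \<beta> / (cnj \<beta> * t - 1) * alpha \<beta> t powi k * t powi (- n))
      = (LINT t|circle. cnj (cnj (lam \<beta> / (cnj \<beta> * t - 1) * alpha \<beta> t powi k * t powi (- n))))"
    by simp
  also have "\<dots> = cnj (LINT t|circle. cnj (lam \<beta> / (cnj \<beta> * t - 1) * alpha \<beta> t powi k * t powi (- n)))"
    by (rule Bochner_Integration.integral_cnj)
  also have "(LINT t|circle. cnj (lam \<beta> / (cnj \<beta> * t - 1) * alpha \<beta> t powi k * t powi (- n))) = F 0"
  proof (rule circle_mean_value)
    show "(\<lambda>t. cnj (lam \<beta> / (cnj \<beta> * t - 1) * alpha \<beta> t powi k * t powi - n)) \<in> borel_measurable borel"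
      by (rule cnj_measurable[OF m])
    show "cnj (lam \<beta> / (cnj \<beta> * t - 1) * alpha \<beta> t powi k * t powi - n) = F t" if t: "cmod t = 1" for t
    proof -
      have t0: "t \<noteq> 0" using t by auto
      have ci: "cnj t = 1 / t" using circle_inverse[OF \<beta> t] by (simp add: inverse_eq_divide)
      have c2: "cnj (lam \<beta> / (cnj \<beta> * t - 1)) = cnj (lam \<beta>) / (\<beta> - t) * t"
      proof -
        have "t \<noteq> \<beta>" by (rule nb) (simp add: t)
        then have "\<beta> - t \<noteq> 0" by simp
        moreover have "\<beta> * (1 / t) - 1 = (\<beta> - t) / t" using t0 by (simp add: diff_divide_distrib)
        ultimately show ?thesis by (simp add: ci)
      qed
      have "cnj (alpha \<beta> t powi k) = cnj (alpha \<beta> t) ^ nat k"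
        using k by (simp add: power_int_def)
      also have "\<dots> = ((cnj \<beta> * t - 1) / (t - \<beta>)) ^ nat k"
        by (simp only: cnj_alpha[OF \<beta> t])
      finally have c1: "cnj (alpha \<beta> t powi k) = ((cnj \<beta> * t - 1) / (t - \<beta>)) ^ nat k" .
      have c3: "t * cnj (t powi - n) = t ^ nat (n + 1)"
      proof (cases "n = -1")
        case True
        then show ?thesis using t by (simp add: complex_norm_square[symmetric])
      next
        case False
        then have n0: "0 \<le> n" using n by simp
        then have "t powi - n = cnj t ^ nat n"
          using circle_inverse[OF \<beta> t] by (cases "n = 0") (auto simp: power_int_def)
        moreover have "nat (n + 1) = Suc (nat n)" using n0 by simp
        ultimately show ?thesis by simp
      qed
      show ?thesis
        unfolding F_def complex_cnj_mult c1 c2 using c3 by (simp add: mult_ac)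
    qed
    show "continuous_on (cball 0 1) F"
      unfolding F_def using nb nb[of \<beta>] by (intro continuous_intros) auto
    show "F holomorphic_on ball 0 1"
      unfolding F_def using nb nb[of \<beta>] by (intro holomorphic_intros) auto
  qed
  finally show ?thesis
    using n by (auto simp: F_def power_0_left fourier_J_powi_integral[OF \<beta>])
qed

subsection \<open>The Hahn--Banach theorem\<close>

definition sublinear :: "('a::real_vector \<Rightarrow> real) \<Rightarrow> bool" where
  "sublinear q \<longleftrightarrow> (\<forall>x y. q (x + y) \<le> q x + q y) \<and> (\<forall>t x. 0 \<le> t \<longrightarrow> q (t *\<^sub>R x) \<le> t * q x)"

lemma sublinear_add: "sublinear q \<Longrightarrow> q (x + y) \<le> q x + q y"
  by (simp add: sublinear_def)

lemma sublinear_scale: "sublinear q \<Longrightarrow> 0 \<le> t \<Longrightarrow> q (t *\<^sub>R x) \<le> t * q x"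
  by (simp add: sublinear_def)

lemma sublinear_0:
  assumes "sublinear q"
  shows "q 0 = 0"
  using sublinear_add[OF assms, of 0 0] sublinear_scale[OF assms, of 0 0] by simp

lemma sublinear_minus_le: "sublinear q \<Longrightarrow> - q (- x) \<le> q x"
  using sublinear_add[of q x "- x"] sublinear_0[of q] by simp

text \<open>Lowers \<open>q\<close> so that it becomes linear along \<open>y\<close>: the result
  stays below \<open>q\<close>, and the parameter \<open>t = 1\<close> shows that its value at
  \<open>- y\<close> is at most \<open>- q y\<close>.\<close>

definition directional :: "('a::real_vector \<Rightarrow> real) \<Rightarrow> 'a \<Rightarrow> 'a \<Rightarrow> real" where
  "directional q y x = (INF t\<in>{0..}. q (x + t *\<^sub>R y) - t * q y)"

lemma directional_bound:
  assumes q: "sublinear q" and t: "0 \<le> t"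
  shows "- q (- x) \<le> q (x + t *\<^sub>R y) - t * q y"
proof (cases "t = 0")
  case True
  then show ?thesis using sublinear_minus_le[OF q, of x] by simp
next
  case False
  have "q y \<le> (1 / t) * q (t *\<^sub>R y)"
    using sublinear_scale[OF q, of "1 / t" "t *\<^sub>R y"] t False by simp
  then have "t * q y \<le> q (t *\<^sub>R y)"
    using t False by (simp add: field_simps)
  also have "\<dots> \<le> q (x + t *\<^sub>R y) + q (- x)"
    using sublinear_add[OF q, of "x + t *\<^sub>R y" "- x"] by simp
  finally show ?thesis by simp
qed

lemma directional_bdd: "sublinear q \<Longrightarrow> bdd_below ((\<lambda>t. q (x + t *\<^sub>R y) - t * q y) ` {0..})"
  using directional_bound[of q _ x y] by (auto intro!: bdd_belowI[of _ "- q (- x)"])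

lemma directional_le:
  assumes "sublinear q" "0 \<le> t"
  shows "directional q y x \<le> q (x + t *\<^sub>R y) - t * q y"
  unfolding directional_def using assms by (intro cINF_lower directional_bdd) auto

lemma sublinear_directional:
  assumes q: "sublinear q"
  shows "sublinear (directional q y)"
  unfolding sublinear_def
proof (intro conjI allI impI)
  fix x x'
  have "directional q y (x + x') - (q (x' + t' *\<^sub>R y) - t' * q y) \<le> directional q y x" if t': "0 \<le> t'" for t'
    unfolding directional_def[of q y x]
  proof (rule cINF_greatest)
    fix t :: real assume t: "t \<in> {0..}"
    have "directional q y (x + x') \<le> q (x + x' + (t + t') *\<^sub>R y) - (t + t') * q y"
      using t t' by (intro directional_le q) auto
    also have "x + x' + (t + t') *\<^sub>R y = (x + t *\<^sub>R y) + (x' + t' *\<^sub>R y)"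
      by (simp add: algebra_simps)
    also have "q \<dots> \<le> q (x + t *\<^sub>R y) + q (x' + t' *\<^sub>R y)"
      by (rule sublinear_add[OF q])
    finally show "directional q y (x + x') - (q (x' + t' *\<^sub>R y) - t' * q y) \<le> q (x + t *\<^sub>R y) - t * q y"
      by (simp add: algebra_simps)
  qed auto
  then have "directional q y (x + x') - directional q y x \<le> q (x' + t' *\<^sub>R y) - t' * q y" if "0 \<le> t'" for t'
    using that by (simp add: algebra_simps)
  then have "directional q y (x + x') - directional q y x \<le> directional q y x'"
    unfolding directional_def[of q y x'] by (intro cINF_greatest) auto
  then show "directional q y (x + x') \<le> directional q y x + directional q y x'" by simp
next
  fix s :: real and x assume s: "0 \<le> s"
  show "directional q y (s *\<^sub>R x) \<le> s * directional q y x"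
  proof (cases "s = 0")
    case True
    then show ?thesis using directional_le[OF q, of 0 y 0] sublinear_0[OF q] by simp
  next
    case False
    have "directional q y (s *\<^sub>R x) / s \<le> directional q y x"
      unfolding directional_def[of q y x]
    proof (rule cINF_greatest)
      fix t :: real assume t: "t \<in> {0..}"
      have "directional q y (s *\<^sub>R x) \<le> q (s *\<^sub>R x + (s * t) *\<^sub>R y) - (s * t) * q y"
        using s t by (intro directional_le q) auto
      also have "s *\<^sub>R x + (s * t) *\<^sub>R y = s *\<^sub>R (x + t *\<^sub>R y)"
        by (simp add: algebra_simps)
      also have "q \<dots> \<le> s * q (x + t *\<^sub>R y)"
        by (rule sublinear_scale[OF q s])
      finally show "directional q y (s *\<^sub>R x) / s \<le> q (x + t *\<^sub>R y) - t * q y"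
        using s False by (simp add: field_simps)
    qed auto
    then show ?thesis using s False by (simp add: field_simps)
  qed
qed

text \<open>A minimal \<open>s\<close> coincides with \<open>directional s y\<close> for every
  \<open>y\<close>, whence \<open>s x \<le> s (x + y) - s y\<close>. This is superadditivity, the
  missing half of additivity.\<close>

lemma minimal_sublinear_linear:
  assumes s: "sublinear s" and min: "\<And>r. sublinear r \<Longrightarrow> (\<And>x. r x \<le> s x) \<Longrightarrow> r = s"
  shows "linear s"
proof -
  have le: "directional s y x \<le> s x" for x y
    using directional_le[OF s, of 0 y x] by simp
  have eq: "directional s y = s" for y
    by (rule min[OF sublinear_directional[OF s] le])
  have add: "s (x + y) = s x + s y" for x y
  proof (rule antisym)
    have "s x \<le> s (x + y) - s y"
      using directional_le[OF s, of 1 y x] eq[of y] by simp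
    then show "s x + s y \<le> s (x + y)" by simp
  qed (rule sublinear_add[OF s])
  have minus: "s (- x) = - s x" for x
    using add[of x "- x"] sublinear_0[OF s] by simp
  have pos: "s (t *\<^sub>R x) = t * s x" if "0 \<le> t" for t x
    using sublinear_scale[OF s that, of x] sublinear_scale[OF s that, of "- x"] minus by simp
  show ?thesis
  proof (rule linearI)
    fix t :: real and x
    show "s (t *\<^sub>R x) = t *\<^sub>R s x"
      using pos[of t x] pos[of "- t" x] minus[of "t *\<^sub>R x"] by (cases "0 \<le> t") auto
  qed (rule add)
qed

text \<open>Zorn's lemma gives a minimal sublinear functional, which is linear. The search starts
  below \<open>directional q x0\<close> instead of \<open>q\<close>, because this forces the value
  \<open>- q x0\<close> as an upper bound at \<open>- x0\<close> and thus equality at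
  \<open>x0\<close>.\<close>

theorem Hahn_Banach_sublinear:
  fixes q :: "'a::real_vector \<Rightarrow> real"
  assumes q: "sublinear q"
  shows "\<exists>f. linear f \<and> (\<forall>x. f x \<le> q x) \<and> f x0 = q x0"
proof -
  define q0 where "q0 = directional q x0"
  have q0: "sublinear q0" unfolding q0_def by (rule sublinear_directional[OF q])
  define A where "A = {s :: 'a \<Rightarrow> real. sublinear s \<and> (\<forall>x. s x \<le> q0 x)}"
  define P where "P s r \<longleftrightarrow> (\<forall>x. r x \<le> s x)" for s r :: "'a \<Rightarrow> real"
  have "\<exists>m\<in>A. \<forall>a\<in>A. P m a \<longrightarrow> a = m"
  proof (rule predicate_Zorn)
    show "partial_order_on A (relation_of P A)"
      by (rule partial_order_on_relation_ofI) (auto simp: P_def intro: order_trans intro!: ext antisym)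
    fix C assume C: "C \<in> Chains (relation_of P A)"
    then have CA: "C \<subseteq> A" and tot: "\<And>s r. s \<in> C \<Longrightarrow> r \<in> C \<Longrightarrow> P s r \<or> P r s"
      by (auto simp: Chains_def relation_of_def)
    show "\<exists>u\<in>A. \<forall>a\<in>C. P a u"
    proof (cases "C = {}")
      case True
      then show ?thesis using q0 by (auto simp: A_def)
    next
      case False
      define u where "u x = (INF s\<in>C. s x)" for x
      have sub: "sublinear s" "s x \<le> q0 x" if "s \<in> C" for s x
        using that CA by (auto simp: A_def)
      have bdd: "bdd_below ((\<lambda>s. s x) ` C)" for x
      proof (rule bdd_belowI)
        fix v assume "v \<in> (\<lambda>s. s x) ` C"
        then obtain s where s: "s \<in> C" "v = s x" by auto
        then show "- q0 (- x) \<le> v"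
          using sublinear_minus_le[OF sub(1)[OF s(1)], of x] sub(2)[OF s(1), of "- x"] by simp
      qed
      have ule: "u x \<le> s x" if "s \<in> C" for s x
        unfolding u_def using that by (intro cINF_lower bdd)
      have "sublinear u"
        unfolding sublinear_def
      proof (intro conjI allI impI)
        fix x y
        \<comment> \<open>In a chain the smaller of \<open>s\<close> and \<open>r\<close> serves at
          both points; this is what makes the pointwise infimum subadditive.\<close>
        have *: "u (x + y) \<le> s x + r y" if sr: "s \<in> C" "r \<in> C" for s r
        proof -
          obtain w where w: "w \<in> C" "w x \<le> s x" "w y \<le> r y"
            using tot[OF sr] sr by (auto simp: P_def)
          show ?thesis
            using ule[OF w(1), of "x + y"] sublinear_add[OF sub(1)[OF w(1)], of x y] w by linarith
        qed
        have "u (x + y) - r y \<le> u x" if "r \<in> C" for r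
          unfolding u_def[of x] using False *[OF _ that] by (intro cINF_greatest) (auto simp: algebra_simps)
        then have "u (x + y) - u x \<le> u y"
          unfolding u_def[of y] using False by (intro cINF_greatest) (auto simp: algebra_simps)
        then show "u (x + y) \<le> u x + u y" by simp
      next
        fix t :: real and x assume t: "0 \<le> t"
        have *: "u (t *\<^sub>R x) \<le> t * s x" if "s \<in> C" for s
          using ule[OF that, of "t *\<^sub>R x"] sublinear_scale[OF sub(1)[OF that] t, of x] by linarith
        show "u (t *\<^sub>R x) \<le> t * u x"
        proof (cases "t = 0")
          case True
          obtain s where "s \<in> C" using False by auto
          then show ?thesis using *[of s] True by simp
        next
          case t0: False
          have "u (t *\<^sub>R x) / t \<le> u x"
            unfolding u_def[of x] using False t t0 * by (intro cINF_greatest) (auto simp: field_simps)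
          then show ?thesis using t t0 by (simp add: field_simps)
        qed
      qed
      moreover have "u x \<le> q0 x" for x
      proof -
        obtain s where "s \<in> C" using False by auto
        then show ?thesis using ule[of s x] sub(2)[of s x] by linarith
      qed
      ultimately show ?thesis using ule by (intro bexI[of _ u]) (auto simp: A_def P_def)
    qed
  qed
  then obtain s where sA: "s \<in> A" and sm: "\<And>a. a \<in> A \<Longrightarrow> P s a \<Longrightarrow> a = s"
    by blast
  have s: "sublinear s" "s x \<le> q0 x" for x
    using sA by (auto simp: A_def)
  have min: "r = s" if r: "sublinear r" "\<And>x. r x \<le> s x" for r
  proof (rule sm)
    show "r \<in> A" unfolding A_def using r(1) order_trans[OF r(2) s(2)] by blast
    show "P s r" unfolding P_def using r(2) by blast
  qed
  have lin: "linear s" by (rule minimal_sublinear_linear[OF s(1) min])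
  have q0q: "q0 x \<le> q x" for x
    unfolding q0_def using directional_le[OF q, of 0 x0 x] by simp
  have "s (- x0) \<le> - q x0"
    using s(2)[of "- x0"] directional_le[OF q, of 1 x0 "- x0"] sublinear_0[OF q] by (simp add: q0_def)
  then have "q x0 \<le> s x0" using linear_neg[OF lin, of x0] by simp
  moreover have "s x \<le> q x" for x using s(2)[of x] q0q[of x] by linarith
  ultimately show ?thesis using lin by (intro exI[of _ s]) (auto intro: antisym)
qed

text \<open>The Hahn-Banach theorem concerns real functionals; the complex functional is recovered
  afterwards from its real part.\<close>

instantiation circle_fun :: real_vector
begin

definition scaleR_circle_fun :: "real \<Rightarrow> circle_fun \<Rightarrow> circle_fun" where
  "scaleR_circle_fun r f = scale (of_real r) f"

instance
  by standard
    (simp_all add: scaleR_circle_fun_def circle_fun.scale_right_distrib circle_fun.scale_left_distrib)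

end

subsection \<open>Hardy spaces\<close>

text \<open>The range of \<open>riesz_Q\<close>, in other words \<open>t^-1\<close> times
  \<open>Hp_bar p\<close>.\<close>

definition Hm :: "real \<Rightarrow> circle_fun set" where
  "Hm p = {f \<in> Lp p. \<forall>n\<ge>0. fourier f n = 0}"

lemma Hp_Lp: "f \<in> Hp p \<Longrightarrow> f \<in> Lp p"
  by (simp add: Hp_def)

lemma Hm_Lp: "f \<in> Hm p \<Longrightarrow> f \<in> Lp p"
  by (simp add: Hm_def)

lemma subspace_Hp: "1 \<le> p \<Longrightarrow> circle_fun.subspace (Hp p)"
  by (auto simp: circle_fun.subspace_def Hp_def Lp_add Lp_scale fourier_add fourier_scale Lp_subset_L1')

lemma subspace_Hm: "1 \<le> p \<Longrightarrow> circle_fun.subspace (Hm p)"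
  by (auto simp: circle_fun.subspace_def Hm_def Lp_add Lp_scale fourier_add fourier_scale Lp_subset_L1')

lemma Hp_add: "1 \<le> p \<Longrightarrow> f \<in> Hp p \<Longrightarrow> g \<in> Hp p \<Longrightarrow> f + g \<in> Hp p"
  by (intro circle_fun.subspace_add subspace_Hp)

lemma Hp_diff: "1 \<le> p \<Longrightarrow> f \<in> Hp p \<Longrightarrow> g \<in> Hp p \<Longrightarrow> f - g \<in> Hp p"
  by (intro circle_fun.subspace_diff subspace_Hp)

lemma Hp_scale: "1 \<le> p \<Longrightarrow> f \<in> Hp p \<Longrightarrow> scale c f \<in> Hp p"
  by (intro circle_fun.subspace_scale subspace_Hp)

lemma Hp_0: "0 \<in> Hp p"
  by (simp add: Hp_def)

lemma Hm_scale: "1 \<le> p \<Longrightarrow> f \<in> Hm p \<Longrightarrow> scale c f \<in> Hm p"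
  by (intro circle_fun.subspace_scale subspace_Hm)

lemma riesz_P_Hp: "1 < p \<Longrightarrow> f \<in> Lp p \<Longrightarrow> riesz_P p f \<in> Hp p"
  by (simp add: Hp_def riesz_P)

lemma riesz_P_id: "1 < p \<Longrightarrow> f \<in> Hp p \<Longrightarrow> riesz_P p f = f"
  by (rule riesz_P_eqI) (auto simp: Hp_def analytic_part_def)

lemma riesz_P_Hm: "1 < p \<Longrightarrow> f \<in> Hm p \<Longrightarrow> riesz_P p f = 0"
  by (rule riesz_P_eqI) (auto simp: Hm_def analytic_part_def)

lemma riesz_P_add: "1 < p \<Longrightarrow> f \<in> Lp p \<Longrightarrow> g \<in> Lp p \<Longrightarrow> riesz_P p (f + g) = riesz_P p f + riesz_P p g"
  by (rule riesz_P_eqI) (auto simp: riesz_P Lp_add analytic_part_def fourier_add Lp_subset_L1)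

lemma riesz_P_scale: "1 < p \<Longrightarrow> f \<in> Lp p \<Longrightarrow> riesz_P p (scale c f) = scale c (riesz_P p f)"
  by (rule riesz_P_eqI) (auto simp: riesz_P Lp_scale analytic_part_def fourier_scale)

lemma riesz_P_diff: "1 < p \<Longrightarrow> f \<in> Lp p \<Longrightarrow> g \<in> Lp p \<Longrightarrow> riesz_P p (f - g) = riesz_P p f - riesz_P p g"
  by (rule riesz_P_eqI) (auto simp: riesz_P Lp_diff analytic_part_def fourier_diff Lp_subset_L1)

lemma riesz_P_eq_0_iff: "1 < p \<Longrightarrow> f \<in> Lp p \<Longrightarrow> riesz_P p f = 0 \<longleftrightarrow> f \<in> Hm p"
  using riesz_P_Hm[of p f] fourier_riesz_P[of p f] by (auto simp: Hm_def) (metis fourier_0)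

lemma riesz_Q_Hm: "1 < p \<Longrightarrow> f \<in> Lp p \<Longrightarrow> riesz_Q p f \<in> Hm p"
  by (auto simp: riesz_Q_def Hm_def Lp_diff riesz_P fourier_diff Lp_subset_L1)

lemma Hp_tvar_powi: "1 \<le> p \<Longrightarrow> 0 \<le> k \<Longrightarrow> tvar powi k \<in> Hp p"
  by (simp add: Hp_def Lp_tvar_powi fourier_tvar_powi)

lemma Hp_tvar_mult: "0 \<le> k \<Longrightarrow> f \<in> Hp p \<Longrightarrow> tvar powi k * f \<in> Hp p"
  by (simp add: Hp_def Lp_tvar_powi_mult fourier_shift)

lemma Hm_tvar_mult: "k \<le> 0 \<Longrightarrow> f \<in> Hm p \<Longrightarrow> tvar powi k * f \<in> Hm p"
  by (simp add: Hm_def Lp_tvar_powi_mult fourier_shift)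

text \<open>The Riesz projection is bounded, fixes \<open>f\<close> and maps trigonometric
  polynomials to trigonometric polynomials, so it may be applied to any approximating
  sequence.\<close>

lemma Hp_dense:
  assumes p: "1 < p" and f: "f \<in> Hp p"
  obtains h where "\<And>n::nat. h n \<in> trig" "\<And>n. h n \<in> Hp p" "(\<lambda>n. Lp_norm p (h n - f)) \<longlonglongrightarrow> 0"
proof -
  obtain g where g: "\<And>n::nat. g n \<in> trig" "(\<lambda>n. Lp_norm p (g n - f)) \<longlonglongrightarrow> 0"
    using trig_dense_seq[OF Hp_Lp[OF f]] p less_imp_le[OF p] by blast
  have gL: "g n \<in> Lp p" for n using g(1) p by (auto intro: trig_Lp)
  obtain C where C: "0 \<le> C" "Lp_norm p (riesz_P p f) \<le> C * Lp_norm p f" if "f \<in> Lp p" for f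
  proof (rule riesz_P_bounded[OF p], goal_cases)
    case (1 C)
    show ?case by (rule 1(1)[of C]) (use 1(2,3) in auto)
  qed
  show thesis
  proof (rule that)
    show "riesz_P p (g n) \<in> trig" for n
    proof -
      obtain h where "h \<in> trig" "analytic_part (g n) h"
        using trig_analytic_part[OF g(1)] by blast
      then show ?thesis using riesz_P_eqI[OF p, of h "g n"] p by (simp add: trig_Lp)
    qed
    show "riesz_P p (g n) \<in> Hp p" for n by (intro riesz_P_Hp p gL)
    show "(\<lambda>n. Lp_norm p (riesz_P p (g n) - f)) \<longlonglongrightarrow> 0"
    proof (rule Lim_null_comparison[OF always_eventually tendsto_mult_right_zero[OF g(2), of C]], rule allI)
      fix n
      have "riesz_P p (g n) - f = riesz_P p (g n - f)"
        using p f gL by (simp add: riesz_P_diff riesz_P_id Hp_Lp)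
      then show "norm (Lp_norm p (riesz_P p (g n) - f)) \<le> C * Lp_norm p (g n - f)"
        using C(2)[of "g n - f"] gL f p by (simp add: Lp_diff Hp_Lp)
    qed
  qed
qed

lemma Hm_dense:
  assumes p: "1 < p" and f: "f \<in> Hm p"
  obtains h where "\<And>n::nat. h n \<in> trig" "\<And>n. h n \<in> Hm p" "(\<lambda>n. Lp_norm p (h n - f)) \<longlonglongrightarrow> 0"
proof -
  obtain g where g: "\<And>n::nat. g n \<in> trig" "(\<lambda>n. Lp_norm p (g n - f)) \<longlonglongrightarrow> 0"
    using trig_dense_seq[OF Hm_Lp[OF f]] p less_imp_le[OF p] by blast
  have gL: "g n \<in> Lp p" for n using g(1) p by (auto intro: trig_Lp)
  obtain C where C: "0 \<le> C" "Lp_norm p (riesz_P p f) \<le> C * Lp_norm p f" if "f \<in> Lp p" for f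
  proof (rule riesz_P_bounded[OF p], goal_cases)
    case (1 C)
    show ?case by (rule 1(1)[of C]) (use 1(2,3) in auto)
  qed
  show thesis
  proof (rule that)
    show "g n - riesz_P p (g n) \<in> trig" for n
    proof -
      obtain h where "h \<in> trig" "analytic_part (g n) h"
        using trig_analytic_part[OF g(1)] by blast
      then show ?thesis using riesz_P_eqI[OF p, of h "g n"] p g(1) by (simp add: trig_Lp trig_diff)
    qed
    show "g n - riesz_P p (g n) \<in> Hm p" for n
      using riesz_Q_Hm[OF p gL] by (simp add: riesz_Q_def)
    show "(\<lambda>n. Lp_norm p (g n - riesz_P p (g n) - f)) \<longlonglongrightarrow> 0"
    proof (rule Lim_null_comparison[OF always_eventually tendsto_mult_right_zero[OF g(2), of "1 + C"]], rule allI)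
      fix n
      have "g n - riesz_P p (g n) - f = (g n - f) - riesz_P p (g n - f)"
        using p f gL by (simp add: riesz_P_diff riesz_P_Hm Hm_Lp)
      moreover have "g n - f \<in> Lp p"
        using p f gL by (simp add: Lp_diff Hm_Lp)
      then have "Lp_norm p ((g n - f) - riesz_P p (g n - f)) \<le> Lp_norm p (g n - f) + Lp_norm p (riesz_P p (g n - f))"
        using p by (intro Lp_norm_triangle_diff riesz_P) auto
      moreover have "Lp_norm p (riesz_P p (g n - f)) \<le> C * Lp_norm p (g n - f)"
        using \<open>g n - f \<in> Lp p\<close> by (rule C)
      ultimately show "norm (Lp_norm p (g n - riesz_P p (g n) - f)) \<le> (1 + C) * Lp_norm p (g n - f)"
        by (simp add: algebra_simps)
    qed
  qed
qed

section \<open>The operator \<open>J\<close> interchanges the two Hardy spaces\<close>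

lemma J_sum: "1 < cmod \<beta> \<Longrightarrow> J \<beta> (sum f S) = (\<Sum>k\<in>S. J \<beta> (f k))"
  by (induction S rule: infinite_finite_induct) (auto simp: J_add)

lemma J_trig_expand:
  assumes \<beta>: "1 < cmod \<beta>" and g: "g \<in> trig"
  obtains S where "finite S" "\<And>k. k \<notin> S \<Longrightarrow> fourier g k = 0"
    "\<And>n. fourier (J \<beta> g) n = (\<Sum>k\<in>S. fourier g k * fourier (J \<beta> (tvar powi k)) n)"
proof -
  obtain S where S: "finite S" "g = (\<Sum>k\<in>S. scale (fourier g k) (tvar powi k))"
    using trig_expand[OF g] by blast
  have zero: "fourier g k = 0" if "k \<notin> S" for k
  proof -
    have "fourier g k = (\<Sum>j\<in>S. fourier g j * (if k = j then 1 else 0))"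
      by (subst S(2)) (simp add: fourier_sum Lp_scale Lp_tvar_powi fourier_scale fourier_tvar_powi)
    also have "\<dots> = 0" using that by (intro sum.neutral) auto
    finally show ?thesis .
  qed
  have "J \<beta> g = (\<Sum>k\<in>S. scale (fourier g k) (J \<beta> (tvar powi k)))"
    by (subst S(2)) (simp add: J_sum[OF \<beta>] J_scale[OF \<beta>])
  then have "fourier (J \<beta> g) n = (\<Sum>k\<in>S. fourier g k * fourier (J \<beta> (tvar powi k)) n)" for n
    by (simp add: fourier_sum Lp_scale J_Lp[OF \<beta>] Lp_tvar_powi fourier_scale)
  with S(1) zero show thesis by (rule that)
qed

lemma fourier_J_tendsto:
  assumes \<beta>: "1 < cmod \<beta>" and p: "1 < p"
    and h: "\<And>n. h n \<in> Lp p" "f \<in> Lp p" "(\<lambda>n. Lp_norm p (h n - f)) \<longlonglongrightarrow> 0"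
  shows "(\<lambda>n. fourier (J \<beta> (h n)) k) \<longlonglongrightarrow> fourier (J \<beta> f) k"
proof (rule J_Lp_bounded[OF \<beta>, of p], goal_cases)
  case (2 D)
  show ?case
  proof (rule fourier_tendsto[OF p 2(2)[OF h(1)] 2(2)[OF h(2)]])
    show "(\<lambda>n. Lp_norm p (J \<beta> (h n) - J \<beta> f)) \<longlonglongrightarrow> 0"
    proof (rule Lim_null_comparison[OF always_eventually tendsto_mult_right_zero[OF h(3), of D]], rule allI)
      fix n
      have "h n - f \<in> Lp p" using h p by (intro Lp_diff) auto
      from 2(3)[OF this] show "norm (Lp_norm p (J \<beta> (h n) - J \<beta> f)) \<le> D * Lp_norm p (h n - f)"
        by (simp add: J_diff[OF \<beta>])
    qed
  qed
qed (use p in simp)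

lemma J_Hp:
  assumes \<beta>: "1 < cmod \<beta>" and p: "1 < p" and f: "f \<in> Hp p"
  shows "J \<beta> f \<in> Hm p"
proof -
  obtain h where h: "\<And>n::nat. h n \<in> trig" "\<And>n. h n \<in> Hp p" "(\<lambda>n. Lp_norm p (h n - f)) \<longlonglongrightarrow> 0"
    using Hp_dense[OF p f] by blast
  have "fourier (J \<beta> f) k = 0" if k: "0 \<le> k" for k
  proof -
    have z: "fourier (J \<beta> (h n)) k = 0" for n
    proof -
      obtain S where S: "fourier (J \<beta> (h n)) k = (\<Sum>j\<in>S. fourier (h n) j * fourier (J \<beta> (tvar powi j)) k)"
        by (rule J_trig_expand[OF \<beta> h(1)[of n]]) blast
      show ?thesis
        unfolding S
      proof (intro sum.neutral ballI)
        fix j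
        show "fourier (h n) j * fourier (J \<beta> (tvar powi j)) k = 0"
          using h(2)[of n] fourier_J_nonneg[OF \<beta>, of j k] k by (cases "0 \<le> j") (auto simp: Hp_def)
      qed
    qed
    have "(\<lambda>n. fourier (J \<beta> (h n)) k) \<longlonglongrightarrow> fourier (J \<beta> f) k"
      by (rule fourier_J_tendsto[OF \<beta> p Hp_Lp[OF h(2)] Hp_Lp[OF f] h(3)])
    then show ?thesis unfolding z by (simp add: LIMSEQ_const_iff)
  qed
  then show ?thesis using J_Lp[OF \<beta> _ Hp_Lp[OF f]] p by (auto simp: Hm_def)
qed

lemma J_Hm:
  assumes \<beta>: "1 < cmod \<beta>" and p: "1 < p" and f: "f \<in> Hm p"
  shows "J \<beta> f \<in> Hp p"
proof -
  obtain h where h: "\<And>n::nat. h n \<in> trig" "\<And>n. h n \<in> Hm p" "(\<lambda>n. Lp_norm p (h n - f)) \<longlonglongrightarrow> 0"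
    using Hm_dense[OF p f] by blast
  have "fourier (J \<beta> f) k = 0" if k: "k < 0" for k
  proof -
    have z: "fourier (J \<beta> (h n)) k = 0" for n
    proof -
      obtain S where S: "fourier (J \<beta> (h n)) k = (\<Sum>j\<in>S. fourier (h n) j * fourier (J \<beta> (tvar powi j)) k)"
        by (rule J_trig_expand[OF \<beta> h(1)[of n]]) blast
      show ?thesis
        unfolding S
      proof (intro sum.neutral ballI)
        fix j
        show "fourier (h n) j * fourier (J \<beta> (tvar powi j)) k = 0"
          using h(2)[of n] fourier_J_neg[OF \<beta>, of j k] k by (cases "0 \<le> j") (auto simp: Hm_def)
      qed
    qed
    have "(\<lambda>n. fourier (J \<beta> (h n)) k) \<longlonglongrightarrow> fourier (J \<beta> f) k"
      by (rule fourier_J_tendsto[OF \<beta> p Hm_Lp[OF h(2)] Hm_Lp[OF f] h(3)])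
    then show ?thesis unfolding z by (simp add: LIMSEQ_const_iff)
  qed
  then show ?thesis using J_Lp[OF \<beta> _ Hm_Lp[OF f]] p by (auto simp: Hp_def)
qed

section \<open>Values of the analytic extension as bounded functionals\<close>

lemma disc_ext_summable:
  assumes f: "f \<in> Lp 1" and z: "cmod z < 1"
  shows "summable (\<lambda>k. cmod (fourier f (int k) * z ^ k))"
proof (rule summable_comparison_test)
  show "\<exists>N. \<forall>k\<ge>N. norm (cmod (fourier f (int k) * z ^ k)) \<le> Lp_norm 1 f * cmod z ^ k"
    using fourier_bound[OF f] by (auto simp: norm_mult norm_power intro!: mult_right_mono)
  show "summable (\<lambda>k. Lp_norm 1 f * cmod z ^ k)"
    using z by (intro summable_mult summable_geometric) auto
qed

lemma disc_ext_diff_le: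
  assumes f: "f \<in> Lp 1" "g \<in> Lp 1" and z: "cmod z < 1"
  shows "cmod (disc_ext f z - disc_ext g z) \<le> Lp_norm 1 (f - g) / (1 - cmod z)"
proof -
  have s: "summable (\<lambda>k. fourier f (int k) * z ^ k)" "summable (\<lambda>k. fourier g (int k) * z ^ k)"
    using disc_ext_summable[OF f(1) z] disc_ext_summable[OF f(2) z] by (auto intro: summable_norm_cancel)
  have fg: "f - g \<in> Lp 1" using f by (simp add: Lp_diff)
  have "disc_ext f z - disc_ext g z = (\<Sum>k. fourier (f - g) (int k) * z ^ k)"
    unfolding disc_ext_def by (subst suminf_diff[OF s]) (simp add: fourier_diff f left_diff_distrib)
  also have "cmod \<dots> \<le> (\<Sum>k. cmod (fourier (f - g) (int k) * z ^ k))"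
    by (rule summable_norm[OF disc_ext_summable[OF fg z]])
  also have "\<dots> \<le> (\<Sum>k. Lp_norm 1 (f - g) * cmod z ^ k)"
    using z by (intro suminf_le disc_ext_summable[OF fg z] summable_mult summable_geometric)
      (auto simp: norm_mult norm_power intro!: mult_right_mono fourier_bound fg)
  also have "\<dots> = Lp_norm 1 (f - g) * (\<Sum>k. cmod z ^ k)"
    using z by (intro suminf_mult summable_geometric) auto
  also have "(\<Sum>k. cmod z ^ k) = 1 / (1 - cmod z)"
    using z by (intro suminf_geometric) auto
  finally show ?thesis by simp
qed

text \<open>Both sides are continuous in \<open>f\<close> and agree on powers of \<open>t\<close>,
  so they agree on the Hardy space. It serves for two functionals with geometric moments, the
  coefficients at -1 of \<open>J \<beta> f\<close> and of \<open>f * J \<beta> 1\<close>.\<close>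

lemma disc_ext_functional:
  assumes p: "1 < p" and z: "cmod z < 1" and f: "f \<in> Hp p"
    and add: "\<And>f g. f \<in> Lp p \<Longrightarrow> g \<in> Lp p \<Longrightarrow> L (f + g) = L f + L g"
    and sc: "\<And>c f. f \<in> Lp p \<Longrightarrow> L (scale c f) = c * L f"
    and bd: "\<And>f. f \<in> Lp p \<Longrightarrow> cmod (L f) \<le> K * Lp_norm p f"
    and pw: "\<And>k. L (tvar powi int k) = \<kappa> * z ^ k"
  shows "L f = \<kappa> * disc_ext f z"
proof -
  have L0: "L 0 = 0" using sc[of 0 0] by simp
  have Lsum: "L (sum F S) = (\<Sum>k\<in>S. L (F k))" if "\<And>k. k \<in> S \<Longrightarrow> F k \<in> Lp p" for F and S :: "int set"
    using that p by (induction S rule: infinite_finite_induct) (auto simp: L0 add Lp_sum)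
  obtain h where h: "\<And>n::nat. h n \<in> trig" "\<And>n. h n \<in> Hp p" "(\<lambda>n. Lp_norm p (h n - f)) \<longlonglongrightarrow> 0"
    using Hp_dense[OF p f] by blast
  have eq: "L (h n) = \<kappa> * disc_ext (h n) z" for n
  proof -
    obtain S where S: "finite S" "h n = (\<Sum>k\<in>S. scale (fourier (h n) k) (tvar powi k))"
      using trig_expand[OF h(1)] by blast
    have zero: "fourier (h n) k = 0" if "k \<notin> S" for k
    proof -
      have "fourier (h n) k = (\<Sum>j\<in>S. fourier (h n) j * (if k = j then 1 else 0))"
        by (subst S(2)) (simp add: fourier_sum Lp_scale Lp_tvar_powi fourier_scale fourier_tvar_powi)
      also have "\<dots> = 0" using that by (intro sum.neutral) auto
      finally show ?thesis .
    qed
    define S' where "S' = {k\<in>S. 0 \<le> k}"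
    have "L (h n) = (\<Sum>k\<in>S. fourier (h n) k * L (tvar powi k))"
      using p by (subst S(2)) (simp add: Lsum Lp_scale Lp_tvar_powi sc)
    also have "\<dots> = (\<Sum>k\<in>S'. fourier (h n) k * L (tvar powi k))"
      using S(1) h(2)[of n] by (intro sum.mono_neutral_right) (auto simp: S'_def Hp_def not_le)
    also have "\<dots> = (\<Sum>k\<in>S'. \<kappa> * (fourier (h n) k * z ^ nat k))"
    proof (rule sum.cong)
      fix k assume "k \<in> S'"
      then have "0 \<le> k" by (simp add: S'_def)
      then show "fourier (h n) k * L (tvar powi k) = \<kappa> * (fourier (h n) k * z ^ nat k)"
        using pw[of "nat k"] by (simp del: power_int_of_nat)
    qed simp
    also have "\<dots> = \<kappa> * (\<Sum>k\<in>S'. fourier (h n) k * z ^ nat k)"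
      by (simp add: sum_distrib_left)
    also have "(\<Sum>k\<in>S'. fourier (h n) k * z ^ nat k) = (\<Sum>j\<in>nat ` S'. fourier (h n) (int j) * z ^ j)"
      by (subst sum.reindex) (auto simp: S'_def inj_on_def intro!: sum.cong)
    also have "\<dots> = disc_ext (h n) z"
      unfolding disc_ext_def
    proof (rule suminf_finite[symmetric])
      show "finite (nat ` S')" using S(1) by (simp add: S'_def)
      fix j assume "j \<notin> nat ` S'"
      then have "int j \<notin> S" unfolding S'_def by force
      then show "fourier (h n) (int j) * z ^ j = 0" by (simp add: zero)
    qed
    finally show ?thesis .
  qed
  have hL: "h n \<in> Lp p" "f \<in> Lp p" for n using h(2)[of n] f by (auto intro: Hp_Lp)
  have "(\<lambda>n. L (h n)) \<longlonglongrightarrow> L f"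
  proof (rule LIM_zero_cancel, rule Lim_null_comparison[OF always_eventually tendsto_mult_right_zero[OF h(3), of K]], rule allI)
    fix n
    have d: "h n - f \<in> Lp p" using hL p by (intro Lp_diff) auto
    have "L (h n) - L f = L (h n - f)"
      using add[OF d hL(2)] by simp
    then show "norm (L (h n) - L f) \<le> K * Lp_norm p (h n - f)"
      using bd[OF d] by simp
  qed
  moreover have "(\<lambda>n. disc_ext (h n) z) \<longlonglongrightarrow> disc_ext f z"
  proof (rule LIM_zero_cancel, rule Lim_null_comparison[OF always_eventually tendsto_mult_right_zero[OF h(3), of "1 / (1 - cmod z)"]], rule allI)
    fix n
    have "cmod (disc_ext (h n) z - disc_ext f z) \<le> Lp_norm 1 (h n - f) / (1 - cmod z)"
      using hL p z by (intro disc_ext_diff_le Lp_subset_L1(1)[of p])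
    also have "\<dots> \<le> Lp_norm p (h n - f) / (1 - cmod z)"
      using hL p z by (intro divide_right_mono Lp_subset_L1(2)) (auto intro: Lp_diff)
    finally show "norm (disc_ext (h n) z - disc_ext f z) \<le> 1 / (1 - cmod z) * Lp_norm p (h n - f)"
      by simp
  qed
  then have "(\<lambda>n. \<kappa> * disc_ext (h n) z) \<longlonglongrightarrow> \<kappa> * disc_ext f z"
    by (rule tendsto_mult_left)
  ultimately show ?thesis
    unfolding eq using LIMSEQ_unique by blast
qed

text \<open>The highest coefficient of \<open>J \<beta> f\<close> is, apart from the power of
  \<open>lam \<beta> / cnj \<beta>\<close> involved, the point evaluation used in the signature;
  this is the only access to the signature in the case of index 1.\<close>

lemma fourier_J_minus_1:
  assumes \<beta>: "1 < cmod \<beta>" and p: "1 < p" and f: "f \<in> Hp p"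
  shows "fourier (J \<beta> f) (- 1) = lam \<beta> / cnj \<beta> * disc_ext f (1 / cnj \<beta>)"
proof (rule J_Lp_bounded[OF \<beta>, of p], goal_cases)
  case (2 D)
  have J1: "J \<beta> f \<in> Lp 1" if "f \<in> Lp p" for f
    using Lp_subset_L1(1)[OF p 2(2)[OF that]] .
  show ?case
  proof (rule disc_ext_functional[where K=D, OF p _ f])
    show "cmod (1 / cnj \<beta>) < 1" using inverse_beta_less[OF \<beta>] by (simp add: norm_divide)
    show "fourier (J \<beta> (f + g)) (- 1) = fourier (J \<beta> f) (- 1) + fourier (J \<beta> g) (- 1)" if "f \<in> Lp p" "g \<in> Lp p" for f g
      using J1 that by (simp add: J_add[OF \<beta>] fourier_add)
    show "fourier (J \<beta> (scale c f)) (- 1) = c * fourier (J \<beta> f) (- 1)" for c f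
      by (simp add: J_scale[OF \<beta>] fourier_scale)
    show "cmod (fourier (J \<beta> f) (- 1)) \<le> D * Lp_norm p f" if f: "f \<in> Lp p" for f
      using fourier_bound_Lp[OF p 2(2)[OF f], of "- 1"] 2(3)[OF f] by linarith
    show "fourier (J \<beta> (tvar powi int k)) (- 1) = lam \<beta> / cnj \<beta> * (1 / cnj \<beta>) ^ k" for k
      using fourier_J_nonneg[OF \<beta>, of "int k" "- 1"] by (simp del: power_int_of_nat)
  qed
qed (use p in simp)

text \<open>\<open>J \<beta> 1\<close> is the function
  \<open>lam \<beta> / (cnj \<beta> * t - 1)\<close>, whose expansion on the circle is a geometric
  series in \<open>1 / (cnj \<beta> * t)\<close>.\<close>

lemma fourier_J_one:
  assumes \<beta>: "1 < cmod \<beta>"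
  shows "fourier (J \<beta> 1) (- 1 - int k) = lam \<beta> / cnj \<beta> * (1 / cnj \<beta>) ^ k"
proof -
  have b: "cnj \<beta> \<noteq> 0" using beta_nonzero[OF \<beta>] by simp
  have v1: "AE t in circle. val 1 (alpha \<beta> t) = 1"
    by (rule AE_alpha[OF \<beta> val_1]) measurable
  have "fourier (J \<beta> 1) (- 1 - int k) = (LINT t|circle. (lam \<beta> / cnj \<beta> * t ^ k) * t / (t - 1 / cnj \<beta>))"
    unfolding fourier_val
  proof (intro integral_cong_AE)
    show "AE t in circle. val (J \<beta> 1) t * t powi - (- 1 - int k) = (lam \<beta> / cnj \<beta> * t ^ k) * t / (t - 1 / cnj \<beta>)"
      using val_J[of \<beta> 1] v1 AE_circle_norm
    proof eventually_elim
      case (elim t)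
      have "t powi - (- 1 - int k) = t ^ k * t"
      proof -
        have "- (- 1 - int k) = int (Suc k)" by simp
        then show ?thesis by (simp only: power_int_of_nat) simp
      qed
      moreover have "t - 1 / cnj \<beta> = (cnj \<beta> * t - 1) / cnj \<beta>"
        using b by (simp add: diff_divide_distrib)
      ultimately show ?case using elim(1,2) b by simp
    qed
  qed measurable
  also have "\<dots> = lam \<beta> / cnj \<beta> * (1 / cnj \<beta>) ^ k"
    using inverse_beta_less[OF \<beta>]
    by (intro circle_Cauchy[where F="\<lambda>t. lam \<beta> / cnj \<beta> * t ^ k"])
      (auto simp: norm_divide beta_nonzero[OF \<beta>] intro!: continuous_intros holomorphic_intros)
  finally show ?thesis .
qed

section \<open>Products of Hardy space functions with conjugate exponents\<close>

lemma fourier_mult_tendsto: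
  assumes p: "1 < p" and h: "\<And>n. h n \<in> Lp p" "f \<in> Lp p" "(\<lambda>n. Lp_norm p (h n - f)) \<longlonglongrightarrow> 0"
    and g: "g \<in> Lp (conj_exp p)"
  shows "(\<lambda>n. fourier (h n * g) k) \<longlonglongrightarrow> fourier (f * g) k"
proof (rule LIM_zero_cancel, rule Lim_null_comparison[OF always_eventually tendsto_mult_left_zero[OF h(3), of "Lp_norm (conj_exp p) g"]], rule allI)
  fix n
  have d: "h n - f \<in> Lp p" using h p by (intro Lp_diff) auto
  have "fourier (h n * g) k - fourier (f * g) k = fourier ((h n - f) * g) k"
    using Lp_mult(1)[OF p h(1) g] Lp_mult(1)[OF p h(2) g] by (simp add: left_diff_distrib fourier_diff)
  also have "cmod \<dots> \<le> Lp_norm 1 ((h n - f) * g)"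
    by (intro fourier_bound Lp_mult(1)[OF p d g])
  also have "\<dots> \<le> Lp_norm p (h n - f) * Lp_norm (conj_exp p) g"
    by (rule Lp_mult(2)[OF p d g])
  finally show "norm (fourier (h n * g) k - fourier (f * g) k) \<le> Lp_norm p (h n - f) * Lp_norm (conj_exp p) g" .
qed

lemma Hp_mult_fourier_neg:
  assumes p: "1 < p" and f: "f \<in> Hp p" and g: "g \<in> Hp (conj_exp p)" and n: "n < 0"
  shows "fourier (f * g) n = 0"
proof -
  obtain h where h: "\<And>n::nat. h n \<in> trig" "\<And>n. h n \<in> Hp p" "(\<lambda>n. Lp_norm p (h n - f)) \<longlonglongrightarrow> 0"
    using Hp_dense[OF p f] by blast
  have g1: "g \<in> Lp 1" using Lp_subset_L1(1)[OF conj_exp(1)[OF p] Hp_Lp[OF g]] .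
  have "fourier (h m * g) n = 0" for m
    unfolding mult.commute[of "h m"]
  proof (rule fourier_mult_zero_trig[OF g1 h(1)])
    fix k
    show "fourier (h m) k = 0 \<or> fourier g (n - k) = 0"
      using h(2)[of m] g n by (cases "k < 0") (auto simp: Hp_def)
  qed
  then show ?thesis
    using fourier_mult_tendsto[OF p Hp_Lp[OF h(2)] Hp_Lp[OF f] h(3) Hp_Lp[OF g], of n]
    by (simp add: LIMSEQ_const_iff)
qed

text \<open>Frequencies in both factors are at most -1, hence at most -2 in the product; so the
  coefficient at -1 vanishes as well.\<close>

lemma Hm_mult_fourier_nonneg:
  assumes p: "1 < p" and f: "f \<in> Hm p" and g: "g \<in> Hm (conj_exp p)" and n: "- 1 \<le> n"
  shows "fourier (f * g) n = 0"
proof -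
  obtain h where h: "\<And>n::nat. h n \<in> trig" "\<And>n. h n \<in> Hm p" "(\<lambda>n. Lp_norm p (h n - f)) \<longlonglongrightarrow> 0"
    using Hm_dense[OF p f] by blast
  have g1: "g \<in> Lp 1" using Lp_subset_L1(1)[OF conj_exp(1)[OF p] Hm_Lp[OF g]] .
  have "fourier (h m * g) n = 0" for m
    unfolding mult.commute[of "h m"]
  proof (rule fourier_mult_zero_trig[OF g1 h(1)])
    fix k
    show "fourier (h m) k = 0 \<or> fourier g (n - k) = 0"
      using h(2)[of m] g n by (cases "k < 0") (auto simp: Hm_def)
  qed
  then show ?thesis
    using fourier_mult_tendsto[OF p Hm_Lp[OF h(2)] Hm_Lp[OF f] h(3) Hm_Lp[OF g], of n]
    by (simp add: LIMSEQ_const_iff)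
qed

lemma Hp_mult_fourier:
  assumes p: "1 < p" and f: "f \<in> Hp p" and g: "g \<in> Hp (conj_exp p)"
  shows "fourier (f * g) (int n) = (\<Sum>k\<le>n. fourier f (int k) * fourier g (int (n - k)))"
proof -
  define s where "s = (\<Sum>k\<le>n. scale (fourier f (int k)) (tvar powi (int k)))"
  have sH: "s \<in> Hp p"
    unfolding s_def using p by (intro circle_fun.subspace_sum subspace_Hp Hp_scale Hp_tvar_powi) auto
  have fs: "fourier s m = (if 0 \<le> m \<and> m \<le> int n then fourier f m else 0)" for m
  proof -
    have "fourier s m = (\<Sum>k\<le>n. fourier f (int k) * (if m = int k then 1 else 0))"
      unfolding s_def
      by (simp add: fourier_sum Lp_scale Lp_tvar_powi fourier_scale fourier_tvar_powi del: power_int_of_nat)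
    also have "\<dots> = (\<Sum>k\<le>n. if k = nat m \<and> 0 \<le> m then fourier f m else 0)"
      by (intro sum.cong) auto
    also have "\<dots> = (if 0 \<le> m \<and> m \<le> int n then fourier f m else 0)"
      by (cases "0 \<le> m") (auto simp: sum.delta nat_le_iff)
    finally show ?thesis .
  qed
  \<comment> \<open>\<open>f\<close> is its Taylor polynomial \<open>s\<close> of degree
    \<open>n\<close> plus \<open>t^(n+1) r\<close> with \<open>r\<close> in the Hardy space, and the
    second summand does not reach the coefficient at \<open>n\<close>.\<close>
  define r where "r = tvar powi (- int (Suc n)) * (f - s)"
  have fsL: "f - s \<in> Hp p" using f sH p by (intro Hp_diff) auto
  have rH: "r \<in> Hp p"
    using f sH p fsL by (auto simp: Hp_def r_def Lp_tvar_powi_mult fourier_shift fourier_diff Lp_subset_L1 fs)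
  have q: "1 < conj_exp p" using conj_exp[OF p] by simp
  have g1: "g \<in> Lp 1" using Lp_subset_L1(1)[OF q Hp_Lp[OF g]] .
  have tr: "tvar powi (int (Suc n)) * r = f - s"
    unfolding r_def mult.assoc[symmetric] tvar_powi_add[symmetric] by simp
  have "f * g = tvar powi (int (Suc n)) * (r * g) + s * g"
    unfolding mult.assoc[symmetric] tr by (simp add: left_diff_distrib)
  moreover have "fourier (tvar powi (int (Suc n)) * (r * g)) (int n) = 0"
    using Hp_mult_fourier_neg[OF p rH g, of "- 1"] by (simp add: fourier_shift)
  moreover have "fourier (s * g) (int n) = (\<Sum>k\<le>n. fourier f (int k) * fourier g (int (n - k)))"
  proof -
    have "s * g = (\<Sum>k\<le>n. scale (fourier f (int k)) (tvar powi (int k) * g))"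
      by (simp add: s_def sum_distrib_right scale_eq_times)
    then have "fourier (s * g) (int n) = (\<Sum>k\<le>n. fourier f (int k) * fourier g (int n - int k))"
      using g1 by (simp only: fourier_sum Lp_scale Lp_tvar_powi_mult fourier_scale fourier_shift)
    then show ?thesis by (simp add: of_nat_diff)
  qed
  moreover have "tvar powi (int (Suc n)) * (r * g) \<in> Lp 1" "s * g \<in> Lp 1"
    using Lp_mult(1)[OF p Hp_Lp[OF rH] Hp_Lp[OF g]] Lp_mult(1)[OF p Hp_Lp[OF sH] Hp_Lp[OF g]]
    by (simp_all only: Lp_tvar_powi_mult)
  ultimately show ?thesis by (simp add: fourier_add)
qed

lemma disc_ext_mult:
  assumes p: "1 < p" and f: "f \<in> Hp p" and g: "g \<in> Hp (conj_exp p)" and z: "cmod z < 1"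
  shows "disc_ext (f * g) z = disc_ext f z * disc_ext g z"
proof -
  have f1: "f \<in> Lp 1" using Lp_subset_L1(1)[OF p Hp_Lp[OF f]] .
  have g1: "g \<in> Lp 1" using Lp_subset_L1(1)[OF conj_exp(1)[OF p] Hp_Lp[OF g]] .
  have "disc_ext f z * disc_ext g z = (\<Sum>n. \<Sum>k\<le>n. (fourier f (int k) * z ^ k) * (fourier g (int (n - k)) * z ^ (n - k)))"
    unfolding disc_ext_def by (rule Cauchy_product[OF disc_ext_summable[OF f1 z] disc_ext_summable[OF g1 z]])
  also have "\<dots> = disc_ext (f * g) z"
    unfolding disc_ext_def
  proof (rule arg_cong[of _ _ suminf], rule ext)
    fix n
    have "(\<Sum>k\<le>n. fourier f (int k) * z ^ k * (fourier g (int (n - k)) * z ^ (n - k)))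
        = (\<Sum>k\<le>n. fourier f (int k) * fourier g (int (n - k)) * z ^ n)"
    proof (rule sum.cong)
      fix k assume "k \<in> {..n}"
      then have "z ^ n = z ^ k * z ^ (n - k)" by (simp flip: power_add)
      then show "fourier f (int k) * z ^ k * (fourier g (int (n - k)) * z ^ (n - k)) = fourier f (int k) * fourier g (int (n - k)) * z ^ n"
        by simp
    qed simp
    then show "(\<Sum>k\<le>n. fourier f (int k) * z ^ k * (fourier g (int (n - k)) * z ^ (n - k))) = fourier (f * g) (int n) * z ^ n"
      by (simp add: Hp_mult_fourier[OF p f g] sum_distrib_right)
  qed
  finally show ?thesis ..
qed

lemma disc_ext_1: "disc_ext 1 z = 1"
proof -
  have "fourier 1 (int k) = (if k = 0 then 1 else 0)" for k
    using fourier_tvar_powi[of 0 "int k"] by simp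
  then have "disc_ext 1 z = (\<Sum>k. if k = 0 then 1 else 0)"
    unfolding disc_ext_def by (intro arg_cong[of _ _ suminf] ext) auto
  also have "\<dots> = (1 :: complex)"
    using suminf_finite[of "{0}" "\<lambda>k. if k = 0 then 1 else (0 :: complex)"] by simp
  finally show ?thesis .
qed

lemma Hp_bar_iff_Hm: "f \<in> Hp_bar p \<longleftrightarrow> tvar powi (- 1) * f \<in> Hm p"
proof -
  have "(\<forall>n>0. fourier f n = 0) \<longleftrightarrow> (\<forall>n\<ge>0. fourier f (n + 1) = 0)"
    by (metis add.commute add_le_same_cancel1 diff_add_cancel int_one_le_iff_zero_less le_add_same_cancel1 zle_diff1_eq zless_imp_add1_zle)
  then show ?thesis
    by (simp add: Hp_bar_def Hm_def Lp_tvar_powi_mult fourier_shift del: power_int_minus1_right)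
qed

lemma Hp_bar_mult_fourier:
  assumes p: "1 < p" and f: "f \<in> Hp_bar p" and g: "g \<in> Hp_bar (conj_exp p)"
  shows "0 < n \<Longrightarrow> fourier (f * g) n = 0" "fourier (f * g) 0 = fourier f 0 * fourier g 0"
proof -
  have q: "1 < conj_exp p" using conj_exp[OF p] by simp
  have L: "f \<in> Lp p" "g \<in> Lp (conj_exp p)" "f \<in> Lp 1" "g \<in> Lp 1"
    using f g p q Lp_subset_L1(1) by (auto simp: Hp_bar_def)
  have f': "tvar powi (- 1) * f \<in> Hm p" and g': "tvar powi (- 1) * g \<in> Hm (conj_exp p)"
    using f g by (simp_all only: Hp_bar_iff_Hm)
  show "fourier (f * g) n = 0" if n: "0 < n"
  proof -
    \<comment> \<open>Each factor is moved into \<open>Hm\<close> by \<open>t^-1\<close>, so the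
      coefficient at \<open>n\<close> is read off at \<open>n - 2\<close>, which is at least
      -1.\<close>
    have "fourier ((tvar powi (- 1) * f) * (tvar powi (- 1) * g)) (n - 2) = 0"
      using n by (intro Hm_mult_fourier_nonneg[OF p f' g']) auto
    also have "(tvar powi (- 1) * f) * (tvar powi (- 1) * g) = tvar powi (- 1 + - 1) * (f * g)"
      unfolding tvar_powi_add by (simp add: mult_ac del: power_int_minus1_right)
    finally show ?thesis by (simp add: fourier_shift)
  qed
  define f0 where "f0 = f - scale (fourier f 0) 1"
  have one: "fourier 1 n = (if n = 0 then 1 else 0)" for n
    using fourier_tvar_powi[of 0 n] by simp
  have f0: "f0 \<in> Hm p"
    using f L p one_Linf by (auto simp: f0_def Hm_def Hp_bar_def fourier_diff Lp_diff Lp_scale Linf_Lp fourier_scale one)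
  have "fourier (f0 * (tvar powi (- 1) * g)) (- 1) = 0"
    by (intro Hm_mult_fourier_nonneg[OF p f0 g']) auto
  then have z: "fourier (f0 * g) 0 = 0"
    using fourier_shift[of "- 1" "f0 * g" "- 1"] by (simp add: mult.left_commute)
  have "f * g = f0 * g + scale (fourier f 0) g"
    by (simp add: f0_def left_diff_distrib scale_eq_times)
  moreover have "f0 * g \<in> Lp 1" using Lp_mult(1)[OF p Hm_Lp[OF f0] L(2)] .
  ultimately show "fourier (f * g) 0 = fourier f 0 * fourier g 0"
    using z L by (simp add: fourier_add Lp_scale fourier_scale)
qed


lemma fourier_mult_J_one:
  assumes \<beta>: "1 < cmod \<beta>" and p: "1 < p" and f: "f \<in> Hp p"
  shows "fourier (f * J \<beta> 1) (- 1) = lam \<beta> / cnj \<beta> * disc_ext f (1 / cnj \<beta>)"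
proof -
  have q: "1 < conj_exp p" using conj_exp[OF p] by simp
  have JL: "J \<beta> 1 \<in> Lp (conj_exp p)" using q by (intro J_Lp[OF \<beta>] Linf_Lp one_Linf) auto
  show ?thesis
  proof (rule disc_ext_functional[where K="Lp_norm (conj_exp p) (J \<beta> 1)", OF p _ f])
    show "cmod (1 / cnj \<beta>) < 1" using inverse_beta_less[OF \<beta>] by (simp add: norm_divide)
    show "fourier ((f + g) * J \<beta> 1) (- 1) = fourier (f * J \<beta> 1) (- 1) + fourier (g * J \<beta> 1) (- 1)" if "f \<in> Lp p" "g \<in> Lp p" for f g
      using Lp_mult(1)[OF p that(1) JL] Lp_mult(1)[OF p that(2) JL] by (simp add: distrib_right fourier_add)
    show "fourier (scale c f * J \<beta> 1) (- 1) = c * fourier (f * J \<beta> 1) (- 1)" for c f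
      by (simp add: scale_eq_times fourier_scale)
    show "cmod (fourier (f * J \<beta> 1) (- 1)) \<le> Lp_norm (conj_exp p) (J \<beta> 1) * Lp_norm p f" if f: "f \<in> Lp p" for f
      using fourier_bound[OF Lp_mult(1)[OF p f JL], of "- 1"] Lp_mult(2)[OF p f JL] by (simp add: mult.commute)
    show "fourier (tvar powi int k * J \<beta> 1) (- 1) = lam \<beta> / cnj \<beta> * (1 / cnj \<beta>) ^ k" for k
      using fourier_J_one[OF \<beta>, of k] by (simp only: fourier_shift)
  qed
qed

subsection \<open>Operators on Hardy spaces\<close>

lemma Hp_closed:
  assumes p: "1 < p" and F: "\<And>n. F n \<in> Hp p" and f: "f \<in> Lp p" "(\<lambda>n. Lp_norm p (F n - f)) \<longlonglongrightarrow> 0"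
  shows "f \<in> Hp p"
proof -
  have "fourier f k = 0" if "k < 0" for k
    using fourier_tendsto[OF p Hp_Lp[OF F] f, of k] F that by (simp add: Hp_def LIMSEQ_const_iff)
  with f(1) show ?thesis by (simp add: Hp_def)
qed

lemma Hp_complete:
  assumes p: "1 < p" and F: "\<And>n::nat. F n \<in> Hp p"
    and cauchy: "\<And>e. 0 < e \<Longrightarrow> \<exists>N. \<forall>m\<ge>N. \<forall>n\<ge>N. Lp_norm p (F m - F n) < e"
  shows "\<exists>f\<in>Hp p. (\<lambda>n. Lp_norm p (F n - f)) \<longlonglongrightarrow> 0"
proof -
  obtain f where f: "f \<in> Lp p" "(\<lambda>n. Lp_norm p (F n - f)) \<longlonglongrightarrow> 0"
    using Lp_complete[OF p Hp_Lp[OF F] cauchy] by blast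
  with Hp_closed[OF p F f] show ?thesis by blast
qed

lemma Metric_space_Hp:
  assumes p: "1 < p"
  shows "Metric_space (Hp p) (\<lambda>f g. Lp_norm p (f - g))"
proof
  show "Lp_norm p (f - g) = Lp_norm p (g - f)" for f g
    using p by (intro Lp_norm_minus_commute) simp
  show "Lp_norm p (f - g) = 0 \<longleftrightarrow> f = g" if "f \<in> Hp p" "g \<in> Hp p" for f g
    using Lp_norm_eq_0[of "f - g" p] that p by (auto simp: Lp_diff Hp_Lp)
  show "Lp_norm p (f - h) \<le> Lp_norm p (f - g) + Lp_norm p (g - h)" if "f \<in> Hp p" "g \<in> Hp p" "h \<in> Hp p" for f g h
    using that p by (intro Lp_norm_triangle_mid Hp_Lp) auto
qed simp

lemma mcomplete_Hp:
  assumes p: "1 < p"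
  shows "Metric_space.mcomplete (Hp p) (\<lambda>f g. Lp_norm p (f - g))"
proof -
  interpret M: Metric_space "Hp p" "\<lambda>f g. Lp_norm p (f - g)" by (rule Metric_space_Hp[OF p])
  show ?thesis
    unfolding M.mcomplete_def
  proof (intro allI impI)
    fix F :: "nat \<Rightarrow> circle_fun" assume "M.MCauchy F"
    then have F: "F n \<in> Hp p" and c: "0 < e \<Longrightarrow> \<exists>N. \<forall>m n. N \<le> m \<longrightarrow> N \<le> n \<longrightarrow> Lp_norm p (F m - F n) < e" for n e
      by (auto simp: M.MCauchy_def)
    have "\<exists>f\<in>Hp p. (\<lambda>n. Lp_norm p (F n - f)) \<longlonglongrightarrow> 0"
    proof (rule Hp_complete[OF p F])
      fix e :: real assume "0 < e"
      from c[OF this] show "\<exists>N. \<forall>m\<ge>N. \<forall>n\<ge>N. Lp_norm p (F m - F n) < e" by blast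
    qed
    then obtain f where f: "f \<in> Hp p" "(\<lambda>n. Lp_norm p (F n - f)) \<longlonglongrightarrow> 0" by blast
    have "\<exists>N. \<forall>n\<ge>N. F n \<in> Hp p \<and> Lp_norm p (F n - f) < e" if e: "0 < e" for e
    proof -
      have "\<forall>\<^sub>F n in sequentially. Lp_norm p (F n - f) < e"
        using f(2) e by (intro order_tendstoD(2)) auto
      then show ?thesis using F by (auto simp: eventually_sequentially)
    qed
    then show "\<exists>x. limitin M.mtopology F x sequentially"
      using f(1) by (intro exI[of _ f]) (auto simp: M.limit_metric_sequentially)
  qed
qed

text \<open>Baire's theorem gives a ball in the closure of the image of some bounded set.
  Differences of approximate preimages then solve \<open>T x = y\<close> up to an error of half the
  norm of \<open>y\<close>, and iteration with completeness removes the error.\<close>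

theorem open_mapping_Hp:
  assumes p: "1 < p"
    and TH: "\<And>f. f \<in> Hp p \<Longrightarrow> T f \<in> Hp p"
    and Tadd: "\<And>f g. f \<in> Hp p \<Longrightarrow> g \<in> Hp p \<Longrightarrow> T (f + g) = T f + T g"
    and Tscale: "\<And>c f. f \<in> Hp p \<Longrightarrow> T (scale c f) = scale c (T f)"
    and Tbd: "\<And>f. f \<in> Hp p \<Longrightarrow> Lp_norm p (T f) \<le> K * Lp_norm p f"
    and surj: "\<And>g. g \<in> Hp p \<Longrightarrow> \<exists>f\<in>Hp p. T f = g"
  obtains C where "0 \<le> C" "\<And>g. g \<in> Hp p \<Longrightarrow> \<exists>f\<in>Hp p. T f = g \<and> Lp_norm p f \<le> C * Lp_norm p g"
proof -
  have p1: "1 \<le> p" "0 \<le> p" using p by auto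
  interpret M: Metric_space "Hp p" "\<lambda>f g. Lp_norm p (f - g)" by (rule Metric_space_Hp[OF p])
  have Tdiff: "T (f - g) = T f - T g" if "f \<in> Hp p" "g \<in> Hp p" for f g
  proof -
    have "T (f + scale (- 1) g) = T f + scale (- 1) (T g)"
      using that p1 by (simp only: Tadd Tscale Hp_scale)
    then show ?thesis by (simp flip: uminus_eq_scale)
  qed
  define A where "A n = T ` {f \<in> Hp p. Lp_norm p f \<le> real n}" for n :: nat
  define cl where "cl n = M.mtopology closure_of (A n)" for n
  have AH: "A n \<subseteq> Hp p" for n using TH by (auto simp: A_def)
  have "\<Union>(range cl) = Hp p"
  proof
    show "\<Union>(range cl) \<subseteq> Hp p" unfolding cl_def M.metric_closure_of by auto
    show "Hp p \<subseteq> \<Union>(range cl)"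
    proof
      fix g assume g: "g \<in> Hp p"
      then obtain f where f: "f \<in> Hp p" "T f = g" using surj by blast
      obtain n :: nat where "Lp_norm p f \<le> real n" using real_arch_simple by blast
      then have "g \<in> A n" using f by (auto simp: A_def)
      moreover have "A n \<subseteq> cl n" unfolding cl_def by (rule closure_of_subset) (simp add: AH)
      ultimately show "g \<in> \<Union>(range cl)" by blast
    qed
  qed
  then have "M.mtopology interior_of \<Union>(range cl) = Hp p"
    using interior_of_topspace[of M.mtopology] by simp
  then have "M.mtopology interior_of \<Union>(range cl) \<noteq> {}" using Hp_0 by blast
  have "\<exists>n. M.mtopology interior_of (cl n) \<noteq> {}"
  proof (rule ccontr)
    assume no: "\<nexists>n. M.mtopology interior_of (cl n) \<noteq> {}"
    have "M.mtopology interior_of \<Union>(range cl) = {}"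
    proof (rule M.metric_Baire_category_alt[OF mcomplete_Hp[OF p]])
      fix T assume "T \<in> range cl"
      then obtain n where n: "T = cl n" by blast
      then have "M.mtopology interior_of T = {}" using no by blast
      moreover have "closedin M.mtopology T" unfolding n cl_def by (rule closedin_closure_of)
      ultimately show "closedin M.mtopology T \<and> M.mtopology interior_of T = {}" by blast
    qed simp
    with \<open>M.mtopology interior_of \<Union>(range cl) \<noteq> {}\<close> show False by blast
  qed
  then obtain n y0 where y0: "y0 \<in> M.mtopology interior_of (cl n)" by blast
  have "openin M.mtopology (M.mtopology interior_of (cl n))" by (rule openin_interior_of)
  then have "\<exists>r>0. M.mball y0 r \<subseteq> M.mtopology interior_of (cl n)"
    using y0 unfolding M.openin_mtopology by blast
  then obtain r where r: "0 < r" "M.mball y0 r \<subseteq> M.mtopology interior_of (cl n)"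
    by blast
  then have ball: "M.mball y0 r \<subseteq> cl n" using interior_of_subset[of M.mtopology "cl n"] by blast
  have y0H: "y0 \<in> Hp p" using y0 interior_of_subset[of M.mtopology "cl n"] unfolding cl_def M.metric_closure_of by blast
  have near: "\<exists>a\<in>Hp p. Lp_norm p a \<le> real n \<and> Lp_norm p (w - T a) < e" if "w \<in> cl n" "0 < e" for w e
    using that unfolding cl_def M.metric_closure_of A_def by auto
  \<comment> \<open>Two preimages of norm at most \<open>n\<close> are subtracted and rescaled by
    \<open>1 / s = 2 * N / r\<close>, which gives \<open>4 * n / r\<close> times the norm of
    \<open>y\<close>.\<close>
  define k where "k = 4 * real n / r"
  have k0: "0 \<le> k" using r by (simp add: k_def)
  have step: "\<exists>x\<in>Hp p. Lp_norm p x \<le> k * Lp_norm p y \<and> Lp_norm p (y - T x) \<le> Lp_norm p y / 2" if y: "y \<in> Hp p" for y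
  proof (cases "Lp_norm p y = 0")
    case True
    then have "y = 0" using y by (intro Lp_norm_eq_0[of _ p] Hp_Lp)
    moreover have "T 0 = 0" using Tscale[OF Hp_0, of 0] by simp
    ultimately show ?thesis using Hp_0 by (intro bexI[of _ 0]) auto
  next
    case False
    define N where "N = Lp_norm p y"
    have N: "0 < N" using False by (simp add: N_def order_less_le)
    \<comment> \<open>Rescales \<open>y\<close> to norm \<open>r / 2\<close>, so that
      \<open>y0 + y'\<close> stays in the ball. Approximating it and \<open>y0\<close> up to
      \<open>r / 8\<close> leaves an error of \<open>r / 4\<close> for \<open>y'\<close>, half of
      its norm.\<close>
    define s where "s = r / (2 * N)"
    have s: "0 < s" using r N by (simp add: s_def)
    define y' where "y' = scale (of_real s) y"
    have y'H: "y' \<in> Hp p" unfolding y'_def using y p1 by (intro Hp_scale) auto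
    have y'n: "Lp_norm p y' = r / 2" using s N p1 by (simp add: y'_def Lp_norm_scale N_def[symmetric]) (simp add: s_def)
    have "y0 + y' \<in> M.mball y0 r"
      using y0H y'H r p1 by (simp add: Hp_add y'n Lp_norm_uminus)
    then have "y0 + y' \<in> cl n" using ball by blast
    from near[OF this, of "r / 8"] obtain a where a: "a \<in> Hp p" "Lp_norm p a \<le> real n" "Lp_norm p (y0 + y' - T a) < r / 8"
      using r by auto
    have "y0 \<in> M.mball y0 r" using y0H r by simp
    then have "y0 \<in> cl n" using ball by blast
    from near[OF this, of "r / 8"] obtain b where b: "b \<in> Hp p" "Lp_norm p b \<le> real n" "Lp_norm p (y0 - T b) < r / 8"
      using r by auto
    define x where "x = scale (of_real (1 / s)) (a - b)"
    have abH: "a - b \<in> Hp p" using a b p1 by (intro Hp_diff) auto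
    have xH: "x \<in> Hp p" unfolding x_def using abH p1 by (intro Hp_scale) auto
    have "Lp_norm p (a - b) \<le> Lp_norm p a + Lp_norm p b"
      using a b p1 by (intro Lp_norm_triangle_diff Hp_Lp)
    then have "Lp_norm p (a - b) \<le> 2 * real n" using a b by linarith
    then have "Lp_norm p x \<le> 1 / s * (2 * real n)"
      using s p1 by (simp add: x_def Lp_norm_scale norm_divide divide_right_mono)
    also have "\<dots> = k * N" using r N by (simp add: s_def k_def)
    finally have 1: "Lp_norm p x \<le> k * Lp_norm p y" by (simp add: N_def)
    have eq: "y' - T (a - b) = (y0 + y' - T a) - (y0 - T b)"
      using a b by (simp add: Tdiff)
    have "Lp_norm p ((y0 + y' - T a) - (y0 - T b)) \<le> Lp_norm p (y0 + y' - T a) + Lp_norm p (y0 - T b)"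
      using a b y0H y'H TH p1 by (intro Lp_norm_triangle_diff Hp_Lp Hp_diff Hp_add) auto
    then have 2: "Lp_norm p (y' - T (a - b)) \<le> r / 4" unfolding eq using a(3) b(3) by linarith
    have Tx: "T x = scale (of_real (1 / s)) (T (a - b))"
      unfolding x_def by (rule Tscale[OF abH])
    have "scale (of_real (1 / s)) y' = y"
      using s by (simp add: y'_def)
    then have "y - T x = scale (of_real (1 / s)) (y' - T (a - b))"
      unfolding Tx circle_fun.scale_right_diff_distrib by simp
    then have "Lp_norm p (y - T x) = 1 / s * Lp_norm p (y' - T (a - b))"
      using s p1 by (simp add: Lp_norm_scale norm_divide)
    also have "\<dots> \<le> 1 / s * (r / 4)" using s 2 by (intro mult_left_mono) auto
    also have "\<dots> = Lp_norm p y / 2" using r N by (simp add: s_def N_def)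
    finally show ?thesis using 1 xH by blast
  qed
  then obtain X where X: "\<And>y. y \<in> Hp p \<Longrightarrow> X y \<in> Hp p"
      "\<And>y. y \<in> Hp p \<Longrightarrow> Lp_norm p (X y) \<le> k * Lp_norm p y"
      "\<And>y. y \<in> Hp p \<Longrightarrow> Lp_norm p (y - T (X y)) \<le> Lp_norm p y / 2"
    by metis
  have "\<exists>f\<in>Hp p. T f = y \<and> Lp_norm p f \<le> 2 * k * Lp_norm p y" if y: "y \<in> Hp p" for y
  proof -
    \<comment> \<open>The successive residuals. They at least halve in norm, so the corrections are
      dominated by a geometric series and their sum by \<open>2 * k\<close> times the norm of
      \<open>y\<close>.\<close>
    define Y where "Y = rec_nat y (\<lambda>_ z. z - T (X z))"
    have Y: "Y 0 = y" "Y (Suc j) = Y j - T (X (Y j))" for j by (simp_all add: Y_def)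
    have YH: "Y j \<in> Hp p" for j
      by (induction j) (auto simp: Y y intro!: Hp_diff TH X p1)
    define N where "N = Lp_norm p y"
    have Yn: "Lp_norm p (Y j) \<le> N * (1 / 2) ^ j" for j
    proof (induction j)
      case (Suc j)
      have "Lp_norm p (Y (Suc j)) \<le> Lp_norm p (Y j) / 2" unfolding Y by (rule X(3)[OF YH])
      with Suc show ?case by simp
    qed (simp add: Y N_def)
    define S where "S m = (\<Sum>j<m. X (Y j))" for m
    have XH: "X (Y j) \<in> Hp p" for j by (rule X(1)[OF YH])
    have SH: "S m \<in> Hp p" for m
      unfolding S_def by (intro circle_fun.subspace_sum subspace_Hp p1 XH)
    have TS: "T (S m) = y - Y m" for m
    proof (induction m)
      case 0
      have "T 0 = 0" using Tscale[OF Hp_0, of 0] by simp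
      then show ?case by (simp add: S_def Y)
    next
      case (Suc m)
      have "T (S (Suc m)) = T (S m) + T (X (Y m))"
        unfolding S_def sum.lessThan_Suc using SH[of m] XH by (intro Tadd) (auto simp: S_def)
      with Suc show ?case by (simp add: Y)
    qed
    have Xn: "Lp_norm p (X (Y j)) \<le> k * N * (1 / 2) ^ j" for j
      using X(2)[OF YH, of j] mult_left_mono[OF Yn k0, of j] by simp
    have kN: "0 \<le> k * N" using k0 by (simp add: N_def)
    have Sdiff: "Lp_norm p (S m - S l) \<le> 2 * (k * N) * (1 / 2) ^ l" if "l \<le> m" for l m
    proof -
      have "S m - S l = (\<Sum>j\<in>{l..<m}. X (Y j))"
        unfolding S_def using that by (simp add: sum_diff_nat_ivl lessThan_atLeast0)
      then have "Lp_norm p (S m - S l) \<le> (\<Sum>j\<in>{l..<m}. Lp_norm p (X (Y j)))"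
        using p1 XH by (auto intro!: Lp_norm_sum Hp_Lp)
      also have "\<dots> \<le> (\<Sum>j\<in>{l..<m}. k * N * (1 / 2) ^ j)" by (intro sum_mono Xn)
      also have "\<dots> = k * N * (\<Sum>j\<in>{l..<m}. (1 / 2) ^ j)" by (simp add: sum_distrib_left)
      also have "(\<Sum>j\<in>{l..<m}. (1 / 2) ^ j) = 2 * (1 / 2) ^ l - 2 * (1 / 2 :: real) ^ m"
        using that
      proof (induction m rule: dec_induct)
        case (step n)
        have "(\<Sum>j\<in>{l..<Suc n}. (1 / 2 :: real) ^ j) = (\<Sum>j\<in>{l..<n}. (1 / 2) ^ j) + (1 / 2) ^ n"
          using step(1) by simp
        moreover have "(1 / 2 :: real) ^ Suc n = (1 / 2) ^ n / 2" by simp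
        ultimately show ?case using step.IH by linarith
      qed simp
      also have "k * N * (2 * (1 / 2) ^ l - 2 * (1 / 2) ^ m) \<le> k * N * (2 * (1 / 2) ^ l)"
        using kN by (intro mult_left_mono) auto
      finally show ?thesis by simp
    qed
    have lim0: "(\<lambda>l. 2 * (k * N) * (1 / 2 :: real) ^ l) \<longlonglongrightarrow> 0"
      by (intro tendsto_mult_right_zero LIMSEQ_realpow_zero) auto
    have "\<exists>x\<in>Hp p. (\<lambda>n. Lp_norm p (S n - x)) \<longlonglongrightarrow> 0"
    proof (rule Hp_complete[OF p SH])
      fix e :: real assume "0 < e"
      then have "\<forall>\<^sub>F l in sequentially. 2 * (k * N) * (1 / 2 :: real) ^ l < e"
        using lim0 by (intro order_tendstoD(2)) auto
      then obtain L where L: "\<And>l. L \<le> l \<Longrightarrow> 2 * (k * N) * (1 / 2 :: real) ^ l < e"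
        by (auto simp: eventually_sequentially)
      have "Lp_norm p (S m - S l) < e" if "L \<le> m" "L \<le> l" for m l
      proof (cases "l \<le> m")
        case True
        then show ?thesis using Sdiff[OF True] L[OF that(2)] by linarith
      next
        case False
        then show ?thesis
          using Sdiff[of m l] L[OF that(1)] Lp_norm_minus_commute[OF p1(1), of "S m" "S l"] by linarith
      qed
      then show "\<exists>N. \<forall>m\<ge>N. \<forall>n\<ge>N. Lp_norm p (S m - S n) < e" by blast
    qed
    then obtain x where x: "x \<in> Hp p" "(\<lambda>n. Lp_norm p (S n - x)) \<longlonglongrightarrow> 0" by blast
    have "Lp_norm p (T x - y) \<le> 0"
    proof (rule LIMSEQ_le_const)
      show "(\<lambda>m. K * Lp_norm p (S m - x) + N * (1 / 2) ^ m) \<longlonglongrightarrow> 0"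
        using tendsto_add[OF tendsto_mult_right_zero[OF x(2), of K] tendsto_mult_right_zero[OF LIMSEQ_realpow_zero[of "1/2"], of N]]
        by simp
      have "Lp_norm p (T x - y) \<le> K * Lp_norm p (S m - x) + N * (1 / 2) ^ m" for m
      proof -
        have "Lp_norm p (T x - y) \<le> Lp_norm p (T x - T (S m)) + Lp_norm p (T (S m) - y)"
          using x SH TH y p1 by (intro Lp_norm_triangle_mid Hp_Lp) auto
        also have "Lp_norm p (T x - T (S m)) = Lp_norm p (T (S m - x))"
          using x SH p1 by (simp add: Tdiff Lp_norm_minus_commute)
        also have "\<dots> \<le> K * Lp_norm p (S m - x)" using x SH p1 by (intro Tbd Hp_diff) auto
        also have "Lp_norm p (T (S m) - y) = Lp_norm p (Y m)" using p1 by (simp add: TS Lp_norm_uminus)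
        also have "\<dots> \<le> N * (1 / 2) ^ m" by (rule Yn)
        finally show ?thesis by simp
      qed
      then show "\<exists>M. \<forall>m\<ge>M. Lp_norm p (T x - y) \<le> K * Lp_norm p (S m - x) + N * (1 / 2) ^ m" by blast
    qed
    then have "Lp_norm p (T x - y) = 0" using Lp_norm_nonneg[of p "T x - y"] by linarith
    then have "T x - y = 0" using x y TH p1 by (intro Lp_norm_eq_0[of _ p] Hp_Lp Hp_diff) auto
    then have Tx: "T x = y" by simp
    have "Lp_norm p x \<le> 2 * k * N"
    proof (rule LIMSEQ_le_const)
      show "(\<lambda>m. Lp_norm p (S m - x) + 2 * k * N) \<longlonglongrightarrow> 2 * k * N"
        using tendsto_add[OF x(2) tendsto_const[of "2 * k * N"]] by simp
      have "Lp_norm p x \<le> Lp_norm p (S m - x) + 2 * k * N" for m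
      proof -
        have "Lp_norm p x \<le> Lp_norm p (S m) + Lp_norm p (S m - x)"
          using Lp_norm_triangle_diff[of "S m" p "S m - x"] SH[of m] x p1 by (simp add: Hp_Lp Hp_diff)
        moreover have "Lp_norm p (S m) \<le> 2 * k * N"
          using Sdiff[of 0 m] by (simp add: S_def)
        ultimately show ?thesis by simp
      qed
      then show "\<exists>M. \<forall>m\<ge>M. Lp_norm p x \<le> Lp_norm p (S m - x) + 2 * k * N" by blast
    qed
    with Tx x show ?thesis by (auto simp: N_def)
  qed
  with k0 show thesis by (intro that[of "2 * k"]) auto
qed

text \<open>A purely algebraic projection, with no claim of continuity. It lets the Hahn-Banach
  theorem, stated for functionals on the whole type, be applied to a sublinear functional given on a
  Hardy space.\<close>

lemma linear_projection_exists:
  assumes "circle_fun.subspace X"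
  obtains \<pi> where "\<And>f. \<pi> f \<in> X" "\<And>f. f \<in> X \<Longrightarrow> \<pi> f = f" "\<And>f g. \<pi> (f + g) = \<pi> f + \<pi> g" "\<And>c f. \<pi> (scale c f) = scale c (\<pi> f)"
proof -
  interpret vs: vector_space_pair scale scale ..
  have "Vector_Spaces.linear scale scale (\<lambda>f. f)"
    by (rule circle_fun.linear_ident)
  from vs.linear_exists_left_inverse_on[OF this assms]
  obtain \<pi> where \<pi>: "range \<pi> \<subseteq> X" "Vector_Spaces.linear scale scale \<pi>" "\<forall>f\<in>X. \<pi> f = f"
    by auto
  interpret L: Vector_Spaces.linear scale scale \<pi> by (rule \<pi>(2))
  show thesis
    by (rule that[of \<pi>]) (use \<pi> in \<open>auto simp: L.add L.scale\<close>)
qed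

text \<open>The sublinear functional is the distance to \<open>M\<close>. It is dominated by the
  norm and vanishes on \<open>M\<close>, so a linear functional below it is bounded and annihilates
  \<open>M\<close>, while its value at \<open>g\<close> can be made equal to the positive
  distance.\<close>

theorem Hp_separation:
  assumes p: "1 < p" and M: "circle_fun.subspace M" "M \<subseteq> Hp p"
    and closed: "\<And>F g. (\<And>n::nat. F n \<in> M) \<Longrightarrow> g \<in> Hp p \<Longrightarrow> (\<lambda>n. Lp_norm p (F n - g)) \<longlonglongrightarrow> 0 \<Longrightarrow> g \<in> M"
    and g: "g \<in> Hp p" "g \<notin> M"
  obtains l where "l \<in> dual p" "\<And>m. m \<in> M \<Longrightarrow> l m = 0" "l g \<noteq> 0"
proof -
  have p1: "1 \<le> p" "0 \<le> p" using p by auto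
  have M0: "0 \<in> M" using M(1) by (rule circle_fun.subspace_0)
  have MLp: "m \<in> Lp p" if "m \<in> M" for m using M(2) that by (auto intro: Hp_Lp)
  \<comment> \<open>Distance 0 would produce a sequence in \<open>M\<close> converging to
    \<open>g\<close>, contrary to closedness.\<close>
  obtain \<delta> where \<delta>: "0 < \<delta>" "\<And>m. m \<in> M \<Longrightarrow> \<delta> \<le> Lp_norm p (g - m)"
  proof (rule ccontr)
    assume no: "\<not> thesis"
    have "\<exists>m\<in>M. Lp_norm p (g - m) < 1 / Suc n" for n :: nat
    proof (rule ccontr)
      assume "\<not> (\<exists>m\<in>M. Lp_norm p (g - m) < 1 / Suc n)"
      then have "1 / Suc n \<le> Lp_norm p (g - m)" if "m \<in> M" for m using that by force
      with no show False using that[of "1 / Suc n"] by auto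
    qed
    then obtain F where F: "\<And>n. F n \<in> M" "\<And>n. Lp_norm p (g - F n) < 1 / Suc n" by metis
    have "(\<lambda>n. Lp_norm p (F n - g)) \<longlonglongrightarrow> 0"
      by (rule tendsto_sandwich[OF _ _ tendsto_const LIMSEQ_inverse_real_of_nat])
        (use F(2) p1 in \<open>auto intro!: always_eventually less_imp_le simp: inverse_eq_divide Lp_norm_minus_commute[of p _ g]\<close>)
    from closed[OF F(1) g(1) this] g(2) show False by simp
  qed
  define d where "d f = (INF m\<in>M. Lp_norm p (f - m))" for f
  have bdd: "bdd_below ((\<lambda>m. Lp_norm p (f - m)) ` M)" for f
    by (rule bdd_belowI[of _ 0]) auto
  have dle: "d f \<le> Lp_norm p (f - m)" if "m \<in> M" for f m
    unfolding d_def using that by (intro cINF_lower bdd)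
  have dge: "x \<le> d f" if "\<And>m. m \<in> M \<Longrightarrow> x \<le> Lp_norm p (f - m)" for x f
    unfolding d_def using that M0 by (intro cINF_greatest) auto
  have dadd: "d (f + h) \<le> d f + d h" if "f \<in> Hp p" "h \<in> Hp p" for f h
  proof -
    have *: "d (f + h) \<le> Lp_norm p (f - m) + Lp_norm p (h - m')" if m: "m \<in> M" "m' \<in> M" for m m'
    proof -
      have "d (f + h) \<le> Lp_norm p (f + h - (m + m'))"
        using m M(1) by (intro dle circle_fun.subspace_add)
      also have "f + h - (m + m') = (f - m) + (h - m')" by simp
      also have "Lp_norm p \<dots> \<le> Lp_norm p (f - m) + Lp_norm p (h - m')"
        using MLp[OF m(1)] MLp[OF m(2)] Hp_Lp[OF \<open>f \<in> Hp p\<close>] Hp_Lp[OF \<open>h \<in> Hp p\<close>] p1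
        by (intro Lp_norm_triangle Lp_diff)
      finally show ?thesis .
    qed
    have "d (f + h) - Lp_norm p (h - m') \<le> d f" if "m' \<in> M" for m'
      using *[OF _ that] by (intro dge) (simp add: algebra_simps)
    then have "d (f + h) - d f \<le> d h"
      by (intro dge) (simp add: algebra_simps)
    then show ?thesis by simp
  qed
  have dscale: "d (scale c f) \<le> cmod c * d f" if f: "f \<in> Hp p" for c f
  proof (cases "c = 0")
    case True
    then show ?thesis using dle[OF M0, of 0] by simp
  next
    case False
    have "d (scale c f) / cmod c \<le> d f"
    proof (rule dge)
      fix m assume m: "m \<in> M"
      have "d (scale c f) \<le> Lp_norm p (scale c f - scale c m)"
        using m M(1) by (intro dle circle_fun.subspace_scale)
      also have "\<dots> = cmod c * Lp_norm p (f - m)"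
        using p1 by (simp add: Lp_norm_scale flip: circle_fun.scale_right_diff_distrib)
      finally show "d (scale c f) / cmod c \<le> Lp_norm p (f - m)"
        using False by (simp add: field_simps)
    qed
    then show ?thesis using False by (simp add: field_simps)
  qed
  obtain \<pi> where \<pi>: "\<And>f. \<pi> f \<in> Hp p" "\<And>f. f \<in> Hp p \<Longrightarrow> \<pi> f = f" "\<And>f g. \<pi> (f + g) = \<pi> f + \<pi> g" "\<And>c f. \<pi> (scale c f) = scale c (\<pi> f)"
    using linear_projection_exists[OF subspace_Hp[OF p1(1)]] by blast
  define q where "q f = d (\<pi> f)" for f
  have "sublinear q"
    unfolding sublinear_def
  proof (intro conjI allI impI)
    show "q (x + y) \<le> q x + q y" for x y
      unfolding q_def \<pi>(3) by (intro dadd \<pi>(1))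
    show "q (t *\<^sub>R x) \<le> t * q x" if "0 \<le> t" for t x
      using dscale[OF \<pi>(1), of "of_real t" x] that unfolding q_def scaleR_circle_fun_def \<pi>(4) by simp
  qed
  then obtain \<rho> where \<rho>: "linear \<rho>" "\<And>x. \<rho> x \<le> q x" "\<rho> g = q g"
    using Hahn_Banach_sublinear[of q g] by blast
  have \<rho>s: "\<rho> (scale (of_real t) f) = t * \<rho> f" for t f
    using linear_scale[OF \<rho>(1), of t f] by (simp add: scaleR_circle_fun_def)
  have \<rho>u: "\<rho> (- f) = - \<rho> f" for f by (rule linear_neg[OF \<rho>(1)])
  have \<rho>a: "\<rho> (f + h) = \<rho> f + \<rho> h" for f h by (rule linear_add[OF \<rho>(1)])
  have \<rho>M: "\<rho> m = 0" if "m \<in> M" for m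
  proof -
    have le: "\<rho> m \<le> 0" if m: "m \<in> M" for m
    proof -
      have "\<rho> m \<le> d m" using \<rho>(2)[of m] m M(2) by (auto simp: q_def \<pi>(2))
      also have "\<dots> \<le> Lp_norm p (m - m)" by (rule dle[OF m])
      finally show ?thesis by simp
    qed
    have "- m \<in> M" using M(1) that by (rule circle_fun.subspace_neg)
    from le[OF this] le[OF that] show ?thesis by (simp add: \<rho>u)
  qed
  have \<rho>b: "\<bar>\<rho> f\<bar> \<le> Lp_norm p f" if f: "f \<in> Hp p" for f
  proof -
    have "\<rho> f \<le> Lp_norm p f" "\<rho> (- f) \<le> Lp_norm p (- f)"
      using \<rho>(2)[of f] \<rho>(2)[of "- f"] dle[OF M0, of f] dle[OF M0, of "- f"] f Hp_scale[OF p1(1) f, of "- 1"]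
      by (auto simp: q_def \<pi>(2) simp flip: uminus_eq_scale)
    then show ?thesis using p1 by (simp add: \<rho>u Lp_norm_uminus)
  qed
  \<comment> \<open>The complex linear functional with real part \<open>\<rho>\<close>.\<close>
  define l where "l f = (if f \<in> Hp p then of_real (\<rho> f) - \<i> * of_real (\<rho> (scale \<i> f)) else 0)" for f
  have lsum: "l (scale c f) = c * l f" if f: "f \<in> Hp p" for c f
  proof -
    have "scale (of_real (Re c)) f + scale (of_real (Im c)) (scale \<i> f) = scale (of_real (Re c) + of_real (Im c) * \<i>) f"
      by (simp only: circle_fun.scale_left_distrib circle_fun.scale_scale)
    also have "of_real (Re c) + of_real (Im c) * \<i> = c" by (simp add: complex_eq_iff)
    finally have cf: "scale c f = scale (of_real (Re c)) f + scale (of_real (Im c)) (scale \<i> f)" ..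
    have "scale (of_real (Re c)) (scale \<i> f) + scale (of_real (- Im c)) f = scale (of_real (Re c) * \<i> + of_real (- Im c)) f"
      by (simp only: circle_fun.scale_left_distrib circle_fun.scale_scale)
    also have "of_real (Re c) * \<i> + of_real (- Im c) = \<i> * c" by (simp add: complex_eq_iff)
    finally have icf: "scale \<i> (scale c f) = scale (of_real (Re c)) (scale \<i> f) + scale (of_real (- Im c)) f"
      by (simp only: circle_fun.scale_scale)
    have "\<rho> (scale c f) = Re c * \<rho> f + Im c * \<rho> (scale \<i> f)"
      unfolding cf \<rho>a \<rho>s ..
    moreover have "\<rho> (scale \<i> (scale c f)) = Re c * \<rho> (scale \<i> f) - Im c * \<rho> f"
      unfolding icf \<rho>a \<rho>s by simp
    ultimately show ?thesis
      using f p1 by (simp add: l_def Hp_scale complex_eq_iff algebra_simps)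
  qed
  show thesis
  proof (rule that[of l])
    show "l \<in> dual p"
      unfolding dual_def
    proof (intro CollectI conjI ballI allI impI)
      show "l (f + h) = l f + l h" if "f \<in> Hp p" "h \<in> Hp p" for f h
        using that p1 by (simp add: l_def Hp_add \<rho>a circle_fun.scale_right_distrib algebra_simps)
      show "l (scale c f) = c * l f" if "f \<in> Hp p" for c f by (rule lsum[OF that])
      show "\<exists>C. \<forall>f\<in>Hp p. cmod (l f) \<le> C * Lp_norm p f"
      proof (intro exI[of _ 2] ballI)
        fix f assume f: "f \<in> Hp p"
        have "cmod (l f) \<le> \<bar>\<rho> f\<bar> + \<bar>\<rho> (scale \<i> f)\<bar>"
          using f norm_triangle_ineq4[of "of_real (\<rho> f)" "\<i> * complex_of_real (\<rho> (scale \<i> f))"] by (simp add: l_def norm_mult)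
        also have "\<dots> \<le> Lp_norm p f + Lp_norm p (scale \<i> f)"
          using f p1 by (intro add_mono \<rho>b Hp_scale)
        also have "\<dots> = 2 * Lp_norm p f" using p1 by (simp add: Lp_norm_scale)
        finally show "cmod (l f) \<le> 2 * Lp_norm p f" .
      qed
    qed (simp add: l_def)
    show "l m = 0" if "m \<in> M" for m
      using \<rho>M[OF that] \<rho>M[OF circle_fun.subspace_scale[OF M(1) that, of \<i>]] by (simp add: l_def)
    have "\<delta> \<le> q g" unfolding q_def \<pi>(2)[OF g(1)] by (rule dge[OF \<delta>(2)])
    then have "0 < \<rho> g" using \<delta>(1) \<rho>(3) by simp
    moreover have "Re (l g) = \<rho> g" using g(1) by (simp add: l_def)
    ultimately show "l g \<noteq> 0" by auto
  qed
qed

text \<open>The value 0 of \<open>dim\<close> is also the default for infinite-dimensional spaces;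
  the finite spanning set excludes this.\<close>

lemma (in vector_space) dim_0_finite_span:
  assumes "V \<subseteq> span B" "finite B" "dim V = 0"
  shows "V \<subseteq> {0}"
proof -
  obtain b where b: "b \<subseteq> V" "independent b" "V \<subseteq> span b" "card b = dim V" by (rule basis_exists)
  have "finite b" using independent_span_bound[OF assms(2) b(2)] b(1) assms(1) by blast
  with b(4) assms(3) have "b = {}" by simp
  with b(3) show ?thesis by simp
qed

lemma (in vector_space) dim_1_finite_span:
  assumes "V \<subseteq> span B" "finite B" "dim V = 1"
  obtains b where "b \<in> V" "b \<noteq> 0" "\<And>v. v \<in> V \<Longrightarrow> \<exists>c. v = scale c b"
proof -
  obtain b where b: "b \<subseteq> V" "independent b" "V \<subseteq> span b" "card b = dim V" by (rule basis_exists)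
  then obtain x where x: "b = {x}" using assms(3) by (auto simp: card_1_singleton_iff)
  have "x \<noteq> 0" using b(2) x dependent_zero[of b] by auto
  moreover have "\<exists>c. v = scale c x" if "v \<in> V" for v
    using b(3) that by (auto simp: x span_singleton)
  ultimately show thesis using b(1) x by (intro that[of x]) auto
qed

subsection \<open>Toeplitz operators and the dual of a Hardy space\<close>

lemma dual_add: "l \<in> dual p \<Longrightarrow> f \<in> Hp p \<Longrightarrow> g \<in> Hp p \<Longrightarrow> l (f + g) = l f + l g"
  by (simp add: dual_def)

lemma dual_scale: "l \<in> dual p \<Longrightarrow> f \<in> Hp p \<Longrightarrow> l (scale c f) = c * l f"
  by (simp add: dual_def)

lemma dual_outside: "l \<in> dual p \<Longrightarrow> f \<notin> Hp p \<Longrightarrow> l f = 0"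
  by (simp add: dual_def)

lemma dual_bound:
  assumes "l \<in> dual p"
  obtains C where "0 \<le> C" "\<And>f. f \<in> Hp p \<Longrightarrow> cmod (l f) \<le> C * Lp_norm p f"
proof -
  obtain C where C: "\<forall>f\<in>Hp p. cmod (l f) \<le> C * Lp_norm p f"
    using assms by (auto simp: dual_def)
  show thesis
  proof (rule that[of "max C 0"])
    fix f assume "f \<in> Hp p"
    then have "cmod (l f) \<le> C * Lp_norm p f" using C by blast
    also have "\<dots> \<le> max C 0 * Lp_norm p f" by (intro mult_right_mono) auto
    finally show "cmod (l f) \<le> max C 0 * Lp_norm p f" .
  qed simp
qed

lemma dual_0: "l \<in> dual p \<Longrightarrow> l 0 = 0"
  using dual_scale[of l p 0 0] by (simp add: Hp_0)

lemma dual_diff: "1 \<le> p \<Longrightarrow> l \<in> dual p \<Longrightarrow> f \<in> Hp p \<Longrightarrow> g \<in> Hp p \<Longrightarrow> l (f - g) = l f - l g"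
  using dual_add[of l p "f - g" g] by (simp add: Hp_diff)

lemma dual_sum: "1 \<le> p \<Longrightarrow> l \<in> dual p \<Longrightarrow> (\<And>i. i \<in> I \<Longrightarrow> f i \<in> Hp p) \<Longrightarrow> l (sum f I) = (\<Sum>i\<in>I. l (f i))"
proof (induction I rule: infinite_finite_induct)
  case (insert i I)
  then show ?case by (simp add: dual_add circle_fun.subspace_sum[OF subspace_Hp])
qed (auto simp: dual_0)

lemma dual_eq_0I:
  assumes p: "1 < p" and l: "l \<in> dual p" and z: "\<And>k::nat. l (tvar powi int k) = 0"
  shows "l = 0"
proof
  fix f
  show "l f = 0 f"
  proof (cases "f \<in> Hp p")
    case True
    obtain h where h: "\<And>n::nat. h n \<in> trig" "\<And>n. h n \<in> Hp p" "(\<lambda>n. Lp_norm p (h n - f)) \<longlonglongrightarrow> 0"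
      using Hp_dense[OF p True] by blast
    have hz: "l (h n) = 0" for n
    proof -
      obtain S where S: "finite S" "h n = (\<Sum>k\<in>S. scale (fourier (h n) k) (tvar powi k))"
        using trig_expand[OF h(1)] by blast
      have "h n = (\<Sum>k\<in>S \<inter> {0..}. scale (fourier (h n) k) (tvar powi k))"
        by (subst S(2), rule sum.mono_neutral_right) (use S(1) h(2)[of n] in \<open>auto simp: Hp_def not_le\<close>)
      then have "l (h n) = l (\<Sum>k\<in>S \<inter> {0..}. scale (fourier (h n) k) (tvar powi k))" by simp
      also have "\<dots> = (\<Sum>k\<in>S \<inter> {0..}. fourier (h n) k * l (tvar powi k))"
        using p l by (subst dual_sum) (auto intro!: Hp_scale Hp_tvar_powi sum.cong dual_scale)
      also have "\<dots> = 0"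
      proof (intro sum.neutral ballI)
        fix k assume "k \<in> S \<inter> {0..}"
        then have "l (tvar powi k) = 0" using z[of "nat k"] by (simp del: power_int_of_nat)
        then show "fourier (h n) k * l (tvar powi k) = 0" by simp
      qed
      finally show ?thesis .
    qed
    obtain C where C: "0 \<le> C" "\<And>f. f \<in> Hp p \<Longrightarrow> cmod (l f) \<le> C * Lp_norm p f"
      using dual_bound[OF l] by blast
    have "cmod (l f) \<le> 0"
    proof (rule LIMSEQ_le_const[OF tendsto_mult_right_zero[OF h(3), of C]])
      have "cmod (l f) \<le> C * Lp_norm p (h n - f)" for n
      proof -
        have "l (h n - f) = - l f" using dual_diff[OF _ l h(2) True, of n] p by (simp add: hz)
        then show ?thesis using C(2)[of "h n - f"] Hp_diff[OF _ h(2) True, of n] p by simp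
      qed
      then show "\<exists>N. \<forall>n\<ge>N. cmod (l f) \<le> C * Lp_norm p (h n - f)" by blast
    qed
    then show ?thesis by simp
  qed (use dual_outside[OF l] in simp)
qed

text \<open>The division argument that replaces the theorem of F. and M. Riesz: comparing the highest
  Fourier coefficient of \<open>r\<close> shows inductively that \<open>l\<close> vanishes on all powers of \<open>t\<close>.\<close>

lemma dual_division:
  assumes p: "1 < p" and l: "l \<in> dual p" and r: "r \<in> Hm p"
    and z: "\<And>n. 0 \<le> n \<Longrightarrow> l (riesz_P p (tvar powi n * r)) = 0"
  shows "r = 0 \<or> l = 0"
proof (cases "r = 0")
  case False
  have p1: "1 \<le> p" using p by simp
  have r1: "r \<in> Lp 1" using Lp_subset_L1(1)[OF p Hm_Lp[OF r]] .
  have "\<exists>n. fourier r n \<noteq> 0" using fourier_unique[OF r1] False by blast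
  then obtain n0 where n0: "fourier r n0 \<noteq> 0" by blast
  \<comment> \<open>\<open>- m\<close> is the highest frequency occurring in
    \<open>r\<close>.\<close>
  define m where "m = (LEAST m::nat. fourier r (- int m) \<noteq> 0)"
  have "n0 < 0"
  proof (rule ccontr)
    assume "\<not> n0 < 0"
    then have "fourier r n0 = 0" using r by (simp add: Hm_def)
    with n0 show False by simp
  qed
  then have "fourier r (- int (nat (- n0))) \<noteq> 0" using n0 by simp
  then have m: "fourier r (- int m) \<noteq> 0" unfolding m_def by (rule LeastI)
  have below: "fourier r (- int j) = 0" if "j < m" for j
    using not_less_Least[of j "\<lambda>m. fourier r (- int m) \<noteq> 0"] that unfolding m_def by blast
  have above: "fourier r k = 0" if "- int m < k" for k
  proof (cases "0 \<le> k")
    case True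
    then show ?thesis using r by (simp add: Hm_def)
  next
    case False
    then show ?thesis using below[of "nat (- k)"] that by simp
  qed
  have "l (tvar powi int j) = 0" for j :: nat
  proof (induction j rule: less_induct)
    case (less j)
    \<comment> \<open>This is the projection of \<open>t^(m+j) r\<close>: a polynomial of degree
      \<open>j\<close> with leading coefficient \<open>fourier r (- m)\<close>, which is not 0. As
      \<open>l\<close> vanishes at it and, by induction, at the lower powers, it vanishes at
      \<open>t^j\<close>.\<close>
    define s where "s = (\<Sum>i\<le>j. scale (fourier r (int i - int m - int j)) (tvar powi int i))"
    have tH: "tvar powi int i \<in> Hp p" for i using p1 by (intro Hp_tvar_powi) auto
    have sH: "s \<in> Hp p"
      unfolding s_def using p1 by (intro circle_fun.subspace_sum subspace_Hp Hp_scale tH) auto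
    have fs: "fourier s n = (if 0 \<le> n \<and> n \<le> int j then fourier r (n - int m - int j) else 0)" for n
    proof -
      have "fourier s n = (\<Sum>i\<le>j. fourier r (int i - int m - int j) * (if n = int i then 1 else 0))"
        unfolding s_def
        by (simp add: fourier_sum Lp_scale Lp_tvar_powi fourier_scale fourier_tvar_powi del: power_int_of_nat)
      also have "\<dots> = (\<Sum>i\<le>j. if i = nat n \<and> 0 \<le> n then fourier r (n - int m - int j) else 0)"
        by (intro sum.cong) auto
      also have "\<dots> = (if 0 \<le> n \<and> n \<le> int j then fourier r (n - int m - int j) else 0)"
        by (cases "0 \<le> n") (auto simp: sum.delta nat_le_iff)
      finally show ?thesis .
    qed
    have "riesz_P p (tvar powi (int m + int j) * r) = s"
    proof (rule riesz_P_eqI[OF p Hp_Lp[OF sH]])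
      show "analytic_part (tvar powi (int m + int j) * r) s"
        using above by (auto simp: analytic_part_def fourier_shift fs diff_diff_eq)
    qed
    then have "0 = l s" using z[of "int m + int j"] by simp
    also have "l s = (\<Sum>i\<le>j. fourier r (int i - int m - int j) * l (tvar powi int i))"
      unfolding s_def using p1 l tH by (subst dual_sum) (auto intro!: Hp_scale sum.cong dual_scale simp del: power_int_of_nat)
    also have "\<dots> = (\<Sum>i\<in>{j}. fourier r (int i - int m - int j) * l (tvar powi int i))"
      using less.IH by (intro sum.mono_neutral_right) (auto simp del: power_int_of_nat)
    finally show ?case using m by simp
  qed
  then have "l = 0" by (rule dual_eq_0I[OF p l])
  then show ?thesis ..
qed simp

lemma toeplitz_Hp: "1 < p \<Longrightarrow> c \<in> Linf \<Longrightarrow> f \<in> Hp p \<Longrightarrow> toeplitz p c f \<in> Hp p"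
  unfolding toeplitz_def by (intro riesz_P_Hp Linf_Lp_mult Hp_Lp) auto

lemma toeplitz_add: "1 < p \<Longrightarrow> c \<in> Linf \<Longrightarrow> f \<in> Hp p \<Longrightarrow> g \<in> Hp p \<Longrightarrow> toeplitz p c (f + g) = toeplitz p c f + toeplitz p c g"
  unfolding toeplitz_def distrib_left by (intro riesz_P_add Linf_Lp_mult Hp_Lp) auto

lemma toeplitz_scale: "1 < p \<Longrightarrow> c \<in> Linf \<Longrightarrow> f \<in> Hp p \<Longrightarrow> toeplitz p c (scale \<mu> f) = scale \<mu> (toeplitz p c f)"
  unfolding toeplitz_def scale_eq_times by (intro riesz_P_scale Linf_Lp_mult Hp_Lp) auto

lemma riesz_P_mult_bound:
  assumes p: "1 < p" and c: "c \<in> Linf"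
  obtains K where "0 \<le> K" "\<And>f. f \<in> Lp p \<Longrightarrow> Lp_norm p (riesz_P p (c * f)) \<le> K * Lp_norm p f"
proof (rule Linf_mult_Lp[OF c], goal_cases)
  case (1 D)
  show ?case
  proof (rule riesz_P_bounded[OF p], goal_cases)
    case A: (1 C)
    show ?case
    proof (rule 1(1)[of "C * D"])
      fix f assume f: "f \<in> Lp p"
      have "Lp_norm p (riesz_P p (c * f)) \<le> C * Lp_norm p (c * f)"
        using p f 1(3) by (intro A(2)) auto
      also have "\<dots> \<le> C * (D * Lp_norm p f)"
        using p f A(1) 1(4) by (intro mult_left_mono) auto
      finally show "Lp_norm p (riesz_P p (c * f)) \<le> C * D * Lp_norm p f" by simp
    qed (use A(1) 1(2) in simp)
  qed
qed

lemma subspace_ker_toeplitz: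
  "1 < p \<Longrightarrow> c \<in> Linf \<Longrightarrow> circle_fun.subspace (ker p (toeplitz p c))"
  by (auto simp: circle_fun.subspace_def ker_def Hp_0 Hp_add Hp_scale toeplitz_add toeplitz_scale)
    (simp add: toeplitz_def riesz_P_Hm Hm_def)

lemma mem_ker_toeplitz_iff: "1 < p \<Longrightarrow> c \<in> Linf \<Longrightarrow> f \<in> ker p (toeplitz p c) \<longleftrightarrow> f \<in> Hp p \<and> c * f \<in> Hm p"
  by (auto simp: ker_def toeplitz_def riesz_P_eq_0_iff Linf_Lp_mult Hp_Lp)

lemma mem_coker_iff: "l \<in> coker p A \<longleftrightarrow> l \<in> dual p \<and> (\<forall>f\<in>Hp p. l (A f) = 0)"
  by (auto simp: coker_def adjoint_op_def fun_eq_iff)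

lemma zero_in_coker: "0 \<in> coker p A"
  by (auto simp: mem_coker_iff dual_def intro!: exI[of _ 0])

lemma zero_in_ker: "1 < p \<Longrightarrow> c \<in> Linf \<Longrightarrow> 0 \<in> ker p (toeplitz p c)"
  by (rule circle_fun.subspace_0[OF subspace_ker_toeplitz])

text \<open>If \<open>f\<close> is in the kernel and \<open>l\<close> in the cokernel, then
  \<open>c * f\<close> is in \<open>Hm\<close> and
  \<open>l (P (t^n c f)) = l (T(c) (t^n f)) = 0\<close>, so the division argument forces
  \<open>c * f = 0\<close> or \<open>l = 0\<close>.\<close>

theorem Coburn:
  assumes p: "1 < p" and c: "c \<in> Linf" "c * c' = 1"
  shows "ker p (toeplitz p c) = {0} \<or> coker p (toeplitz p c) = {0}"
proof (rule ccontr)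
  assume "\<not> ?thesis"
  then obtain f l where f: "f \<in> ker p (toeplitz p c)" "f \<noteq> 0" and l: "l \<in> coker p (toeplitz p c)" "l \<noteq> 0"
    using zero_in_ker[OF p c(1)] zero_in_coker[of p "toeplitz p c"] by blast
  have fH: "f \<in> Hp p" and r: "c * f \<in> Hm p" using f(1) by (auto simp: mem_ker_toeplitz_iff[OF p c(1)])
  have ld: "l \<in> dual p" and l0: "\<And>f. f \<in> Hp p \<Longrightarrow> l (toeplitz p c f) = 0" using l(1) by (auto simp: mem_coker_iff)
  have "c * f = 0 \<or> l = 0"
  proof (rule dual_division[OF p ld r])
    fix n :: int assume "0 \<le> n"
    then show "l (riesz_P p (tvar powi n * (c * f))) = 0"
      using l0[OF Hp_tvar_mult[OF _ fH], of n] by (simp add: toeplitz_def mult.left_commute)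
  qed
  moreover have "c' * (c * f) = f" using c(2) by (simp add: mult.assoc[symmetric] mult.commute[of c'])
  ultimately show False using f(2) l(2) by auto
qed

text \<open>A closed range is the common null space of the cokernel. The condition is imposed on a
  single \<open>g\<close>, because it is also used when the cokernel is one-dimensional.\<close>

lemma coker_trivial_surj:
  assumes p: "1 < p" and c: "c \<in> Linf" and cl: "closed_range p (toeplitz p c)"
    and g: "g \<in> Hp p" and lg: "\<And>l. l \<in> coker p (toeplitz p c) \<Longrightarrow> l g = 0"
  shows "\<exists>f\<in>Hp p. toeplitz p c f = g"
proof (rule ccontr)
  assume no: "\<not> ?thesis"
  define M where "M = toeplitz p c ` Hp p"
  have "circle_fun.subspace M"
    unfolding circle_fun.subspace_def
  proof (intro conjI ballI allI)
    show "0 \<in> M"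
      unfolding M_def using toeplitz_scale[OF p c Hp_0, of 0] Hp_0 by (intro image_eqI[of _ _ 0]) auto
    show "x + y \<in> M" if xy: "x \<in> M" "y \<in> M" for x y
    proof -
      obtain f h where "f \<in> Hp p" "h \<in> Hp p" "x = toeplitz p c f" "y = toeplitz p c h"
        using xy by (auto simp: M_def)
      then show ?thesis
        unfolding M_def using p toeplitz_add[OF p c, of f h] Hp_add[of p f h] by (intro image_eqI[of _ _ "f + h"]) auto
    qed
    show "scale \<mu> x \<in> M" if x: "x \<in> M" for \<mu> x
    proof -
      obtain f where "f \<in> Hp p" "x = toeplitz p c f"
        using x by (auto simp: M_def)
      then show ?thesis
        unfolding M_def using p toeplitz_scale[OF p c, of f \<mu>] Hp_scale[of p f \<mu>] by (intro image_eqI[of _ _ "scale \<mu> f"]) auto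
    qed
  qed
  moreover have "M \<subseteq> Hp p" using toeplitz_Hp[OF p c] by (auto simp: M_def)
  moreover have "h \<in> M" if "\<And>n::nat. F n \<in> M" "h \<in> Hp p" "(\<lambda>n. Lp_norm p (F n - h)) \<longlonglongrightarrow> 0" for F h
    using cl that unfolding closed_range_def M_def by blast
  moreover have "g \<notin> M" using no by (auto simp: M_def)
  ultimately obtain l where l: "l \<in> dual p" "\<And>m. m \<in> M \<Longrightarrow> l m = 0" "l g \<noteq> 0"
    using Hp_separation[OF p _ _ _ g, of M] by blast
  then have "l \<in> coker p (toeplitz p c)" by (auto simp: mem_coker_iff M_def)
  with lg l(3) show False by blast
qed

subsection \<open>Wiener--Hopf factorization\<close>

lemma Lp_Fatou:
  assumes p: "1 \<le> p" and F: "\<And>n::nat. F n \<in> Lp p" "\<And>n. Lp_norm p (F n) \<le> D"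
    and lim: "AE t in circle. (\<lambda>n. val (F n) t) \<longlonglongrightarrow> val f t"
  shows "f \<in> Lp p"
proof -
  have D: "0 \<le> D" using order_trans[OF Lp_norm_nonneg F(2)] by simp
  have "(\<integral>\<^sup>+t. ennreal (cmod (val f t) powr p) \<partial>circle)
      = (\<integral>\<^sup>+t. liminf (\<lambda>m. ennreal (cmod (val (F m) t) powr p)) \<partial>circle)"
  proof (intro nn_integral_cong_AE)
    show "AE t in circle. ennreal (cmod (val f t) powr p) = liminf (\<lambda>m. ennreal (cmod (val (F m) t) powr p))"
      using lim
    proof eventually_elim
      case (elim t)
      have "(\<lambda>m. ennreal (cmod (val (F m) t) powr p)) \<longlonglongrightarrow> ennreal (cmod (val f t) powr p)"
        using p elim by (intro tendsto_ennrealI tendsto_powr' tendsto_intros) auto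
      then show ?case by (intro lim_imp_Liminf[symmetric]) auto
    qed
  qed
  also have "\<dots> \<le> liminf (\<lambda>m. \<integral>\<^sup>+t. ennreal (cmod (val (F m) t) powr p) \<partial>circle)"
    by (rule nn_integral_liminf) measurable
  also have "\<dots> \<le> ennreal (D powr p)"
  proof (rule Liminf_le)
    have "(\<integral>\<^sup>+t. ennreal (cmod (val (F m) t) powr p) \<partial>circle) \<le> ennreal (D powr p)" for m
    proof -
      have "(\<integral>\<^sup>+t. ennreal (cmod (val (F m) t) powr p) \<partial>circle) = ennreal (Lp_norm p (F m) powr p)"
        using F(1)[of m] p by (subst nn_integral_eq_integral) (auto simp: mem_Lp_iff Lp_norm_powr)
      also have "\<dots> \<le> ennreal (D powr p)"
        using F(2)[of m] p by (intro ennreal_leI powr_mono2) auto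
      finally show ?thesis .
    qed
    then show "\<forall>\<^sub>F m in sequentially. (\<integral>\<^sup>+t. ennreal (cmod (val (F m) t) powr p) \<partial>circle) \<le> ennreal (D powr p)"
      by simp
  qed simp
  finally have "(\<integral>\<^sup>+t. ennreal (cmod (val f t) powr p) \<partial>circle) \<le> ennreal (D powr p)" .
  then show ?thesis
    unfolding mem_Lp_iff by (intro integrableI_bounded) (auto simp: order_le_less_trans)
qed

text \<open>The quotient \<open>u = gm / hm = hp / gp\<close> has no positive frequencies in the
  first form, no negative ones in the second, and mean 1 by normalization; hence
  \<open>u = 1\<close>.\<close>

lemma wiener_hopf_unique:
  assumes p: "1 < p" and 1: "wiener_hopf p g n gm gp" and 2: "wiener_hopf p g n hm hp"
  shows "gp = hp"
proof -
  define q where "q = conj_exp p"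
  have q: "1 < q" "conj_exp q = p" using conj_exp[OF p] by (auto simp: q_def)
  have G: "g = gm * tvar powi (- n) * gp" "gm * inverse gm = 1" "gp * inverse gp = 1" "fourier gm 0 = 1"
    "gp \<in> Hp q" "inverse gp \<in> Hp p" "gm \<in> Hp_bar p" "inverse gm \<in> Hp_bar q"
    using 1 by (auto simp: wiener_hopf_def Let_def q_def)
  have H: "g = hm * tvar powi (- n) * hp" "hm * inverse hm = 1" "hp * inverse hp = 1" "fourier hm 0 = 1"
    "hp \<in> Hp q" "inverse hp \<in> Hp p" "hm \<in> Hp_bar p" "inverse hm \<in> Hp_bar q"
    using 2 by (auto simp: wiener_hopf_def Let_def q_def)
  have tt: "tvar powi n * tvar powi (- n) = 1"
    using tvar_powi_add[of n "- n"] by simp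
  have "gm * gp = tvar powi n * g" unfolding G(1) using tt by (simp add: algebra_simps)
  moreover have "hm * hp = tvar powi n * g" unfolding H(1) using tt by (simp add: algebra_simps)
  ultimately have eq: "gm * gp = hm * hp" by simp
  define u where "u = gm * inverse hm"
  have "u = gm * inverse hm * (gp * inverse gp)" using G(3) by (simp add: u_def)
  also have "\<dots> = (gm * gp) * (inverse hm * inverse gp)" by (simp add: algebra_simps)
  also have "\<dots> = (hm * inverse hm) * (hp * inverse gp)" unfolding eq by (simp add: algebra_simps)
  finally have u2: "u = inverse gp * hp" using H(2) by (simp add: mult.commute)
  have one: "fourier 1 k = (if k = 0 then 1 else 0)" for k
    using fourier_tvar_powi[of 0 k] by simp
  have h0: "fourier (inverse hm) 0 = 1"
  proof -
    have "fourier (hm * inverse hm) 0 = fourier hm 0 * fourier (inverse hm) 0"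
      using Hp_bar_mult_fourier(2)[OF p H(7)] H(8) by (simp add: q_def)
    then show ?thesis using H(2,4) one by simp
  qed
  have "u = 1"
  proof (rule fourier_eqI)
    show "u \<in> Lp 1"
      unfolding u2 using Lp_mult(1)[OF p Hp_Lp[OF G(6)]] Hp_Lp[OF H(5)] by (simp add: q_def)
    show "1 \<in> Lp 1" by (intro Linf_Lp one_Linf) simp
    show "fourier u k = fourier 1 k" for k
    proof -
      consider "k < 0" | "k = 0" | "0 < k" by linarith
      then show ?thesis
      proof cases
        case 1
        then show ?thesis
          unfolding u2 using Hp_mult_fourier_neg[OF p G(6), of hp k] H(5) by (simp add: one q_def)
      next
        case 2
        then show ?thesis
          unfolding u_def using Hp_bar_mult_fourier(2)[OF p G(7), of "inverse hm"] H(8) G(4) h0 by (simp add: one q_def)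
      next
        case 3
        then show ?thesis
          unfolding u_def using Hp_bar_mult_fourier(1)[OF p G(7), of "inverse hm" k] H(8) by (simp add: one q_def)
      qed
    qed
  qed
  then have "gp * (inverse gp * hp) = gp" unfolding u2 by simp
  then show ?thesis using G(3) by (simp add: mult.assoc[symmetric])
qed

text \<open>The factors are \<open>g \<phi>\<close> and \<open>\<phi>\<^sup>-\<^sup>1\<close>, where \<open>T(g) \<phi> = 1\<close>. The bounded functional \<open>U\<close> that maps \<open>f\<close> to the
  mean of \<open>T(g)\<^sup>-\<^sup>1 P (g f)\<close> takes the value \<open>\<kappa>\<close> times the mean of \<open>h\<close> at \<open>h \<phi>\<close>. Testing it on truncations
  of \<open>h = \<bar>\<phi>\<bar>\<^sup>-\<^sup>q\<close> shows that \<open>\<phi>\<^sup>-\<^sup>1\<close> is in \<open>L\<^sup>q\<close>.\<close>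

lemma wiener_hopf_exists:
  assumes p: "1 < p" and g: "g \<in> Linf" and g': "g' \<in> Linf" and gg': "g * g' = 1"
    and surj: "\<And>y. y \<in> Hp p \<Longrightarrow> \<exists>f\<in>Hp p. toeplitz p g f = y"
    and inj: "\<And>f. f \<in> Hp p \<Longrightarrow> toeplitz p g f = 0 \<Longrightarrow> f = 0"
  shows "\<exists>gm gp. wiener_hopf p g 0 gm gp"
proof -
  define q where "q = conj_exp p"
  have q: "1 < q" "conj_exp q = p" "1 / p + 1 / q = 1" using conj_exp[OF p] by (auto simp: q_def)
  have p1: "1 \<le> p" "0 \<le> p" and q1: "1 \<le> q" "0 \<le> q" using p q by auto
  define T where "T = toeplitz p g"
  have TH: "T f \<in> Hp p" if "f \<in> Hp p" for f unfolding T_def by (rule toeplitz_Hp[OF p g that])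
  have Tadd: "T (f + h) = T f + T h" if "f \<in> Hp p" "h \<in> Hp p" for f h unfolding T_def by (rule toeplitz_add[OF p g that])
  have Tscale: "T (scale c f) = scale c (T f)" if "f \<in> Hp p" for c f unfolding T_def by (rule toeplitz_scale[OF p g that])
  obtain K where K: "0 \<le> K" "\<And>f. f \<in> Lp p \<Longrightarrow> Lp_norm p (riesz_P p (g * f)) \<le> K * Lp_norm p f"
    using riesz_P_mult_bound[OF p g] by blast
  obtain K1 where K1: "0 \<le> K1" "\<And>f. f \<in> Lp p \<Longrightarrow> Lp_norm p (riesz_P p (1 * f)) \<le> K1 * Lp_norm p f"
    using riesz_P_mult_bound[OF p one_Linf] by blast
  have Tbd: "Lp_norm p (T f) \<le> K * Lp_norm p f" if "f \<in> Hp p" for f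
    using K(2)[OF Hp_Lp[OF that]] by (simp add: T_def toeplitz_def)
  have Tsurj: "\<exists>f\<in>Hp p. T f = y" if "y \<in> Hp p" for y
    unfolding T_def by (rule surj[OF that])
  obtain C where C: "0 \<le> C" "\<And>y. y \<in> Hp p \<Longrightarrow> \<exists>f\<in>Hp p. T f = y \<and> Lp_norm p f \<le> C * Lp_norm p y"
    using open_mapping_Hp[OF p TH Tadd Tscale Tbd Tsurj] by blast
  have Tinj: "f = h" if "f \<in> Hp p" "h \<in> Hp p" "T f = T h" for f h
  proof -
    have "T (f - h) + T h = T f" using Tadd[of "f - h" h] that p1 by (simp add: Hp_diff)
    then have "T (f - h) = 0" using that by simp
    then have "f - h = 0" unfolding T_def using that p1 by (intro inj[OF Hp_diff])
    then show ?thesis by simp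
  qed
  define B where "B y = (THE f. f \<in> Hp p \<and> T f = y)" for y
  have B_T: "B (T f) = f" if "f \<in> Hp p" for f
    unfolding B_def using that Tinj by (intro the_equality) auto
  have B: "B y \<in> Hp p" "T (B y) = y" "Lp_norm p (B y) \<le> C * Lp_norm p y" if "y \<in> Hp p" for y
    using C(2)[OF that] B_T by auto
  have Badd: "B (x + y) = B x + B y" if "x \<in> Hp p" "y \<in> Hp p" for x y
    using B_T[of "B x + B y"] B[OF that(1)] B[OF that(2)] p1 by (simp add: Tadd Hp_add)
  have Bscale: "B (scale c y) = scale c (B y)" if "y \<in> Hp p" for c y
    using B_T[of "scale c (B y)"] B[OF that] p1 by (simp add: Tscale Hp_scale)
  have B0: "B 0 = 0" using Bscale[OF Hp_0, of 0] by simp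
  have BO: "bounded_operator p B"
    unfolding bounded_operator_def using B Badd Bscale by blast
  define V where "V f = fourier (B (riesz_P p f)) 0" for f
  have Vadd: "V (f + h) = V f + V h" if "f \<in> Lp p" "h \<in> Lp p" for f h
    unfolding V_def using that p
    by (simp add: riesz_P_add Badd riesz_P_Hp fourier_add[OF Lp_subset_L1(1)[OF p Hp_Lp] Lp_subset_L1(1)[OF p Hp_Lp]] B)
  have Vscale: "V (scale c f) = c * V f" if "f \<in> Lp p" for c f
    unfolding V_def using that p by (simp add: riesz_P_scale Bscale riesz_P_Hp fourier_scale)
  have Vbd: "cmod (V f) \<le> C * K1 * Lp_norm p f" if f: "f \<in> Lp p" for f
  proof -
    have "cmod (V f) \<le> Lp_norm p (B (riesz_P p f))"
      unfolding V_def using fourier_bound_Lp[OF p Hp_Lp[OF B(1)[OF riesz_P_Hp[OF p f]]]] .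
    also have "\<dots> \<le> C * Lp_norm p (riesz_P p f)" using f by (intro B riesz_P_Hp[OF p])
    also have "\<dots> \<le> C * (K1 * Lp_norm p f)" using K1(2)[OF f] C(1) by (intro mult_left_mono) auto
    finally show ?thesis by simp
  qed
  have Vg: "V (g * f) = fourier f 0" if "f \<in> Hp p" for f
    using B_T[OF that] by (simp add: V_def T_def toeplitz_def)
  have VHm: "V f = 0" if "f \<in> Hm p" for f
    using that p by (simp add: V_def riesz_P_Hm B0)
  have oneH: "1 \<in> Hp p" using Hp_tvar_powi[OF p1(1), of 0] by simp
  define \<phi> where "\<phi> = B 1"
  define m where "m = g * \<phi>"
  define \<kappa> where "\<kappa> = fourier \<phi> 0"
  have \<phi>H: "\<phi> \<in> Hp p" and T\<phi>: "T \<phi> = 1" using B[OF oneH] by (auto simp: \<phi>_def)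
  have mL: "m \<in> Lp p" unfolding m_def using \<phi>H g p1 by (intro Linf_Lp_mult Hp_Lp)
  have one: "fourier 1 k = (if k = 0 then 1 else 0)" for k
    using fourier_tvar_powi[of 0 k] by simp
  have fm: "fourier m k = (if k = 0 then 1 else 0)" if "0 \<le> k" for k
  proof -
    have "riesz_P p m = 1" using T\<phi> by (simp add: T_def toeplitz_def m_def)
    then show ?thesis using fourier_riesz_P[OF p mL, of k] that one by simp
  qed
  define U where "U f = V (g * f)" for f
  have gL: "g * f \<in> Lp p" if "f \<in> Lp p" for f using that g p1 by (intro Linf_Lp_mult)
  have Uadd: "U (f + h) = U f + U h" if "f \<in> Lp p" "h \<in> Lp p" for f h
    unfolding U_def distrib_left by (intro Vadd gL that)
  have Uscale: "U (scale c f) = c * U f" if "f \<in> Lp p" for c f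
    unfolding U_def scale_eq_times by (intro Vscale gL that)
  obtain D0 where D0: "0 \<le> D0" "\<And>f. f \<in> Lp p \<Longrightarrow> Lp_norm p (g * f) \<le> D0 * Lp_norm p f"
  proof (rule Linf_mult_Lp[OF g], goal_cases)
    case (1 D)
    show ?case by (rule 1(1)[OF 1(2) 1(4)[OF _ p1(1)]])
  qed
  define D where "D = C * K1 * D0"
  have D: "0 \<le> D" using C(1) K1(1) D0(1) by (simp add: D_def)
  have Ubd: "cmod (U f) \<le> D * Lp_norm p f" if f: "f \<in> Lp p" for f
  proof -
    have "cmod (U f) \<le> C * K1 * Lp_norm p (g * f)" unfolding U_def by (intro Vbd gL f)
    also have "\<dots> \<le> C * K1 * (D0 * Lp_norm p f)" using D0(2)[OF f] C(1) K1(1) by (intro mult_left_mono) auto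
    finally show ?thesis by (simp add: D_def)
  qed
  \<comment> \<open>For \<open>n < 0\<close> the function \<open>t^n g \<phi>\<close> has only
    negative frequencies, because \<open>g \<phi>\<close> has none that is positive; for
    \<open>n > 0\<close> the operator inverse recovers \<open>t^n \<phi>\<close>, whose mean is
    0.\<close>
  have Ut: "U (tvar powi n * \<phi>) = (if n = 0 then \<kappa> else 0)" for n
  proof -
    consider "n < 0" | "n = 0" | "0 < n" by linarith
    then show ?thesis
    proof cases
      case 1
      have "tvar powi n * m \<in> Hm p" using 1 mL by (auto simp: Hm_def Lp_tvar_powi_mult fourier_shift fm)
      then have "V (tvar powi n * m) = 0" by (rule VHm)
      then show ?thesis using 1 by (simp add: U_def m_def mult.left_commute)
    next
      case 2
      have m1: "m - 1 \<in> Hm p" using mL p1 oneH by (auto simp: Hm_def Lp_diff Hp_Lp fourier_diff Lp_subset_L1' fm one)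
      have "V m = V (1 + (m - 1))" by simp
      also have "\<dots> = V 1 + V (m - 1)" using m1 oneH by (intro Vadd Hm_Lp Hp_Lp)
      also have "\<dots> = \<kappa>" using VHm[OF m1] p oneH by (simp add: V_def riesz_P_id \<kappa>_def \<phi>_def)
      finally show ?thesis using 2 by (simp add: U_def m_def)
    next
      case 3
      have "U (tvar powi n * \<phi>) = fourier (tvar powi n * \<phi>) 0"
        unfolding U_def using 3 \<phi>H by (intro Vg Hp_tvar_mult) auto
      then show ?thesis using 3 \<phi>H by (simp add: fourier_shift Hp_def)
    qed
  qed
  have \<phi>L: "\<phi> \<in> Lp p" by (rule Hp_Lp[OF \<phi>H])
  have h\<phi>L: "h * \<phi> \<in> Lp p" if "h \<in> Linf" for h using that \<phi>L p1 by (intro Linf_Lp_mult)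
  have Utrig: "U (h * \<phi>) = \<kappa> * fourier h 0" if "h \<in> trig" for h
    using that
  proof (induction rule: trig_induct)
    case zero
    show ?case using Uscale[OF \<phi>L, of 0] by simp
  next
    case (add c k h)
    have "U ((scale c (tvar powi k) + h) * \<phi>) = U (scale c (tvar powi k * \<phi>)) + U (h * \<phi>)"
      unfolding distrib_right scale_eq_times using add(1)
      by (intro Uadd Lp_scale h\<phi>L Linf_tvar_powi trig_Linf)
    also have "U (scale c (tvar powi k * \<phi>)) = c * U (tvar powi k * \<phi>)"
      by (intro Uscale h\<phi>L Linf_tvar_powi)
    finally show ?case
      using add by (simp add: Ut fourier_add Lp_scale Lp_tvar_powi trig_Lp fourier_scale fourier_tvar_powi distrib_left)
  qed
  have Utend: "(\<lambda>n. U (F n)) \<longlonglongrightarrow> U f" if "\<And>n::nat. F n \<in> Lp p" "f \<in> Lp p" "(\<lambda>n. Lp_norm p (F n - f)) \<longlonglongrightarrow> 0" for F f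
  proof (rule LIM_zero_cancel, rule Lim_null_comparison[OF always_eventually tendsto_mult_right_zero[OF that(3), of D]], rule allI)
    fix n
    have d: "F n - f \<in> Lp p" using that p1 by (intro Lp_diff) auto
    have "U (F n) - U f = U (F n - f)" using Uadd[OF d that(2)] by simp
    then show "norm (U (F n) - U f) \<le> D * Lp_norm p (F n - f)" using Ubd[OF d] by simp
  qed
  have ULinf: "U (h * \<phi>) = \<kappa> * fourier h 0" if h: "h \<in> Linf" for h
  proof -
    obtain k E where k: "\<And>n::nat. k n \<in> trig" "\<And>n. AE t in circle. cmod (val (k n) t) \<le> E" "0 \<le> E"
      "AE t in circle. (\<lambda>n. val (k n) t) \<longlonglongrightarrow> val h t"
      using trig_bounded_approx[OF h] by blast
    have "AE t in circle. \<forall>n. val (k n * \<phi>) t = val (k n) t * val \<phi> t"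
      unfolding AE_all_countable using val_times by blast
    then have a: "AE t in circle. (\<lambda>n. val (k n * \<phi>) t) \<longlonglongrightarrow> val (h * \<phi>) t"
      using k(4) val_times[of h \<phi>]
    proof eventually_elim
      case (elim t)
      then show ?case by (simp add: tendsto_mult_right)
    qed
    have b: "AE t in circle. cmod (val (k n * \<phi>) t) \<le> E * cmod (val \<phi> t)" for n
      using k(2)[of n] val_times[of "k n" \<phi>]
    proof eventually_elim
      case (elim t)
      show ?case unfolding elim(2) norm_mult by (rule mult_right_mono[OF elim(1) norm_ge_zero])
    qed
    have c: "integrable circle (\<lambda>t. (E * cmod (val \<phi> t)) powr p)"
      using \<phi>L k(3) by (simp add: mem_Lp_iff powr_mult)
    have "(\<lambda>n. U (k n * \<phi>)) \<longlonglongrightarrow> U (h * \<phi>)"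
      by (rule Utend[OF Lp_dominated_convergence(2,1,3)[OF p1(1) a b c]])
    moreover have "(\<lambda>n. fourier (1 * k n) 0) \<longlonglongrightarrow> fourier (1 * h) 0"
      by (rule fourier_mult_Linf_limit[OF _ k(4,2)]) (intro Linf_Lp one_Linf, simp)
    then have "(\<lambda>n. \<kappa> * fourier (k n) 0) \<longlonglongrightarrow> \<kappa> * fourier h 0"
      by (intro tendsto_mult_left) simp
    ultimately show ?thesis
      unfolding Utrig[OF k(1)] by (rule LIMSEQ_unique)
  qed
  have \<phi>0: "\<phi> \<noteq> 0"
  proof
    assume "\<phi> = 0"
    then have "fourier m 0 = 0" by (simp add: m_def)
    then show False using fm[of 0] by simp
  qed
  \<comment> \<open>If \<open>\<kappa>\<close> were 0, let \<open>k\<close> be the lowest frequency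
    of \<open>\<phi>\<close>. Then \<open>t^(-k) \<phi>\<close> is still in the Hardy space, and
    \<open>U\<close> maps it to its mean, the nonzero coefficient at \<open>k\<close>, although the
    moments of \<open>U\<close> would all be 0.\<close>
  have \<kappa>: "\<kappa> \<noteq> 0"
  proof
    assume \<kappa>0: "\<kappa> = 0"
    have "\<exists>n. fourier \<phi> n \<noteq> 0" using fourier_unique[OF Lp_subset_L1(1)[OF p \<phi>L]] \<phi>0 by blast
    then obtain n0 where n0: "fourier \<phi> n0 \<noteq> 0" by blast
    have "0 \<le> n0"
    proof (rule ccontr)
      assume "\<not> 0 \<le> n0"
      then have "fourier \<phi> n0 = 0" using \<phi>H unfolding Hp_def by simp
      with n0 show False by simp
    qed
    define k where "k = (LEAST k::nat. fourier \<phi> (int k) \<noteq> 0)"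
    have "fourier \<phi> (int (nat n0)) \<noteq> 0" using n0 \<open>0 \<le> n0\<close> by simp
    then have k: "fourier \<phi> (int k) \<noteq> 0" unfolding k_def by (rule LeastI)
    have below: "fourier \<phi> (int j) = 0" if "j < k" for j
      using not_less_Least[of j "\<lambda>k. fourier \<phi> (int k) \<noteq> 0"] that unfolding k_def by blast
    have "fourier \<phi> j = 0" if "j < int k" for j
    proof (cases "0 \<le> j")
      case True
      then show ?thesis using below[of "nat j"] that by simp
    next
      case False
      then show ?thesis using \<phi>H by (simp add: Hp_def)
    qed
    then have "tvar powi (- int k) * \<phi> \<in> Hp p"
      using \<phi>L by (auto simp: Hp_def Lp_tvar_powi_mult fourier_shift)
    then have "U (tvar powi (- int k) * \<phi>) = fourier (tvar powi (- int k) * \<phi>) 0"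
      unfolding U_def by (rule Vg)
    also have "\<dots> = fourier \<phi> (int k)" by (simp add: fourier_shift)
    finally show False using k Ut[of "- int k"] \<kappa>0 by (simp split: if_splits)
  qed
  have \<phi>nz: "AE t in circle. val \<phi> t \<noteq> 0"
  proof -
    \<comment> \<open>For the indicator of the zero set \<open>h * \<phi>\<close> is 0, so the
      measure of this set, being the mean of \<open>h\<close>, vanishes.\<close>
    define h where "h = abs_circle_fun (\<lambda>t. if val \<phi> t = 0 then 1 else 0)"
    have hv: "AE t in circle. val h t = (if val \<phi> t = 0 then 1 else 0)"
      unfolding h_def by (rule val_abs) measurable
    have hL: "h \<in> Linf" unfolding mem_Linf_iff
      by (rule exI[of _ 1]) (use hv in \<open>auto elim!: eventually_mono\<close>)
    have "h * \<phi> = 0"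
      unfolding circle_fun_eq_iff using hv val_times[of h \<phi>] val_0 by eventually_elim auto
    then have "\<kappa> * fourier h 0 = 0" using ULinf[OF hL] Uscale[OF \<phi>L, of 0] by simp
    then have "fourier h 0 = 0" using \<kappa> by simp
    moreover have "fourier h 0 = (LINT t|circle. of_real (cmod (val h t)))"
      unfolding fourier_val by (intro integral_cong_AE) (use hv in \<open>auto elim!: eventually_mono\<close>)
    ultimately have "Lp_norm 1 h = 0" by (simp add: Lp_norm_1)
    then have "h = 0" using hL by (intro Lp_norm_eq_0[of _ 1] Linf_Lp) auto
    then have "AE t in circle. val h t = 0" using val_0 by simp
    with hv show ?thesis by eventually_elim (auto split: if_splits)
  qed
  define w where "w = inverse \<phi>"
  have wv: "AE t in circle. val w t = inverse (val \<phi> t)" unfolding w_def by (rule val_inverse)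
  have \<phi>w: "\<phi> * w = 1"
    unfolding circle_fun_eq_iff using val_times[of \<phi> w] wv \<phi>nz val_1 by eventually_elim simp
  \<comment> \<open>Truncations of the inverse of \<open>\<phi>\<close>; they are bounded, and their
    norms in \<open>L^q\<close> will be bounded uniformly in \<open>N\<close>.\<close>
  define wN where "wN N = abs_circle_fun (\<lambda>t. if 1 / real (Suc N) \<le> cmod (val \<phi> t) then inverse (val \<phi> t) else 0)" for N
  have wNv: "AE t in circle. val (wN N) t = (if 1 / real (Suc N) \<le> cmod (val \<phi> t) then inverse (val \<phi> t) else 0)" for N
    unfolding wN_def by (rule val_abs) measurable
  have inv_le: "inverse x \<le> real (Suc N)" if "1 / real (Suc N) \<le> x" for x N
    using that le_imp_inverse_le[of "1 / real (Suc N)" x] by simp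
  have wNL: "wN N \<in> Linf" for N
    unfolding mem_Linf_iff
  proof (rule exI[of _ "real (Suc N)"])
    show "AE t in circle. cmod (val (wN N) t) \<le> real (Suc N)"
      using wNv[of N] by eventually_elim (use inv_le in \<open>auto simp: norm_inverse\<close>)
  qed
  have pq: "(q - 1) * p = q" using p by (simp add: q_def conj_exp_def field_simps)
  have wNn: "Lp_norm q (wN N) \<le> D / cmod \<kappa>" for N
  proof -
    define h where "h = abs_circle_fun (\<lambda>t. if 1 / real (Suc N) \<le> cmod (val \<phi> t) then of_real (inverse (cmod (val \<phi> t)) powr q) else 0)"
    have hv: "AE t in circle. val h t = (if 1 / real (Suc N) \<le> cmod (val \<phi> t) then of_real (inverse (cmod (val \<phi> t)) powr q) else 0)"
      unfolding h_def by (rule val_abs) measurable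
    have hL: "h \<in> Linf"
      unfolding mem_Linf_iff
    proof (rule exI[of _ "real (Suc N) powr q"])
      show "AE t in circle. cmod (val h t) \<le> real (Suc N) powr q"
        using hv
      proof eventually_elim
        case (elim t)
        show ?case
        proof (cases "1 / real (Suc N) \<le> cmod (val \<phi> t)")
          case True
          have "inverse (cmod (val \<phi> t)) powr q \<le> real (Suc N) powr q"
            using inv_le[OF True] q1 by (intro powr_mono2) auto
          with True elim show ?thesis by simp
        qed (use elim in simp)
      qed
    qed
    define G where "G = Lp_norm q (wN N)"
    have "AE t in circle. of_real (cmod (val (wN N) t) powr q) = val h t"
      using hv wNv[of N] by eventually_elim (auto simp: norm_inverse)
    then have "fourier h 0 = (LINT t|circle. of_real (cmod (val (wN N) t) powr q))"
      unfolding fourier_val by (intro integral_cong_AE) (auto elim!: eventually_mono)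
    then have fh: "fourier h 0 = of_real (G powr q)" using q1 by (simp add: G_def Lp_norm_powr)
    have "(LINT t|circle. cmod (val (h * \<phi>) t) powr p) = (LINT t|circle. cmod (val (wN N) t) powr q)"
    proof (intro integral_cong_AE)
      show "AE t in circle. cmod (val (h * \<phi>) t) powr p = cmod (val (wN N) t) powr q"
        using hv wNv[of N] val_times[of h \<phi>]
      proof eventually_elim
        case (elim t)
        show ?case
        proof (cases "1 / real (Suc N) \<le> cmod (val \<phi> t)")
          case True
          define c where "c = cmod (val \<phi> t)"
          have "0 < 1 / real (Suc N)" by simp
          then have c: "0 < c" using True unfolding c_def by linarith
          have "cmod (val (h * \<phi>) t) = inverse c powr q * c"
            using elim True by (simp add: norm_mult c_def)
          also have "\<dots> = inverse c powr (q - 1)"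
            using c by (simp add: powr_diff divide_inverse)
          finally have "cmod (val (h * \<phi>) t) powr p = inverse c powr q"
            by (simp add: powr_powr pq)
          then show ?thesis using elim(2) True by (simp add: norm_inverse c_def)
        qed (use elim p q in simp)
      qed
    qed measurable
    then have "Lp_norm p (h * \<phi>) = (G powr q) powr (1 / p)"
      using q1 by (simp add: Lp_norm_val[of p] Lp_norm_powr G_def)
    also have "\<dots> = G powr (q - 1)"
    proof -
      have "q * (1 / p) = q - 1" using pq p by (simp add: field_simps)
      then show ?thesis by (simp add: powr_powr)
    qed
    finally have n: "Lp_norm p (h * \<phi>) = G powr (q - 1)" .
    have "cmod (U (h * \<phi>)) \<le> D * Lp_norm p (h * \<phi>)" by (intro Ubd h\<phi>L hL)
    then have le: "cmod \<kappa> * G powr q \<le> D * G powr (q - 1)"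
      by (simp add: ULinf[OF hL] fh norm_mult n)
    show ?thesis
    proof (cases "G = 0")
      case True
      then show ?thesis using D by (simp add: G_def)
    next
      case False
      then have G: "0 < G" by (simp add: G_def order_less_le)
      have "G powr q = G * G powr (q - 1)" using G by (simp add: powr_mult_base)
      then have "cmod \<kappa> * G \<le> D" using le G by (simp add: mult.assoc[symmetric])
      then show ?thesis using \<kappa> by (simp add: G_def field_simps)
    qed
  qed
  have wNlim: "AE t in circle. (\<lambda>N. val (wN N) t) \<longlonglongrightarrow> val w t \<and> (\<forall>N. cmod (val (wN N) t) \<le> cmod (val w t)) \<and> (\<forall>N. cmod (val (wN N) t * val \<phi> t) \<le> 1)"
  proof -
    have "AE t in circle. \<forall>N. val (wN N) t = (if 1 / real (Suc N) \<le> cmod (val \<phi> t) then inverse (val \<phi> t) else 0)"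
      unfolding AE_all_countable using wNv by blast
    then show ?thesis
      using wv \<phi>nz
    proof eventually_elim
      case (elim t)
      have "\<forall>\<^sub>F N in sequentially. 1 / real (Suc N) < cmod (val \<phi> t)"
        using LIMSEQ_inverse_real_of_nat elim(3) by (intro order_tendstoD(2)) (auto simp: inverse_eq_divide)
      then have "\<forall>\<^sub>F N in sequentially. val (wN N) t = val w t"
        by eventually_elim (simp add: elim)
      then have "(\<lambda>N. val (wN N) t) \<longlonglongrightarrow> val w t" by (rule tendsto_eventually)
      moreover have "cmod (val (wN N) t) \<le> cmod (val w t)" "cmod (val (wN N) t * val \<phi> t) \<le> 1" for N
        using elim by (auto simp: norm_mult norm_inverse)
      ultimately show ?case by blast
    qed
  qed
  have wL: "w \<in> Lp q"
    by (rule Lp_Fatou[OF q1(1) Linf_Lp[OF wNL q1(2)] wNn]) (use wNlim in \<open>auto elim: eventually_mono\<close>)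
  \<comment> \<open>Formally \<open>f = (f * w) * \<phi>\<close>, to which \<open>ULinf\<close>
    would apply; as \<open>f * w\<close> need not be bounded, \<open>w\<close> is replaced by its
    truncations.\<close>
  have URep: "U f = \<kappa> * fourier (w * f) 0" if f: "f \<in> Linf" for f
  proof -
    obtain E where E: "AE t in circle. cmod (val f t) \<le> E" using f by (auto simp: mem_Linf_iff)
    define F where "F N = (wN N * f) * \<phi>" for N
    have "AE t in circle. \<forall>N. val (F N) t = val (wN N * f) t * val \<phi> t \<and> val (wN N * f) t = val (wN N) t * val f t"
      unfolding AE_all_countable
    proof
      fix N
      show "AE t in circle. val (F N) t = val (wN N * f) t * val \<phi> t \<and> val (wN N * f) t = val (wN N) t * val f t"
        unfolding F_def using val_times[of "wN N * f" \<phi>] val_times[of "wN N" f] by eventually_elim simp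
    qed
    then have all: "AE t in circle. (\<lambda>N. val (F N) t) \<longlonglongrightarrow> val f t \<and> (\<forall>N. cmod (val (F N) t) \<le> E)
        \<and> (\<lambda>N. val (wN N * f) t) \<longlonglongrightarrow> val (w * f) t \<and> (\<forall>N. cmod (val (wN N * f) t) \<le> cmod (val (w * f) t))"
      using wNlim wv \<phi>nz E val_times[of w f]
    proof eventually_elim
      case (elim t)
      have "(\<lambda>N. val (wN N) t * val f t * val \<phi> t) \<longlonglongrightarrow> val w t * val f t * val \<phi> t"
        using elim(2) by (intro tendsto_intros) auto
      moreover have "val w t * val f t * val \<phi> t = val f t" using elim by simp
      ultimately have 1: "(\<lambda>N. val (F N) t) \<longlonglongrightarrow> val f t" using elim(1) by simp
      have 2: "cmod (val (F N) t) \<le> E" for N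
      proof -
        have "cmod (val (F N) t) = cmod (val (wN N) t * val \<phi> t) * cmod (val f t)"
          using elim(1) by (simp add: norm_mult)
        also have "\<dots> \<le> 1 * cmod (val f t)" using elim(2) by (intro mult_right_mono) auto
        finally show ?thesis using elim(5) by simp
      qed
      have 3: "(\<lambda>N. val (wN N * f) t) \<longlonglongrightarrow> val (w * f) t"
        using elim(1,2,6) by (simp add: tendsto_mult_right)
      have 4: "cmod (val (wN N * f) t) \<le> cmod (val (w * f) t)" for N
        using elim(1,2,6) by (simp add: norm_mult mult_right_mono)
      show ?case using 1 2 3 4 by blast
    qed
    have a: "AE t in circle. (\<lambda>N. val (F N) t) \<longlonglongrightarrow> val f t" "AE t in circle. cmod (val (F N) t) \<le> E"
      "AE t in circle. (\<lambda>N. val (wN N * f) t) \<longlonglongrightarrow> val (w * f) t" "AE t in circle. cmod (val (wN N * f) t) \<le> cmod (val (w * f) t)" for N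
      using all by (auto elim: eventually_mono)
    have wfL: "w * f \<in> Lp q" using Linf_Lp_mult[OF f wL q1(1)] by (simp add: mult.commute)
    have "(\<lambda>N. U (F N)) \<longlonglongrightarrow> U f"
      by (rule Utend[OF Lp_dominated_convergence(2,1,3)[OF p1(1) a(1,2)]]) auto
    moreover have "(\<lambda>N. fourier (wN N * f) 0) \<longlonglongrightarrow> fourier (w * f) 0"
      by (rule fourier_tendsto[OF q(1) Lp_dominated_convergence(2,1,3)[OF q1(1) a(3,4)]])
        (use wfL in \<open>auto simp: mem_Lp_iff\<close>)
    then have "(\<lambda>N. \<kappa> * fourier (wN N * f) 0) \<longlonglongrightarrow> \<kappa> * fourier (w * f) 0" by (rule tendsto_mult_left)
    moreover have "U (F N) = \<kappa> * fourier (wN N * f) 0" for N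
      unfolding F_def by (intro ULinf Linf_mult wNL f)
    ultimately show ?thesis using LIMSEQ_unique by auto
  qed
  have wH: "w \<in> Hp q"
  proof -
    \<comment> \<open>The coefficient is, up to \<open>\<kappa>\<close>, the value of
      \<open>U\<close> at \<open>t^(-n)\<close>. This function is in the Hardy space, so
      \<open>U\<close> returns its mean, which is 0.\<close>
    have "fourier w n = 0" if n: "n < 0" for n
    proof -
      have "fourier w n = fourier (w * tvar powi (- n)) 0"
        unfolding mult.commute[of w] by (simp add: fourier_shift)
      moreover have "U (tvar powi (- n)) = fourier (tvar powi (- n)) 0"
        unfolding U_def using n p1 by (intro Vg Hp_tvar_powi) auto
      moreover have "\<dots> = 0" using n by (simp add: fourier_tvar_powi)
      ultimately show ?thesis using URep[OF Linf_tvar_powi[of "- n"]] \<kappa> by simp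
    qed
    with wL show ?thesis by (simp add: Hp_def)
  qed
  have g'wL: "g' * w \<in> Lp q" by (rule Linf_Lp_mult[OF g' wL q1(1)])
  have g'wH: "g' * w \<in> Hp_bar q"
  proof -
    have "fourier (g' * w) n = 0" if n: "0 < n" for n
    proof -
      have L: "g' * tvar powi (- n) \<in> Linf" by (intro Linf_mult g' Linf_tvar_powi)
      have "fourier (g' * w) n = fourier (tvar powi (- n) * (g' * w)) 0"
        by (simp add: fourier_shift)
      also have "tvar powi (- n) * (g' * w) = w * (g' * tvar powi (- n))" by (simp only: mult_ac)
      finally have 1: "fourier (g' * w) n = fourier (w * (g' * tvar powi (- n))) 0" .
      \<comment> \<open>Multiplication by \<open>g\<close> turns the test function into
        \<open>t^(-n)\<close>, which the projection annihilates for \<open>n > 0\<close>.\<close>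
      have "g * (g' * tvar powi (- n)) = tvar powi (- n)" using gg' by (simp only: mult.assoc[symmetric] mult_1)
      moreover have "tvar powi (- n) \<in> Hm p" using n p1 by (simp add: Hm_def Lp_tvar_powi fourier_tvar_powi)
      ultimately have "U (g' * tvar powi (- n)) = 0" unfolding U_def using VHm by simp
      then show ?thesis using URep[OF L] \<kappa> 1 by simp
    qed
    with g'wL show ?thesis by (simp add: Hp_bar_def)
  qed
  have mbar: "m \<in> Hp_bar p" using mL fm by (simp add: Hp_bar_def)
  have "m * (g' * w) = (g * g') * (\<phi> * w)" unfolding m_def by (simp only: mult_ac)
  then have mi: "m * (g' * w) = 1" using gg' \<phi>w by simp
  have im: "inverse m = g' * w" "m * inverse m = 1" using inverse_unique_circle_fun[OF mi] by auto
  have w\<phi>: "w * \<phi> = 1" using \<phi>w by (simp add: mult.commute)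
  have iw: "inverse w = \<phi>" "w * inverse w = 1" using inverse_unique_circle_fun[OF w\<phi>] by auto
  have BP: "B f = inverse w * riesz_P q (inverse m * f)" if f: "f \<in> circle_fun.span (range (\<lambda>k::nat. tvar ^ k))" for f
  proof -
    have ftrig: "f \<in> trig"
    proof -
      have "range (\<lambda>k::nat. tvar ^ k) \<subseteq> range (\<lambda>k::int. tvar powi k)"
        using power_int_of_nat[of tvar] by (metis image_subsetI rangeI)
      then show ?thesis using f circle_fun.span_mono unfolding trig_def by blast
    qed
    have fH: "f \<in> Hp p"
    proof -
      have "range (\<lambda>k::nat. tvar ^ k) \<subseteq> Hp p" using Hp_tvar_powi[OF p1(1), of "int _"] by auto
      then have "circle_fun.span (range (\<lambda>k::nat. tvar ^ k)) \<subseteq> Hp p"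
        by (rule circle_fun.span_minimal[OF _ subspace_Hp[OF p1(1)]])
      with f show ?thesis by blast
    qed
    define x where "x = B f"
    have xH: "x \<in> Hp p" and Tx: "T x = f" using B[OF fH] by (auto simp: x_def)
    have gxL: "g * x \<in> Lp p" by (rule gL[OF Hp_Lp[OF xH]])
    define r where "r = riesz_Q p (g * x)"
    have rH: "r \<in> Hm p" unfolding r_def by (rule riesz_Q_Hm[OF p gxL])
    have gx: "g * x = f + r" using Tx by (simp add: r_def riesz_Q_def T_def toeplitz_def)
    define y where "y = g' * w * f"
    have yL: "y \<in> Lp q" unfolding y_def using Linf_Lp_mult[OF trig_Linf[OF ftrig] g'wL q1(1)] by (simp add: mult.commute)
    have y1: "y \<in> Lp 1" by (rule Lp_subset_L1(1)[OF q(1) yL])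
    have g'wr: "(g' * w) * r \<in> Lp 1"
      using Lp_mult(1)[OF q(1) g'wL] Hm_Lp[OF rH] q(2) by simp
    have g'wr0: "fourier ((g' * w) * r) n = 0" if "0 \<le> n" for n
    proof -
      have "tvar powi (- 1) * (g' * w) \<in> Hm q" using g'wH by (simp only: Hp_bar_iff_Hm)
      from Hm_mult_fourier_nonneg[OF q(1) this _ , of r "n - 1"]
      have "fourier (tvar powi (- 1) * (g' * w) * r) (n - 1) = 0" using rH q(2) that by simp
      then show ?thesis
        unfolding mult.assoc[of "tvar powi (- 1)"] by (simp only: fourier_shift) simp
    qed
    have "w * x = w * (g * g') * x" using gg' by simp
    also have "\<dots> = (g' * w) * (g * x)" by (simp only: mult_ac)
    finally have wx: "w * x = y + (g' * w) * r" unfolding gx y_def by (simp only: distrib_left)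
    have wx1: "w * x \<in> Lp 1" unfolding wx using y1 g'wr by (intro Lp_add) auto
    \<comment> \<open>With \<open>x = B f\<close> one has \<open>g x = f + r\<close>, and division
      by \<open>m\<close> gives \<open>w x = y + r / m\<close>. The left side has no negative
      frequencies and \<open>r / m\<close> only negative ones, so \<open>w x\<close> is the
      projection of \<open>y\<close>.\<close>
    have "riesz_P q y = w * x"
    proof (rule fourier_eqI)
      show "riesz_P q y \<in> Lp 1" by (rule Lp_subset_L1(1)[OF q(1) riesz_P_Lp[OF q(1) yL]])
      show "w * x \<in> Lp 1" by (rule wx1)
      show "fourier (riesz_P q y) n = fourier (w * x) n" for n
      proof (cases "0 \<le> n")
        case True
        have "fourier (w * x) n = fourier y n"
          unfolding wx using y1 g'wr True by (simp add: fourier_add g'wr0)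
        then show ?thesis using True by (simp add: fourier_riesz_P[OF q(1) yL])
      next
        case False
        then show ?thesis
          using Hp_mult_fourier_neg[OF q(1) wH, of x n] xH q(2) by (simp add: fourier_riesz_P[OF q(1) yL])
      qed
    qed
    then have "inverse w * riesz_P q (inverse m * f) = \<phi> * (w * x)"
      unfolding im iw y_def by simp
    also have "\<dots> = x" using \<phi>w by (simp add: mult.assoc[symmetric])
    finally show ?thesis by (simp add: x_def)
  qed
  have "m * w = g * (\<phi> * w)" unfolding m_def by (simp only: mult.assoc)
  then have "g = m * tvar powi (- 0) * w" using \<phi>w by simp
  then have "wiener_hopf p g 0 m w"
    unfolding wiener_hopf_def Let_def q_def[symmetric]
    using im iw fm[of 0] wH \<phi>H mbar g'wH BO BP by auto
  then show ?thesis by blast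
qed

lemma wiener_hopf_shift:
  assumes "wiener_hopf p (tvar powi n * g) 0 gm gp"
  shows "wiener_hopf p g n gm gp"
proof -
  have t: "tvar powi (- n) * tvar powi n = 1" using tvar_powi_add[of "- n" n] by simp
  have "tvar powi n * g = gm * gp" using assms by (simp add: wiener_hopf_def Let_def)
  then have "tvar powi (- n) * (tvar powi n * g) = tvar powi (- n) * (gm * gp)" by simp
  then have "g = gm * tvar powi (- n) * gp" using t by (simp only: mult.assoc[symmetric] mult_1) (simp only: mult_ac)
  with assms show ?thesis by (simp add: wiener_hopf_def Let_def)
qed

lemma signature_eq:
  assumes p: "1 < p" and wh: "wiener_hopf p g (ind p (toeplitz p g)) gm gp"
  shows "signature p \<beta> g = (lam \<beta> / cnj \<beta>) powi (ind p (toeplitz p g)) * disc_ext (inverse gp) (1 / cnj \<beta>)"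
proof -
  have "(THE gp. \<exists>gm. wiener_hopf p g (ind p (toeplitz p g)) gm gp) = gp"
  proof (rule the_equality)
    show "\<exists>gm. wiener_hopf p g (ind p (toeplitz p g)) gm gp" using wh by blast
    show "hp = gp" if "\<exists>hm. wiener_hopf p g (ind p (toeplitz p g)) hm hp" for hp
      using that wiener_hopf_unique[OF p _ wh] by blast
  qed
  then show ?thesis by (simp add: signature_def Let_def)
qed

subsection \<open>Kernel or cokernel is trivial\<close>

text \<open>Both signs are treated at once through \<open>\<epsilon> * \<epsilon> = 1\<close>. Index
  and signature of \<open>c = a * b'\<close> enter only when the hypotheses \<open>ker0\<close> and
  \<open>coker0\<close> are verified.\<close>

lemma kernel_or_cokernel:
  assumes p: "1 < p" and \<beta>: "1 < cmod \<beta>"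
    and L: "a \<in> Linf" "b \<in> Linf" "a' \<in> Linf" "b' \<in> Linf" and aa': "a * a' = 1" and bb': "b * b' = 1"
    and match: "a * shift \<beta> a = b * shift \<beta> b"
    and \<epsilon>: "\<epsilon> * \<epsilon> = 1"
    and A: "\<And>\<phi>. \<phi> \<in> Hp p \<Longrightarrow> A \<phi> = riesz_P p (a * \<phi> + b * scale \<epsilon> (J \<beta> \<phi>))"
    and ker0: "\<And>\<phi>. \<phi> \<in> Hp p \<Longrightarrow> a * b' * \<phi> = - scale \<epsilon> (J \<beta> \<phi>) \<Longrightarrow> \<phi> = 0"
    and coker0: "\<And>l. l \<in> coker p (toeplitz p (a * b')) \<Longrightarrow>
        (\<And>f. f \<in> Lp p \<Longrightarrow> l (riesz_P p f) = l (riesz_P p (a * b' * scale \<epsilon> (J \<beta> f)))) \<Longrightarrow> l = 0"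
  shows "ker p A = {0} \<or> coker p A = {0}"
proof (cases "coker p A = {0}")
  case False
  have p1: "1 \<le> p" "0 \<le> p" using p by auto
  define N where "N f = scale \<epsilon> (J \<beta> f)" for f
  have N_N: "N (N f) = f" for f
    using \<epsilon> by (simp add: N_def J_scale[OF \<beta>] J_J[OF \<beta>])
  have N_add: "N (f + g) = N f + N g" for f g
    by (simp add: N_def J_add[OF \<beta>] circle_fun.scale_right_distrib)
  have N_scale: "N (scale k f) = scale k (N f)" for k f
    by (simp add: N_def J_scale[OF \<beta>] mult.commute)
  have N_mult: "N (h * f) = shift \<beta> h * N f" for h f
    by (simp add: N_def J_mult[OF \<beta>] scale_eq_times)
  have N_Hp: "N f \<in> Hm p" if "f \<in> Hp p" for f
    unfolding N_def by (intro Hm_scale p1 J_Hp \<beta> p that)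
  have N_Hm: "N f \<in> Hp p" if "f \<in> Hm p" for f
    unfolding N_def by (intro Hp_scale p1 J_Hm \<beta> p that)
  have N_Lp: "N f \<in> Lp p" if "f \<in> Lp p" for f
    unfolding N_def by (intro Lp_scale J_Lp \<beta> p1 that)
  obtain D where D: "0 \<le> D" "\<And>f. f \<in> Lp p \<Longrightarrow> Lp_norm p (J \<beta> f) \<le> D * Lp_norm p f"
  proof (rule J_Lp_bounded[OF \<beta> p1(1)], goal_cases)
    case (1 D)
    show ?case by (rule 1(1)[OF 1(2,4)])
  qed
  have N_bound: "Lp_norm p (N f) \<le> cmod \<epsilon> * D * Lp_norm p f" if "f \<in> Lp p" for f
    unfolding N_def Lp_norm_scale[OF p1(1)] using mult_left_mono[OF D(2)[OF that], of "cmod \<epsilon>"] by simp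
  define c where "c = a * b'"
  define c' where "c' = b * a'"
  have cL: "c \<in> Linf" unfolding c_def by (intro Linf_mult L)
  have bc: "b * c = a" by (simp add: c_def mult.left_commute[of b a] bb')
  have ac': "a * c' = b" by (simp add: c'_def mult.left_commute[of a b] aa')
  have sbb': "shift \<beta> b * shift \<beta> b' = 1"
    using shift_mult[OF \<beta>, of b b'] bb' shift_1[OF \<beta>] by simp
  \<comment> \<open>The matching condition in the form \<open>c_\<alpha> = b / a\<close>, the
    inverse of \<open>c\<close>.\<close>
  have sc: "shift \<beta> c = c'"
  proof -
    have "shift \<beta> a * shift \<beta> b' = (a * a') * (shift \<beta> a * shift \<beta> b')" using aa' by simp
    also have "\<dots> = (a * shift \<beta> a) * (a' * shift \<beta> b')" by (simp only: mult_ac)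
    also have "\<dots> = b * a' * (shift \<beta> b * shift \<beta> b')" unfolding match by (simp only: mult_ac)
    finally have "shift \<beta> a * shift \<beta> b' = b * a'" using sbb' by simp
    then show ?thesis by (simp add: c_def c'_def shift_mult[OF \<beta>])
  qed
  then have sc': "shift \<beta> c' = c" using shift_shift[OF \<beta>, of c] by simp
  have sb': "shift \<beta> (shift \<beta> b') = b'" by (rule shift_shift[OF \<beta>])
  obtain l where l: "l \<in> coker p A" "l \<noteq> 0" using False zero_in_coker[of p A] by blast
  have ld: "l \<in> dual p" and lA: "\<And>f. f \<in> Hp p \<Longrightarrow> l (A f) = 0" using l(1) by (auto simp: mem_coker_iff)
  have aL: "a * f \<in> Lp p" and bL: "b * f \<in> Lp p" if "f \<in> Lp p" for f
    using that L p1 by (auto intro: Linf_Lp_mult)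
  define \<Lambda> where "\<Lambda> f = l (riesz_P p f)" for f
  have \<Lambda>_add: "\<Lambda> (f + g) = \<Lambda> f + \<Lambda> g" if "f \<in> Lp p" "g \<in> Lp p" for f g
    unfolding \<Lambda>_def riesz_P_add[OF p that] by (intro dual_add[OF ld] riesz_P_Hp p that)
  have \<Lambda>_scale: "\<Lambda> (scale k f) = k * \<Lambda> f" if "f \<in> Lp p" for k f
    unfolding \<Lambda>_def riesz_P_scale[OF p that] by (intro dual_scale[OF ld] riesz_P_Hp p that)
  have \<Lambda>_Hm: "\<Lambda> f = 0" if "f \<in> Hm p" for f
    unfolding \<Lambda>_def riesz_P_Hm[OF p that] by (rule dual_0[OF ld])
  \<comment> \<open>The functional \<open>l\<close> composed with \<open>A\<close>, extended by its
    formula from the Hardy space to all of \<open>L^p\<close>.\<close>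
  define E where "E f = \<Lambda> (a * f + b * N f)" for f
  have E_Hp: "E f = 0" if "f \<in> Hp p" for f
    using lA[OF that] A[OF that] by (simp add: E_def \<Lambda>_def N_def)
  have E_add: "E (f + g) = E f + E g" if "f \<in> Lp p" "g \<in> Lp p" for f g
  proof -
    have "a * (f + g) + b * N (f + g) = (a * f + b * N f) + (a * g + b * N g)"
      unfolding N_add by (simp add: distrib_left)
    then show ?thesis unfolding E_def using that p1 by (simp add: \<Lambda>_add Lp_add aL bL N_Lp)
  qed
  have E_scale: "E (scale k f) = k * E f" if "f \<in> Lp p" for k f
  proof -
    have "a * scale k f + b * N (scale k f) = scale k (a * f + b * N f)"
      unfolding N_scale by (simp add: scale_eq_times circle_fun.scale_right_distrib)
    then show ?thesis unfolding E_def using that p1 by (simp add: \<Lambda>_scale Lp_add aL bL N_Lp)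
  qed
  \<comment> \<open>Multiplication by \<open>c' = b / a\<close> interchanges the two terms:
    \<open>a c' f = b f\<close> and \<open>b N (c' f) = b c N f = a N f\<close>. This is the
    symmetry \<open>l'\<close> inherits.\<close>
  have E_c': "E (c' * f) = E (N f)" for f
  proof -
    have "a * (c' * f) + b * (c * N f) = a * N f + b * f"
      unfolding mult.assoc[symmetric] bc ac' by (rule add.commute)
    then show ?thesis by (simp add: E_def N_mult sc' N_N)
  qed
  define l' where "l' f = (if f \<in> Hp p then E (N f) else 0)" for f
  \<comment> \<open>The projection may be inserted freely, because \<open>N\<close> maps the
    complementary part into the Hardy space, where \<open>E\<close> vanishes.\<close>
  have l'P: "l' (riesz_P p f) = E (N f)" if f: "f \<in> Lp p" for f
  proof -
    have P: "riesz_P p f \<in> Hp p" and Q: "riesz_Q p f \<in> Hm p"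
      using riesz_P_Hp[OF p f] riesz_Q_Hm[OF p f] by auto
    have "f = riesz_P p f + riesz_Q p f" by (simp add: riesz_Q_def)
    then have "E (N f) = E (N (riesz_P p f) + N (riesz_Q p f))" using N_add by metis
    also have "\<dots> = E (N (riesz_P p f)) + E (N (riesz_Q p f))"
      using P Q by (intro E_add N_Lp Hp_Lp[OF P] Hm_Lp[OF Q])
    also have "E (N (riesz_Q p f)) = 0" by (intro E_Hp N_Hm Q)
    finally show ?thesis using P by (simp add: l'_def)
  qed
  obtain Kl where Kl: "0 \<le> Kl" "\<And>f. f \<in> Hp p \<Longrightarrow> cmod (l f) \<le> Kl * Lp_norm p f"
    using dual_bound[OF ld] by blast
  obtain Ka where Ka: "0 \<le> Ka" "\<And>f. f \<in> Lp p \<Longrightarrow> Lp_norm p (riesz_P p (a * f)) \<le> Ka * Lp_norm p f"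
    using riesz_P_mult_bound[OF p L(1)] by blast
  obtain Kb where Kb: "0 \<le> Kb" "\<And>f. f \<in> Lp p \<Longrightarrow> Lp_norm p (riesz_P p (b * f)) \<le> Kb * Lp_norm p f"
    using riesz_P_mult_bound[OF p L(2)] by blast
  have l'_bound: "cmod (E (N f)) \<le> (Kl * Ka * (cmod \<epsilon> * D) + Kl * Kb) * Lp_norm p f" if f: "f \<in> Lp p" for f
  proof -
    have "cmod (\<Lambda> (a * N f)) \<le> Kl * Lp_norm p (riesz_P p (a * N f))"
      unfolding \<Lambda>_def by (intro Kl riesz_P_Hp[OF p] aL N_Lp f)
    also have "\<dots> \<le> Kl * (Ka * (cmod \<epsilon> * D * Lp_norm p f))"
      using order_trans[OF Ka(2)[OF N_Lp[OF f]] mult_left_mono[OF N_bound[OF f] Ka(1)]] Kl(1)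
      by (rule mult_left_mono)
    finally have 1: "cmod (\<Lambda> (a * N f)) \<le> Kl * Ka * (cmod \<epsilon> * D) * Lp_norm p f" by (simp add: mult_ac)
    have "cmod (\<Lambda> (b * f)) \<le> Kl * Lp_norm p (riesz_P p (b * f))"
      unfolding \<Lambda>_def by (intro Kl riesz_P_Hp[OF p] bL f)
    also have "\<dots> \<le> Kl * (Kb * Lp_norm p f)" by (rule mult_left_mono[OF Kb(2)[OF f] Kl(1)])
    finally have 2: "cmod (\<Lambda> (b * f)) \<le> Kl * Kb * Lp_norm p f" by simp
    have "E (N f) = \<Lambda> (a * N f) + \<Lambda> (b * f)"
      unfolding E_def N_N using f by (intro \<Lambda>_add aL bL N_Lp)
    then show ?thesis using norm_triangle_ineq[of "\<Lambda> (a * N f)" "\<Lambda> (b * f)"] 1 2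
      by (simp add: distrib_right)
  qed
  have l'd: "l' \<in> dual p"
    unfolding dual_def mem_Collect_eq
  proof (intro conjI ballI allI impI)
    show "l' (f + g) = l' f + l' g" if "f \<in> Hp p" "g \<in> Hp p" for f g
      using that p1 by (simp add: l'_def Hp_add N_add E_add N_Lp Hp_Lp)
    show "l' (scale k f) = k * l' f" if "f \<in> Hp p" for k f
      using that p1 by (simp add: l'_def Hp_scale N_scale E_scale N_Lp Hp_Lp)
    show "\<exists>C. \<forall>f\<in>Hp p. cmod (l' f) \<le> C * Lp_norm p f"
      using l'_bound[OF Hp_Lp] by (auto simp: l'_def)
    show "l' f = 0" if "f \<notin> Hp p" for f using that by (simp add: l'_def)
  qed
  have cLp: "c * f \<in> Lp p" if "f \<in> Lp p" for f using that cL p1 by (intro Linf_Lp_mult)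
  have "l' \<in> coker p (toeplitz p c)"
    unfolding mem_coker_iff
  proof (intro conjI l'd ballI)
    fix f assume f: "f \<in> Hp p"
    have "l' (toeplitz p c f) = E (N (c * f))"
      unfolding toeplitz_def by (intro l'P cLp Hp_Lp f)
    also have "\<dots> = E f" by (simp add: N_mult sc E_c' N_N)
    finally show "l' (toeplitz p c f) = 0" using E_Hp[OF f] by simp
  qed
  moreover have "l' (riesz_P p f) = l' (riesz_P p (c * N f))" if f: "f \<in> Lp p" for f
  proof -
    have "l' (riesz_P p (c * N f)) = E (N (c * N f))" by (intro l'P cLp N_Lp f)
    also have "\<dots> = E (N f)" by (simp add: N_mult sc N_N E_c')
    finally show ?thesis using l'P[OF f] by simp
  qed
  ultimately have l'0: "l' = 0" unfolding c_def N_def by (rule coker0)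
  \<comment> \<open>Since \<open>N\<close> is an involution, vanishing of \<open>l'\<close> on
    projections means vanishing of \<open>E\<close> on all of \<open>L^p\<close>.\<close>
  have E0: "E f = 0" if "f \<in> Lp p" for f
    using l'P[OF N_Lp[OF that]] l'0 N_N by simp
  have anti: "\<Lambda> (a * f) = - \<Lambda> (b * N f)" if f: "f \<in> Lp p" for f
    using E0[OF f] \<Lambda>_add[OF aL[OF f] bL[OF N_Lp[OF f]]] by (simp add: E_def eq_neg_iff_add_eq_0)
  have "\<phi> = 0" if \<phi>: "\<phi> \<in> ker p A" for \<phi>
  proof -
    have \<phi>H: "\<phi> \<in> Hp p" and A\<phi>: "A \<phi> = 0" using \<phi> by (auto simp: ker_def)
    define r where "r = a * \<phi> + b * N \<phi>"
    have rL: "r \<in> Lp p" unfolding r_def using p1 \<phi>H by (intro Lp_add aL bL N_Lp Hp_Lp)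
    have rH: "r \<in> Hm p"
      using A[OF \<phi>H] A\<phi> riesz_P_eq_0_iff[OF p rL] by (simp add: r_def N_def)
    have "N r = shift \<beta> a * N \<phi> + shift \<beta> b * \<phi>" by (simp add: r_def N_add N_mult N_N)
    then have "a * (shift \<beta> b' * N r) = (a * shift \<beta> a) * (shift \<beta> b' * N \<phi>) + (shift \<beta> b * shift \<beta> b') * (a * \<phi>)"
      by (simp only: distrib_left mult_ac)
    also have "\<dots> = (shift \<beta> b * shift \<beta> b') * (b * N \<phi>) + (shift \<beta> b * shift \<beta> b') * (a * \<phi>)"
      unfolding match by (simp only: mult_ac)
    \<comment> \<open>With the matching condition, \<open>a N r = b_\<alpha> r\<close>; division by
      \<open>b_\<alpha>\<close> exhibits \<open>r\<close> as a multiple of \<open>a\<close>.\<close>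
    finally have r_eq: "r = a * (shift \<beta> b' * N r)"
      by (simp only: sbb' mult_1 r_def add.commute)
    have "\<Lambda> (tvar powi n * r) = 0" if n: "0 \<le> n" for n
    proof -
      have H: "tvar powi n * N r \<in> Hp p" by (intro Hp_tvar_mult n N_Hm rH)
      define f where "f = shift \<beta> b' * (tvar powi n * N r)"
      have fL: "f \<in> Lp p" unfolding f_def by (intro Linf_Lp_mult shift_Linf \<beta> L p1 Hp_Lp[OF H])
      have "tvar powi n * r = a * f" by (subst r_eq) (simp only: f_def mult_ac)
      then have "\<Lambda> (tvar powi n * r) = - \<Lambda> (b * N f)" using anti[OF fL] by simp
      \<comment> \<open>Here \<open>N\<close> turns the factor \<open>b'_\<alpha>\<close> of
        \<open>f\<close> into \<open>b'\<close>, which cancels \<open>b\<close>.\<close>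
      also have "b * N f = N (tvar powi n * N r)"
        unfolding f_def N_mult[of "shift \<beta> b'"] sb' by (metis bb' mult.assoc mult_1)
      also have "\<Lambda> (N (tvar powi n * N r)) = 0" by (intro \<Lambda>_Hm N_Hp H)
      finally show ?thesis by simp
    qed
    then have "r = 0" using dual_division[OF p ld rH] l(2) unfolding \<Lambda>_def by blast
    moreover have "b * (a * b' * \<phi> + N \<phi>) = (b * b') * (a * \<phi>) + b * N \<phi>"
      by (simp only: distrib_left mult_ac)
    ultimately have "b * (a * b' * \<phi> + N \<phi>) = 0" using bb' by (simp add: r_def)
    then have "b' * (b * (a * b' * \<phi> + N \<phi>)) = 0" by simp
    then have "a * b' * \<phi> + N \<phi> = 0" using bb' by (simp only: mult.assoc[symmetric] mult.commute[of b'] mult_1)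
    then show "\<phi> = 0" by (intro ker0[OF \<phi>H]) (simp add: N_def eq_neg_iff_add_eq_0)
  qed
  moreover have "A 0 = 0" using A[OF Hp_0] \<beta> riesz_P_Hm[OF p, of 0] by (simp add: Hm_def)
  ultimately show ?thesis by (auto simp: ker_def Hp_0)
qed simp

subsection \<open>Index and signature\<close>

lemma (in vector_space) dim_zero: "dim {0} = 0"
  using dim_le_card[of "{0}" "{}"] by simp

lemma fredholm_finite:
  assumes "fredholm p A"
  shows "\<exists>B. finite B \<and> ker p A \<subseteq> circle_fun.span B" "\<exists>B. finite B \<and> coker p A \<subseteq> functional.span B"
  by (insert assms, unfold fredholm_def, elim conjE, assumption, elim conjE, assumption)

text \<open>By Coburn one of the two dimensions is 0, and the index makes the other 0. The finite
  spanning sets rule out infinite dimension, for which \<open>dim\<close> would also be 0.\<close>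

lemma toeplitz_index_0:
  assumes p: "1 < p" and c: "c \<in> Linf" "c * c' = 1" and F: "fredholm p (toeplitz p c)"
    and i: "ind p (toeplitz p c) = 0"
  shows "ker p (toeplitz p c) = {0}" "coker p (toeplitz p c) = {0}"
proof -
  have 1: "\<exists>B. finite B \<and> ker p (toeplitz p c) \<subseteq> circle_fun.span B"
    by (rule fredholm_finite[OF F])
  then obtain B1 where B1: "finite B1" "ker p (toeplitz p c) \<subseteq> circle_fun.span B1" by (elim exE conjE)
  have 2: "\<exists>B. finite B \<and> coker p (toeplitz p c) \<subseteq> functional.span B"
    by (rule fredholm_finite[OF F])
  then obtain B2 where B2: "finite B2" "coker p (toeplitz p c) \<subseteq> functional.span B2" by (elim exE conjE)
  have "circle_fun.dim (ker p (toeplitz p c)) = 0 \<and> functional.dim (coker p (toeplitz p c)) = 0"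
  proof (cases "ker p (toeplitz p c) = {0}")
    case True
    then show ?thesis using i unfolding ind_def True circle_fun.dim_zero by simp
  next
    case False
    then have "coker p (toeplitz p c) = {0}" using Coburn[OF p c] by blast
    then show ?thesis using i unfolding ind_def by (simp add: functional.dim_zero)
  qed
  then have d: "circle_fun.dim (ker p (toeplitz p c)) = 0" "functional.dim (coker p (toeplitz p c)) = 0" by auto
  have "ker p (toeplitz p c) \<subseteq> {0}" by (rule circle_fun.dim_0_finite_span[OF B1(2,1) d(1)])
  then show "ker p (toeplitz p c) = {0}" using zero_in_ker[OF p c(1)] by blast
  have "coker p (toeplitz p c) \<subseteq> {0}" by (rule functional.dim_0_finite_span[OF B2(2,1) d(2)])
  then show "coker p (toeplitz p c) = {0}" using zero_in_coker[of p "toeplitz p c"] by blast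
qed

text \<open>With a trivial kernel the index could not be positive, so by Coburn the cokernel is
  trivial and the dimension of the kernel is the index.\<close>

lemma toeplitz_index_1:
  assumes p: "1 < p" and c: "c \<in> Linf" "c * c' = 1" and F: "fredholm p (toeplitz p c)"
    and i: "ind p (toeplitz p c) = 1"
  shows "coker p (toeplitz p c) = {0}"
    "\<exists>\<phi>\<in>ker p (toeplitz p c). \<phi> \<noteq> 0 \<and> (\<forall>f\<in>ker p (toeplitz p c). \<exists>\<mu>. f = scale \<mu> \<phi>)"
proof -
  have "\<exists>B. finite B \<and> ker p (toeplitz p c) \<subseteq> circle_fun.span B" by (rule fredholm_finite[OF F])
  then obtain B where B: "finite B" "ker p (toeplitz p c) \<subseteq> circle_fun.span B" by (elim exE conjE)
  show 1: "coker p (toeplitz p c) = {0}"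
  proof (rule ccontr)
    assume "\<not> ?thesis"
    then have k: "ker p (toeplitz p c) = {0}" using Coburn[OF p c] by blast
    have "ind p (toeplitz p c) = - int (functional.dim (coker p (toeplitz p c)))"
      unfolding ind_def k circle_fun.dim_zero by simp
    then show False using i by linarith
  qed
  have "ind p (toeplitz p c) = int (circle_fun.dim (ker p (toeplitz p c)))"
    unfolding ind_def 1 functional.dim_zero by simp
  then have "circle_fun.dim (ker p (toeplitz p c)) = 1" using i by linarith
  then show "\<exists>\<phi>\<in>ker p (toeplitz p c). \<phi> \<noteq> 0 \<and> (\<forall>f\<in>ker p (toeplitz p c). \<exists>\<mu>. f = scale \<mu> \<phi>)"
  proof (rule circle_fun.dim_1_finite_span[OF B(2,1)], goal_cases)
    case (1 \<phi>)
    show ?case using 1(3) by (intro bexI[OF _ 1(1)] conjI[OF 1(2)] ballI)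
  qed
qed

lemma toeplitz_index_minus_1:
  assumes p: "1 < p" and c: "c \<in> Linf" "c * c' = 1" and F: "fredholm p (toeplitz p c)"
    and i: "ind p (toeplitz p c) = - 1"
  shows "ker p (toeplitz p c) = {0}"
    "\<exists>l\<in>coker p (toeplitz p c). l \<noteq> 0 \<and> (\<forall>m\<in>coker p (toeplitz p c). \<exists>\<mu>. m = fun_scale \<mu> l)"
proof -
  have "\<exists>B. finite B \<and> coker p (toeplitz p c) \<subseteq> functional.span B" by (rule fredholm_finite[OF F])
  then obtain B where B: "finite B" "coker p (toeplitz p c) \<subseteq> functional.span B" by (elim exE conjE)
  show 1: "ker p (toeplitz p c) = {0}"
  proof (rule ccontr)
    assume "\<not> ?thesis"
    then have k: "coker p (toeplitz p c) = {0}" using Coburn[OF p c] by blast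
    have "ind p (toeplitz p c) = int (circle_fun.dim (ker p (toeplitz p c)))"
      unfolding ind_def k functional.dim_zero by simp
    then show False using i by linarith
  qed
  have "ind p (toeplitz p c) = - int (functional.dim (coker p (toeplitz p c)))"
    unfolding ind_def 1 circle_fun.dim_zero by simp
  then have "functional.dim (coker p (toeplitz p c)) = 1" using i by linarith
  then show "\<exists>l\<in>coker p (toeplitz p c). l \<noteq> 0 \<and> (\<forall>m\<in>coker p (toeplitz p c). \<exists>\<mu>. m = fun_scale \<mu> l)"
  proof (rule functional.dim_1_finite_span[OF B(2,1)], goal_cases)
    case (1 l)
    show ?case using 1(3) by (intro bexI[OF _ 1(1)] conjI[OF 1(2)] ballI)
  qed
qed

lemma fourier_toeplitz: "1 < p \<Longrightarrow> c \<in> Linf \<Longrightarrow> f \<in> Hp p \<Longrightarrow> 0 \<le> n \<Longrightarrow> fourier (toeplitz p c f) n = fourier (c * f) n"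
  by (simp add: toeplitz_def fourier_riesz_P Linf_Lp_mult Hp_Lp)

lemma tvar_powi_cancel: "tvar powi k * (tvar powi (- k) * f) = f"
  using tvar_powi_add[of k "- k"] by (simp add: mult.assoc[symmetric])

lemma tvar_powi_unit:
  assumes "c * c' = 1"
  shows "tvar powi k * c * (tvar powi (- k) * c') = 1"
proof -
  have "tvar powi k * c * (tvar powi (- k) * c') = tvar powi k * (tvar powi (- k) * (c * c'))"
    by (simp only: mult_ac)
  also have "\<dots> = c * c'" by (rule tvar_powi_cancel)
  finally show ?thesis by (simp only: assms)
qed

text \<open>Since \<open>T(t c) f = T(c) (t f)\<close>, passing from \<open>c\<close> to
  \<open>t c\<close> restricts \<open>T(c)\<close> to functions with constant term 0. This removes
  the one-dimensional kernel, whose generator has nonzero constant term, without losing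
  surjectivity.\<close>

lemma wiener_hopf_index_1:
  assumes p: "1 < p" and c: "c \<in> Linf" "c' \<in> Linf" "c * c' = 1" and F: "fredholm p (toeplitz p c)"
    and i: "ind p (toeplitz p c) = 1"
  shows "\<exists>gm gp. wiener_hopf p c 1 gm gp"
proof -
  have p1: "1 \<le> p" using p by simp
  obtain \<phi> where \<phi>: "\<phi> \<in> ker p (toeplitz p c)" "\<phi> \<noteq> 0"
      "\<forall>f\<in>ker p (toeplitz p c). \<exists>\<mu>. f = scale \<mu> \<phi>"
    using toeplitz_index_1(2)[OF p c(1,3) F i] by blast
  have \<phi>H: "\<phi> \<in> Hp p" "c * \<phi> \<in> Hm p" using \<phi>(1) by (auto simp: mem_ker_toeplitz_iff[OF p c(1)])
  have down: "tvar powi (- 1) * f \<in> Hp p" if "f \<in> Hp p" "fourier f 0 = 0" for f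
  proof -
    have "fourier f (n + 1) = 0" if "n < 0" for n
      using \<open>f \<in> Hp p\<close> \<open>fourier f 0 = 0\<close> that by (cases "n = - 1") (auto simp: Hp_def)
    then show ?thesis
      using that(1) unfolding Hp_def mem_Collect_eq Lp_tvar_powi_mult fourier_shift by simp
  qed
  \<comment> \<open>Otherwise \<open>\<phi> / t\<close> would be in the kernel too, hence a multiple
    of \<open>\<phi>\<close>, and the recursion for the coefficients would give
    \<open>\<phi> = 0\<close>.\<close>
  have \<phi>0: "fourier \<phi> 0 \<noteq> 0"
  proof
    assume z: "fourier \<phi> 0 = 0"
    define f where "f = tvar powi (- 1) * \<phi>"
    have "c * f = tvar powi (- 1) * (c * \<phi>)" by (simp only: f_def mult_ac)
    then have "f \<in> ker p (toeplitz p c)"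
      using down[OF \<phi>H(1) z] Hm_tvar_mult[of "- 1", OF _ \<phi>H(2)]
      by (simp only: mem_ker_toeplitz_iff[OF p c(1)] f_def)
    then obtain \<mu> where \<mu>: "f = scale \<mu> \<phi>" using \<phi>(3) by blast
    have "\<phi> = tvar powi 1 * f" unfolding f_def by (rule tvar_powi_cancel[symmetric])
    then have "\<phi> = scale \<mu> (tvar powi 1 * \<phi>)" by (simp only: \<mu> scale_eq_times)
    then have rec: "fourier \<phi> n = \<mu> * fourier \<phi> (n - 1)" for n by (metis fourier_scale fourier_shift)
    have nat: "fourier \<phi> (int k) = 0" for k
    proof (induction k)
      case (Suc k)
      then show ?case using rec[of "int (Suc k)"] by simp
    qed (simp add: z)
    have "fourier \<phi> n = 0" for n
      using nat[of "nat n"] \<phi>H(1) by (cases "0 \<le> n") (auto simp: Hp_def)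
    then show False using fourier_unique[OF Lp_subset_L1(1)[OF p Hp_Lp[OF \<phi>H(1)]]] \<phi>(2) by blast
  qed
  have "\<exists>gm gp. wiener_hopf p (tvar powi 1 * c) 0 gm gp"
  proof (rule wiener_hopf_exists[OF p _ _ tvar_powi_unit[OF c(3)]])
    show "tvar powi 1 * c \<in> Linf" "tvar powi (- 1) * c' \<in> Linf"
      by (intro Linf_mult Linf_tvar_powi c)+
    have T: "toeplitz p (tvar powi 1 * c) f = toeplitz p c (tvar powi 1 * f)" for f
      unfolding toeplitz_def by (simp only: mult_ac)
    show "\<exists>f\<in>Hp p. toeplitz p (tvar powi 1 * c) f = y" if y: "y \<in> Hp p" for y
    proof -
      obtain h where h: "h \<in> Hp p" "toeplitz p c h = y"
        using coker_trivial_surj[OF p c(1) _ y] F unfolding fredholm_def toeplitz_index_1(1)[OF p c(1,3) F i] by auto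
      \<comment> \<open>Chosen such that adding this multiple of the kernel element cancels the
        constant term of the solution.\<close>
      define q where "q = - (fourier h 0 / fourier \<phi> 0)"
      define k where "k = h + scale q \<phi>"
      have kH: "k \<in> Hp p" unfolding k_def by (intro Hp_add Hp_scale p1 h \<phi>H)
      have "fourier k 0 = 0"
        unfolding k_def fourier_scale q_def using \<phi>0
          fourier_add[OF Lp_subset_L1(1)[OF p Hp_Lp[OF h(1)]] Lp_scale[OF Lp_subset_L1(1)[OF p Hp_Lp[OF \<phi>H(1)]]]]
        by (simp only: fourier_scale) simp
      then have "tvar powi (- 1) * k \<in> Hp p" by (rule down[OF kH])
      moreover have "toeplitz p (tvar powi 1 * c) (tvar powi (- 1) * k) = toeplitz p c k"
        unfolding T tvar_powi_cancel ..
      moreover have "toeplitz p c k = y"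
        unfolding k_def using h \<phi> by (simp add: toeplitz_add[OF p c(1)] toeplitz_scale[OF p c(1)] Hp_scale p1 \<phi>H ker_def)
      ultimately show ?thesis by metis
    qed
    show "f = 0" if f: "f \<in> Hp p" "toeplitz p (tvar powi 1 * c) f = 0" for f
    proof -
      have "tvar powi 1 * f \<in> ker p (toeplitz p c)"
        using f Hp_tvar_mult[of 1 f p] by (simp only: ker_def T mem_Collect_eq)
      then obtain \<mu> where \<mu>: "tvar powi 1 * f = scale \<mu> \<phi>" using \<phi>(3) by blast
      have "\<mu> * fourier \<phi> 0 = fourier (tvar powi 1 * f) 0" by (simp only: \<mu> fourier_scale)
      also have "\<dots> = 0" using f(1) unfolding fourier_shift by (simp add: Hp_def)
      finally have "tvar powi 1 * f = 0" using \<phi>0 \<mu> by simp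
      then have "tvar powi (- 1) * (tvar powi (- (- 1)) * f) = 0" by (simp only: minus_minus mult_zero_right)
      then show "f = 0" unfolding tvar_powi_cancel .
    qed
  qed
  then show ?thesis using wiener_hopf_shift by blast
qed

text \<open>The operator \<open>T(c / t)\<close> is \<open>T(c)\<close> followed by the backward
  shift, so only \<open>T(c) f = t y + const\<close> has to be solved. The constant is determined by
  the annihilating functional \<open>l\<close>, provided that \<open>l 1\<close> is not 0.\<close>

lemma wiener_hopf_index_minus_1:
  assumes p: "1 < p" and c: "c \<in> Linf" "c' \<in> Linf" "c * c' = 1" and F: "fredholm p (toeplitz p c)"
    and i: "ind p (toeplitz p c) = - 1"
  shows "\<exists>gm gp. wiener_hopf p c (- 1) gm gp"
proof -
  have p1: "1 \<le> p" using p by simp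
  have oneH: "1 \<in> Hp p" using Hp_tvar_powi[OF p1, of 0] by simp
  have one: "fourier 1 k = (if k = 0 then 1 else 0)" for k using fourier_tvar_powi[of 0 k] by simp
  obtain l where l: "l \<in> coker p (toeplitz p c)" "l \<noteq> 0"
      "\<forall>m\<in>coker p (toeplitz p c). \<exists>\<mu>. m = fun_scale \<mu> l"
    using toeplitz_index_minus_1(2)[OF p c(1,3) F i] by blast
  have ld: "l \<in> dual p" and lT: "\<And>f. f \<in> Hp p \<Longrightarrow> l (toeplitz p c f) = 0" using l(1) by (auto simp: mem_coker_iff)
  have surj: "\<exists>f\<in>Hp p. toeplitz p c f = y" if "y \<in> Hp p" "l y = 0" for y
  proof (rule coker_trivial_surj[OF p c(1) _ that(1)])
    show "closed_range p (toeplitz p c)" using F by (simp add: fredholm_def)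
    show "m y = 0" if "m \<in> coker p (toeplitz p c)" for m
      using bspec[OF l(3) that] \<open>l y = 0\<close> by (auto simp: fun_scale_def)
  qed
  \<comment> \<open>If \<open>l 1 = 0\<close>, then \<open>T(c) f = 1\<close> is solvable and
    \<open>c f / t\<close> is in \<open>Hm\<close>. The functional vanishes at the projections of
    \<open>t^n c f / t\<close>, for \<open>n = 0\<close> because the projection is 0 and for
    \<open>n > 0\<close> because it is \<open>T(c) (t^(n-1) f)\<close>; division gives
    \<open>c f = 0\<close>, a contradiction.\<close>
  have l1: "l 1 \<noteq> 0"
  proof
    assume "l 1 = 0"
    then obtain f where f: "f \<in> Hp p" "toeplitz p c f = 1" using surj[OF oneH] by blast
    have cfL: "c * f \<in> Lp p" using c(1) f(1) p1 by (intro Linf_Lp_mult Hp_Lp)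
    have "fourier (c * f) n = (if n = 0 then 1 else 0)" if "0 \<le> n" for n
      using fourier_toeplitz[OF p c(1) f(1) that] f(2) one by simp
    then have r: "tvar powi (- 1) * (c * f) \<in> Hm p"
      using cfL unfolding Hm_def mem_Collect_eq Lp_tvar_powi_mult fourier_shift by simp
    have "tvar powi (- 1) * (c * f) = 0 \<or> l = 0"
    proof (rule dual_division[OF p ld r])
      fix n :: int assume n: "0 \<le> n"
      show "l (riesz_P p (tvar powi n * (tvar powi (- 1) * (c * f)))) = 0"
      proof (cases "n = 0")
        case True
        then show ?thesis using riesz_P_Hm[OF p r] dual_0[OF ld] by simp
      next
        case False
        have "tvar powi n * (tvar powi (- 1) * (c * f)) = tvar powi (n - 1) * (c * f)"
          using tvar_powi_add[of n "- 1"] by (simp only: mult.assoc[symmetric] diff_conv_add_uminus)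
        also have "\<dots> = c * (tvar powi (n - 1) * f)" by (simp only: mult_ac)
        finally show ?thesis
          using lT[OF Hp_tvar_mult[of "n - 1", OF _ f(1)]] n False by (simp only: toeplitz_def)
      qed
    qed
    then have "tvar powi (- (- 1)) * (tvar powi (- 1) * (c * f)) = 0" using l(2) by (simp only: mult_zero_right) simp
    then have "c * f = 0" using tvar_powi_cancel[of "- (- 1)" "c * f"] by (simp only: minus_minus)
    then have "toeplitz p c f = 0" using riesz_P_Hm[OF p, of 0] by (simp add: toeplitz_def Hm_def)
    with f(2) one[of 0] show False by simp
  qed
  have fT: "fourier (toeplitz p (tvar powi (- 1) * c) f) n = fourier (toeplitz p c f) (n + 1)"
    if "f \<in> Hp p" "0 \<le> n" for f n
  proof -
    have "fourier (toeplitz p (tvar powi (- 1) * c) f) n = fourier (tvar powi (- 1) * (c * f)) n"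
      using fourier_toeplitz[OF p Linf_mult[OF Linf_tvar_powi c(1)] that] by (simp only: mult.assoc)
    then show ?thesis using fourier_toeplitz[OF p c(1) that(1), of "n + 1"] that(2) by (simp only: fourier_shift) simp
  qed
  have dL: "tvar powi (- 1) * c \<in> Linf" by (intro Linf_mult Linf_tvar_powi c)
  have "\<exists>gm gp. wiener_hopf p (tvar powi (- 1) * c) 0 gm gp"
  proof (rule wiener_hopf_exists[OF p dL _ tvar_powi_unit[OF c(3)]])
    show "tvar powi (- (- 1)) * c' \<in> Linf" by (intro Linf_mult Linf_tvar_powi c)
    show "\<exists>f\<in>Hp p. toeplitz p (tvar powi (- 1) * c) f = y" if y: "y \<in> Hp p" for y
    proof -
      have tyH: "tvar powi 1 * y \<in> Hp p" by (rule Hp_tvar_mult[OF _ y]) simp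
      define q where "q = - (l (tvar powi 1 * y) / l 1)"
      define x where "x = tvar powi 1 * y + scale q 1"
      have xH: "x \<in> Hp p" unfolding x_def by (intro Hp_add Hp_scale p1 tyH oneH)
      have "l x = 0"
        unfolding x_def dual_add[OF ld tyH Hp_scale[OF p1 oneH]] dual_scale[OF ld oneH] q_def using l1 by simp
      then obtain f where f: "f \<in> Hp p" "toeplitz p c f = x" using surj[OF xH] by blast
      have fx: "fourier x (n + 1) = fourier y n" if "0 \<le> n" for n
        unfolding x_def using that one
        by (subst fourier_add) (auto simp: Lp_subset_L1(1)[OF p Hp_Lp] tyH oneH Lp_scale fourier_scale fourier_shift simp del: power_int_1_right)
      have "toeplitz p (tvar powi (- 1) * c) f = y"
      proof (rule fourier_eqI)
        have H: "toeplitz p (tvar powi (- 1) * c) f \<in> Hp p" by (rule toeplitz_Hp[OF p dL f(1)])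
        show "toeplitz p (tvar powi (- 1) * c) f \<in> Lp 1" "y \<in> Lp 1"
          using H y by (auto intro: Lp_subset_L1(1)[OF p Hp_Lp])
        show "fourier (toeplitz p (tvar powi (- 1) * c) f) n = fourier y n" for n
          using fT[OF f(1), of n] fx[of n] H y f(2) by (cases "0 \<le> n") (auto simp: Hp_def)
      qed
      with f(1) show ?thesis by blast
    qed
    show "f = 0" if f: "f \<in> Hp p" "toeplitz p (tvar powi (- 1) * c) f = 0" for f
    proof -
      define k where "k = fourier (toeplitz p c f) 0"
      have TH: "toeplitz p c f \<in> Hp p" by (rule toeplitz_Hp[OF p c(1) f(1)])
      have eq: "toeplitz p c f = scale k 1"
      proof (rule fourier_eqI)
        show "toeplitz p c f \<in> Lp 1" "scale k 1 \<in> Lp 1"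
          using TH oneH by (auto intro: Lp_subset_L1(1)[OF p Hp_Lp] Lp_scale)
        show "fourier (toeplitz p c f) n = fourier (scale k 1) n" for n
        proof -
          consider "n < 0" | "n = 0" | "0 \<le> n - 1" by linarith
          then show ?thesis
          proof cases
            case 3
            then show ?thesis using fT[OF f(1) 3] f(2) one by (simp add: fourier_scale)
          qed (use TH one in \<open>auto simp: Hp_def fourier_scale k_def\<close>)
        qed
      qed
      have "k * l 1 = 0" using lT[OF f(1)] dual_scale[OF ld oneH, of k] eq by simp
      then have "f \<in> ker p (toeplitz p c)" using eq l1 f(1) by (simp add: ker_def)
      then show "f = 0" using toeplitz_index_minus_1(1)[OF p c(1,3) F i] by simp
    qed
  qed
  then show ?thesis using wiener_hopf_shift by blast
qed

text \<open>The kernel is spanned by the inverse of \<open>gp\<close>, so \<open>f\<close> is a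
  multiple \<open>k\<close> of it. At -1 the coefficient of \<open>c * f\<close> is
  \<open>k\<close>, while that of \<open>- J \<beta> f\<close> is \<open>- k\<close> times the
  signature; signature 1 leaves only \<open>k = 0\<close>.\<close>

lemma signature_index_1:
  assumes p: "1 < p" and \<beta>: "1 < cmod \<beta>" and c: "c \<in> Linf" "c' \<in> Linf" "c * c' = 1"
    and F: "fredholm p (toeplitz p c)" and i: "ind p (toeplitz p c) = 1" and s: "signature p \<beta> c = 1"
    and f: "f \<in> Hp p" "c * f = - J \<beta> f"
  shows "f = 0"
proof -
  obtain gm gp where wh: "wiener_hopf p c 1 gm gp" using wiener_hopf_index_1[OF p c F i] by blast
  define \<phi> where "\<phi> = inverse gp"
  have ceq: "c = gm * tvar powi (- 1) * gp" and gp: "gp * \<phi> = 1" and gm0: "fourier gm 0 = 1"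
    and \<phi>H: "\<phi> \<in> Hp p" and gm: "gm \<in> Hp_bar p"
    using wh unfolding wiener_hopf_def Let_def \<phi>_def by blast+
  have "c * \<phi> = tvar powi (- 1) * gm * (gp * \<phi>)" unfolding ceq by (simp only: mult_ac)
  then have c\<phi>: "c * \<phi> = tvar powi (- 1) * gm" unfolding gp by (simp only: mult_1_right)
  have c\<phi>1: "fourier (c * \<phi>) (- 1) = 1" unfolding c\<phi> fourier_shift using gm0 by simp
  have "c * \<phi> \<in> Hm p" unfolding c\<phi> using gm by (simp only: Hp_bar_iff_Hm)
  then have \<phi>ker: "\<phi> \<in> ker p (toeplitz p c)" using \<phi>H by (simp only: mem_ker_toeplitz_iff[OF p c(1)])
  have \<phi>0: "\<phi> \<noteq> 0"
  proof
    assume "\<phi> = 0"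
    then show False using c\<phi>1 by simp
  qed
  have sig: "lam \<beta> / cnj \<beta> * disc_ext \<phi> (1 / cnj \<beta>) = 1"
    using signature_eq[OF p wh[folded i], of \<beta>] s i by (simp add: \<phi>_def)
  obtain \<psi> where \<psi>: "\<forall>f\<in>ker p (toeplitz p c). \<exists>\<mu>. f = scale \<mu> \<psi>"
    using toeplitz_index_1(2)[OF p c(1,3) F i] by blast
  have "c * f \<in> Hm p"
    unfolding f(2) uminus_eq_scale using p by (intro Hm_scale J_Hp \<beta> p f) simp
  then have fker: "f \<in> ker p (toeplitz p c)" using f(1) by (simp only: mem_ker_toeplitz_iff[OF p c(1)])
  obtain \<mu> where \<mu>: "f = scale \<mu> \<psi>" using \<psi> fker by blast
  obtain \<nu> where \<nu>: "\<phi> = scale \<nu> \<psi>" using \<psi> \<phi>ker by blast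
  have "\<nu> \<noteq> 0" using \<nu> \<phi>0 by auto
  then have feq: "f = scale (\<mu> / \<nu>) \<phi>" by (simp add: \<mu> \<nu>)
  have "\<mu> / \<nu> = fourier (c * f) (- 1)"
    using c\<phi>1 by (simp only: feq scale_eq_times fourier_scale mult_1_right)
  also have "\<dots> = - (\<mu> / \<nu>)"
    using fourier_J_minus_1[OF \<beta> p \<phi>H] sig
    unfolding f(2) by (simp only: fourier_uminus) (simp only: feq J_scale[OF \<beta>] fourier_scale mult_1_right)
  finally have "\<mu> / \<nu> = 0" by simp
  then show ?thesis by (simp only: feq circle_fun.scale_zero_left)
qed

text \<open>The cokernel is spanned by the mean of \<open>f\<close> times the inverse of
  \<open>gm\<close>, so the required symmetry need only be tested at \<open>f = 1\<close>.\<close>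

lemma signature_index_minus_1:
  assumes p: "1 < p" and \<beta>: "1 < cmod \<beta>" and c: "c \<in> Linf" "c' \<in> Linf" "c * c' = 1"
    and F: "fredholm p (toeplitz p c)" and i: "ind p (toeplitz p c) = - 1" and s: "signature p \<beta> c = 1"
    and l: "l \<in> coker p (toeplitz p c)"
    and eq: "l (riesz_P p 1) = - l (riesz_P p (c * J \<beta> 1))"
  shows "l = 0"
proof -
  define q where "q = conj_exp p"
  have q: "1 < q" "conj_exp q = p" using conj_exp[OF p] by (auto simp: q_def)
  have p1: "1 \<le> p" "0 \<le> p" and q1: "1 \<le> q" using p q by auto
  obtain gm gp where wh: "wiener_hopf p c (- 1) gm gp" using wiener_hopf_index_minus_1[OF p c F i] by blast
  define w where "w = inverse gm"
  have ceq: "c = gm * tvar powi (- (- 1)) * gp" and gmw: "gm * w = 1" and gp: "gp * inverse gp = 1"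
    and gm0: "fourier gm 0 = 1" and gpH: "gp \<in> Hp q" "inverse gp \<in> Hp p"
    and gm: "gm \<in> Hp_bar p" "w \<in> Hp_bar q"
    using wh unfolding wiener_hopf_def Let_def w_def q_def by blast+
  have wL: "w \<in> Lp q" using gm(2) by (simp add: Hp_bar_def)
  \<comment> \<open>The factor \<open>gm\<close> cancels, so pairing \<open>c * f\<close> with this
    functional yields the coefficient at -1 of \<open>gp * f\<close>; it is 0 for \<open>f\<close>
    in the Hardy space.\<close>
  have cw: "c * f * w = tvar powi 1 * (gp * f)" for f
  proof -
    have "c * f * w = tvar powi (- (- 1)) * (gp * f) * (gm * w)" unfolding ceq by (simp only: mult_ac)
    then show ?thesis unfolding gmw by (simp only: mult_1_right minus_minus)
  qed
  define m where "m f = (if f \<in> Hp p then fourier (f * w) 0 else 0)" for f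
  have fw1: "f * w \<in> Lp 1" if "f \<in> Lp p" for f
    by (rule Lp_mult(1)[OF p that wL[unfolded q_def]])
  have md: "m \<in> dual p"
    unfolding dual_def mem_Collect_eq
  proof (intro conjI ballI allI impI)
    show "m (f + g) = m f + m g" if "f \<in> Hp p" "g \<in> Hp p" for f g
      using that p1 by (simp add: m_def Hp_add distrib_right fourier_add fw1 Hp_Lp)
    show "m (scale k f) = k * m f" if "f \<in> Hp p" for k f
      using that p1 by (simp add: m_def Hp_scale scale_eq_times fourier_scale)
    show "\<exists>C. \<forall>f\<in>Hp p. cmod (m f) \<le> C * Lp_norm p f"
    proof (intro exI[of _ "Lp_norm q w"] ballI)
      fix f assume f: "f \<in> Hp p"
      have "cmod (m f) \<le> Lp_norm 1 (f * w)"
        using f by (simp add: m_def fourier_bound[OF fw1[OF Hp_Lp]])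
      also have "\<dots> \<le> Lp_norm q w * Lp_norm p f"
        using Lp_mult(2)[OF p Hp_Lp[OF f] wL[unfolded q_def]] by (simp add: q_def mult.commute)
      finally show "cmod (m f) \<le> Lp_norm q w * Lp_norm p f" .
    qed
    show "m f = 0" if "f \<notin> Hp p" for f using that by (simp add: m_def)
  qed
  have mP: "m (riesz_P p f) = fourier (f * w) 0" if f: "f \<in> Lp p" for f
  proof -
    have P: "riesz_P p f \<in> Hp p" and Q: "riesz_Q p f \<in> Hm p"
      using riesz_P_Hp[OF p f] riesz_Q_Hm[OF p f] by auto
    have "tvar powi (- 1) * w \<in> Hm (conj_exp p)"
      using gm(2) unfolding q_def by (simp only: Hp_bar_iff_Hm)
    from Hm_mult_fourier_nonneg[OF p Q this, of "- 1"]
    have "fourier (tvar powi (- 1) * (riesz_Q p f * w)) (- 1) = 0"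
      by (simp only: order_refl mult_ac)
    then have "fourier (riesz_Q p f * w) 0 = 0" unfolding fourier_shift by simp
    moreover have "f * w = riesz_P p f * w + riesz_Q p f * w"
      by (simp add: riesz_Q_def flip: distrib_right)
    ultimately show ?thesis
      using P by (simp only: m_def fourier_add[OF fw1[OF Hp_Lp[OF P]] fw1[OF Hm_Lp[OF Q]]]) simp
  qed
  have cLp: "c * f \<in> Lp p" if "f \<in> Lp p" for f using that c p1 by (intro Linf_Lp_mult)
  have mT: "m (riesz_P p (c * f)) = fourier (gp * f) (- 1)" if "f \<in> Lp p" for f
    unfolding mP[OF cLp[OF that]] cw fourier_shift by simp
  have mcoker: "m \<in> coker p (toeplitz p c)"
    unfolding mem_coker_iff
  proof (intro conjI md ballI)
    fix f assume f: "f \<in> Hp p"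
    show "m (toeplitz p c f) = 0"
      unfolding toeplitz_def mT[OF Hp_Lp[OF f]] using f q by (intro Hp_mult_fourier_neg[OF q(1) gpH(1)]) auto
  qed
  have oneH: "1 \<in> Hp p" using Hp_tvar_powi[OF p1(1), of 0] by simp
  have w0: "fourier w 0 = 1"
    using Hp_bar_mult_fourier(2)[OF p gm(1) gm(2)[unfolded q_def]] gm0 gmw fourier_tvar_powi[of 0 0] by simp
  then have m1: "m 1 = 1" using oneH by (simp add: m_def)
  obtain m' where m': "\<forall>h\<in>coker p (toeplitz p c). \<exists>\<mu>. h = fun_scale \<mu> m'"
    using toeplitz_index_minus_1(2)[OF p c(1,3) F i] by blast
  obtain \<mu> where \<mu>: "l = fun_scale \<mu> m'" using m' l by blast
  obtain \<nu> where \<nu>: "m = fun_scale \<nu> m'" using m' mcoker by blast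
  have "\<nu> \<noteq> 0" using m1 by (auto simp: \<nu> fun_scale_def)
  then have lm: "l f = \<mu> / \<nu> * m f" for f by (simp add: \<mu> \<nu> fun_scale_def)
  define \<kappa> where "\<kappa> = lam \<beta> / cnj \<beta>"
  define z where "z = 1 / cnj \<beta>"
  have z: "cmod z < 1" using inverse_less_1_iff[of "cmod \<beta>"] \<beta> by (simp add: z_def norm_divide inverse_eq_divide)
  have "inverse \<kappa> * disc_ext (inverse gp) z = 1"
    using signature_eq[OF p wh[folded i], of \<beta>] s i by (simp add: \<kappa>_def z_def del: inverse_divide)
  \<comment> \<open>The index -1 puts the reciprocal of \<open>\<kappa>\<close> into the signature.
    Multiplicativity of point evaluation then turns the condition into
    \<open>\<kappa> * disc_ext gp z = 1\<close>, and the left side is the coefficient at -1 of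
    \<open>gp * J \<beta> 1\<close>.\<close>
  then have "disc_ext (inverse gp) z = \<kappa>" by (cases "\<kappa> = 0") (auto simp: field_simps)
  moreover have "disc_ext gp z * disc_ext (inverse gp) z = 1"
    using disc_ext_mult[OF q(1) gpH(1) _ z, of "inverse gp"] gpH(2) q(2) gp disc_ext_1 by simp
  ultimately have "\<kappa> * disc_ext gp z = 1" by (simp add: mult.commute)
  then have J1: "fourier (gp * J \<beta> 1) (- 1) = 1"
    using fourier_mult_J_one[OF \<beta> q(1) gpH(1)] by (simp add: \<kappa>_def z_def)
  have "m (riesz_P p (c * J \<beta> 1)) = 1"
    using mT[OF J_Lp[OF \<beta> p1(1) Hp_Lp[OF oneH]]] J1 by simp
  then have "\<mu> / \<nu> = - (\<mu> / \<nu>)" using eq m1 by (simp only: lm riesz_P_id[OF p oneH] mult_1_right)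
  then have "\<mu> / \<nu> = 0" by simp
  then show "l = 0" using lm by (auto simp only: fun_eq_iff mult_zero_left zero_fun_apply)
qed

theorem proposition5p1:
  fixes p :: real and \<beta> :: complex and a b c d :: circle_fun
  assumes "1 < p"
    and "1 < cmod \<beta>"
    and "matching_pair \<beta> a b"
    and "(c, d) = subordinated_pair \<beta> a b"
    and "fredholm p (toeplitz p c)"
  shows
    "(ind p (toeplitz p c) = 1 \<and> signature p \<beta> c = 1 \<longrightarrow>
        ker p (toeplitz p a + hankel p \<beta> b) = {0} \<or> coker p (toeplitz p a + hankel p \<beta> b) = {0})
   \<and> (ind p (toeplitz p c) = - 1 \<and> signature p \<beta> c = 1 \<longrightarrow>
        ker p (toeplitz p a - hankel p \<beta> b) = {0} \<or> coker p (toeplitz p a - hankel p \<beta> b) = {0})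
   \<and> (ind p (toeplitz p c) = 0 \<longrightarrow>
        (ker p (toeplitz p a + hankel p \<beta> b) = {0} \<or> coker p (toeplitz p a + hankel p \<beta> b) = {0})
      \<and> (ker p (toeplitz p a - hankel p \<beta> b) = {0} \<or> coker p (toeplitz p a - hankel p \<beta> b) = {0}))"
proof -
  note p = assms(1) and \<beta> = assms(2) and F = assms(5)
  have p1: "1 \<le> p" using p by simp
  obtain a' where L: "a \<in> Linf" "b \<in> Linf" "a' \<in> Linf" and aa': "a * a' = 1"
    and match: "a * shift \<beta> a = b * shift \<beta> b"
    using assms(3) unfolding matching_pair_def invertible_Linf_def by blast
  \<comment> \<open>The inverse of \<open>b\<close>, obtained from the matching condition as
    \<open>b_\<alpha>\<close> divided by \<open>a a_\<alpha>\<close>.\<close>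
  define b' where "b' = shift \<beta> b * a' * shift \<beta> a'"
  have saa': "shift \<beta> a * shift \<beta> a' = 1"
    using shift_mult[OF \<beta>, of a a'] aa' shift_1[OF \<beta>] by simp
  have b'L: "b' \<in> Linf" unfolding b'_def by (intro Linf_mult shift_Linf \<beta> L)
  have "b * b' = (b * shift \<beta> b) * (a' * shift \<beta> a')" unfolding b'_def by (simp only: mult_ac)
  also have "\<dots> = (a * a') * (shift \<beta> a * shift \<beta> a')" unfolding match[symmetric] by (simp only: mult_ac)
  finally have bb': "b * b' = 1" by (simp add: aa' saa')
  have c: "c = a * b'"
    using assms(4) inverse_unique_circle_fun(1)[OF bb'] by (simp add: subordinated_pair_def)
  define c' where "c' = b * a'"
  have cL: "c \<in> Linf" and c'L: "c' \<in> Linf" unfolding c c'_def by (intro Linf_mult L b'L)+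
  have "c * c' = (a * a') * (b * b')" unfolding c c'_def by (simp only: mult_ac)
  then have cc': "c * c' = 1" using aa' bb' by simp
  \<comment> \<open>\<open>J\<close> maps the Hardy space into the range of \<open>Q\<close>, so the
    inner projection in the Hankel operator acts as the identity.\<close>
  have H: "hankel p \<beta> b f = riesz_P p (b * J \<beta> f)" and bJ: "b * J \<beta> f \<in> Lp p" and aL: "a * f \<in> Lp p" if "f \<in> Hp p" for f
  proof -
    have J: "J \<beta> f \<in> Hm p" by (rule J_Hp[OF \<beta> p that])
    then show "hankel p \<beta> b f = riesz_P p (b * J \<beta> f)"
      by (simp add: hankel_def riesz_Q_def riesz_P_Hm[OF p])
    show "b * J \<beta> f \<in> Lp p" "a * f \<in> Lp p" by (intro Linf_Lp_mult L p1 Hm_Lp[OF J] Hp_Lp[OF that])+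
  qed
  have plus: "(toeplitz p a + hankel p \<beta> b) f = riesz_P p (a * f + b * scale 1 (J \<beta> f))" if "f \<in> Hp p" for f
    using H[OF that] riesz_P_add[OF p aL[OF that] bJ[OF that]] by (simp add: toeplitz_def)
  have minus: "(toeplitz p a - hankel p \<beta> b) f = riesz_P p (a * f + b * scale (- 1) (J \<beta> f))" if "f \<in> Hp p" for f
    using H[OF that] riesz_P_diff[OF p aL[OF that] bJ[OF that]]
    by (simp add: toeplitz_def fun_diff_def)
  have core_plus: "ker p (toeplitz p a + hankel p \<beta> b) = {0} \<or> coker p (toeplitz p a + hankel p \<beta> b) = {0}"
    if K: "\<And>f. f \<in> Hp p \<Longrightarrow> c * f = - J \<beta> f \<Longrightarrow> f = 0"
      and C: "\<And>l. l \<in> coker p (toeplitz p c) \<Longrightarrow>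
        (\<And>f. f \<in> Lp p \<Longrightarrow> l (riesz_P p f) = l (riesz_P p (c * J \<beta> f))) \<Longrightarrow> l = 0"
  proof (rule kernel_or_cokernel[OF p \<beta> L b'L aa' bb' match _ plus])
    show "1 * 1 = (1::complex)" by simp
    show "f = 0" if "f \<in> Hp p" "a * b' * f = - scale 1 (J \<beta> f)" for f
      by (rule K) (use that in \<open>simp_all add: c\<close>)
    show "l = 0" if "l \<in> coker p (toeplitz p (a * b'))"
        "\<And>f. f \<in> Lp p \<Longrightarrow> l (riesz_P p f) = l (riesz_P p (a * b' * scale 1 (J \<beta> f)))" for l
      by (rule C) (use that in \<open>simp_all add: c\<close>)
  qed
  have core_minus: "ker p (toeplitz p a - hankel p \<beta> b) = {0} \<or> coker p (toeplitz p a - hankel p \<beta> b) = {0}"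
    if K: "\<And>f. f \<in> Hp p \<Longrightarrow> c * f = J \<beta> f \<Longrightarrow> f = 0"
      and C: "\<And>l. l \<in> coker p (toeplitz p c) \<Longrightarrow>
        (\<And>f. f \<in> Lp p \<Longrightarrow> l (riesz_P p f) = l (riesz_P p (- (c * J \<beta> f)))) \<Longrightarrow> l = 0"
  proof (rule kernel_or_cokernel[OF p \<beta> L b'L aa' bb' match _ minus])
    show "(- 1) * (- 1) = (1::complex)" by simp
    show "f = 0" if "f \<in> Hp p" "a * b' * f = - scale (- 1) (J \<beta> f)" for f
      by (rule K) (use that in \<open>simp_all add: c\<close>)
    show "l = 0" if "l \<in> coker p (toeplitz p (a * b'))"
        "\<And>f. f \<in> Lp p \<Longrightarrow> l (riesz_P p f) = l (riesz_P p (a * b' * scale (- 1) (J \<beta> f)))" for l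
      by (rule C) (use that in \<open>simp_all add: c\<close>)
  qed
  have J_ker: "f \<in> ker p (toeplitz p c)" if "f \<in> Hp p" "c * f = J \<beta> f \<or> c * f = - J \<beta> f" for f
  proof -
    have J: "J \<beta> f \<in> Hm p" by (rule J_Hp[OF \<beta> p that(1)])
    have "- J \<beta> f \<in> Hm p" unfolding uminus_eq_scale by (rule Hm_scale[OF p1 J])
    with J that show ?thesis unfolding mem_ker_toeplitz_iff[OF p cL] by metis
  qed
  have one: "1 \<in> Lp p" using p by (intro Linf_Lp one_Linf) simp
  have cJ: "c * J \<beta> 1 \<in> Lp p" by (intro Linf_Lp_mult cL p1 J_Lp \<beta> one)
  show ?thesis
  proof (intro conjI impI; (elim conjE)?)
    assume i: "ind p (toeplitz p c) = 1" and s: "signature p \<beta> c = 1"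
    show "ker p (toeplitz p a + hankel p \<beta> b) = {0} \<or> coker p (toeplitz p a + hankel p \<beta> b) = {0}"
    proof (rule core_plus)
      show "f = 0" if "f \<in> Hp p" "c * f = - J \<beta> f" for f
        by (rule signature_index_1[OF p \<beta> cL c'L cc' F i s that])
      show "l = 0" if "l \<in> coker p (toeplitz p c)" for l
        using that toeplitz_index_1(1)[OF p cL cc' F i] by simp
    qed
  next
    assume i: "ind p (toeplitz p c) = - 1" and s: "signature p \<beta> c = 1"
    show "ker p (toeplitz p a - hankel p \<beta> b) = {0} \<or> coker p (toeplitz p a - hankel p \<beta> b) = {0}"
    proof (rule core_minus)
      show "f = 0" if "f \<in> Hp p" "c * f = J \<beta> f" for f
        using J_ker[OF that(1)] that(2) toeplitz_index_minus_1(1)[OF p cL cc' F i] by simp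
      show "l = 0" if l: "l \<in> coker p (toeplitz p c)"
        and eq: "\<And>f. f \<in> Lp p \<Longrightarrow> l (riesz_P p f) = l (riesz_P p (- (c * J \<beta> f)))" for l
      proof (rule signature_index_minus_1[OF p \<beta> cL c'L cc' F i s l])
        have ld: "l \<in> dual p" using l by (simp add: mem_coker_iff)
        have "l (riesz_P p 1) = l (riesz_P p (- (c * J \<beta> 1)))" by (rule eq[OF one])
        also have "\<dots> = - l (riesz_P p (c * J \<beta> 1))"
          unfolding uminus_eq_scale riesz_P_scale[OF p cJ] dual_scale[OF ld riesz_P_Hp[OF p cJ]] by simp
        finally show "l (riesz_P p 1) = - l (riesz_P p (c * J \<beta> 1))" .
      qed
    qed
  next
    assume i: "ind p (toeplitz p c) = 0"
    note triv = toeplitz_index_0[OF p cL cc' F i]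
    show "ker p (toeplitz p a + hankel p \<beta> b) = {0} \<or> coker p (toeplitz p a + hankel p \<beta> b) = {0}"
    proof (rule core_plus)
      show "f = 0" if "f \<in> Hp p" "c * f = - J \<beta> f" for f
        using J_ker[OF that(1)] that(2) triv(1) by simp
      show "l = 0" if "l \<in> coker p (toeplitz p c)" for l using that triv(2) by simp
    qed
    show "ker p (toeplitz p a - hankel p \<beta> b) = {0} \<or> coker p (toeplitz p a - hankel p \<beta> b) = {0}"
    proof (rule core_minus)
      show "f = 0" if "f \<in> Hp p" "c * f = J \<beta> f" for f
        using J_ker[OF that(1)] that(2) triv(1) by simp
      show "l = 0" if "l \<in> coker p (toeplitz p c)" for l using that triv(2) by simp
    qed
  qed
qed

end
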